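(* Let $P$ be a spiked lattice $3$-polytope which is quasi-minimal but not minimal, of size at least seven. Then $P$ is unimodularly equivalent to one of the following polytopes, where in each case $k\ge2$ is an integer and the equivalence sends the (unique) non-essential vertex of $P$ to the last listed point: (1) $\mathrm{conv}\{(1,-1,-1),(-1,1,1),(-1,-1,0),(0,0,k)\}$, of size $k+4$; (2) $\mathrm{conv}\{(1,-1,0),(-1,1,-1),(-1,-1,0),(0,0,k)\}$, of size $k+5$; (3) $\mathrm{conv}\{(1,-1,0),(-1,1,0),(-1,-1,0),(0,0,k)\}$, of size $k+6$; (4) $\mathrm{conv}\{(2,-1,-1),(-1,2,1),(-1,-1,0),(0,0,k)\}$, of size $k+4$; (5) $\mathrm{conv}\{(1,-1,-1),(0,1,a),(-1,-1,0),(0,0,k)\}$ with $a\in\{-1,0\}$, of size $k+4$; (6) $\mathrm{conv}\{(1,0,0),(0,1,a),(-1,-1,0),(0,0,k)\}$ with $a\in\{-2,-1,0\}$, of size $k+4$; (7) $\mathrm{conv}\{(2,1,0),(-1,1,a),(-1,-1,0),(0,0,k)\}$ with $a\in\{-5,-1\}$, of size $k+4$; (8) $\mathrm{conv}\{(1,0,0),(0,1,0),(-1,0,a),(0,-1,b),(0,0,k)\}$ with $a\in\{-1,0\}$ and integer $b$ with $a\le b<2k$, of size $k+5$; (9) $\mathrm{conv}\{(1,0,0),(0,1,0),(-1,-1,a),(1,1,2k-a+b)\}$ with $a\in\{-2,-1,0\}$, $b\in\{0,1\}$, of size $k+5$; (10a) $\mathrm{conv}\{(1,0,a),(0,2,b),(-1,0,0),(0,0,k)\}$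 with $a,b\in\{-1,0\}$, of size $\lfloor(3k+b)/2\rfloor+5$; (10b) $\mathrm{conv}\{(1,0,0),(0,2,a),(-1,0,0),(0,1,k)\}$ with $a\in\{-1,0\}$, of size $k+5$.
   Context: A lattice polytope has vertices in $\mathbb{Z}^d$; its size is $|P\cap\mathbb{Z}^d|$; unimodular equivalence is via affine maps $t$ with $t(\mathbb{Z}^d)=\mathbb{Z}^d$. An affine functional $f$ is integer if $f(\mathbb{Z}^d)\subseteq\mathbb{Z}$. The width of a finite set or polytope $S$ is the minimum over non-constant integer affine functionals $f$ of $\max_S f-\min_S f$ ($0$ if $S$ is not full-dimensional). For a finite $A\subseteq\mathbb{Z}^d$ with $\mathrm{conv}(A)$ of width $>1$, a vertex $v$ of $\mathrm{conv}(A)$ is essential if $\mathrm{conv}(A\setminus\{v\})$ has width at most one; $A$ is minimal if all vertices are essential and quasi-minimal if at most one vertex is non-essential. A lattice polytope $P$ is (quasi-)minimal if $P\cap\mathbb{Z}^d$ is. A quasi-minimal lattice $3$-polytope $P$ is spiked if there is an affine map $\pi:\mathbb{R}^3\to\mathbb{R}^2$ with $\pi(\mathbb{Z}^3)=\mathbb{Z}^2$ such that, with $A'=\pi(P\cap\mathbb{Z}^3)$, every vertex of $\mathrm{conv}(A')$ has a unique preimage in $P\cap\mathbb{Z}^3$ and $\pi$ restricts to a bijection between the essential vertices of $P\cap\mathbb{Z}^3$ and those of $A'$ (computed in $\mathbb{Z}^2$). *)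

theory Defs
  imports "HOL-Analysis.Analysis"
begin

definition int_lattice :: "(real ^ 'n) set" where
  "int_lattice = {x. \<forall>i. x $ i \<in> \<int>}"

definition affine_fun :: "('a::real_vector \<Rightarrow> 'b::real_vector) \<Rightarrow> bool" where
  "affine_fun f \<longleftrightarrow> (\<exists>L c. linear L \<and> f = (\<lambda>x. L x + c))"

definition integer_functional :: "(real ^ 'n \<Rightarrow> real) \<Rightarrow> bool" where
  "integer_functional f \<longleftrightarrow> affine_fun f \<and> f ` int_lattice \<subseteq> \<int>"

text \<open>The infimum over functionals, and the supremum and infimum over \<open>S\<close>, are attained when
  \<open>S\<close> is nonempty, compact and full-dimensional; the definition is only used for such \<open>S\<close>
  (or with the value \<open>0\<close>).\<close>

definition lattice_width :: "(real ^ 'n) set \<Rightarrow> real" where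
  "lattice_width S =
    (if aff_dim S = int CARD('n)
     then INF f \<in> {f. integer_functional f \<and> \<not> f constant_on UNIV}. (SUP x\<in>S. f x) - (INF x\<in>S. f x)
     else 0)"

definition vertices :: "(real ^ 'n) set \<Rightarrow> (real ^ 'n) set" where
  "vertices P = {v. v extreme_point_of P}"

definition essential_vertices :: "(real ^ 'n) set \<Rightarrow> (real ^ 'n) set" where
  "essential_vertices A =
    {v \<in> vertices (convex hull A). lattice_width (convex hull (A - {v})) \<le> 1}"

definition nonessential_vertices :: "(real ^ 'n) set \<Rightarrow> (real ^ 'n) set" where
  "nonessential_vertices A = vertices (convex hull A) - essential_vertices A"

text \<open>The width bounds below are the condition under which one speaks of essential vertices
  and (quasi-)minimality.\<close>

definition minimal_config :: "(real ^ 'n) set \<Rightarrow> bool" where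
  "minimal_config A \<longleftrightarrow>
    finite A \<and> A \<subseteq> int_lattice \<and> lattice_width (convex hull A) > 1 \<and>
    nonessential_vertices A = {}"

definition quasi_minimal_config :: "(real ^ 'n) set \<Rightarrow> bool" where
  "quasi_minimal_config A \<longleftrightarrow>
    finite A \<and> A \<subseteq> int_lattice \<and> lattice_width (convex hull A) > 1 \<and>
    (\<forall>u\<in>nonessential_vertices A. \<forall>v\<in>nonessential_vertices A. u = v)"

definition lattice_polytope :: "(real ^ 'n) set \<Rightarrow> bool" where
  "lattice_polytope P \<longleftrightarrow> polytope P \<and> vertices P \<subseteq> int_lattice"

definition lattice_size :: "(real ^ 'n) set \<Rightarrow> nat" where
  "lattice_size P = card (P \<inter> int_lattice)"

definition minimal :: "(real ^ 'n) set \<Rightarrow> bool" where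
  "minimal P \<longleftrightarrow> lattice_polytope P \<and> minimal_config (P \<inter> int_lattice)"

definition quasi_minimal :: "(real ^ 'n) set \<Rightarrow> bool" where
  "quasi_minimal P \<longleftrightarrow> lattice_polytope P \<and> quasi_minimal_config (P \<inter> int_lattice)"

text \<open>No width condition on \<open>A'\<close> is needed: for full-dimensional \<open>P\<close> the set \<open>A'\<close> affinely spans
  the plane, and composing a functional with \<open>\<pi>\<close> shows that the width of \<open>A'\<close> is at least
  that of \<open>P\<close>, so it exceeds one.\<close>

definition spiked :: "(real ^ 3) set \<Rightarrow> bool" where
  "spiked P \<longleftrightarrow>
    quasi_minimal P \<and> aff_dim P = 3 \<and>
    (\<exists>\<pi> :: real ^ 3 \<Rightarrow> real ^ 2.
      affine_fun \<pi> \<and> \<pi> ` int_lattice = int_lattice \<and>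
      (let A = P \<inter> int_lattice; A' = \<pi> ` A in
        (\<forall>w \<in> vertices (convex hull A'). \<exists>!x. x \<in> A \<and> \<pi> x = w) \<and>
        bij_betw \<pi> (essential_vertices A) (essential_vertices A')))"

definition unimodular :: "(real ^ 'n \<Rightarrow> real ^ 'n) \<Rightarrow> bool" where
  "unimodular t \<longleftrightarrow> affine_fun t \<and> t ` int_lattice = int_lattice"

text \<open>\<open>P\<close> is unimodularly equivalent to the convex hull of the listed points, by an equivalence
  under which the last listed point is the image of the non-essential vertex of \<open>P\<close> (which is
  thereby asserted to exist and be unique); the hull has \<open>n\<close> lattice points.\<close>

definition equivalent_to_hull :: "(real ^ 'n) set \<Rightarrow> (real ^ 'n) list \<Rightarrow> int \<Rightarrow> bool" where
  "equivalent_to_hull P ps n \<longleftrightarrow>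
    (\<exists>t. unimodular t \<and> t ` P = convex hull (set ps) \<and>
      (\<exists>v. nonessential_vertices (P \<inter> int_lattice) = {v} \<and> t v = last ps)) \<and>
    int (lattice_size (convex hull (set ps))) = n"

definition pt :: "int \<Rightarrow> int \<Rightarrow> int \<Rightarrow> real ^ 3" where
  "pt x y z = vector [of_int x, of_int y, of_int z]"

end

theory Submission
  imports Defs
begin

text \<open>
  The projection \<open>\<pi>\<close> can be completed to a unimodular map of space, so we may assume that it forgets the
  third coordinate. Let \<open>v\<close> be the non-essential vertex and \<open>E\<close> the set of essential ones. Every
  \<open>e \<in> E\<close> has an integer functional \<open>f\<^sub>e\<close> of the plane that is at least two at \<open>e\<close> and zero or one at
  all other lattice points of \<open>P\<close>; conversely, since \<open>v\<close> is not essential, no functional of space has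
  oscillation at most one on the lattice points other than \<open>v\<close>.

  If two lattice points other than \<open>e\<close> have projections congruent modulo two, then \<open>f\<^sub>e\<close> takes the same
  value at both. Three functionals constant along the same direction cannot have three
  different strict maximizers, so this bounds \<open>E\<close> by four elements; if there are four, they project onto
  a centrally symmetric unimodular cross with \<open>v\<close> over its centre, which is (8).

  If \<open>E\<close> has three elements, the position of \<open>\<pi> v\<close> relative to their triangle decides. In the interior, the
  values of the \<open>f\<^sub>e\<close> determine the barycentric coordinates of \<open>\<pi> v\<close> up to finitely many cases, namely
  (4)--(7) and (10b). On an edge, \<open>\<pi> v\<close> is the midpoint of the edge, giving (1)--(3) and (10a). Outside,
  at least two lattice points of \<open>P\<close> have the same projection, and one obtains (9).
\<close>

text \<open>With planar coordinates fixed, the remaining freedom is to reflect the third coordinate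
  and to add to it an integer affine function of the other two. Heights matter only modulo that
  freedom: a quotient survives, which is the length \<open>k\<close> of the spike, and remainders,
  which are the origin of the parameters with finitely many values. The spike also does planar work.
  Two lattice points with the same projection form a segment, and its hull with a vertex that is a
  proper multiple, seen from the foot of the segment, contains a lattice point over the first planar
  lattice point on the way. There the functional of the vertex would be too large, so vertices are
  primitive vectors. The values of the functionals at the vertices then form a small integer matrix
  with off-diagonal entries 0 or -1, annihilated by the vector of determinants, and divisibility
  leaves finitely many shapes. This is where the size seven enters: it guarantees a fibre that is
  long enough.\<close>

definition emb :: "int \<times> int \<times> int \<Rightarrow> real ^ 3" where
  "emb q = pt (fst q) (fst (snd q)) (snd (snd q))"

definition lat :: "(int \<times> int \<times> int) set \<Rightarrow> (int \<times> int \<times> int) set" where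
  "lat S = {q. emb q \<in> convex hull (emb ` S)}"

definition plane_fun :: "int \<Rightarrow> int \<Rightarrow> int \<Rightarrow> int \<times> int \<times> int \<Rightarrow> int" where
  "plane_fun a b c q = a * fst q + b * fst (snd q) + c"

definition lin_fun :: "int \<Rightarrow> int \<Rightarrow> int \<Rightarrow> int \<times> int \<times> int \<Rightarrow> int" where
  "lin_fun a b c q = a * fst q + b * fst (snd q) + c * snd (snd q)"

text \<open>The integral form of the problem, in coordinates where the projection forgets the
  height: \<open>E\<close> are the essential vertices and \<open>v\<close> is the tip. The
  \<open>plane_fun\<close> clause says that each vertex of \<open>E\<close> is essential already in
  the projection, with its functional normalised. The \<open>lin_fun\<close> clause says that the
  lattice points other than \<open>v\<close> still have width at least two; only differences count
  there, hence no constant term.\<close>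

definition spike_config :: "(int \<times> int \<times> int) set \<Rightarrow> int \<times> int \<times> int \<Rightarrow> bool" where
  "spike_config E v \<longleftrightarrow>
    finite E \<and> 3 \<le> card E \<and> emb v \<notin> convex hull (emb ` E) \<and> 7 \<le> card (lat (insert v E)) \<and>
    (\<forall>e\<in>E. \<exists>a b c. 2 \<le> plane_fun a b c e \<and>
       (\<forall>q\<in>lat (insert v E) - {e}. plane_fun a b c q = 0 \<or> plane_fun a b c q = 1)) \<and>
    (\<forall>a b c. (a, b, c) \<noteq> (0, 0, 0) \<longrightarrow>
       (\<exists>p\<in>lat (insert v E) - {v}. \<exists>q\<in>lat (insert v E) - {v}. lin_fun a b c p + 2 \<le> lin_fun a b c q))"

text \<open>The unimodular maps that carry fibres of the projection to fibres: an element of GL_2(Z)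
  on the plane, a sign on the height, a shear of the height along the plane, and a
  translation.\<close>

definition block_map :: "(int \<times> int \<times> int \<Rightarrow> int \<times> int \<times> int) \<Rightarrow> bool" where
  "block_map T \<longleftrightarrow> (\<exists>a b c d e f l m s n. (a * d - b * c = 1 \<or> a * d - b * c = -1) \<and> (s = 1 \<or> s = -1) \<and>
     T = (\<lambda>(x, y, z). (a * x + b * y + e, c * x + d * y + f, l * x + m * y + s * z + n)))"

text \<open>\<open>equivalent_to_hull\<close> for the hull of \<open>insert v E\<close>, stated on
  finite sets of vertices; affine maps commute with hulls, so the passage back is immediate.\<close>

definition hull_equiv ::
    "(int \<times> int \<times> int) set \<Rightarrow> int \<times> int \<times> int \<Rightarrow> (real ^ 3) list \<Rightarrow> int \<Rightarrow> bool" where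
  "hull_equiv E v ps n \<longleftrightarrow>
     (\<exists>t. unimodular t \<and> t ` emb ` insert v E = set ps \<and> t (emb v) = last ps) \<and>
     int (lattice_size (convex hull (set ps))) = n"

text \<open>The list with the equivalence left open: the case analysis proves it for
  \<open>hull_equiv\<close>, where coordinates can be changed freely, and monotonicity carries it to
  \<open>equivalent_to_hull\<close>.\<close>

definition in_list :: "((real ^ 3) list \<Rightarrow> int \<Rightarrow> bool) \<Rightarrow> bool" where
  "in_list H \<longleftrightarrow> (\<exists>k::int. k \<ge> 2 \<and>
     (H [pt 1 (-1) (-1), pt (-1) 1 1, pt (-1) (-1) 0, pt 0 0 k] (k + 4) \<or>
      H [pt 1 (-1) 0, pt (-1) 1 (-1), pt (-1) (-1) 0, pt 0 0 k] (k + 5) \<or>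
      H [pt 1 (-1) 0, pt (-1) 1 0, pt (-1) (-1) 0, pt 0 0 k] (k + 6) \<or>
      H [pt 2 (-1) (-1), pt (-1) 2 1, pt (-1) (-1) 0, pt 0 0 k] (k + 4) \<or>
      (\<exists>a\<in>{-1, 0}.
        H [pt 1 (-1) (-1), pt 0 1 a, pt (-1) (-1) 0, pt 0 0 k] (k + 4)) \<or>
      (\<exists>a\<in>{-2, -1, 0}.
        H [pt 1 0 0, pt 0 1 a, pt (-1) (-1) 0, pt 0 0 k] (k + 4)) \<or>
      (\<exists>a\<in>{-5, -1}.
        H [pt 2 1 0, pt (-1) 1 a, pt (-1) (-1) 0, pt 0 0 k] (k + 4)) \<or>
      (\<exists>a\<in>{-1, 0}. \<exists>b. a \<le> b \<and> b < 2 * k \<and>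
        H [pt 1 0 0, pt 0 1 0, pt (-1) 0 a, pt 0 (-1) b, pt 0 0 k] (k + 5)) \<or>
      (\<exists>a\<in>{-2, -1, 0}. \<exists>b\<in>{0, 1}.
        H [pt 1 0 0, pt 0 1 0, pt (-1) (-1) a, pt 1 1 (2 * k - a + b)] (k + 5)) \<or>
      (\<exists>a\<in>{-1, 0}. \<exists>b\<in>{-1, 0}.
        H [pt 1 0 a, pt 0 2 b, pt (-1) 0 0, pt 0 0 k]
          (\<lfloor>of_int (3 * k + b) / (2::real)\<rfloor> + 5)) \<or>
      (\<exists>a\<in>{-1, 0}.
        H [pt 1 0 0, pt 0 2 a, pt (-1) 0 0, pt 0 1 k] (k + 5))))"

section \<open>Integer triples as the lattice points of space\<close>

lemma emb_pair [simp]: "emb (x, y, z) = pt x y z"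
  by (simp add: emb_def)

lemma pt_nth [simp]: "pt x y z $ 1 = of_int x" "pt x y z $ 2 = of_int y" "pt x y z $ 3 = of_int z"
  by (simp_all add: pt_def)

lemma emb_nth [simp]: "emb q $ 1 = of_int (fst q)" "emb q $ 2 = of_int (fst (snd q))"
  "emb q $ 3 = of_int (snd (snd q))"
  by (simp_all add: emb_def)

lemma vec3_eq_iff: "(v::real^3) = w \<longleftrightarrow> v $ 1 = w $ 1 \<and> v $ 2 = w $ 2 \<and> v $ 3 = w $ 3"
  by (simp add: vec_eq_iff forall_3)

lemma emb_inj: "emb p = emb q \<longleftrightarrow> p = q"
  by (cases p; cases q) (simp add: vec3_eq_iff)

lemma range_emb: "range emb = int_lattice"
proof -
  have "x \<in> range emb" if "x \<in> int_lattice" for x :: "real^3"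
  proof -
    have "x = emb (\<lfloor>x$1\<rfloor>, \<lfloor>x$2\<rfloor>, \<lfloor>x$3\<rfloor>)"
      using that by (simp add: int_lattice_def forall_3 vec3_eq_iff)
    then show ?thesis by blast
  qed
  then show ?thesis by (auto simp: int_lattice_def forall_3)
qed

lemma emb_lat: "emb ` lat S = (convex hull (emb ` S)) \<inter> int_lattice"
  unfolding lat_def range_emb[symmetric] by auto

lemma lattice_size_lat: "lattice_size (convex hull (emb ` S)) = card (lat S)"
proof -
  have "inj_on emb (lat S)" by (simp add: inj_on_def emb_inj)
  then show ?thesis unfolding lattice_size_def emb_lat[symmetric] by (rule card_image)
qed

lemma lat_incl: "q \<in> S \<Longrightarrow> q \<in> lat S"
  by (simp add: lat_def hull_inc)

section \<open>Block maps and the invariance of configurations\<close>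

lemma block_map_inverse:
  assumes "block_map T"
  obtains S where "block_map S" "\<And>q. S (T q) = q" "\<And>q. T (S q) = q"
proof -
  obtain a b c d e f l m s n where D: "a * d - b * c = 1 \<or> a * d - b * c = -1" and s: "s = 1 \<or> s = -1"
    and T: "T = (\<lambda>(x, y, z). (a * x + b * y + e, c * x + d * y + f, l * x + m * y + s * z + n))"
    using assms unfolding block_map_def by blast
  define D where "D = a * d - b * c"
  \<comment> \<open>A determinant 1 or -1 is its own inverse: \<open>D\<close> times the adjugate
    inverts the planar block, and the height is then solved for with the sign
    \<open>s\<close>.\<close>
  have DD: "D * D = 1" using D by (auto simp: D_def)
  have ss: "s * s = 1" using s by auto
  define S where "S = (\<lambda>(x, y, z). (D * d * x + (- D * b) * y + D * (b * f - d * e),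
     (- D * c) * x + D * a * y + D * (c * e - a * f),
     (- s * (l * D * d - m * D * c)) * x + (- s * (m * D * a - l * D * b)) * y + s * z
       + (- s * (l * D * (b * f - d * e) + m * D * (c * e - a * f) + n))))"
  have det: "D * d * (D * a) - (- D * b) * (- D * c) = D * D * D"
    by (simp add: D_def algebra_simps)
  have "block_map S"
    unfolding block_map_def
  proof (intro exI conjI)
    show "S = (\<lambda>(x, y, z). (D * d * x + (- D * b) * y + D * (b * f - d * e),
     (- D * c) * x + D * a * y + D * (c * e - a * f),
     (- s * (l * D * d - m * D * c)) * x + (- s * (m * D * a - l * D * b)) * y + s * z
       + (- s * (l * D * (b * f - d * e) + m * D * (c * e - a * f) + n))))"
      by (rule S_def)
    show "D * d * (D * a) - (- D * b) * (- D * c) = 1 \<or> D * d * (D * a) - (- D * b) * (- D * c) = -1"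
      unfolding det DD using D D_def by simp
  qed (fact s)
  moreover have S: "S (x, y, z) = (D * (d * (x - e) - b * (y - f)), D * (a * (y - f) - c * (x - e)),
      s * (z - n - l * (D * (d * (x - e) - b * (y - f))) - m * (D * (a * (y - f) - c * (x - e)))))" for x y z
    unfolding S_def by (simp add: algebra_simps)
  have k1: "D * (d * (a * x + b * y) - b * (c * x + d * y)) = x" for x y
  proof -
    have "D * (d * (a * x + b * y) - b * (c * x + d * y)) = D * D * x"
      by (simp add: D_def algebra_simps)
    then show ?thesis using DD by simp
  qed
  have k2: "D * (a * (c * x + d * y) - c * (a * x + b * y)) = y" for x y
  proof -
    have "D * (a * (c * x + d * y) - c * (a * x + b * y)) = D * D * y"
      by (simp add: D_def algebra_simps)
    then show ?thesis using DD by simp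
  qed
  have k3: "a * (D * (d * x - b * y)) + b * (D * (a * y - c * x)) = x" for x y
  proof -
    have "a * (D * (d * x - b * y)) + b * (D * (a * y - c * x)) = D * D * x"
      by (simp add: D_def algebra_simps)
    then show ?thesis using DD by simp
  qed
  have k4: "c * (D * (d * x - b * y)) + d * (D * (a * y - c * x)) = y" for x y
  proof -
    have "c * (D * (d * x - b * y)) + d * (D * (a * y - c * x)) = D * D * y"
      by (simp add: D_def algebra_simps)
    then show ?thesis using DD by simp
  qed
  have k5: "s * (s * u) = u" for u using ss by (simp add: mult.assoc[symmetric])
  have "S (T q) = q" for q
  proof (cases q)
    case (fields x y z)
    show ?thesis unfolding fields T by (simp only: prod.case S add_diff_cancel_right' k1 k2) (simp add: k5)
  qed
  moreover have "T (S q) = q" for q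
  proof (cases q)
    case (fields x y z)
    show ?thesis unfolding fields T S by (simp only: prod.case k3 k4 k5) simp
  qed
  ultimately show thesis by (rule that)
qed

lemma block_map_real:
  assumes "block_map T"
  obtains t where "affine_fun t" "\<And>q. t (emb q) = emb (T q)" "\<And>A. t ` (convex hull A) = convex hull (t ` A)"
proof -
  obtain a b c d e f l m s n where
    T: "T = (\<lambda>(x, y, z). (a * x + b * y + e, c * x + d * y + f, l * x + m * y + s * z + n))"
    using assms unfolding block_map_def by blast
  define L :: "real^3 \<Rightarrow> real^3" where
    "L = (\<lambda>v. vector [of_int a * v$1 + of_int b * v$2, of_int c * v$1 + of_int d * v$2,
                of_int l * v$1 + of_int m * v$2 + of_int s * v$3])"
  have L: "linear L"
    by (rule linearI) (simp_all add: L_def vec3_eq_iff algebra_simps)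
  define t where "t = (\<lambda>v. L v + pt e f n)"
  have "affine_fun t" using L unfolding affine_fun_def t_def by blast
  moreover have "t (emb q) = emb (T q)" for q
    by (cases q) (simp add: t_def L_def T vec3_eq_iff)
  moreover have "t ` (convex hull A) = convex hull (t ` A)" for A
  proof -
    have e: "t = (\<lambda>x. pt e f n + x) \<circ> L" by (auto simp: t_def)
    show ?thesis unfolding e image_comp[symmetric] convex_hull_linear_image[OF L]
      by (simp add: convex_hull_translation)
  qed
  ultimately show thesis by (rule that)
qed

lemma affine_fun_comp:
  assumes "affine_fun f" "affine_fun g" shows "affine_fun (g \<circ> f)"
proof -
  obtain L c L' c' where *: "linear L" "f = (\<lambda>x. L x + c)" "linear L'" "g = (\<lambda>x. L' x + c')"
    using assms unfolding affine_fun_def by blast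
  have "g \<circ> f = (\<lambda>x. (L' \<circ> L) x + (L' c + c'))"
    using *(2,4) linear_add[OF *(3)] by auto
  then show ?thesis using linear_compose[OF *(1,3)] unfolding affine_fun_def by blast
qed

lemma unimodular_comp: "unimodular f \<Longrightarrow> unimodular g \<Longrightarrow> unimodular (g \<circ> f)"
  unfolding unimodular_def by (metis affine_fun_comp image_comp)

lemma unimodular_of_block_map:
  assumes T: "block_map T" and t: "affine_fun t" "\<And>q. t (emb q) = emb (T q)"
  shows "unimodular t"
proof -
  obtain S where "\<And>q. T (S q) = q" using block_map_inverse[OF T] by metis
  then have "range T = UNIV" by (metis surjI)
  have "t ` range emb = emb ` range T" by (simp add: image_image t(2))
  then show ?thesis using t(1) \<open>range T = UNIV\<close> unfolding unimodular_def range_emb by (simp add: range_emb)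
qed

lemma lat_block_map_le:
  assumes T: "block_map T" shows "T ` lat S \<subseteq> lat (T ` S)"
proof -
  obtain t where t: "\<And>q. t (emb q) = emb (T q)" "\<And>A. t ` (convex hull A) = convex hull (t ` A)"
    using block_map_real[OF T] by metis
  have "t ` emb ` S = emb ` T ` S" by (simp add: image_image t)
  then have "t ` (convex hull (emb ` S)) = convex hull (emb ` T ` S)" using t(2) by simp
  then show ?thesis using t(1) unfolding lat_def by (metis (mono_tags, lifting) image_iff image_subsetI mem_Collect_eq)
qed

text \<open>The inverse of a block map is a block map, so the inclusions for \<open>T\<close> and
  for its inverse combine to equality.\<close>

lemma lat_block_map:
  assumes T: "block_map T" shows "lat (T ` S) = T ` lat S"
proof -
  obtain U where U: "block_map U" "\<And>q. U (T q) = q" "\<And>q. T (U q) = q" using block_map_inverse[OF T] by metis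
  have "U ` lat (T ` S) \<subseteq> lat (U ` T ` S)" by (rule lat_block_map_le[OF U(1)])
  also have "U ` T ` S = S" by (simp add: image_image U)
  finally have "T ` U ` lat (T ` S) \<subseteq> T ` lat S" by blast
  then show ?thesis using lat_block_map_le[OF T, of S] by (simp add: image_image U subset_antisym)
qed

text \<open>The block shape is used here: the first two coordinates of the image do not see the
  height.\<close>

lemma plane_fun_block_map:
  assumes "block_map T" obtains a' b' c' where "\<And>q. plane_fun a b c (T q) = plane_fun a' b' c' q"
proof -
  obtain p q r d e f l m s n where 
    T: "T = (\<lambda>(x, y, z). (p * x + q * y + e, r * x + d * y + f, l * x + m * y + s * z + n))"
    using assms unfolding block_map_def by blast
  have "plane_fun a b c (T u) = plane_fun (a * p + b * r) (a * q + b * d) (a * e + b * f + c) u" for u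
    by (cases u) (simp add: T plane_fun_def algebra_simps)
  then show thesis using that by blast
qed

lemma lin_fun_block_map:
  assumes "block_map T" obtains a' b' c' n where "\<And>q. lin_fun a b c (T q) = lin_fun a' b' c' q + n"
proof -
  obtain p q r d e f l m s n where 
    T: "T = (\<lambda>(x, y, z). (p * x + q * y + e, r * x + d * y + f, l * x + m * y + s * z + n))"
    using assms unfolding block_map_def by blast
  have "lin_fun a b c (T u) = lin_fun (a * p + b * r + c * l) (a * q + b * d + c * m) (c * s) u + (a * e + b * f + c * n)" for u
    by (cases u) (simp add: T lin_fun_def algebra_simps)
  then show thesis using that by blast
qed

lemma spike_config_essential:
  assumes "spike_config E v" "e \<in> E"
  obtains a b c where "2 \<le> plane_fun a b c e"
    "\<And>q. q \<in> lat (insert v E) - {e} \<Longrightarrow> plane_fun a b c q = 0 \<or> plane_fun a b c q = 1"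
proof -
  have "\<forall>e\<in>E. \<exists>a b c. 2 \<le> plane_fun a b c e \<and>
       (\<forall>q\<in>lat (insert v E) - {e}. plane_fun a b c q = 0 \<or> plane_fun a b c q = 1)"
    using assms(1) unfolding spike_config_def by (elim conjE)
  then show thesis using assms(2) that by meson
qed

lemma spike_config_wide:
  assumes "spike_config E v" "(a, b, c) \<noteq> (0, 0, 0)"
  obtains p q where "p \<in> lat (insert v E) - {v}" "q \<in> lat (insert v E) - {v}" "lin_fun a b c p + 2 \<le> lin_fun a b c q"
proof -
  have "\<forall>a b c. (a, b, c) \<noteq> (0, 0, 0) \<longrightarrow>
       (\<exists>p\<in>lat (insert v E) - {v}. \<exists>q\<in>lat (insert v E) - {v}. lin_fun a b c p + 2 \<le> lin_fun a b c q)"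
    using assms(1) unfolding spike_config_def by (elim conjE)
  then show thesis using assms(2) that by meson
qed

text \<open>Lattice points move along with \<open>T\<close>. The functional of an essential vertex
  is pulled back along the inverse, and a functional of space on the image is pulled back along
  \<open>T\<close>.\<close>

lemma spike_config_block_map:
  assumes T: "block_map T" and E: "spike_config E v" shows "spike_config (T ` E) (T v)"
proof -
  obtain S where S: "block_map S" "\<And>q. S (T q) = q" "\<And>q. T (S q) = q" using block_map_inverse[OF T] by metis
  have inj: "inj T" using S(2) by (rule inj_on_inverseI)
  have lat: "lat (insert (T v) (T ` E)) = T ` lat (insert v E)"
    using lat_block_map[OF T, of "insert v E"] by simp
  have "\<exists>a b c. 2 \<le> plane_fun a b c (T e) \<and>
       (\<forall>q\<in>T ` lat (insert v E) - {T e}. plane_fun a b c q = 0 \<or> plane_fun a b c q = 1)" if "e \<in> E" for e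
  proof -
    obtain a b c where abc: "2 \<le> plane_fun a b c e"
       "\<And>q. q\<in>lat (insert v E) - {e} \<Longrightarrow> plane_fun a b c q = 0 \<or> plane_fun a b c q = 1"
      using spike_config_essential[OF E \<open>e \<in> E\<close>] by metis
    obtain a' b' c' where *: "\<And>q. plane_fun a b c (S q) = plane_fun a' b' c' q" using plane_fun_block_map[OF S(1)] by metis
    have **: "plane_fun a' b' c' (T q) = plane_fun a b c q" for q using *[of "T q"] S by simp
    have "plane_fun a' b' c' q = 0 \<or> plane_fun a' b' c' q = 1" if q: "q \<in> T ` lat (insert v E) - {T e}" for q
    proof -
      obtain p where "p \<in> lat (insert v E) - {e}" "q = T p" using q by blast
      then show ?thesis using abc(2) ** by simp
    qed
    moreover have "2 \<le> plane_fun a' b' c' (T e)" using abc(1) ** by simp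
    ultimately show ?thesis by blast
  qed
  moreover have "\<exists>p\<in>T ` lat (insert v E) - {T v}. \<exists>q\<in>T ` lat (insert v E) - {T v}. lin_fun a b c p + 2 \<le> lin_fun a b c q"
    if abc: "(a, b, c) \<noteq> (0, 0, 0)" for a b c
  proof -
    obtain a' b' c' n where *: "\<And>q. lin_fun a b c (T q) = lin_fun a' b' c' q + n" using lin_fun_block_map[OF T] by metis
    \<comment> \<open>If the pulled back functional vanished, the original one would be constant on
      all triples because \<open>T\<close> is onto, and the unit vectors would kill its
      coefficients.\<close>
    have "(a', b', c') \<noteq> (0, 0, 0)"
    proof
      assume "(a', b', c') = (0, 0, 0)"
      then have "lin_fun a b c q = n" for q using *[of "S q"] S by (simp add: lin_fun_def)
      from this[of "(0,0,0)"] this[of "(1,0,0)"] this[of "(0,1,0)"] this[of "(0,0,1)"]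
      show False using abc by (simp add: lin_fun_def)
    qed
    then obtain p q where pq: "p\<in>lat (insert v E) - {v}" "q\<in>lat (insert v E) - {v}" "lin_fun a' b' c' p + 2 \<le> lin_fun a' b' c' q"
      using spike_config_wide[OF E] by metis
    have "lin_fun a b c (T p) + 2 \<le> lin_fun a b c (T q)" using pq(3) * by simp
    moreover have "T p \<in> T ` lat (insert v E) - {T v}" "T q \<in> T ` lat (insert v E) - {T v}"
      using pq(1,2) inj by (simp_all add: inj_eq)
    ultimately show ?thesis by blast
  qed
  moreover have "emb (T v) \<notin> convex hull (emb ` T ` E)"
  proof -
    have "v \<notin> lat E" using E by (simp add: spike_config_def lat_def)
    then have "T v \<notin> T ` lat E" using inj by (auto simp: inj_eq)
    then have "T v \<notin> lat (T ` E)" using lat_block_map[OF T, of E] by simp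
    then show ?thesis unfolding lat_def mem_Collect_eq .
  qed
  moreover have "card (T ` X) = card X" for X using card_image[OF inj_on_subset[OF inj subset_UNIV]] .
  moreover have "finite E" "3 \<le> card E" "7 \<le> card (lat (insert v E))" using E by (simp_all add: spike_config_def)
  ultimately show ?thesis unfolding spike_config_def lat by (intro conjI ballI allI impI) (simp, simp, blast, simp, blast, blast)
qed

lemma hull_equiv_block_map:
  assumes T: "block_map T" and h: "hull_equiv (T ` E) (T v) ps n" shows "hull_equiv E v ps n"
proof -
  obtain t where t: "affine_fun t" "\<And>q. t (emb q) = emb (T q)" using block_map_real[OF T] by metis
  obtain u where u: "unimodular u" "u ` emb ` insert (T v) (T ` E) = set ps" "u (emb (T v)) = last ps"
    using h unfolding hull_equiv_def by blast
  have "unimodular (u \<circ> t)" by (rule unimodular_comp[OF unimodular_of_block_map[OF T t] u(1)])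
  moreover have "(u \<circ> t) ` emb ` insert v E = set ps" using u(2) by (simp add: image_image t(2))
  moreover have "(u \<circ> t) (emb v) = last ps" using u(3) t(2) by simp
  ultimately show ?thesis using h unfolding hull_equiv_def by blast
qed

lemma in_list_mono:
  assumes "in_list H" "\<And>ps n. H ps n \<Longrightarrow> H' ps n" shows "in_list H'"
proof -
  have bex: "\<exists>x\<in>A. Q x" if "\<exists>x\<in>A. P x" "\<And>x. P x \<Longrightarrow> Q x" for A :: "int set" and P Q using that by blast
  show ?thesis using assms(1) unfolding in_list_def
    by (elim ex_forward conj_forward disj_forward bex assms(2))
qed

lemma in_list_block_map:
  assumes T: "block_map T" and h: "in_list (hull_equiv (T ` E) (T v))" shows "in_list (hull_equiv E v)"
  using in_list_mono[OF h] hull_equiv_block_map[OF T] by blast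

text \<open>The exit of every case: \<open>T\<close> has to hit the listed vertices. The lattice
  points are counted in the coordinates of the configuration at hand, and \<open>T\<close> carries
  the count over.\<close>

lemma hull_equivI:
  assumes T: "block_map T" and qs: "T ` insert v E = set qs" "T v = last qs" "qs \<noteq> []"
    and n: "int (card (lat (insert v E))) = n" and ps: "map emb qs = ps"
  shows "hull_equiv E v ps n"
proof -
  obtain t where t: "affine_fun t" "\<And>q. t (emb q) = emb (T q)" using block_map_real[OF T] by metis
  have "t ` emb ` insert v E = emb ` T ` insert v E" by (simp only: image_image t(2))
  then have 1: "t ` emb ` insert v E = set ps" unfolding qs(1) ps[symmetric] by simp
  obtain S where "\<And>q. S (T q) = q" using block_map_inverse[OF T] by metis
  then have "inj_on T (lat (insert v E))" by (rule inj_on_inverseI)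
  then have "card (lat (T ` insert v E)) = card (lat (insert v E))"
    unfolding lat_block_map[OF T] by (rule card_image)
  moreover have "emb ` set qs = set ps" unfolding ps[symmetric] by simp
  ultimately have "int (lattice_size (convex hull (set ps))) = n"
    using n lattice_size_lat[of "set qs"] unfolding qs(1) by simp
  moreover have "t (emb v) = last ps" unfolding t(2) qs(2) ps[symmetric] last_map[OF qs(3)] ..
  ultimately show ?thesis using unimodular_of_block_map[OF T t] 1 unfolding hull_equiv_def by blast
qed

section \<open>Lattice points in convex hulls\<close>

lemma emb_comb5_mem:
  assumes "p1 \<in> lat S" "p2 \<in> lat S" "p3 \<in> lat S" "p4 \<in> lat S" "p5 \<in> lat S"
    and "0 \<le> a" "0 \<le> b" "0 \<le> c" "0 \<le> d" "0 \<le> e" "a + b + c + d + e = 1"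
  shows "a *\<^sub>R emb p1 + b *\<^sub>R emb p2 + c *\<^sub>R emb p3 + d *\<^sub>R emb p4 + e *\<^sub>R emb p5 \<in> convex hull (emb ` S)"
proof -
  define w where "w = (\<lambda>i::nat. [a, b, c, d, e] ! i)"
  define p where "p = (\<lambda>i::nat. [p1, p2, p3, p4, p5] ! i)"
  have "(\<Sum>i\<in>{..<5}. w i *\<^sub>R emb (p i)) \<in> convex hull (emb ` S)"
  proof (rule convex_sum)
    show "sum w {..<5} = 1" using assms by (simp add: w_def eval_nat_numeral algebra_simps)
    fix i :: nat assume "i \<in> {..<5}"
    then have "i = 0 \<or> i = 1 \<or> i = 2 \<or> i = 3 \<or> i = 4" by auto
    then show "0 \<le> w i" "emb (p i) \<in> convex hull (emb ` S)"
      using assms by (auto simp: w_def p_def lat_def eval_nat_numeral)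
  qed auto
  then show ?thesis by (simp add: w_def p_def eval_nat_numeral add.assoc)
qed

text \<open>Membership is certified by explicit weights; five points cover a tip together with four
  vertices.\<close>

lemma latI5:
  fixes a b c d e :: real
  assumes "(x1, y1, z1) \<in> lat S" "(x2, y2, z2) \<in> lat S" "(x3, y3, z3) \<in> lat S" "(x4, y4, z4) \<in> lat S"
     "(x5, y5, z5) \<in> lat S"
    and "0 \<le> a" "0 \<le> b" "0 \<le> c" "0 \<le> d" "0 \<le> e" "a + b + c + d + e = 1"
    and "of_int x = a * x1 + b * x2 + c * x3 + d * x4 + e * x5"
     "of_int y = a * y1 + b * y2 + c * y3 + d * y4 + e * y5"
     "of_int z = a * z1 + b * z2 + c * z3 + d * z4 + e * z5"
  shows "(x, y, z) \<in> lat S"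
proof -
  have "emb (x, y, z) = a *\<^sub>R emb (x1, y1, z1) + b *\<^sub>R emb (x2, y2, z2) + c *\<^sub>R emb (x3, y3, z3)
     + d *\<^sub>R emb (x4, y4, z4) + e *\<^sub>R emb (x5, y5, z5)"
    using assms(12-) by (simp add: vec3_eq_iff)
  then show ?thesis using emb_comb5_mem[OF assms(1-11)] by (simp add: lat_def)
qed

lemma latI3:
  fixes a b c :: real
  assumes "(x1, y1, z1) \<in> lat S" "(x2, y2, z2) \<in> lat S" "(x3, y3, z3) \<in> lat S"
    and "0 \<le> a" "0 \<le> b" "0 \<le> c" "a + b + c = 1"
    and "of_int x = a * x1 + b * x2 + c * x3" "of_int y = a * y1 + b * y2 + c * y3"
     "of_int z = a * z1 + b * z2 + c * z3"
  shows "(x, y, z) \<in> lat S"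
  by (rule latI5[OF assms(1,2,3,3,3,4,5,6), of 0 0]) (use assms in auto)

lemma lat_fibre_interval:
  assumes "(x, y, z1) \<in> lat S" "(x, y, z2) \<in> lat S" "z1 \<le> z" "z \<le> z2"
  shows "(x, y, z) \<in> lat S"
proof (cases "z1 = z2")
  case True then show ?thesis using assms by simp
next
  case False
  then have pos: "real_of_int z2 - z1 > 0" using assms by simp
  define t where "t = (real_of_int z2 - z) / (real_of_int z2 - z1)"
  have t: "0 \<le> t" "t \<le> 1" "t * (real_of_int z2 - z1) = real_of_int z2 - z"
    using pos assms by (simp_all add: t_def field_simps)
  show ?thesis
    by (rule latI3[OF assms(1,2,2), of t "1 - t" 0]) (use t in \<open>simp_all add: algebra_simps\<close>)
qed

lemma lat_midpoint:
  assumes "(x1, y1, z1) \<in> lat S" "(x2, y2, z2) \<in> lat S" "2 * x = x1 + x2" "2 * y = y1 + y2" "2 * z = z1 + z2"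
  shows "(x, y, z) \<in> lat S"
proof (rule latI3[OF assms(1,2,2), of "1/2" "1/2" 0])
  have "real_of_int (2 * x) = real_of_int (x1 + x2)" "real_of_int (2 * y) = real_of_int (y1 + y2)"
    "real_of_int (2 * z) = real_of_int (z1 + z2)" using assms(3-5) by simp_all
  then show "of_int x = 1/2 * real_of_int x1 + 1/2 * real_of_int x2 + 0 * real_of_int x2" "of_int y = 1/2 * real_of_int y1 + 1/2 * real_of_int y2 + 0 * real_of_int y2"
    "of_int z = 1/2 * real_of_int z1 + 1/2 * real_of_int z2 + 0 * real_of_int z2" by simp_all
qed simp_all

text \<open>The points \<open>(1 - s/r) (x0, y0, \<zeta>) + (s/r) (x0 + X, y0 + Y, h)\<close> with \<open>\<zeta>\<close> in \<open>[z1, z2]\<close> have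
  heights whose \<open>r\<close>-fold covers at least \<open>r\<close> consecutive integers.\<close>
lemma lat_fibre_ratio:
  assumes z: "(x0, y0, z1) \<in> lat S" "(x0, y0, z2) \<in> lat S" "z1 < z2" and p: "(x0 + X, y0 + Y, h) \<in> lat S"
    and xy: "r * x = s * X" "r * y = s * Y" and r: "0 \<le> s" "s < r" "r \<le> (r - s) * (z2 - z1) + 1"
  obtains z where "(x0 + x, y0 + y, z) \<in> lat S"
proof -
  have r0: "0 < r" using r by simp
  define n where "n = (r - s) * z1 + s * h"
  \<comment> \<open>The least integer at or above \<open>n / r\<close>. The interval of admissible
    \<open>r\<close>-fold heights starts at \<open>n\<close> and has length at least
    \<open>r - 1\<close>, so \<open>r * z\<close> falls into it.\<close>
  define z where "z = - ((- n) div r)"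
  have "r * z \<ge> n" "r * z \<le> n + (r - 1)"
  proof -
    have "r * (- n div r) = - n - (- n) mod r" using mult_div_mod_eq[of r "- n"] by linarith
    moreover have "0 \<le> (- n) mod r" "(- n) mod r < r" using r0 by simp_all
    moreover have "r * z = - (r * (- n div r))" by (simp add: z_def)
    ultimately show "r * z \<ge> n" "r * z \<le> n + (r - 1)" by linarith+
  qed
  moreover have "(r - s) * (z2 - z1) = (r - s) * z2 - (r - s) * z1" by (simp add: algebra_simps)
  ultimately have zz: "(r - s) * z1 \<le> r * z - s * h" "r * z - s * h \<le> (r - s) * z2" using r(3) unfolding n_def
    by linarith+
  define R where "R = real_of_int r"
  define q where "q = real_of_int s"
  have R: "R > 0" "q < R" "0 \<le> q" using r r0 by (simp_all add: R_def q_def)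
  define t where "t = (of_int ((r - s) * z2) - of_int (r * z - s * h)) / ((R - q) * real_of_int (z2 - z1))"
  have pos: "(R - q) * real_of_int (z2 - z1) > 0" using R z by simp
  have "real_of_int (r * z - s * h) \<le> real_of_int ((r - s) * z2)" using zz(2) by (simp only: of_int_le_iff)
  then have t0: "0 \<le> t" using pos by (simp add: t_def)
  have "real_of_int ((r - s) * z1) \<le> real_of_int (r * z - s * h)" using zz(1) by (simp only: of_int_le_iff)
  then have "of_int ((r - s) * z2) - of_int (r * z - s * h) \<le> (R - q) * real_of_int (z2 - z1)"
    by (simp add: R_def q_def algebra_simps)
  then have t1: "t \<le> 1" using pos by (simp add: t_def)
  have "t * ((R - q) * real_of_int (z2 - z1)) = of_int ((r - s) * z2) - of_int (r * z - s * h)"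
    using pos by (intro nonzero_eq_divide_eq[THEN iffD1, OF _ t_def]) linarith
  then have tt: "t * ((R - q) * real_of_int (z2 - z1)) = (R - q) * z2 - (R * z - q * h)" by (simp add: R_def q_def)
  have xyR: "R * real_of_int x = q * X" "R * real_of_int y = q * Y"
    using xy unfolding R_def q_def by (metis of_int_mult)+
  have "(x0 + x, y0 + y, z) \<in> lat S"
  proof (rule latI3[OF z(1,2) p, of "(1 - q/R) * t" "(1 - q/R) * (1 - t)" "q/R"])
    show "0 \<le> (1 - q/R) * t" "0 \<le> (1 - q/R) * (1 - t)" using R t0 t1 by simp_all
    show "real_of_int z = (1 - q/R) * t * z1 + (1 - q/R) * (1 - t) * z2 + q/R * h"
    proof -
      have "R * ((1 - q/R) * t * z1 + (1 - q/R) * (1 - t) * z2 + q/R * h) = (R - q) * z2 - t * ((R - q) * real_of_int (z2 - z1)) + q * h"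
        using R by (simp add: field_simps)
      also have "\<dots> = R * z" using tt by simp
      finally show ?thesis using R by simp
    qed
    show "real_of_int (x0 + x) = (1 - q/R) * t * x0 + (1 - q/R) * (1 - t) * x0 + q/R * (x0 + X)"
    proof -
      have "(1 - q/R) * t * x0 + (1 - q/R) * (1 - t) * x0 + q/R * (x0 + X) = x0 + q * X / R" using R by (simp add: field_simps)
      then show ?thesis using R unfolding xyR[symmetric] by simp
    qed
    show "real_of_int (y0 + y) = (1 - q/R) * t * y0 + (1 - q/R) * (1 - t) * y0 + q/R * (y0 + Y)"
    proof -
      have "(1 - q/R) * t * y0 + (1 - q/R) * (1 - t) * y0 + q/R * (y0 + Y) = y0 + q * Y / R" using R by (simp add: field_simps)
      then show ?thesis using R unfolding xyR[symmetric] by simp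
    qed
  qed (use R in \<open>simp_all add: field_simps\<close>)
  then show thesis by (rule that)
qed

text \<open>For \<open>s = 1\<close> a fibre of length one already suffices, as
  \<open>(r - 1) * 1 + 1 = r\<close>. It serves to show that a vertex is not a proper multiple when
  seen from a fibre with two points.\<close>

lemma lat_fibre_scale:
  assumes z: "(x0, y0, z1) \<in> lat S" "(x0, y0, z2) \<in> lat S" "z1 < z2" and p: "(x0 + r * x, y0 + r * y, h) \<in> lat S" and r: "2 \<le> r"
  obtains z where "(x0 + x, y0 + y, z) \<in> lat S"
proof (rule lat_fibre_ratio[OF z p, of r x 1 y])
  have "(r - 1) * 1 \<le> (r - 1) * (z2 - z1)" by (rule mult_left_mono) (use r z in simp_all)
  then show "r \<le> (r - 1) * (z2 - z1) + 1" by simp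
qed (use r that in simp_all)

lemma lat4_cases:
  assumes "(x, y, z) \<in> lat {(x1, y1, z1), (x2, y2, z2), (x3, y3, z3), (x4, y4, z4)}"
  obtains a b c d :: real where "0 \<le> a" "0 \<le> b" "0 \<le> c" "0 \<le> d" "a + b + c + d = 1"
    "of_int x = a * x1 + b * x2 + c * x3 + d * x4" "of_int y = a * y1 + b * y2 + c * y3 + d * y4"
    "of_int z = a * z1 + b * z2 + c * z3 + d * z4"
proof -
  have "emb (x, y, z) \<in> convex hull (insert (emb (x1, y1, z1)) {emb (x2, y2, z2), emb (x3, y3, z3), emb (x4, y4, z4)})"
    using assms by (simp add: lat_def)
  then obtain u v m where u: "0 \<le> u" "0 \<le> v" "u + v = 1" and m: "m \<in> convex hull {emb (x2, y2, z2), emb (x3, y3, z3), emb (x4, y4, z4)}"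
    and e: "emb (x, y, z) = u *\<^sub>R emb (x1, y1, z1) + v *\<^sub>R m"
    by (subst (asm) convex_hull_insert) auto
  obtain p q r where w: "0 \<le> p" "0 \<le> q" "0 \<le> r" "p + q + r = 1" "m = p *\<^sub>R emb (x2, y2, z2) + q *\<^sub>R emb (x3, y3, z3) + r *\<^sub>R emb (x4, y4, z4)"
    using m unfolding convex_hull_3 by blast
  show thesis
  proof (rule that[of u "v * p" "v * q" "v * r"])
    have "v * p + v * q + v * r = v * (p + q + r)" by (simp add: algebra_simps)
    then show "u + v * p + v * q + v * r = 1" using u w by (simp add: add.assoc)
  qed (use u w e in \<open>simp_all add: vec3_eq_iff algebra_simps\<close>)
qed

lemma lat5_cases:
  assumes "(x, y, z) \<in> lat {(x0, y0, z0), (x1, y1, z1), (x2, y2, z2), (x3, y3, z3), (x4, y4, z4)}"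
  obtains e a b c d :: real where "0 \<le> e" "0 \<le> a" "0 \<le> b" "0 \<le> c" "0 \<le> d" "e + a + b + c + d = 1"
    "of_int x = e * x0 + a * x1 + b * x2 + c * x3 + d * x4" "of_int y = e * y0 + a * y1 + b * y2 + c * y3 + d * y4"
    "of_int z = e * z0 + a * z1 + b * z2 + c * z3 + d * z4"
proof -
  have "emb (x, y, z) \<in> convex hull (insert (emb (x0, y0, z0)) (insert (emb (x1, y1, z1)) {emb (x2, y2, z2), emb (x3, y3, z3), emb (x4, y4, z4)}))"
    using assms by (simp add: lat_def)
  then obtain u' v' m' where u': "0 \<le> u'" "0 \<le> v'" "u' + v' = 1" and m': "m' \<in> convex hull (insert (emb (x1, y1, z1)) {emb (x2, y2, z2), emb (x3, y3, z3), emb (x4, y4, z4)})"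
    and e': "emb (x, y, z) = u' *\<^sub>R emb (x0, y0, z0) + v' *\<^sub>R m'"
    by (subst (asm) convex_hull_insert) auto
  obtain u v m where u: "0 \<le> u" "0 \<le> v" "u + v = 1" and m: "m \<in> convex hull {emb (x2, y2, z2), emb (x3, y3, z3), emb (x4, y4, z4)}"
    and e: "m' = u *\<^sub>R emb (x1, y1, z1) + v *\<^sub>R m"
    using m' by (subst (asm) convex_hull_insert) auto
  obtain p q r where w: "0 \<le> p" "0 \<le> q" "0 \<le> r" "p + q + r = 1" "m = p *\<^sub>R emb (x2, y2, z2) + q *\<^sub>R emb (x3, y3, z3) + r *\<^sub>R emb (x4, y4, z4)"
    using m unfolding convex_hull_3 by blast
  show thesis
  proof (rule that[of u' "v' * u" "v' * (v * p)" "v' * (v * q)" "v' * (v * r)"])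
    have "v' * u + v' * (v * p) + v' * (v * q) + v' * (v * r) = v' * (u + v * (p + q + r))" by (simp add: algebra_simps)
    then show "u' + v' * u + v' * (v * p) + v' * (v * q) + v' * (v * r) = 1" using u' u w by (simp add: add.assoc)
  qed (use u' u w e e' in \<open>simp_all add: vec3_eq_iff algebra_simps\<close>)
qed

lemma wide_pair_of_card3:
  fixes F :: "int set" assumes "finite F" "3 \<le> card F"
  obtains z1 z2 where "z1 \<in> F" "z2 \<in> F" "z1 + 2 \<le> z2"
proof -
  have "F \<noteq> {}" using assms by auto
  have "F \<subseteq> {Min F..Max F}" using assms by auto
  then have "card F \<le> nat (Max F - Min F + 1)" by (metis card_atLeastAtMost_int card_mono finite_atLeastAtMost_int add.commute add_diff_eq)
  then show thesis using that[of "Min F" "Max F"] assms \<open>F \<noteq> {}\<close> by auto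
qed

lemma spike_config_finite: "spike_config E v \<Longrightarrow> finite (lat (insert v E))"
  unfolding spike_config_def by (rule card_ge_0_finite) linarith

lemma spike_config_card: "spike_config E v \<Longrightarrow> 7 \<le> card (lat (insert v E))"
  by (simp add: spike_config_def)

lemma spike_config_tip: "spike_config E v \<Longrightarrow> v \<notin> lat E"
  by (simp add: spike_config_def lat_def)

section \<open>Triangles with the tip over the interior\<close>

text \<open>The tip is the origin. Positivity of the three determinants places it strictly inside
  the projected triangle with its vertices in counterclockwise order; divided by their sum they are
  its barycentric coordinates. The functionals appear without their constant term, which equals one,
  so the values 0 and 1 have become -1 and 0, and a vertex has value at least one under its own
  functional.\<close>

locale interior_tip =
  fixes x1 y1 h1 x2 y2 h2 x3 y3 h3 a1 b1 a2 b2 a3 b3 :: int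
  assumes config: "spike_config {(x1, y1, h1), (x2, y2, h2), (x3, y3, h3)} (0, 0, 0)"
    and D1: "0 < x2 * y3 - x3 * y2" and D2: "0 < x3 * y1 - x1 * y3" and D3: "0 < x1 * y2 - x2 * y1"
    and p1: "1 \<le> a1 * x1 + b1 * y1" and p2: "1 \<le> a2 * x2 + b2 * y2" and p3: "1 \<le> a3 * x3 + b3 * y3"
    and g1: "\<And>x y z. (x, y, z) \<in> lat {(0, 0, 0), (x1, y1, h1), (x2, y2, h2), (x3, y3, h3)} \<Longrightarrow>
      (x, y, z) \<noteq> (x1, y1, h1) \<Longrightarrow> a1 * x + b1 * y = 0 \<or> a1 * x + b1 * y = -1"
    and g2: "\<And>x y z. (x, y, z) \<in> lat {(0, 0, 0), (x1, y1, h1), (x2, y2, h2), (x3, y3, h3)} \<Longrightarrow>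
      (x, y, z) \<noteq> (x2, y2, h2) \<Longrightarrow> a2 * x + b2 * y = 0 \<or> a2 * x + b2 * y = -1"
    and g3: "\<And>x y z. (x, y, z) \<in> lat {(0, 0, 0), (x1, y1, h1), (x2, y2, h2), (x3, y3, h3)} \<Longrightarrow>
      (x, y, z) \<noteq> (x3, y3, h3) \<Longrightarrow> a3 * x + b3 * y = 0 \<or> a3 * x + b3 * y = -1"
begin

abbreviation "A \<equiv> lat {(0, 0, 0), (x1, y1, h1), (x2, y2, h2), (x3, y3, h3)}"

text \<open>All data are cyclic, so a fact about vertex 1, or about vertices 1 and 2, has to be
  proved only once.\<close>

lemma rotate: "interior_tip x2 y2 h2 x3 y3 h3 x1 y1 h1 a2 b2 a3 b3 a1 b1"
proof -
  have 1: "{(x2, y2, h2), (x3, y3, h3), (x1, y1, h1)} = {(x1, y1, h1), (x2, y2, h2), (x3, y3, h3)}"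
    and 2: "{(0, 0, 0), (x2, y2, h2), (x3, y3, h3), (x1, y1, h1)} = {(0, 0, 0), (x1, y1, h1), (x2, y2, h2), (x3, y3, h3)}"
    by blast+
  show ?thesis unfolding interior_tip_def 1 2 using config D1 D2 D3 p1 p2 p3 g1 g2 g3 by blast
qed

lemma vertices_mem: "(0, 0, 0) \<in> A" "(x1, y1, h1) \<in> A" "(x2, y2, h2) \<in> A" "(x3, y3, h3) \<in> A"
  by (simp_all add: lat_incl)

lemma entries:
  "a1 * x2 + b1 * y2 = 0 \<or> a1 * x2 + b1 * y2 = -1" "a1 * x3 + b1 * y3 = 0 \<or> a1 * x3 + b1 * y3 = -1"
  "a2 * x1 + b2 * y1 = 0 \<or> a2 * x1 + b2 * y1 = -1" "a2 * x3 + b2 * y3 = 0 \<or> a2 * x3 + b2 * y3 = -1"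
  "a3 * x1 + b3 * y1 = 0 \<or> a3 * x1 + b3 * y1 = -1" "a3 * x2 + b3 * y2 = 0 \<or> a3 * x2 + b3 * y2 = -1"
proof -
  have ne: "(x1, y1) \<noteq> (x2, y2)" "(x1, y1) \<noteq> (x3, y3)" "(x2, y2) \<noteq> (x3, y3)" using D1 D2 D3 by auto
  show "a1 * x2 + b1 * y2 = 0 \<or> a1 * x2 + b1 * y2 = -1"
    by (rule g1[OF vertices_mem(3)]) (use ne(1) in auto)
  show "a1 * x3 + b1 * y3 = 0 \<or> a1 * x3 + b1 * y3 = -1"
    by (rule g1[OF vertices_mem(4)]) (use ne(2) in auto)
  show "a2 * x1 + b2 * y1 = 0 \<or> a2 * x1 + b2 * y1 = -1"
    by (rule g2[OF vertices_mem(2)]) (use ne(1) in auto)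
  show "a2 * x3 + b2 * y3 = 0 \<or> a2 * x3 + b2 * y3 = -1"
    by (rule g2[OF vertices_mem(4)]) (use ne(3) in auto)
  show "a3 * x1 + b3 * y1 = 0 \<or> a3 * x1 + b3 * y1 = -1"
    by (rule g3[OF vertices_mem(2)]) (use ne(2) in auto)
  show "a3 * x2 + b3 * y2 = 0 \<or> a3 * x2 + b3 * y2 = -1"
    by (rule g3[OF vertices_mem(3)]) (use ne(3) in auto)
qed

text \<open>The determinants are the linear relation between three planar vectors, so they
  annihilate every row of the matrix of values of functionals at vertices. Signs and divisibility
  are read off from the three rows.\<close>

lemma row1: "(x2 * y3 - x3 * y2) * (a1 * x1 + b1 * y1) + (x3 * y1 - x1 * y3) * (a1 * x2 + b1 * y2)
    + (x1 * y2 - x2 * y1) * (a1 * x3 + b1 * y3) = 0"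
  by (simp add: algebra_simps)

lemma row2: "(x2 * y3 - x3 * y2) * (a2 * x1 + b2 * y1) + (x3 * y1 - x1 * y3) * (a2 * x2 + b2 * y2)
    + (x1 * y2 - x2 * y1) * (a2 * x3 + b2 * y3) = 0"
  by (simp add: algebra_simps)

lemma row3: "(x2 * y3 - x3 * y2) * (a3 * x1 + b3 * y1) + (x3 * y1 - x1 * y3) * (a3 * x2 + b3 * y2)
    + (x1 * y2 - x2 * y1) * (a3 * x3 + b3 * y3) = 0"
  by (simp add: algebra_simps)

text \<open>Up to the factor \<open>D\<close>, a point in the cone of vertices 1 and 2 is
  \<open>\<alpha>\<close> times the first plus \<open>\<beta>\<close> times the second. Functionals
  1 and 2 are not positive there, which gives \<open>\<alpha> * P \<le> \<beta>\<close> and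
  \<open>\<beta> * Q \<le> \<alpha>\<close> and hence equality throughout. The third functional
  leaves the sum of both vertices or half of it, and the sum lies outside the triangle. The entries
  in the conclusion will make the three edges exclude each other.\<close>

lemma midpoint12:
  assumes q: "(x, y, z) \<in> A" "(x, y, z) \<noteq> (x1, y1, h1)" "(x, y, z) \<noteq> (x2, y2, h2)" "(x, y, z) \<noteq> (x3, y3, h3)"
    and xy: "(x, y) \<noteq> (0, 0)" and s: "0 \<le> x1 * y - x * y1" "x2 * y - x * y2 \<le> 0"
  shows "2 * x = x1 + x2 \<and> 2 * y = y1 + y2 \<and> 2 * z = h1 + h2 \<and>
    a1 * x2 + b1 * y2 = -1 \<and> a2 * x1 + b2 * y1 = -1 \<and> a1 * x3 + b1 * y3 = 0 \<and> a2 * x3 + b2 * y3 = 0"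
proof -
  define \<alpha> where "\<alpha> = x * y2 - x2 * y"
  define \<beta> where "\<beta> = x1 * y - x * y1"
  define D where "D = x1 * y2 - x2 * y1"
  define P where "P = a1 * x1 + b1 * y1"
  define Q where "Q = a2 * x2 + b2 * y2"
  define G12 where "G12 = a1 * x2 + b1 * y2"
  define G21 where "G21 = a2 * x1 + b2 * y1"
  have ab: "0 \<le> \<alpha>" "0 \<le> \<beta>" "0 < D" "1 \<le> P" "1 \<le> Q" using s D3 p1 p2 by (simp_all add: \<alpha>_def \<beta>_def D_def P_def Q_def)
  have Dx: "D * x = \<alpha> * x1 + \<beta> * x2" and Dy: "D * y = \<alpha> * y1 + \<beta> * y2"
    by (simp_all add: D_def \<alpha>_def \<beta>_def algebra_simps)
  have e1: "D * (a1 * x + b1 * y) = \<alpha> * P + \<beta> * G12"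
    and e2: "D * (a2 * x + b2 * y) = \<alpha> * G21 + \<beta> * Q"
    and e3: "D * (a3 * x + b3 * y) = \<alpha> * (a3 * x1 + b3 * y1) + \<beta> * (a3 * x2 + b3 * y2)"
    by (simp_all add: D_def \<alpha>_def \<beta>_def P_def Q_def G12_def G21_def algebra_simps)
  have nz: "\<not> (\<alpha> = 0 \<and> \<beta> = 0)" using Dx Dy xy ab by auto
  have le: "a1 * x + b1 * y \<le> 0" "a2 * x + b2 * y \<le> 0" using g1[OF q(1,2)] g2[OF q(1,3)] by auto
  have l1: "\<alpha> * P + \<beta> * G12 \<le> 0" "\<alpha> * G21 + \<beta> * Q \<le> 0"
    using e1 e2 le ab by (metis mult_nonneg_nonpos less_imp_le)+
  have G: "G12 = 0 \<or> G12 = -1" "G21 = 0 \<or> G21 = -1" using entries by (simp_all add: G12_def G21_def)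
  have PQ: "\<alpha> \<le> \<alpha> * P" "\<beta> \<le> \<beta> * Q" using ab by (simp_all add: mult_le_cancel_left1)
  have G12: "G12 = -1" 
  proof (rule ccontr)
    assume "G12 \<noteq> -1"
    then have "\<alpha> = 0" using G l1 PQ ab by auto
    then show False using l1 PQ ab nz by auto
  qed
  have G21: "G21 = -1" 
  proof (rule ccontr)
    assume "G21 \<noteq> -1"
    then have "\<beta> = 0" using G l1 PQ ab by auto
    then show False using l1 PQ ab nz by auto
  qed
  have l2: "\<alpha> * P \<le> \<beta>" "\<beta> * Q \<le> \<alpha>" using l1 G12 G21 by simp_all
  then have "\<alpha> = \<beta>" using PQ by linarith
  then have eq: "\<alpha> = \<beta>" "0 < \<alpha>" using ab nz by auto
  have "\<alpha> * P = \<alpha>" "\<beta> * Q = \<beta>" using l2 PQ eq by linarith+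
  then have P1: "P = 1" "Q = 1" using eq by auto
  define H13 where "H13 = a1 * x3 + b1 * y3"
  define H23 where "H23 = a2 * x3 + b2 * y3"
  define E1 where "E1 = x2 * y3 - x3 * y2"
  define E2 where "E2 = x3 * y1 - x1 * y3"
  have r1: "E1 - E2 + D * H13 = 0" using row1 G12 P1 unfolding P_def G12_def E1_def E2_def D_def H13_def by simp
  have r2: "E2 - E1 + D * H23 = 0" using row2 G21 P1 unfolding Q_def G21_def E1_def E2_def D_def H23_def by simp
  \<comment> \<open>The leading terms of the two rows cancel, so the two remaining entries add up to
    zero; neither is positive, hence both vanish.\<close>
  have "D * (H13 + H23) = 0" using r1 r2 by (simp add: algebra_simps)
  then have "H13 + H23 = 0" using ab by simp
  then have H: "H13 = 0" "H23 = 0" using entries(2,4) by (auto simp: H13_def H23_def)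
  define K1 where "K1 = a3 * x1 + b3 * y1"
  define K2 where "K2 = a3 * x2 + b3 * y2"
  have E: "0 < E1" "E1 = E2" using D1 r1 H by (simp_all add: E1_def)
  have "E1 * K1 + E2 * K2 + D * (a3 * x3 + b3 * y3) = 0"
    using row3 unfolding K1_def K2_def E1_def E2_def D_def .
  then have "E1 * (K1 + K2) + D * (a3 * x3 + b3 * y3) = 0"
    unfolding E(2)[symmetric] by (simp add: distrib_left)
  moreover have "0 < D * (a3 * x3 + b3 * y3)" using ab p3 by simp
  ultimately have "E1 * (K1 + K2) < 0" by linarith
  then have "K1 + K2 < 0" using E by (simp add: mult_less_0_iff)
  then have K: "K1 + K2 = -1 \<or> K1 + K2 = -2" using entries(5,6) by (auto simp: K1_def K2_def)
  have "D * (a3 * x + b3 * y) = \<alpha> * (K1 + K2)" using e3 eq by (simp add: K1_def K2_def algebra_simps)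
  moreover have "a3 * x + b3 * y = 0 \<or> a3 * x + b3 * y = -1" using g3 q by blast
  ultimately have DK: "D = \<alpha> \<or> D = 2 * \<alpha>" using K eq ab by auto
  obtain t a b c :: real where w: "0 \<le> t" "0 \<le> a" "0 \<le> b" "0 \<le> c" "t + a + b + c = 1"
    "of_int x = a * x1 + b * x2 + c * x3" "of_int y = a * y1 + b * y2 + c * y3" "of_int z = a * h1 + b * h2 + c * h3"
    using lat4_cases[OF q(1)] by (metis (no_types, lifting) add_0 mult_zero_right of_int_0)
  \<comment> \<open>The weight \<open>c\<close> of vertex 3 can only decrease the coordinates
    \<open>\<alpha>\<close> and \<open>\<beta>\<close> given by Cramer's rule.\<close>
  have ra: "real_of_int \<alpha> = a * D - c * E1" 
    unfolding \<alpha>_def D_def E1_def of_int_diff of_int_mult w(6,7) by (simp add: algebra_simps)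
  have rb: "real_of_int \<beta> = b * D - c * E2" 
    unfolding \<beta>_def D_def E2_def of_int_diff of_int_mult w(6,7) by (simp add: algebra_simps)
  have cE: "0 \<le> c * E1" "0 \<le> c * E2" using w E by simp_all
  have "2 * real_of_int \<alpha> = (a + b) * D - c * E1 - c * E2" using ra rb eq by (simp add: algebra_simps)
  moreover have "(a + b) * D \<le> D" using w ab by (simp add: mult_le_cancel_right1)
  ultimately have "2 * real_of_int \<alpha> \<le> real_of_int D" and *: "c * E1 + c * E2 \<le> D - 2 * real_of_int \<alpha>"
    using cE by linarith+
  then have "D = 2 * \<alpha>" using DK eq by auto
  then have "c * E1 + c * E2 \<le> 0" using * by simp
  then have "c * E1 = 0" using cE by linarith
  then have c: "c = 0" and "a * D = real_of_int \<alpha>" "b * D = real_of_int \<beta>" using E ra rb by auto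
  then have "a * (2 * \<alpha>) = \<alpha>" "b * (2 * \<alpha>) = \<alpha>" using eq \<open>D = 2 * \<alpha>\<close> by simp_all
  then have ab2: "a = 1/2" "b = 1/2" using eq by auto
  have "of_int (2 * x) = real_of_int (x1 + x2)" "of_int (2 * y) = real_of_int (y1 + y2)" "of_int (2 * z) = real_of_int (h1 + h2)"
    using w c ab2 by simp_all
  then show ?thesis using G12 G21 H unfolding G12_def G21_def H13_def H23_def of_int_eq_iff by simp
qed

definition pair :: "int \<Rightarrow> int \<Rightarrow> int \<Rightarrow> int \<Rightarrow> int \<Rightarrow> int \<Rightarrow> int \<Rightarrow> int \<Rightarrow> int \<Rightarrow> bool" where
  "pair x y z x' y' z' x'' y'' z'' \<longleftrightarrow> 2 * x = x' + x'' \<and> 2 * y = y' + y'' \<and> 2 * z = z' + z''"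

text \<open>The three cones spanned by pairs of vertices cover the plane: a positive combination of
  the determinants of the point with the vertices is zero, so they are not all of one strict sign,
  and a change of sign between cyclic neighbours selects the cone.\<close>

lemma other_point_cases:
  assumes q: "(x, y, z) \<in> A" "(x, y, z) \<noteq> (x1, y1, h1)" "(x, y, z) \<noteq> (x2, y2, h2)" "(x, y, z) \<noteq> (x3, y3, h3)"
    and xy: "(x, y) \<noteq> (0, 0)"
  shows "pair x y z x1 y1 h1 x2 y2 h2 \<and> a1 * x2 + b1 * y2 = -1 \<and> a2 * x3 + b2 * y3 = 0 \<or>
     pair x y z x2 y2 h2 x3 y3 h3 \<and> a2 * x3 + b2 * y3 = -1 \<and> a3 * x1 + b3 * y1 = 0 \<or>
     pair x y z x3 y3 h3 x1 y1 h1 \<and> a3 * x1 + b3 * y1 = -1 \<and> a1 * x2 + b1 * y2 = 0"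
proof -
  interpret r: interior_tip x2 y2 h2 x3 y3 h3 x1 y1 h1 a2 b2 a3 b3 a1 b1 by (rule rotate)
  interpret rr: interior_tip x3 y3 h3 x1 y1 h1 x2 y2 h2 a3 b3 a1 b1 a2 b2 by (rule r.rotate)
  have A: "r.A = A" "rr.A = A" by (rule arg_cong[where f = lat], blast)+
  define s1 where "s1 = x1 * y - x * y1"
  define s2 where "s2 = x2 * y - x * y2"
  define s3 where "s3 = x3 * y - x * y3"
  have sum: "(x2 * y3 - x3 * y2) * s1 + (x3 * y1 - x1 * y3) * s2 + (x1 * y2 - x2 * y1) * s3 = 0"
    by (simp add: s1_def s2_def s3_def algebra_simps)
  have "0 \<le> s1 \<and> s2 \<le> 0 \<or> 0 \<le> s2 \<and> s3 \<le> 0 \<or> 0 \<le> s3 \<and> s1 \<le> 0"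
  proof (rule ccontr)
    assume "\<not> ?thesis"
    then have "0 < s1 \<and> 0 < s2 \<and> 0 < s3 \<or> s1 < 0 \<and> s2 < 0 \<and> s3 < 0" by linarith
    then show False
    proof
      assume "0 < s1 \<and> 0 < s2 \<and> 0 < s3"
      then have "0 < (x2 * y3 - x3 * y2) * s1" "0 < (x3 * y1 - x1 * y3) * s2" "0 < (x1 * y2 - x2 * y1) * s3"
        using D1 D2 D3 by simp_all
      then show False using sum by linarith
    next
      assume "s1 < 0 \<and> s2 < 0 \<and> s3 < 0"
      then have "(x2 * y3 - x3 * y2) * s1 < 0" "(x3 * y1 - x1 * y3) * s2 < 0" "(x1 * y2 - x2 * y1) * s3 < 0"
        using D1 D2 D3 by (simp_all add: mult_less_0_iff)
      then show False using sum by linarith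
    qed
  qed
  then show ?thesis
    using midpoint12[OF q xy] r.midpoint12[unfolded A, OF q(1,3,4,2) xy] rr.midpoint12[unfolded A, OF q(1,4,2,3) xy]
    unfolding s1_def s2_def s3_def pair_def by blast
qed

text \<open>Any two of the three cases ask for different values of some entry, so both points belong
  to the same edge and are its midpoint.\<close>

lemma other_point_unique:
  assumes q: "(x, y, z) \<in> A" "(x, y, z) \<noteq> (x1, y1, h1)" "(x, y, z) \<noteq> (x2, y2, h2)" "(x, y, z) \<noteq> (x3, y3, h3)" "(x, y) \<noteq> (0, 0)"
    and q': "(x', y', z') \<in> A" "(x', y', z') \<noteq> (x1, y1, h1)" "(x', y', z') \<noteq> (x2, y2, h2)" "(x', y', z') \<noteq> (x3, y3, h3)" "(x', y') \<noteq> (0, 0)"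
  shows "(x, y, z) = (x', y', z')"
  using other_point_cases[OF q] other_point_cases[OF q'] unfolding pair_def by auto

definition "fibre = {z. (0, 0, z) \<in> A}"
definition "others = A - {(x1, y1, h1), (x2, y2, h2), (x3, y3, h3)} - (\<lambda>z. (0, 0, z)) ` fibre"

lemma A_finite: "finite A" using spike_config_finite[OF config] by simp

lemma fibre_finite: "finite fibre"
proof (rule finite_imageD)
  have "(\<lambda>z. (0, 0, z)) ` fibre \<subseteq> A" by (auto simp: fibre_def)
  then show "finite ((\<lambda>z::int. (0::int, 0::int, z)) ` fibre)" using A_finite by (rule finite_subset)
qed (simp add: inj_on_def)

lemma nonzero: "(x1, y1) \<noteq> (0, 0)" "(x2, y2) \<noteq> (0, 0)" "(x3, y3) \<noteq> (0, 0)"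
  using D1 D2 D3 by auto

lemma distinct: "(x1, y1) \<noteq> (x2, y2)" "(x1, y1) \<noteq> (x3, y3)" "(x2, y2) \<noteq> (x3, y3)" using D1 D2 D3 by auto

lemma card_A: "card A = 3 + card fibre + card others" and others_le: "card others \<le> 1"
proof -
  let ?E = "{(x1, y1, h1), (x2, y2, h2), (x3, y3, h3)}" and ?F = "(\<lambda>z. (0::int, 0::int, z)) ` fibre"
  have "?E \<subseteq> A" using vertices_mem by simp
  moreover have "?F \<subseteq> A" by (auto simp: fibre_def)
  ultimately have A: "A = ?E \<union> ?F \<union> others" unfolding others_def by blast
  have fin: "finite ?F" "finite others" using fibre_finite A_finite by (auto simp: others_def)
  have "?E \<inter> ?F = {}" using nonzero by blast
  moreover have "(?E \<union> ?F) \<inter> others = {}" by (auto simp: others_def)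
  ultimately have "card A = card ?E + card ?F + card others"
    using fin by (subst A, subst card_Un_disjoint, simp, simp, simp, subst card_Un_disjoint) simp_all
  moreover have "card ?E = 3"
  proof -
    have "(x1, y1, h1) \<noteq> (x2, y2, h2)" "(x1, y1, h1) \<noteq> (x3, y3, h3)" "(x2, y2, h2) \<noteq> (x3, y3, h3)"
      using distinct by blast+
    then show ?thesis by simp
  qed
  moreover have "card ?F = card fibre" by (rule card_image) (simp add: inj_on_def)
  ultimately show "card A = 3 + card fibre + card others" by simp
  have mem: "(x, y, z) \<in> A" "(x, y, z) \<noteq> (x1, y1, h1)" "(x, y, z) \<noteq> (x2, y2, h2)" "(x, y, z) \<noteq> (x3, y3, h3)" "(x, y) \<noteq> (0, 0)"
    if "(x, y, z) \<in> others" for x y z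
  proof -
    show q: "(x, y, z) \<in> A" "(x, y, z) \<noteq> (x1, y1, h1)" "(x, y, z) \<noteq> (x2, y2, h2)" "(x, y, z) \<noteq> (x3, y3, h3)"
      using that unfolding others_def by blast+
    show "(x, y) \<noteq> (0, 0)"
    proof
      assume "(x, y) = (0, 0)"
      then have "(x, y, z) \<in> ?F" using q(1) unfolding fibre_def by blast
      then show False using that unfolding others_def by blast
    qed
  qed
  have "q = q'" if "q \<in> others" "q' \<in> others" for q q'
  proof -
    obtain x y z x' y' z' where q: "q = (x, y, z)" "q' = (x', y', z')" by (metis prod_cases3)
    show ?thesis unfolding q by (rule other_point_unique; rule mem) (use that q in simp_all)
  qed
  then show "card others \<le> 1" using fin card_le_Suc0_iff_eq[of others] by auto
qed

lemma wide_fibre: obtains z1 z2 where "(0, 0, z1) \<in> A" "(0, 0, z2) \<in> A" "z1 + 2 \<le> z2"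
proof -
  have "7 \<le> card A" using spike_config_card[OF config] by simp
  \<comment> \<open>Three vertices and at most one edge midpoint leave three of the seven points for
    the fibre.\<close>
  then have "3 \<le> card fibre" using card_A others_le by simp
  then obtain z1 z2 where "z1 \<in> fibre" "z2 \<in> fibre" "z1 + 2 \<le> z2" by (rule wide_pair_of_card3[OF fibre_finite])
  then show thesis using that[of z1 z2] by (simp add: fibre_def)
qed

text \<open>If vertex 1 were a proper multiple, the fibre over the origin would produce a lattice
  point over the quotient vector. Functional 1 is not positive there, yet \<open>r\<close> times its
  value is at least one.\<close>

lemma primitive1: assumes "2 \<le> r" "x1 = r * x" "y1 = r * y" shows False
proof -
  obtain z1 z2 where z: "(0, 0, z1) \<in> A" "(0, 0, z2) \<in> A" "z1 + 2 \<le> z2" by (rule wide_fibre)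
  have "(0 + r * x, 0 + r * y, h1) \<in> A" "z1 < z2" using vertices_mem(2) assms z(3) by simp_all
  then obtain z' where z': "(0 + x, 0 + y, z') \<in> A" using lat_fibre_scale[OF z(1,2) _ _ assms(1)] by blast
  have ne: "(x, y, z') \<noteq> (x1, y1, h1)" using assms nonzero(1) by auto
  have "a1 * x1 + b1 * y1 = r * (a1 * x + b1 * y)" using assms by (simp add: algebra_simps)
  moreover have "r * (a1 * x + b1 * y) \<le> 0" using g1[OF _ ne] z' assms(1) by (auto simp: mult_le_0_iff)
  ultimately show False using p1 by simp
qed

lemma coprime1: "coprime x1 y1"
proof (rule ccontr)
  assume "\<not> coprime x1 y1"
  then have "gcd x1 y1 \<noteq> 1" by (simp add: coprime_iff_gcd_eq_1)
  moreover have "gcd x1 y1 \<ge> 0" "gcd x1 y1 \<noteq> 0" using nonzero(1) by simp_all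
  ultimately have "2 \<le> gcd x1 y1" by linarith
  moreover obtain x y where "x1 = gcd x1 y1 * x" "y1 = gcd x1 y1 * y" by (meson dvdE gcd_dvd1 gcd_dvd2)
  ultimately show False using primitive1 by blast
qed

end

section \<open>Arithmetic of coprime vectors and of triples dividing each other's sums\<close>

lemma orthogonal_to_coprime:
  fixes a b x y :: int assumes "coprime x y" "a * x + b * y = 0" obtains m where "a = - m * y" "b = m * x"
proof -
  obtain u v where uv: "u * x + v * y = 1" using assms(1) by (metis bezout_int coprime_iff_gcd_eq_1)
  define m where "m = u * b - v * a"
  have "a = a * (u * x + v * y)" "b = b * (u * x + v * y)" using uv by simp_all
  then have "a = u * (a * x + b * y) - m * y" "b = v * (a * x + b * y) + m * x" by (simp_all add: m_def algebra_simps)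
  then show thesis using that[of m] unfolding assms(2) by simp
qed

text \<open>Modulo two, coprime pairs are nonzero vectors of a plane over the field with two
  elements, and two of these are dependent only if they are equal.\<close>

lemma even_det_parity:
  fixes x y x' y' :: int
  assumes "coprime x y" "coprime x' y'" "even (x * y' - x' * y)" shows "even (x - x') \<and> even (y - y')"
proof -
  have "odd x \<or> odd y" "odd x' \<or> odd y'" using assms(1,2) by (auto dest: coprime_common_divisor[of _ _ 2])
  then show ?thesis using assms(3) by auto
qed

text \<open>Each number divides the sum of the other two, which leaves multiples of (1, 1, 1), (1,
  1, 2) and (1, 2, 3). The last two divisibilities bound the factor: it is 1 or 3 in the first case,
  1 or 2 in the second, and 1 in the third.\<close>

lemma sorted_divisor_triple:
  fixes d1 d2 d3 p1 p2 p3 :: int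
  assumes pos: "0 < d1" "d1 \<le> d2" "d2 \<le> d3" and p: "d1 * p1 = d2 + d3" "d2 * p2 = d1 + d3" "d3 * p3 = d1 + d2"
    and m: "d1 dvd p2 * p3 - 1" "d3 dvd p1 * p2 - 1"
  shows "d1 = 1 \<or> (d1 = 3 \<and> d2 = 3 \<and> d3 = 3) \<or> (even d1 \<and> even d2 \<and> even d3)"
proof -
  have "0 < d3 * p3" "d3 * p3 \<le> d3 * 2" using p(3) pos by linarith+
  then have "p3 = 1 \<or> p3 = 2" using pos by (auto simp: zero_less_mult_iff)
  then show ?thesis
  proof
    assume [simp]: "p3 = 2"
    then have "d1 = d3" "d2 = d3" using p(3) pos by auto
    then have "p1 = 2" "p2 = 2" using p pos by auto
    then have "d3 dvd 3" using m(2) by simp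
    then have "d3 = 1 \<or> d3 = 3" using pos zdvd_imp_le[of d3 3] by (cases "d3 = 2") auto
    then show ?thesis using \<open>d1 = d3\<close> \<open>d2 = d3\<close> by auto
  next
    assume [simp]: "p3 = 1"
    have d3: "d3 = d1 + d2" using p by simp
    have "d2 * (p2 - 1) = 2 * d1" using p(2) d3 by (simp add: algebra_simps)
    moreover from this have "0 < d2 * (p2 - 1)" "d2 * (p2 - 1) \<le> d2 * 2" using pos by linarith+
    then have "p2 = 2 \<or> p2 = 3" using pos by (auto simp: zero_less_mult_iff)
    ultimately show ?thesis
    proof (elim disjE)
      assume [simp]: "p2 = 2"
      show ?thesis using m(1) pos by simp
    next
      assume "d2 * (p2 - 1) = 2 * d1" and [simp]: "p2 = 3"
      then have "d2 = d1" by simp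
      have "d1 dvd 2" using m(1) by simp
      then have "d1 = 1 \<or> d1 = 2" using pos zdvd_imp_le[of d1 2] by auto
      then show ?thesis using \<open>d2 = d1\<close> d3 by auto
    qed
  qed
qed

lemma divisor_triple:
  fixes d1 d2 d3 p1 p2 p3 :: int
  assumes pos: "0 < d1" "0 < d2" "0 < d3" and p: "d1 * p1 = d2 + d3" "d2 * p2 = d1 + d3" "d3 * p3 = d1 + d2"
    and m: "d1 dvd p2 * p3 - 1" "d2 dvd p1 * p3 - 1" "d3 dvd p1 * p2 - 1"
  shows "d1 = 1 \<or> d2 = 1 \<or> d3 = 1 \<or> (d1 = 3 \<and> d2 = 3 \<and> d3 = 3) \<or> (even d1 \<and> even d2 \<and> even d3)"
proof -
  have p': "d1 * p1 = d3 + d2" "d2 * p2 = d3 + d1" "d3 * p3 = d2 + d1" using p by simp_all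
  have m': "d1 dvd p3 * p2 - 1" "d2 dvd p3 * p1 - 1" "d3 dvd p2 * p1 - 1" using m by (simp_all add: mult.commute)
  have "d1 \<le> d2 \<and> d2 \<le> d3 \<or> d1 \<le> d3 \<and> d3 \<le> d2 \<or> d2 \<le> d1 \<and> d1 \<le> d3 \<or> d2 \<le> d3 \<and> d3 \<le> d1 \<or>
     d3 \<le> d1 \<and> d1 \<le> d2 \<or> d3 \<le> d2 \<and> d2 \<le> d1" by linarith
  then show ?thesis
    using sorted_divisor_triple[OF pos(1) _ _ p m(1,3)] sorted_divisor_triple[OF pos(1) _ _ p'(1) p(3,2) m'(1) m(2)]
      sorted_divisor_triple[OF pos(2) _ _ p(2,1) p'(3) m(2) m'(3)]
      sorted_divisor_triple[OF pos(2) _ _ p'(2,3) p(1) m'(2) m(1)]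
      sorted_divisor_triple[OF pos(3) _ _ p(3) p'(1) p'(2) m(3) m'(2)]
      sorted_divisor_triple[OF pos(3) _ _ p'(3,2,1) m'(3,1)]
    by blast
qed

text \<open>\<open>p\<close> and \<open>q\<close> will be the coordinates of the negative of vertex
  1 in the basis of the other two vertices, \<open>c\<close> and \<open>b\<close> the diagonal
  values of functionals 2 and 3. The two equations make \<open>p\<close> and \<open>q\<close> differ
  by at most one, and if they differ, the smaller one divides 1 or 2. The case \<open>p = q\<close>
  is left to primitivity.\<close>

lemma basis_coordinates:
  fixes p q b c s t e f :: int
  assumes "0 < p" "0 < q" "1 \<le> b" "1 \<le> c" "s = 0 \<or> s = -1" "t = 0 \<or> t = -1" "e = 0 \<or> e = 1" "f = 0 \<or> f = 1"
    and pc: "p * c + q * s = e" and qb: "p * t + q * b = f"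
  shows "p = 1 \<and> q = 1 \<or> p = 1 \<and> q = 2 \<or> p = 2 \<and> q = 1 \<or> p = 2 \<and> q = 3 \<or> p = 3 \<and> q = 2 \<or> p = q"
proof -
  have le: "p \<le> p * c" "q \<le> q * b" using assms by (simp_all add: mult_le_cancel_left1)
  have "p \<le> q + 1" using le pc assms(2,5,7) by auto
  moreover have "q \<le> p + 1" using le qb assms(1,6,8) by auto
  ultimately have "p = q \<or> p = q + 1 \<or> q = p + 1" by linarith
  moreover have ?thesis if "p = q + 1"
  proof (cases "t = 0")
    case True
    then have "q = 1" using qb le assms(2,8) by auto
    then show ?thesis using that by simp
  next
    case False
    then have "q * (b - 1) = 1 + f" using qb that assms(6) by (simp add: algebra_simps)
    then have "q dvd 1 + f" by (metis dvd_triv_left)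
    then have "q \<le> 2" using zdvd_imp_le[of q "1 + f"] assms(8) by auto
    then show ?thesis using that assms(2) by auto
  qed
  moreover have ?thesis if "q = p + 1"
  proof (cases "s = 0")
    case True
    then have "p = 1" using pc le assms(1,7) by auto
    then show ?thesis using that by simp
  next
    case False
    then have "p * (c - 1) = 1 + e" using pc that assms(5) by (simp add: algebra_simps)
    then have "p dvd 1 + e" by (metis dvd_triv_left)
    then have "p \<le> 2" using zdvd_imp_le[of p "1 + e"] assms(7) by auto
    then show ?thesis using that assms(1) by auto
  qed
  ultimately show ?thesis by blast
qed

context interior_tip begin

text \<open>A functional vanishing at a primitive vector is an integer multiple \<open>m\<close> of
  the determinant with it. Up to sign, its value at the remaining vertex is \<open>m\<close> times
  \<open>x2 * y3 - x3 * y2\<close>, and the row relation makes that value -1.\<close>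

lemma zero_entry:
  assumes "a1 * x2 + b1 * y2 = 0 \<or> a1 * x3 + b1 * y3 = 0" shows "x2 * y3 - x3 * y2 = 1"
proof -
  interpret r: interior_tip x2 y2 h2 x3 y3 h3 x1 y1 h1 a2 b2 a3 b3 a1 b1 by (rule rotate)
  interpret rr: interior_tip x3 y3 h3 x1 y1 h1 x2 y2 h2 a3 b3 a1 b1 a2 b2 by (rule r.rotate)
  have pos: "0 < (x2 * y3 - x3 * y2) * (a1 * x1 + b1 * y1)" using D1 p1 by simp
  from assms show ?thesis
  proof
    assume z: "a1 * x2 + b1 * y2 = 0"
    then have "a1 * x3 + b1 * y3 = -1" using entries(2) row1 pos by auto
    moreover obtain m where "a1 = - m * y2" "b1 = m * x2" using orthogonal_to_coprime[OF r.coprime1 z] .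
    ultimately have "m * (x2 * y3 - x3 * y2) = -1" by (simp add: algebra_simps)
    then have "x2 * y3 - x3 * y2 dvd 1" by (metis dvd_triv_right dvd_minus_iff)
    then show ?thesis using D1 by simp
  next
    assume z: "a1 * x3 + b1 * y3 = 0"
    then have "a1 * x2 + b1 * y2 = -1" using entries(1) row1 pos by auto
    moreover obtain m where "a1 = - m * y3" "b1 = m * x3" using orthogonal_to_coprime[OF rr.coprime1 z] .
    ultimately have "m * (x2 * y3 - x3 * y2) = 1" by (simp add: algebra_simps)
    then have "x2 * y3 - x3 * y2 dvd 1" by (metis dvd_triv_right)
    then show ?thesis using D1 by simp
  qed
qed

lemma minor12: "(a1 * b2 - a2 * b1) * (x1 * y2 - x2 * y1) =
    (a1 * x1 + b1 * y1) * (a2 * x2 + b2 * y2) - (a1 * x2 + b1 * y2) * (a2 * x1 + b2 * y1)"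
  by (simp add: algebra_simps)

text \<open>The midpoint of the edge is a lattice point, and there functional 1 takes half the sum
  of its values at the ends. This is not positive, so the diagonal value is at most one.\<close>

lemma even_midpoint12:
  assumes "even (x1 - x2)" "even (y1 - y2)" "even (h1 - h2)"
  shows "a1 * x1 + b1 * y1 = 1" "a2 * x2 + b2 * y2 = 1"
proof -
  have "even (x1 + x2)" "even (y1 + y2)" "even (h1 + h2)" using assms by simp_all
  obtain x where x: "x1 + x2 = 2 * x" using \<open>even (x1 + x2)\<close> by (rule evenE)
  obtain y where y: "y1 + y2 = 2 * y" using \<open>even (y1 + y2)\<close> by (rule evenE)
  obtain z where z: "h1 + h2 = 2 * z" using \<open>even (h1 + h2)\<close> by (rule evenE)
  note m = x y z
  have A: "(x, y, z) \<in> A" using lat_midpoint[OF vertices_mem(2,3)] m by simp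
  have ne: "(x, y, z) \<noteq> (x1, y1, h1)" "(x, y, z) \<noteq> (x2, y2, h2)" using m distinct(1) by auto
  have "2 * (a1 * x + b1 * y) = a1 * (x1 + x2) + b1 * (y1 + y2)" using m by (simp add: algebra_simps)
  also have "\<dots> = (a1 * x1 + b1 * y1) + (a1 * x2 + b1 * y2)" by (simp add: algebra_simps)
  finally show "a1 * x1 + b1 * y1 = 1" using g1[OF A ne(1)] p1 entries(1) by auto
  have "2 * (a2 * x + b2 * y) = a2 * (x1 + x2) + b2 * (y1 + y2)" using m by (simp add: algebra_simps)
  also have "\<dots> = (a2 * x1 + b2 * y1) + (a2 * x2 + b2 * y2)" by (simp add: algebra_simps)
  finally show "a2 * x2 + b2 * y2 = 1" using g2[OF A ne(2)] p2 entries(3) by auto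
qed

text \<open>Without a determinant equal to one, \<open>zero_entry\<close> makes every off-diagonal
  entry -1, and rows and minors give the divisibilities of \<open>divisor_triple\<close>. If all
  determinants are even, the projected vertices agree modulo two; two of the three heights have the
  same parity, so an edge has a lattice midpoint and two diagonal values are one, which makes a
  determinant vanish.\<close>

lemma determinant_cases:
  "x2 * y3 - x3 * y2 = 1 \<or> x3 * y1 - x1 * y3 = 1 \<or> x1 * y2 - x2 * y1 = 1 \<or>
   (x1 * y2 - x2 * y1 = 3 \<and> a1 * b2 - a2 * b1 = 1 \<and>
    a1 * x1 + b1 * y1 = 2 \<and> a1 * x2 + b1 * y2 = -1 \<and> a1 * x3 + b1 * y3 = -1 \<and>
    a2 * x1 + b2 * y1 = -1 \<and> a2 * x2 + b2 * y2 = 2 \<and> a2 * x3 + b2 * y3 = -1)"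
proof -
  interpret r: interior_tip x2 y2 h2 x3 y3 h3 x1 y1 h1 a2 b2 a3 b3 a1 b1 by (rule rotate)
  interpret rr: interior_tip x3 y3 h3 x1 y1 h1 x2 y2 h2 a3 b3 a1 b1 a2 b2 by (rule r.rotate)
  define d1 where "d1 = x2 * y3 - x3 * y2"
  define d2 where "d2 = x3 * y1 - x1 * y3"
  define d3 where "d3 = x1 * y2 - x2 * y1"
  define q1 where "q1 = a1 * x1 + b1 * y1"
  define q2 where "q2 = a2 * x2 + b2 * y2"
  define q3 where "q3 = a3 * x3 + b3 * y3"
  have pos: "0 < d1" "0 < d2" "0 < d3" using D1 D2 D3 by (simp_all add: d1_def d2_def d3_def)
  show ?thesis
  proof (rule ccontr)
    assume not: "\<not> ?thesis"
    then have n: "\<not> (a1 * x2 + b1 * y2 = 0 \<or> a1 * x3 + b1 * y3 = 0)" "\<not> (a2 * x3 + b2 * y3 = 0 \<or> a2 * x1 + b2 * y1 = 0)"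
        "\<not> (a3 * x1 + b3 * y1 = 0 \<or> a3 * x2 + b3 * y2 = 0)"
      using zero_entry r.zero_entry rr.zero_entry by blast+
    have e: "a1 * x2 + b1 * y2 = -1" "a1 * x3 + b1 * y3 = -1" "a2 * x1 + b2 * y1 = -1"
      "a2 * x3 + b2 * y3 = -1" "a3 * x1 + b3 * y1 = -1" "a3 * x2 + b3 * y2 = -1"
      using n entries by blast+
    have q: "d1 * q1 = d2 + d3" "d2 * q2 = d1 + d3" "d3 * q3 = d1 + d2"
      using row1 row2 row3 unfolding e q1_def[symmetric] q2_def[symmetric] q3_def[symmetric]
        d1_def[symmetric] d2_def[symmetric] d3_def[symmetric] by linarith+
    have m3: "(a1 * b2 - a2 * b1) * d3 = q1 * q2 - 1"
      using minor12 unfolding e q1_def q2_def d3_def by simp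
    have m1: "(a2 * b3 - a3 * b2) * d1 = q2 * q3 - 1"
      using r.minor12 unfolding e q2_def q3_def d1_def by simp
    have m2: "(a3 * b1 - a1 * b3) * d2 = q1 * q3 - 1"
      using rr.minor12 unfolding e q1_def q3_def d2_def by (simp add: mult.commute)
    have dv: "d1 dvd q2 * q3 - 1" "d2 dvd q1 * q3 - 1" "d3 dvd q1 * q2 - 1"
      using m1 m2 m3 by (metis dvd_triv_right)+
    have "d1 \<noteq> 1" "d2 \<noteq> 1" "d3 \<noteq> 1" using not by (simp_all add: d1_def d2_def d3_def)
    then consider "d1 = 3 \<and> d2 = 3 \<and> d3 = 3" | "even d1" "even d2" "even d3"
      using divisor_triple[OF pos q dv] by blast
    then show False
    proof cases
      case 1
      then have "q1 = 2" "q2 = 2" using q by simp_all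
      then have "a1 * b2 - a2 * b1 = 1" using m3 1 by simp
      then show False using not e \<open>q1 = 2\<close> \<open>q2 = 2\<close> 1 unfolding q1_def q2_def d3_def by blast
    next
      case 2
      have e12: "even (x1 - x2) \<and> even (y1 - y2)" using even_det_parity[OF coprime1 r.coprime1] 2(3) by (simp add: d3_def)
      have e23: "even (x2 - x3) \<and> even (y2 - y3)" using even_det_parity[OF r.coprime1 rr.coprime1] 2(1) by (simp add: d1_def)
      have e31: "even (x3 - x1) \<and> even (y3 - y1)" using even_det_parity[OF rr.coprime1 coprime1] 2(2) by (simp add: d2_def)
      have "even (h1 - h2) \<or> even (h2 - h3) \<or> even (h3 - h1)" by auto
      then have "q1 = 1 \<and> q2 = 1 \<or> q2 = 1 \<and> q3 = 1 \<or> q3 = 1 \<and> q1 = 1"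
        using even_midpoint12 r.even_midpoint12 rr.even_midpoint12 e12 e23 e31 unfolding q1_def q2_def q3_def by blast
      then show False using q pos by auto
    qed
  qed
qed

text \<open>The vertical line through the tip meets the plane of the three vertices at height
  \<open>- T / S\<close>, the weighted mean of their heights; the fibre consists of the integers
  from there up to the tip.\<close>

lemma fibre_eq:
  assumes T: "(x2 * y3 - x3 * y2) * h1 + (x3 * y1 - x1 * y3) * h2 + (x1 * y2 - x2 * y1) * h3 = - T" and pos: "0 < T"
    and S: "(x2 * y3 - x3 * y2) + (x3 * y1 - x1 * y3) + (x1 * y2 - x2 * y1) = S"
  shows "fibre = {- (T div S)..0}"
proof -
  define d1 where "d1 = x2 * y3 - x3 * y2"
  define d2 where "d2 = x3 * y1 - x1 * y3"
  define d3 where "d3 = x1 * y2 - x2 * y1"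
  have d: "0 < d1" "0 < d2" "0 < d3" using D1 D2 D3 by (simp_all add: d1_def d2_def d3_def)
  have S': "S = d1 + d2 + d3" "0 < S" using S d by (simp_all add: d1_def d2_def d3_def)
  have T': "d1 * h1 + d2 * h2 + d3 * h3 = - T" using T by (simp add: d1_def d2_def d3_def)
  have "z \<in> fibre \<longleftrightarrow> - T \<le> S * z \<and> z \<le> 0" for z
  proof
    assume "z \<in> fibre"
    then have "(0, 0, z) \<in> A" by (simp add: fibre_def)
    then obtain t a b c :: real where w: "0 \<le> t" "0 \<le> a" "0 \<le> b" "0 \<le> c" "t + a + b + c = 1"
      "of_int 0 = t * of_int 0 + a * x1 + b * x2 + c * x3" "of_int 0 = t * of_int 0 + a * y1 + b * y2 + c * y3" "of_int z = t * of_int 0 + a * h1 + b * h2 + c * h3"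
      by (rule lat4_cases)
    have z0: "a * x1 + b * x2 + c * x3 = 0" "a * y1 + b * y2 + c * y3 = 0" using w(6,7) by simp_all
    \<comment> \<open>Cramer's rule: the weights of the vertices in a combination over the origin
      are proportional to the determinants.\<close>
    have "a * d3 - c * d1 = (a * x1 + b * x2 + c * x3) * y2 - (a * y1 + b * y2 + c * y3) * x2"
      by (simp add: d3_def d1_def algebra_simps)
    then have a: "a * d3 = c * d1" using z0 by simp
    have "b * d3 - c * d2 = (a * y1 + b * y2 + c * y3) * x1 - (a * x1 + b * x2 + c * x3) * y1"
      by (simp add: d3_def d2_def algebra_simps)
    then have b: "b * d3 = c * d2" using z0 by simp
    have "d3 * real_of_int z = (a * d3) * h1 + (b * d3) * h2 + c * d3 * h3" using w(8) by (simp add: algebra_simps)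
    also have "\<dots> = c * real_of_int (d1 * h1 + d2 * h2 + d3 * h3)" unfolding a b by (simp add: algebra_simps)
    finally have z: "d3 * real_of_int z = - (c * T)" unfolding T' by simp
    have "d3 * (a + b + c) = c * S" using a b unfolding S' by (simp add: algebra_simps)
    moreover have "d3 * (a + b + c) \<le> d3" using w d by (simp add: mult_le_cancel_left1)
    ultimately have "c * S \<le> d3" by simp
    then have "c * S * T \<le> d3 * T" using pos by simp
    moreover have "d3 * (S * real_of_int z) = - (c * S * T)" using z by (simp add: algebra_simps)
    ultimately have "d3 * (S * real_of_int z) \<ge> d3 * (- real_of_int T)" by simp
    then have "S * real_of_int z \<ge> - real_of_int T" using d by (intro mult_left_le_imp_le[of d3 "- real_of_int T"]) simp_all
    then have "real_of_int (- T) \<le> real_of_int (S * z)" by simp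
    then have "- T \<le> S * z" unfolding of_int_le_iff .
    moreover have "d3 * real_of_int z \<le> 0" using z w pos by simp
    then have "z \<le> 0" using d by (simp add: mult_le_0_iff)
    ultimately show "- T \<le> S * z \<and> z \<le> 0" by simp
  next
    assume z: "- T \<le> S * z \<and> z \<le> 0"
    define l where "l = - real_of_int z / T"
    have l: "0 \<le> l" "l * T = - real_of_int z" using z pos by (simp_all add: l_def divide_le_0_iff)
    have "real_of_int (- T) \<le> real_of_int (S * z)" using z by (simp only: of_int_le_iff)
    then have "S * (l * T) \<le> T" unfolding l by simp
    then have "(S * l) * T \<le> 1 * T" by (simp add: algebra_simps)
    then have Sl: "S * l \<le> 1" by (intro mult_right_le_imp_le[of "S * l" T 1]) (use pos in simp_all)
    have z0: "d1 * x1 + d2 * x2 + d3 * x3 = 0" "d1 * y1 + d2 * y2 + d3 * y3 = 0"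
      by (simp_all add: d1_def d2_def d3_def algebra_simps)
    have "(0, 0, z) \<in> A"
    proof (rule latI5[OF vertices_mem(1,1-4), of 0 "1 - S * l" "l * d1" "l * d2" "l * d3"])
      have "l * d1 * x1 + l * d2 * x2 + l * d3 * x3 = l * real_of_int (d1 * x1 + d2 * x2 + d3 * x3)" by (simp add: algebra_simps)
      then show "real_of_int 0 = 0 * of_int 0 + (1 - S * l) * of_int 0 + l * d1 * x1 + l * d2 * x2 + l * d3 * x3" unfolding z0 by simp
      have "l * d1 * y1 + l * d2 * y2 + l * d3 * y3 = l * real_of_int (d1 * y1 + d2 * y2 + d3 * y3)" by (simp add: algebra_simps)
      then show "real_of_int 0 = 0 * of_int 0 + (1 - S * l) * of_int 0 + l * d1 * y1 + l * d2 * y2 + l * d3 * y3" unfolding z0 by simp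
      have "l * d1 * h1 + l * d2 * h2 + l * d3 * h3 = l * real_of_int (d1 * h1 + d2 * h2 + d3 * h3)" by (simp add: algebra_simps)
      then show "real_of_int z = 0 * of_int 0 + (1 - S * l) * of_int 0 + l * d1 * h1 + l * d2 * h2 + l * d3 * h3"
        unfolding T' using l by simp
    qed (use d l Sl S' in \<open>simp_all add: algebra_simps\<close>)
    then show "z \<in> fibre" by (simp add: fibre_def)
  qed
  moreover have "- T \<le> S * z \<longleftrightarrow> - (T div S) \<le> z" for z
  proof -
    have "- T \<le> S * z \<longleftrightarrow> (- z) * S \<le> T" by (simp add: algebra_simps) linarith
    also have "\<dots> \<longleftrightarrow> - z \<le> T div S"
    proof
      assume "- z * S \<le> T"
      then show "- z \<le> T div S" using zdiv_mono1[OF _ S'(2)] S'(2) by (metis nonzero_mult_div_cancel_right less_irrefl)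
    next
      assume "- z \<le> T div S"
      then have "- z * S \<le> T div S * S" using S'(2) by (intro mult_right_mono) simp_all
      then show "- z * S \<le> T" using S'(2) div_mult_mod_eq[of T S] pos_mod_sign[of S T] by linarith
    qed
    finally show ?thesis by linarith
  qed
  ultimately show ?thesis by auto
qed

lemma card_A_eq:
  assumes "(x2 * y3 - x3 * y2) * h1 + (x3 * y1 - x1 * y3) * h2 + (x1 * y2 - x2 * y1) * h3 = - T" "0 < T"
    and "(x2 * y3 - x3 * y2) + (x3 * y1 - x1 * y3) + (x1 * y2 - x2 * y1) = S"
  shows "int (card A) = T div S + 4 + int (card others)"
proof -
  have "0 < S" using assms(3) D1 D2 D3 by simp
  then have "0 \<le> T div S" using assms(2) by (simp add: pos_imp_zdiv_nonneg_iff)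
  then have "int (card fibre) = T div S + 1" unfolding fibre_eq[OF assms] by simp
  then show ?thesis using card_A by simp
qed

end

context interior_tip begin

lemma others_empty:
  assumes "\<And>x y z. \<not> pair x y z x1 y1 h1 x2 y2 h2" "\<And>x y z. \<not> pair x y z x2 y2 h2 x3 y3 h3"
     "\<And>x y z. \<not> pair x y z x3 y3 h3 x1 y1 h1"
  shows "card others = 0"
proof -
  have "q \<notin> others" for q
  proof
    assume q: "q \<in> others"
    obtain x y z where [simp]: "q = (x, y, z)" by (metis prod_cases3)
    have "(x, y) \<noteq> (0, 0)"
    proof
      assume "(x, y) = (0, 0)"
      moreover have "(x, y, z) \<in> A" using q unfolding others_def by simp
      ultimately have "(x, y, z) \<in> (\<lambda>z. (0, 0, z)) ` fibre" unfolding fibre_def by blast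
      then show False using q unfolding others_def by simp
    qed
    then show False using other_point_cases[of x y z] q assms unfolding others_def by simp
  qed
  then have "others = {}" by blast
  then show ?thesis by simp
qed

lemma others_one:
  assumes "(x, y, z) \<in> A" "(x, y) \<noteq> (0, 0)" "(x, y) \<noteq> (x1, y1)" "(x, y) \<noteq> (x2, y2)" "(x, y) \<noteq> (x3, y3)"
  shows "card others = 1"
proof -
  have "(x, y, z) \<in> others" using assms unfolding others_def by blast
  moreover have "finite others" using A_finite by (simp add: others_def)
  ultimately have "card others \<noteq> 0" by auto
  then show ?thesis using others_le by linarith
qed

end

section \<open>Position of the tip: constant terms and coplanarity\<close>

lemma vertex_functional:
  assumes config: "spike_config {(x1, y1, h1), (x2, y2, h2), (x3, y3, h3)} (0, 0, 0)"
    and D1: "0 < x2 * y3 - x3 * y2" and D2: "0 < x3 * y1 - x1 * y3" and D3: "0 < x1 * y2 - x2 * y1"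
  shows "\<exists>a b. 1 \<le> a * x1 + b * y1 \<and>
    (\<forall>x y z. (x, y, z) \<in> lat {(0, 0, 0), (x1, y1, h1), (x2, y2, h2), (x3, y3, h3)} \<longrightarrow>
      (x, y, z) \<noteq> (x1, y1, h1) \<longrightarrow> a * x + b * y = 0 \<or> a * x + b * y = -1)"
proof -
  let ?A = "lat {(0, 0, 0), (x1, y1, h1), (x2, y2, h2), (x3, y3, h3)}"
  obtain a b c where f: "2 \<le> plane_fun a b c (x1, y1, h1)"
    "\<And>q. q \<in> ?A - {(x1, y1, h1)} \<Longrightarrow> plane_fun a b c q = 0 \<or> plane_fun a b c q = 1"
    by (rule spike_config_essential[OF config, of "(x1, y1, h1)"]) simp_all
  have f1: "2 \<le> a * x1 + b * y1 + c" using f(1) by (simp add: plane_fun_def)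
  have f2: "a * x + b * y + c = 0 \<or> a * x + b * y + c = 1" if "(x, y, z) \<in> ?A" "(x, y, z) \<noteq> (x1, y1, h1)" for x y z
    using f(2)[of "(x, y, z)"] that unfolding plane_fun_def by simp
  have ne: "(x1, y1) \<noteq> (0, 0)" "(x2, y2) \<noteq> (x1, y1)" "(x3, y3) \<noteq> (x1, y1)" using D1 D2 D3 by auto
  have "(0, 0, 0) \<noteq> (x1, y1, h1)" using ne by auto
  then have c: "c = 0 \<or> c = 1" using f2[of 0 0 0] by (simp add: lat_incl)
  have nn: "0 \<le> a * x2 + b * y2 + c" "0 \<le> a * x3 + b * y3 + c"
    using f2[of x2 y2 h2] f2[of x3 y3 h3] ne by (auto simp: lat_incl)
  \<comment> \<open>The sum of the values at the vertices weighted by determinants is the total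
    determinant times the value \<open>c\<close> at the tip. Vertex 1 contributes a positive term
    and no term is negative, so \<open>c\<close> is not zero.\<close>
  have "((x2 * y3 - x3 * y2) + (x3 * y1 - x1 * y3) + (x1 * y2 - x2 * y1)) * c =
     (x2 * y3 - x3 * y2) * (a * x1 + b * y1 + c) + (x3 * y1 - x1 * y3) * (a * x2 + b * y2 + c)
     + (x1 * y2 - x2 * y1) * (a * x3 + b * y3 + c)" by (simp add: algebra_simps)
  moreover have "0 < (x2 * y3 - x3 * y2) * (a * x1 + b * y1 + c)" "0 \<le> (x3 * y1 - x1 * y3) * (a * x2 + b * y2 + c)"
     "0 \<le> (x1 * y2 - x2 * y1) * (a * x3 + b * y3 + c)"
    using D1 D2 D3 f1 nn by simp_all
  ultimately have "c \<noteq> 0" by auto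
  then have "c = 1" using c by simp
  have "a * x + b * y = 0 \<or> a * x + b * y = -1" if "(x, y, z) \<in> ?A" "(x, y, z) \<noteq> (x1, y1, h1)" for x y z
    using f2[OF that] \<open>c = 1\<close> by linarith
  then show ?thesis using f1 \<open>c = 1\<close> by (intro exI[of _ a] exI[of _ b]) simp
qed

lemma interior_tip_of_config:
  assumes config: "spike_config {(x1, y1, h1), (x2, y2, h2), (x3, y3, h3)} (0, 0, 0)"
    and D: "0 < x2 * y3 - x3 * y2" "0 < x3 * y1 - x1 * y3" "0 < x1 * y2 - x2 * y1"
  obtains a1 b1 a2 b2 a3 b3 where "interior_tip x1 y1 h1 x2 y2 h2 x3 y3 h3 a1 b1 a2 b2 a3 b3"
proof -
  let ?A = "lat {(0, 0, 0), (x1, y1, h1), (x2, y2, h2), (x3, y3, h3)}"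
  have e: "{(x2, y2, h2), (x3, y3, h3), (x1, y1, h1)} = {(x1, y1, h1), (x2, y2, h2), (x3, y3, h3)}"
     "{(x3, y3, h3), (x1, y1, h1), (x2, y2, h2)} = {(x1, y1, h1), (x2, y2, h2), (x3, y3, h3)}"
     "{(0, 0, 0), (x2, y2, h2), (x3, y3, h3), (x1, y1, h1)} = {(0, 0, 0), (x1, y1, h1), (x2, y2, h2), (x3, y3, h3)}"
     "{(0, 0, 0), (x3, y3, h3), (x1, y1, h1), (x2, y2, h2)} = {(0, 0, 0), (x1, y1, h1), (x2, y2, h2), (x3, y3, h3)}"
    by blast+
  obtain a1 b1 where 1: "1 \<le> a1 * x1 + b1 * y1" "\<And>x y z. (x, y, z) \<in> ?A \<Longrightarrow> (x, y, z) \<noteq> (x1, y1, h1) \<Longrightarrow> a1 * x + b1 * y = 0 \<or> a1 * x + b1 * y = -1"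
    using vertex_functional[OF config D] by blast
  obtain a2 b2 where 2: "1 \<le> a2 * x2 + b2 * y2" "\<And>x y z. (x, y, z) \<in> ?A \<Longrightarrow> (x, y, z) \<noteq> (x2, y2, h2) \<Longrightarrow> a2 * x + b2 * y = 0 \<or> a2 * x + b2 * y = -1"
    using vertex_functional[of x2 y2 h2 x3 y3 h3 x1 y1 h1, unfolded e, OF config D(2,3,1)] by blast
  obtain a3 b3 where 3: "1 \<le> a3 * x3 + b3 * y3" "\<And>x y z. (x, y, z) \<in> ?A \<Longrightarrow> (x, y, z) \<noteq> (x3, y3, h3) \<Longrightarrow> a3 * x + b3 * y = 0 \<or> a3 * x + b3 * y = -1"
    using vertex_functional[of x3 y3 h3 x1 y1 h1 x2 y2 h2, unfolded e, OF config D(3,1,2)] by blast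
  have "interior_tip x1 y1 h1 x2 y2 h2 x3 y3 h3 a1 b1 a2 b2 a3 b3"
    unfolding interior_tip_def
    by (intro conjI allI impI;
      (fact config D 1(1) 2(1) 3(1) | (rule 1(2); assumption) | (rule 2(2); assumption) | (rule 3(2); assumption)))
  then show thesis by (rule that)
qed

text \<open>Otherwise the tip would be the convex combination of the vertices with weights
  \<open>d1 / S\<close>, \<open>d2 / S\<close>, \<open>d3 / S\<close>.\<close>

lemma tip_not_coplanar:
  assumes config: "spike_config {(x1, y1, h1), (x2, y2, h2), (x3, y3, h3)} (0, 0, 0)"
    and D: "0 < x2 * y3 - x3 * y2" "0 < x3 * y1 - x1 * y3" "0 < x1 * y2 - x2 * y1"
  shows "(x2 * y3 - x3 * y2) * h1 + (x3 * y1 - x1 * y3) * h2 + (x1 * y2 - x2 * y1) * h3 \<noteq> 0"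
proof
  define d1 where "d1 = x2 * y3 - x3 * y2"
  define d2 where "d2 = x3 * y1 - x1 * y3"
  define d3 where "d3 = x1 * y2 - x2 * y1"
  define S where "S = real_of_int (d1 + d2 + d3)"
  have d: "0 < d1" "0 < d2" "0 < d3" using D by (simp_all add: d1_def d2_def d3_def)
  have S: "0 < S" using d by (simp add: S_def)
  assume "(x2 * y3 - x3 * y2) * h1 + (x3 * y1 - x1 * y3) * h2 + (x1 * y2 - x2 * y1) * h3 = 0"
  then have "d1 * x1 + d2 * x2 + d3 * x3 = 0" "d1 * y1 + d2 * y2 + d3 * y3 = 0" "d1 * h1 + d2 * h2 + d3 * h3 = 0"
    by (simp_all add: d1_def d2_def d3_def algebra_simps)
  then have "real_of_int (d1 * x1 + d2 * x2 + d3 * x3) = 0" "real_of_int (d1 * y1 + d2 * y2 + d3 * y3) = 0"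
    "real_of_int (d1 * h1 + d2 * h2 + d3 * h3) = 0" by simp_all
  then have z: "(d1 * x1 + d2 * x2 + d3 * x3) / S = 0" "(d1 * y1 + d2 * y2 + d3 * y3) / S = 0"
    "(d1 * h1 + d2 * h2 + d3 * h3) / S = 0" by simp_all
  have "(0, 0, 0) \<in> lat {(x1, y1, h1), (x2, y2, h2), (x3, y3, h3)}"
  proof (rule latI3[of x1 y1 h1 _ x2 y2 h2 x3 y3 h3 "d1 / S" "d2 / S" "d3 / S"])
    have "d1 / S + d2 / S + d3 / S = (real_of_int d1 + d2 + d3) / S" by (simp add: add_divide_distrib)
    then show "d1 / S + d2 / S + d3 / S = 1" using S by (simp add: S_def)
  qed (use d S z in \<open>simp_all add: lat_incl add_divide_distrib\<close>)
  then show False using spike_config_tip[OF config] by simp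
qed

section \<open>Coordinate changes and the normal forms of the interior case\<close>

lemma block_mapI:
  "a * d - b * c = 1 \<or> a * d - b * c = -1 \<Longrightarrow> s = 1 \<or> s = -1 \<Longrightarrow>
    block_map (\<lambda>(x, y, z). (a * x + b * y + e, c * x + d * y + f, l * x + m * y + s * z + n))"
  unfolding block_map_def by blast

lemma in_list_reduce:
  assumes "block_map T" "T ` E = E'" "T v = v'" "spike_config E v"
    and "spike_config E' v' \<Longrightarrow> in_list (hull_equiv E' v')"
  shows "in_list (hull_equiv E v)"
  using in_list_block_map[OF assms(1), of E v] spike_config_block_map[OF assms(1,4)] assms(5) unfolding assms(2,3) by blast

lemma hull_equiv4I:
  assumes T: "block_map T" and E: "E = {e1, e2, e3}" and q: "T e1 = q1" "T e2 = q2" "T e3 = q3" "T v = q4"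
    and n: "int (card (lat (insert v E))) = n"
  shows "hull_equiv E v [emb q1, emb q2, emb q3, emb q4] n"
proof (rule hull_equivI[OF T])
  show "T ` insert v E = set [q1, q2, q3, q4]" unfolding E using q by auto
qed (use q n in simp_all)

lemma in_list_1: "2 \<le> k \<Longrightarrow> H [pt 1 (-1) (-1), pt (-1) 1 1, pt (-1) (-1) 0, pt 0 0 k] (k + 4) \<Longrightarrow> in_list H"
  and in_list_2: "2 \<le> k \<Longrightarrow> H [pt 1 (-1) 0, pt (-1) 1 (-1), pt (-1) (-1) 0, pt 0 0 k] (k + 5) \<Longrightarrow> in_list H"
  and in_list_3: "2 \<le> k \<Longrightarrow> H [pt 1 (-1) 0, pt (-1) 1 0, pt (-1) (-1) 0, pt 0 0 k] (k + 6) \<Longrightarrow> in_list H"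
  and in_list_4: "2 \<le> k \<Longrightarrow> H [pt 2 (-1) (-1), pt (-1) 2 1, pt (-1) (-1) 0, pt 0 0 k] (k + 4) \<Longrightarrow> in_list H"
  and in_list_5: "2 \<le> k \<Longrightarrow> a \<in> {-1, 0} \<Longrightarrow>
    H [pt 1 (-1) (-1), pt 0 1 a, pt (-1) (-1) 0, pt 0 0 k] (k + 4) \<Longrightarrow> in_list H"
  and in_list_6: "2 \<le> k \<Longrightarrow> a \<in> {-2, -1, 0} \<Longrightarrow>
    H [pt 1 0 0, pt 0 1 a, pt (-1) (-1) 0, pt 0 0 k] (k + 4) \<Longrightarrow> in_list H"
  and in_list_7: "2 \<le> k \<Longrightarrow> a \<in> {-5, -1} \<Longrightarrow>
    H [pt 2 1 0, pt (-1) 1 a, pt (-1) (-1) 0, pt 0 0 k] (k + 4) \<Longrightarrow> in_list H"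
  and in_list_8: "2 \<le> k \<Longrightarrow> a \<in> {-1, 0} \<Longrightarrow> a \<le> b \<Longrightarrow> b < 2 * k \<Longrightarrow>
    H [pt 1 0 0, pt 0 1 0, pt (-1) 0 a, pt 0 (-1) b, pt 0 0 k] (k + 5) \<Longrightarrow> in_list H"
  and in_list_9: "2 \<le> k \<Longrightarrow> a \<in> {-2, -1, 0} \<Longrightarrow> b \<in> {0, 1} \<Longrightarrow>
    H [pt 1 0 0, pt 0 1 0, pt (-1) (-1) a, pt 1 1 (2 * k - a + b)] (k + 5) \<Longrightarrow> in_list H"
  and in_list_10a: "2 \<le> k \<Longrightarrow> a \<in> {-1, 0} \<Longrightarrow> b \<in> {-1, 0} \<Longrightarrow>
    H [pt 1 0 a, pt 0 2 b, pt (-1) 0 0, pt 0 0 k] (\<lfloor>of_int (3 * k + b) / (2::real)\<rfloor> + 5) \<Longrightarrow> in_list H"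
  and in_list_10b: "2 \<le> k \<Longrightarrow> a \<in> {-1, 0} \<Longrightarrow>
    H [pt 1 0 0, pt 0 2 a, pt (-1) 0 0, pt 0 1 k] (k + 5) \<Longrightarrow> in_list H"
  unfolding in_list_def by blast+

text \<open>All determinants are one, so the fibre has \<open>m div 3 + 1\<close> points. The shear
  raises the tip to \<open>k\<close>, puts the vertex over (-1, -1) at height zero and keeps (1, 0,
  0); the remaining vertex receives the remainder, which is the range -2 to 0 of family (6).\<close>

lemma in_list_triangle_1_1:
  assumes c: "spike_config {(-1, -1, -m), (1, 0, 0), (0, 1, 0)} (0, 0, 0)" and m: "0 < m"
  shows "in_list (hull_equiv {(-1, -1, -m), (1, 0, 0), (0, 1, 0)} (0, 0, 0))"
proof -
  obtain a1 b1 a2 b2 a3 b3 where "interior_tip (-1) (-1) (-m) 1 0 0 0 1 0 a1 b1 a2 b2 a3 b3"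
    by (rule interior_tip_of_config[OF c]) simp_all
  then interpret interior_tip "-1" "-1" "-m" 1 0 0 0 1 0 a1 b1 a2 b2 a3 b3 .
  have "card others = 0" by (rule others_empty) (simp_all add: pair_def, presburger+)
  then have card: "int (card A) = m div 3 + 4" using card_A_eq[of m 3] m by simp
  define k where "k = m div 3"
  have k: "2 \<le> k" using card spike_config_card[OF config] by (simp add: k_def)
  define a where "a = 3 * k - m"
  have a: "a \<in> {-2, -1, 0}" unfolding a_def k_def by simp presburger
  show ?thesis
  proof (rule in_list_6[OF k a])
    have "hull_equiv {(-1, -1, -m), (1, 0, 0), (0, 1, 0)} (0, 0, 0) [emb (1, 0, 0), emb (0, 1, a), emb (-1, -1, 0), emb (0, 0, k)] (k + 4)"
      by (rule hull_equiv4I[OF block_mapI[of 1 1 0 0 1 0 0 "-k" "2 * k - m" k], of _ "(1, 0, 0)" "(0, 1, 0)" "(-1, -1, -m)"])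
        (use card in \<open>auto simp: a_def k_def\<close>)
    then show "hull_equiv {(-1, -1, -m), (1, 0, 0), (0, 1, 0)} (0, 0, 0) [pt 1 0 0, pt 0 1 a, pt (-1) (-1) 0, pt 0 0 k] (k + 4)" by simp
  qed
qed

text \<open>The determinants are 1, 2, 1. Only the edge of vertices 1 and 3 has ends that agree
  modulo two in the plane, and its midpoint is a lattice point exactly if \<open>m\<close> is even:
  this gives family (10b), and odd \<open>m\<close> gives family (5).\<close>

lemma in_list_triangle_2_1:
  assumes c: "spike_config {(-2, -1, -m), (1, 0, 0), (0, 1, 0)} (0, 0, 0)" and m: "0 < m"
  shows "in_list (hull_equiv {(-2, -1, -m), (1, 0, 0), (0, 1, 0)} (0, 0, 0))"
proof -
  obtain a1 b1 a2 b2 a3 b3 where "interior_tip (-2) (-1) (-m) 1 0 0 0 1 0 a1 b1 a2 b2 a3 b3"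
    by (rule interior_tip_of_config[OF c]) simp_all
  then interpret interior_tip "-2" "-1" "-m" 1 0 0 0 1 0 a1 b1 a2 b2 a3 b3 .
  define k where "k = m div 4"
  have card: "int (card A) = k + 4 + int (card others)" using card_A_eq[of m 4] m by (simp add: k_def)
  have 7: "7 \<le> card A" using spike_config_card[OF config] by simp
  have mod: "m = 4 * k \<or> m = 4 * k + 1 \<or> m = 4 * k + 2 \<or> m = 4 * k + 3" unfolding k_def by presburger
  show ?thesis
  proof (cases "even m")
    case True
    then obtain n where n: "m = 2 * n" by (rule evenE)
    have "(-1, 0, -n) \<in> A" using lat_midpoint[OF vertices_mem(2,4)] n by simp
    then have "card others = 1" by (rule others_one) simp_all
    then have card5: "int (card A) = k + 5" using card by simp
    then have k: "2 \<le> k" using 7 by simp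
    define a where "a = 2 * k - n"
    have a: "a \<in> {-1, 0}" using mod n by (auto simp: a_def)
    show ?thesis
    proof (rule in_list_10b[OF k a])
      have "hull_equiv {(-2, -1, -m), (1, 0, 0), (0, 1, 0)} (0, 0, 0) [emb (1, 0, 0), emb (0, 2, a), emb (-1, 0, 0), emb (0, 1, k)] (k + 5)"
        by (rule hull_equiv4I[OF block_mapI[of 0 "-1" 1 1 1 0 1 "a - k" "-k" k], of _ "(0, 1, 0)" "(1, 0, 0)" "(-2, -1, -m)"])
          (use card5 n in \<open>auto simp: a_def\<close>)
      then show "hull_equiv {(-2, -1, -m), (1, 0, 0), (0, 1, 0)} (0, 0, 0) [pt 1 0 0, pt 0 2 a, pt (-1) 0 0, pt 0 1 k] (k + 5)" by simp
    qed
  next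
    case False
    then have "card others = 0" by (intro others_empty) (simp_all add: pair_def, presburger+)
    then have card4: "int (card A) = k + 4" using card by simp
    then have k: "2 \<le> k" using 7 by simp
    obtain n where n: "m = 2 * n + 1" using False by (rule oddE)
    define a where "a = 2 * k - n"
    have a: "a \<in> {-1, 0}" using mod n by (auto simp: a_def)
    show ?thesis
    proof (rule in_list_5[OF k a])
      have "hull_equiv {(-2, -1, -m), (1, 0, 0), (0, 1, 0)} (0, 0, 0) [emb (1, -1, -1), emb (0, 1, a), emb (-1, -1, 0), emb (0, 0, k)] (k + 4)"
        by (rule hull_equiv4I[OF block_mapI[of 0 "-1" 1 1 1 0 0 "a - k" "-1 - k" k], of _ "(0, 1, 0)" "(1, 0, 0)" "(-2, -1, -m)"])
          (use card4 n in \<open>auto simp: a_def\<close>)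
      then show "hull_equiv {(-2, -1, -m), (1, 0, 0), (0, 1, 0)} (0, 0, 0) [pt 1 (-1) (-1), pt 0 1 a, pt (-1) (-1) 0, pt 0 0 k] (k + 4)" by simp
    qed
  qed
qed

text \<open>The determinants are 1, 3, 2 with sum 6. If \<open>m\<close> were divisible by two or by
  three, an edge at vertex 1 would contain a lattice point at which functional 1 or 3 has a
  forbidden value. Hence \<open>m\<close> is 1 or 5 modulo 6, the origin of -1 and -5 in family
  (7).\<close>

lemma in_list_triangle_3_2:
  assumes c: "spike_config {(-3, -2, -m), (1, 0, 0), (0, 1, 0)} (0, 0, 0)" and m: "0 < m"
  shows "in_list (hull_equiv {(-3, -2, -m), (1, 0, 0), (0, 1, 0)} (0, 0, 0))"
proof -
  obtain a1 b1 a2 b2 a3 b3 where "interior_tip (-3) (-2) (-m) 1 0 0 0 1 0 a1 b1 a2 b2 a3 b3"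
    by (rule interior_tip_of_config[OF c]) simp_all
  then interpret interior_tip "-3" "-2" "-m" 1 0 0 0 1 0 a1 b1 a2 b2 a3 b3 .
  have odd: "odd m"
  proof
    assume "even m"
    then obtain n where n: "m = 2 * n" by (rule evenE)
    have "(-1, -1, -n) \<in> A" using lat_midpoint[OF vertices_mem(2,3)] n by simp
    then have "- a1 - b1 = 0 \<or> - a1 - b1 = -1" using g1[of "-1" "-1" "-n"] by simp
    moreover have "a1 = 0 \<or> a1 = -1" "b1 = 0 \<or> b1 = -1" using entries(1,2) by simp_all
    ultimately show False using p1 by auto
  qed
  have m3: "\<not> 3 dvd m"
  proof
    assume "3 dvd m"
    then obtain n where n: "m = 3 * n" by (rule dvdE)
    have "(-1, 0, -n) \<in> A"
      by (rule latI3[OF vertices_mem(2,4,4), of "1/3" "2/3" 0]) (simp_all add: n)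
    then have "a3 = 0 \<or> a3 = 1" using g3[of "-1" 0 "-n"] by simp
    then have "a3 = 0" using entries(6) by auto
    then show False using entries(5) p3 by simp
  qed
  define k where "k = m div 6"
  have "m = 6 * k + m mod 6" "0 \<le> m mod 6" "m mod 6 < 6" unfolding k_def by simp_all
  then have mod: "m = 6 * k + 1 \<or> m = 6 * k + 5" using odd m3 by presburger
  have "card others = 0" using odd by (intro others_empty) (simp_all add: pair_def, presburger+)
  then have card: "int (card A) = k + 4" using card_A_eq[of m 6] m by (simp add: k_def)
  have k: "2 \<le> k" using card spike_config_card[OF config] by simp
  define a where "a = 6 * k - m"
  have a: "a \<in> {-5, -1}" using mod by (auto simp: a_def)
  show ?thesis
  proof (rule in_list_7[OF k a])
    have "hull_equiv {(-3, -2, -m), (1, 0, 0), (0, 1, 0)} (0, 0, 0) [emb (2, 1, 0), emb (-1, 1, a), emb (-1, -1, 0), emb (0, 0, k)] (k + 4)"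
      by (rule hull_equiv4I[OF block_mapI[of "-1" 1 2 "-1" 1 0 0 "-k" "-k" k], of _ "(0, 1, 0)" "(-3, -2, -m)" "(1, 0, 0)"])
        (use card in \<open>auto simp: a_def\<close>)
    then show "hull_equiv {(-3, -2, -m), (1, 0, 0), (0, 1, 0)} (0, 0, 0) [pt 2 1 0, pt (-1) 1 a, pt (-1) (-1) 0, pt 0 0 k] (k + 4)" by simp
  qed
qed

lemma in_list_triangle_swap:
  assumes c: "spike_config {(- p, - q, - m), (1, 0, 0), (0, 1, 0)} (0, 0, 0)"
    and "spike_config {(- q, - p, - m), (1, 0, 0), (0, 1, 0)} (0, 0, 0) \<Longrightarrow>
      in_list (hull_equiv {(- q, - p, - m), (1, 0, 0), (0, 1, 0)} (0, 0, 0))"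
  shows "in_list (hull_equiv {(- p, - q, - m), (1, 0, 0), (0, 1, 0)} (0, 0, 0))"
  by (rule in_list_reduce[OF block_mapI[of 0 0 1 1 1 0 0 0 0 0] _ _ c assms(2)]) auto

context interior_tip begin

text \<open>With determinant one, vertices 2 and 3 are a lattice basis. Sending them to the unit
  vectors and shearing their heights away leaves vertex 1 at \<open>(- p, - q, - T)\<close>: besides
  the planar shape only one integer remains.\<close>

lemma in_list_basis:
  assumes d1: "x2 * y3 - x3 * y2 = 1"
    and T: "(x2 * y3 - x3 * y2) * h1 + (x3 * y1 - x1 * y3) * h2 + (x1 * y2 - x2 * y1) * h3 = - T" "0 < T"
  shows "in_list (hull_equiv {(x1, y1, h1), (x2, y2, h2), (x3, y3, h3)} (0, 0, 0))"
proof -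
  define p where "p = x3 * y1 - x1 * y3"
  define q where "q = x1 * y2 - x2 * y1"
  have pq: "0 < p" "0 < q" using D2 D3 by (simp_all add: p_def q_def)
  have x1: "x1 = - (p * x2 + q * x3)" "y1 = - (p * y2 + q * y3)"
  proof -
    have "(x2 * y3 - x3 * y2) * x1 + p * x2 + q * x3 = 0" "(x2 * y3 - x3 * y2) * y1 + p * y2 + q * y3 = 0"
      by (simp_all add: p_def q_def algebra_simps)
    then show "x1 = - (p * x2 + q * x3)" "y1 = - (p * y2 + q * y3)" unfolding d1 by simp_all
  qed
  let ?c = "a2 * x2 + b2 * y2" and ?b = "a3 * x3 + b3 * y3"
  have "p * ?c + q * (a2 * x3 + b2 * y3) = - (a2 * x1 + b2 * y1)" "p * (a3 * x2 + b3 * y2) + q * ?b = - (a3 * x1 + b3 * y1)"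
    using row2 row3 unfolding d1 p_def[symmetric] q_def[symmetric] by simp_all
  moreover have "- (a2 * x1 + b2 * y1) = 0 \<or> - (a2 * x1 + b2 * y1) = 1" "- (a3 * x1 + b3 * y1) = 0 \<or> - (a3 * x1 + b3 * y1) = 1"
    using entries(3,5) by auto
  ultimately have cases: "p = 1 \<and> q = 1 \<or> p = 1 \<and> q = 2 \<or> p = 2 \<and> q = 1 \<or> p = 2 \<and> q = 3 \<or> p = 3 \<and> q = 2 \<or> p = q"
    by (intro basis_coordinates[OF pq p3 p2 entries(4,6)]) 
  \<comment> \<open>For \<open>p = q\<close> vertex 1 is \<open>p\<close> times a lattice
    vector.\<close>
  have "p = 1" if "p = q"
  proof (rule ccontr)
    assume "p \<noteq> 1"
    then have "2 \<le> p" using pq by simp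
    then show False using primitive1[of p "- (x2 + x3)" "- (y2 + y3)"] x1 that by (simp add: algebra_simps)
  qed
  then have cases: "p = 1 \<and> q = 1 \<or> p = 1 \<and> q = 2 \<or> p = 2 \<and> q = 1 \<or> p = 2 \<and> q = 3 \<or> p = 3 \<and> q = 2"
    using cases by auto
  show ?thesis
  proof (rule in_list_reduce[OF block_mapI[of y3 x2 "- x3" "- y2" 1 0 0 "- (h2 * y3 - h3 * y2)" "h2 * x3 - h3 * x2" 0]])
    show "y3 * x2 - - x3 * - y2 = 1 \<or> y3 * x2 - - x3 * - y2 = - 1" using d1 by (simp add: algebra_simps)
    show "(\<lambda>(x, y, z). (y3 * x + - x3 * y + 0, - y2 * x + x2 * y + 0,
       - (h2 * y3 - h3 * y2) * x + (h2 * x3 - h3 * x2) * y + 1 * z + 0)) ` {(x1, y1, h1), (x2, y2, h2), (x3, y3, h3)}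
       = {(- p, - q, - T), (1, 0, 0), (0, 1, 0)}"
    proof -
      have "y3 * x1 + - x3 * y1 + 0 = - p" "- y2 * x1 + x2 * y1 + 0 = - q"
        by (simp_all add: p_def q_def algebra_simps)
      moreover have "- (h2 * y3 - h3 * y2) * x1 + (h2 * x3 - h3 * x2) * y1 + 1 * h1 + 0 = - T"
        unfolding T(1)[symmetric] d1 by (simp add: algebra_simps)
      moreover have "y3 * x2 + - x3 * y2 + 0 = 1" "- y2 * x2 + x2 * y2 + 0 = 0" "y3 * x3 + - x3 * y3 + 0 = 0" "- y2 * x3 + x2 * y3 + 0 = 1"
        using d1 by (simp_all add: algebra_simps)
      moreover have "- (h2 * y3 - h3 * y2) * x2 + (h2 * x3 - h3 * x2) * y2 + 1 * h2 + 0 = h2 * (1 - (x2 * y3 - x3 * y2))"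
         "- (h2 * y3 - h3 * y2) * x3 + (h2 * x3 - h3 * x2) * y3 + 1 * h3 + 0 = h3 * (1 - (x2 * y3 - x3 * y2))"
        by (simp_all add: algebra_simps)
      ultimately show ?thesis unfolding d1 by (simp only: image_insert image_empty prod.case) simp
    qed
    assume c: "spike_config {(- p, - q, - T), (1, 0, 0), (0, 1, 0)} (0, 0, 0)"
    show "in_list (hull_equiv {(- p, - q, - T), (1, 0, 0), (0, 1, 0)} (0, 0, 0))"
      using cases
    proof (elim disjE conjE)
      assume [simp]: "p = 1" "q = 1"
      show ?thesis using in_list_triangle_1_1[of T] c T(2) by simp
    next
      assume [simp]: "p = 2" "q = 1"
      show ?thesis using in_list_triangle_2_1[of T] c T(2) by simp
    next
      assume [simp]: "p = 1" "q = 2"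
      show ?thesis using in_list_triangle_swap[OF c] in_list_triangle_2_1[of T] T(2) by simp
    next
      assume [simp]: "p = 3" "q = 2"
      show ?thesis using in_list_triangle_3_2[of T] c T(2) by simp
    next
      assume [simp]: "p = 2" "q = 3"
      show ?thesis using in_list_triangle_swap[OF c] in_list_triangle_3_2[of T] T(2) by simp
    qed
  qed (simp_all add: config)
qed

end

text \<open>All determinants are 3, so residues modulo three of the height differences matter; under
  the assumed congruences an integral shear brings the heights to -1, 1, 0. The tip lies
  \<open>k\<close> above the mean height of the vertices.\<close>

lemma in_list_triangle_9:
  assumes c: "spike_config {(2, -1, h1), (-1, 2, h2), (-1, -1, h3)} (0, 0, 0)" and neg: "h1 + h2 + h3 < 0"
    and mod: "3 dvd h1 - h3 + 1" "3 dvd h2 - h3 - 1"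
  shows "in_list (hull_equiv {(2, -1, h1), (-1, 2, h2), (-1, -1, h3)} (0, 0, 0))"
proof -
  obtain a1 b1 a2 b2 a3 b3 where "interior_tip 2 (-1) h1 (-1) 2 h2 (-1) (-1) h3 a1 b1 a2 b2 a3 b3"
    by (rule interior_tip_of_config[OF c]) simp_all
  then interpret interior_tip 2 "-1" h1 "-1" 2 h2 "-1" "-1" h3 a1 b1 a2 b2 a3 b3 .
  have "card others = 0" by (rule others_empty) (simp_all add: pair_def, presburger+)
  obtain n1 where n1: "h1 - h3 + 1 = 3 * n1" using mod(1) by (rule dvdE)
  obtain n2 where n2: "h2 - h3 - 1 = 3 * n2" using mod(2) by (rule dvdE)
  define k where "k = - (n1 + n2 + h3)"
  have k3: "h1 + h2 + h3 = - (3 * k)" using n1 n2 by (simp add: k_def)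
  have "int (card A) = 9 * k div 9 + 4 + int (card others)"
    by (rule card_A_eq) (use k3 neg in simp_all)
  then have card: "int (card A) = k + 4" using \<open>card others = 0\<close> by simp
  have k: "2 \<le> k" using card spike_config_card[OF config] by simp
  show ?thesis
  proof (rule in_list_4[OF k])
    have "hull_equiv {(2, -1, h1), (-1, 2, h2), (-1, -1, h3)} (0, 0, 0) [emb (2, -1, -1), emb (-1, 2, 1), emb (-1, -1, 0), emb (0, 0, k)] (k + 4)"
      by (rule hull_equiv4I[OF block_mapI[of 1 1 0 0 1 0 0 "- n1" "- n2" k], of _ "(2, -1, h1)" "(-1, 2, h2)" "(-1, -1, h3)"])
        (use card n1 n2 in \<open>auto simp: k_def\<close>)
    then show "hull_equiv {(2, -1, h1), (-1, 2, h2), (-1, -1, h3)} (0, 0, 0) [pt 2 (-1) (-1), pt (-1) 2 1, pt (-1) (-1) 0, pt 0 0 k] (k + 4)" by simp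
  qed
qed

text \<open>Otherwise lattice points divide the edge into three parts. At the one next to vertex 1
  functional 1 is at least \<open>(2 * 1 - 1) / 3\<close>, hence positive.\<close>

lemma (in interior_tip) third_points12:
  assumes "3 dvd x1 - x2" "3 dvd y1 - y2" "3 dvd h1 - h2"
  shows False
proof -
  obtain x where x: "x1 - x2 = 3 * x" using assms(1) by (rule dvdE)
  obtain y where y: "y1 - y2 = 3 * y" using assms(2) by (rule dvdE)
  obtain z where z: "h1 - h2 = 3 * z" using assms(3) by (rule dvdE)
  have e: "x1 = x2 + 3 * x" "y1 = y2 + 3 * y" "h1 = h2 + 3 * z" using x y z by simp_all
  have A: "(x2 + 2 * x, y2 + 2 * y, h2 + 2 * z) \<in> A"
    by (rule latI3[OF vertices_mem(2,3,3), of "2/3" "1/3" 0]) (simp_all add: e field_simps)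
  have "(x2 + 2 * x, y2 + 2 * y, h2 + 2 * z) \<noteq> (x1, y1, h1)" using e distinct(1) by auto
  from g1[OF A this] have "a1 * (x2 + 2 * x) + b1 * (y2 + 2 * y) \<le> 0" by auto
  moreover have "3 * (a1 * (x2 + 2 * x) + b1 * (y2 + 2 * y)) = 2 * (a1 * x1 + b1 * y1) + (a1 * x2 + b1 * y2)"
    unfolding e by (simp add: algebra_simps)
  ultimately have "2 * (a1 * x1 + b1 * y1) + (a1 * x2 + b1 * y2) \<le> 0" by simp
  moreover have "2 \<le> 2 * (a1 * x1 + b1 * y1)" using p1 by simp
  ultimately show False using entries(1) by auto
qed

lemma in_list_interior_neg:
  assumes c: "spike_config {(x1, y1, h1), (x2, y2, h2), (x3, y3, h3)} (0, 0, 0)"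
    and D: "0 < x2 * y3 - x3 * y2" "0 < x3 * y1 - x1 * y3" "0 < x1 * y2 - x2 * y1"
    and neg: "(x2 * y3 - x3 * y2) * h1 + (x3 * y1 - x1 * y3) * h2 + (x1 * y2 - x2 * y1) * h3 < 0"
  shows "in_list (hull_equiv {(x1, y1, h1), (x2, y2, h2), (x3, y3, h3)} (0, 0, 0))"
proof -
  obtain a1 b1 a2 b2 a3 b3 where "interior_tip x1 y1 h1 x2 y2 h2 x3 y3 h3 a1 b1 a2 b2 a3 b3"
    by (rule interior_tip_of_config[OF c D])
  then interpret interior_tip x1 y1 h1 x2 y2 h2 x3 y3 h3 a1 b1 a2 b2 a3 b3 .
  interpret r: interior_tip x2 y2 h2 x3 y3 h3 x1 y1 h1 a2 b2 a3 b3 a1 b1 by (rule rotate)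
  interpret rr: interior_tip x3 y3 h3 x1 y1 h1 x2 y2 h2 a3 b3 a1 b1 a2 b2 by (rule r.rotate)
  define T where "T = - ((x2 * y3 - x3 * y2) * h1 + (x3 * y1 - x1 * y3) * h2 + (x1 * y2 - x2 * y1) * h3)"
  have T: "0 < T" using neg by (simp add: T_def)
  have E: "{(x2, y2, h2), (x3, y3, h3), (x1, y1, h1)} = {(x1, y1, h1), (x2, y2, h2), (x3, y3, h3)}"
     "{(x3, y3, h3), (x1, y1, h1), (x2, y2, h2)} = {(x1, y1, h1), (x2, y2, h2), (x3, y3, h3)}" by blast+
  from determinant_cases show ?thesis
  proof (elim disjE conjE)
    assume "x2 * y3 - x3 * y2 = 1"
    then show ?thesis by (rule in_list_basis[OF _ _ T]) (simp add: T_def)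
  next
    assume "x3 * y1 - x1 * y3 = 1"
    then show ?thesis by (rule r.in_list_basis[unfolded E, OF _ _ T]) (simp add: T_def)
  next
    assume "x1 * y2 - x2 * y1 = 1"
    then show ?thesis by (rule rr.in_list_basis[unfolded E, OF _ _ T]) (simp add: T_def)
  next
    assume d: "a1 * b2 - a2 * b1 = 1" and e: "a1 * x1 + b1 * y1 = 2" "a1 * x2 + b1 * y2 = -1" "a1 * x3 + b1 * y3 = -1"
     "a2 * x1 + b2 * y1 = -1" "a2 * x2 + b2 * y2 = 2" "a2 * x3 + b2 * y3 = -1"
    have d3: "x1 * y2 - x2 * y1 = 3" using minor12 d e by simp
    define u where "u = x2 * y3 - x3 * y2"
    define v where "v = x3 * y1 - x1 * y3"
    have "u = 3" "v = 3" using row1 row2 unfolding e d3 u_def[symmetric] v_def[symmetric] by linarith+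
    then have d1: "x2 * y3 - x3 * y2 = 3" and d2: "x3 * y1 - x1 * y3 = 3" by (simp_all add: u_def v_def)
    \<comment> \<open>Functionals 1 and 2 have determinant one and serve as planar coordinates;
      their values at the vertices are the new positions.\<close>
    show ?thesis
    proof (rule in_list_reduce[OF block_mapI[of a1 b2 b1 a2 1 0 0 0 0 0] _ _ c])
      show "a1 * b2 - b1 * a2 = 1 \<or> a1 * b2 - b1 * a2 = - 1" using d by (simp add: mult.commute)
      show "(\<lambda>(x, y, z). (a1 * x + b1 * y + 0, a2 * x + b2 * y + 0, 0 * x + 0 * y + 1 * z + 0)) `
          {(x1, y1, h1), (x2, y2, h2), (x3, y3, h3)} = {(2, -1, h1), (-1, 2, h2), (-1, -1, h3)}"
        by (simp add: e)
      assume c': "spike_config {(2, -1, h1), (-1, 2, h2), (-1, -1, h3)} (0, 0, 0)"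
      have neg': "h1 + h2 + h3 < 0" using neg unfolding d1 d2 d3 by linarith
      obtain a1' b1' a2' b2' a3' b3' where "interior_tip 2 (-1) h1 (-1) 2 h2 (-1) (-1) h3 a1' b1' a2' b2' a3' b3'"
        by (rule interior_tip_of_config[OF c']) simp_all
      then interpret s: interior_tip 2 "-1" h1 "-1" 2 h2 "-1" "-1" h3 a1' b1' a2' b2' a3' b3' .
      interpret sr: interior_tip "-1" 2 h2 "-1" "-1" h3 2 "-1" h1 a2' b2' a3' b3' a1' b1' by (rule s.rotate)
      interpret srr: interior_tip "-1" "-1" h3 2 "-1" h1 "-1" 2 h2 a3' b3' a1' b1' a2' b2' by (rule sr.rotate)
      have "\<not> 3 dvd h1 - h2" using s.third_points12 by auto
      moreover have "\<not> 3 dvd h2 - h3" using sr.third_points12 by auto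
      moreover have "\<not> 3 dvd h3 - h1" using srr.third_points12 by auto
      \<comment> \<open>The three heights are pairwise incongruent modulo three, so up to exchanging
        the first two vertices there is only one pattern.\<close>
      ultimately have "3 dvd h1 - h3 + 1 \<and> 3 dvd h2 - h3 - 1 \<or> 3 dvd h2 - h3 + 1 \<and> 3 dvd h1 - h3 - 1" by presburger
      then show "in_list (hull_equiv {(2, -1, h1), (-1, 2, h2), (-1, -1, h3)} (0, 0, 0))"
      proof (elim disjE conjE)
        assume "3 dvd h1 - h3 + 1" "3 dvd h2 - h3 - 1"
        then show ?thesis by (rule in_list_triangle_9[OF c' neg'])
      next
        assume m: "3 dvd h2 - h3 + 1" "3 dvd h1 - h3 - 1"
        have neg2: "h2 + h1 + h3 < 0" using neg' by simp
        show ?thesis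
          by (rule in_list_reduce[OF block_mapI[of 0 0 1 1 1 0 0 0 0 0] _ _ c' in_list_triangle_9[OF _ neg2 m]]) auto
      qed
    qed simp_all
  qed
qed

text \<open>If the plane of the vertices passes above the tip, the heights are reflected.\<close>

lemma in_list_interior:
  assumes c: "spike_config {(x1, y1, h1), (x2, y2, h2), (x3, y3, h3)} (0, 0, 0)"
    and D: "0 < x2 * y3 - x3 * y2" "0 < x3 * y1 - x1 * y3" "0 < x1 * y2 - x2 * y1"
  shows "in_list (hull_equiv {(x1, y1, h1), (x2, y2, h2), (x3, y3, h3)} (0, 0, 0))"
proof (cases "(x2 * y3 - x3 * y2) * h1 + (x3 * y1 - x1 * y3) * h2 + (x1 * y2 - x2 * y1) * h3 < 0")
  case True
  then show ?thesis by (rule in_list_interior_neg[OF c D])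
next
  case False
  then have neg: "(x2 * y3 - x3 * y2) * (- h1) + (x3 * y1 - x1 * y3) * (- h2) + (x1 * y2 - x2 * y1) * (- h3) < 0"
    using tip_not_coplanar[OF c D] by linarith
  show ?thesis
    by (rule in_list_reduce[OF block_mapI[of 1 1 0 0 "-1" 0 0 0 0 0] _ _ c in_list_interior_neg[OF _ D neg]]) auto
qed

section \<open>Triangles with the tip over an edge\<close>

lemma essential_functional:
  assumes "spike_config E v" "(x1, y1, z1) \<in> E"
  obtains a b c where "2 \<le> a * x1 + b * y1 + c"
    "\<forall>x y z. (x, y, z) \<in> lat (insert v E) \<longrightarrow> (x, y, z) \<noteq> (x1, y1, z1) \<longrightarrow> a * x + b * y + c = 0 \<or> a * x + b * y + c = 1"
proof -
  obtain a b c where f: "2 \<le> plane_fun a b c (x1, y1, z1)"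
    "\<And>q. q \<in> lat (insert v E) - {(x1, y1, z1)} \<Longrightarrow> plane_fun a b c q = 0 \<or> plane_fun a b c q = 1"
    using spike_config_essential[OF assms] by metis
  have "a * x + b * y + c = 0 \<or> a * x + b * y + c = 1" if "(x, y, z) \<in> lat (insert v E)" "(x, y, z) \<noteq> (x1, y1, z1)" for x y z
    using f(2)[of "(x, y, z)"] that unfolding plane_fun_def by simp
  then show thesis using f(1) that[of a b c] by (simp add: plane_fun_def)
qed

text \<open>The form in which the width clause gets contradicted later: by exhibiting a functional
  with two consecutive values off the tip.\<close>

lemma not_constant_without_tip:
  assumes c: "spike_config E v" and "(a, b, d) \<noteq> (0, 0, 0)"
    and "\<And>x y z. (x, y, z) \<in> lat (insert v E) \<Longrightarrow> (x, y, z) \<noteq> v \<Longrightarrow> a * x + b * y + d * z = n \<or> a * x + b * y + d * z = n + 1"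
  shows False
proof -
  obtain p q where pq: "p \<in> lat (insert v E) - {v}" "q \<in> lat (insert v E) - {v}" "lin_fun a b d p + 2 \<le> lin_fun a b d q"
    by (rule spike_config_wide[OF c assms(2)])
  obtain x y z x' y' z' where "p = (x, y, z)" "q = (x', y', z')" by (metis prod_cases3)
  then show False using pq assms(3)[of x y z] assms(3)[of x' y' z'] by (auto simp: lin_fun_def)
qed

text \<open>Over (0, 0) and (0, 1) there are two vertical segments whose upper ends are the tip and
  the midpoint of tip and apex. Their lower ends may be non-integral if \<open>a\<close> or
  \<open>b\<close> is -1, but they lie less than one below zero, so rounding gives 0.\<close>

lemma lat_10a:
  assumes a: "a \<in> {-1, 0}" and b: "b \<in> {-1, 0}" and k: "0 \<le> k"
  shows "lat {(0, 0, k), (1, 0, a), (0, 2, b), (-1, 0, 0)} =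
    {(1, 0, a), (0, 2, b), (-1, 0, 0)} \<union> (\<lambda>z. (0, 0, z)) ` {0..k} \<union> (\<lambda>z. (0, 1, z)) ` {0..(k + b) div 2}"
    (is "?A = ?B")
proof (intro equalityI subsetI)
  fix q assume q: "q \<in> ?A"
  obtain x y z where [simp]: "q = (x, y, z)" by (metis prod_cases3)
  obtain t u v w :: real where w: "0 \<le> t" "0 \<le> u" "0 \<le> v" "0 \<le> w" "t + u + v + w = 1"
    and e: "of_int x = t * of_int 0 + u * of_int 1 + v * of_int 0 + w * of_int (-1)"
      "of_int y = t * of_int 0 + u * of_int 0 + v * of_int 2 + w * of_int 0"
      "of_int z = t * of_int k + u * of_int a + v * of_int b + w * of_int 0"
    using q unfolding \<open>q = _\<close> by (rule lat4_cases)
  have x: "real_of_int x = u - w" and y: "real_of_int y = 2 * v" and z: "real_of_int z = t * k + u * a + v * b" using e by simp_all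
  have "real_of_int x \<le> 1" "real_of_int x \<ge> -1" "real_of_int y \<ge> 0" "real_of_int y \<le> 2" using x y w by simp_all
  then have "x = -1 \<or> x = 0 \<or> x = 1" "y = 0 \<or> y = 1 \<or> y = 2" by auto
  moreover have "z = a" if "x = 1"
  proof -
    have "u = 1" "v = 0" "t = 0" using x w that by simp_all
    then show ?thesis using z by simp
  qed
  moreover have "y = 0" if "x = 1" using x y w that by simp
  moreover have "z = 0" if "x = -1"
  proof -
    have "u = 0" "v = 0" "t = 0" using x w that by simp_all
    then show ?thesis using z by simp
  qed
  moreover have "y = 0" if "x = -1" using x y w that by simp
  moreover have "z = b" if "y = 2"
  proof -
    have "u = 0" "v = 1" "t = 0" using y w that by simp_all
    then show ?thesis using z by simp
  qed
  moreover have "0 \<le> z \<and> z \<le> k" if "x = 0" "y = 0"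
  proof -
    have h: "w = u" "v = 0" "t = 1 - 2 * u" using x y w that by simp_all
    have "u * k \<ge> 0" "u * a \<le> 0" "u * a \<ge> - u" using w k a by (auto simp: mult_le_0_iff)
    moreover have zz: "real_of_int z = k - 2 * (u * k) + u * a" using z h by (simp add: algebra_simps)
    moreover have "u \<le> 1/2" using h w by simp
    ultimately have "real_of_int z \<le> k" by linarith
    have "u * (2 * real_of_int k) \<le> 1/2 * (2 * real_of_int k)" by (rule mult_right_mono) (use \<open>u \<le> 1/2\<close> k in simp_all)
    then have "real_of_int z \<ge> -1/2" using zz \<open>u * a \<ge> - u\<close> \<open>u \<le> 1/2\<close> by simp
    then show ?thesis using \<open>real_of_int z \<le> k\<close> by linarith
  qed
  moreover have "0 \<le> z \<and> z \<le> (k + b) div 2" if "x = 0" "y = 1"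
  proof -
    have h: "w = u" "v = 1/2" "t = 1/2 - 2 * u" using x y w that by simp_all
    have "u * k \<ge> 0" "u * a \<le> 0" "u * a \<ge> - u" using w k a by (auto simp: mult_le_0_iff)
    moreover have zz: "real_of_int z = k / 2 - 2 * (u * k) + u * a + b / 2" using z h by (simp add: algebra_simps)
    moreover have u: "u \<le> 1/4" using h w by simp
    ultimately have "real_of_int (2 * z) \<le> real_of_int (k + b)" by simp
    then have "2 * z \<le> k + b" by (simp only: of_int_le_iff)
    have "u * (2 * real_of_int k) \<le> 1/4 * (2 * real_of_int k)" by (rule mult_right_mono) (use u k in simp_all)
    then have "real_of_int z \<ge> -1/4 + b / 2" using zz \<open>u * a \<ge> - u\<close> u by simp
    then have "real_of_int z > -1" using b by auto
    then show ?thesis using \<open>2 * z \<le> k + b\<close> by simp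
  qed
  ultimately show "q \<in> ?B" by auto
next
  fix q assume q: "q \<in> ?B"
  have m: "(0, 0, k) \<in> ?A" "(1, 0, a) \<in> ?A" "(0, 2, b) \<in> ?A" "(-1, 0, 0) \<in> ?A" by (simp_all add: lat_incl)
  have 0: "(0, 0, 0) \<in> ?A"
  proof -
    consider "a = 0" | "a = -1" "k = 0" | "a = -1" "0 < k" using a k by force
    then show ?thesis
    proof cases
      case 1 then show ?thesis using lat_midpoint[OF m(2,4)] by simp
    next
      case 2 then show ?thesis using m(1) by simp
    next
      case 3
      \<comment> \<open>The base edge passes over the origin at height -1/2; mixing it with the tip
        in the ratio \<open>2 * k\<close> to 1 gives height zero.\<close>
      have "(2 * real_of_int k + 1) \<noteq> 0" using 3 by simp
      then have *: "1 / (2 * real_of_int k + 1) + k / (2 * real_of_int k + 1) + k / (2 * real_of_int k + 1) = 1"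
        by (simp add: add_divide_distrib[symmetric])
      show ?thesis by (rule latI3[OF m(1,2,4), of "1 / (2 * real_of_int k + 1)" "k / (2 * real_of_int k + 1)" "k / (2 * real_of_int k + 1)"])
        (use 3 * in simp_all)
    qed
  qed
  have 00: "(0, 0, z) \<in> ?A" if "0 \<le> z" "z \<le> k" for z by (rule lat_fibre_interval[OF 0 m(1) that])
  have "(0, 1, z) \<in> ?A" if "0 \<le> z" "z \<le> (k + b) div 2" for z
    by (rule lat_midpoint[OF 00[of "2 * z - b"] m(3)]) (use that b in auto)
  then show "q \<in> ?A" using q m 00 by auto
qed

lemma in_list_edge_2:
  assumes c: "spike_config {(0, 2, b), (1, 0, a), (-1, 0, 0)} (0, 0, k)" and a: "a \<in> {-1, 0}" and b: "b \<in> {-1, 0}" and k: "0 \<le> k"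
  shows "in_list (hull_equiv {(0, 2, b), (1, 0, a), (-1, 0, 0)} (0, 0, k))"
proof -
  have E: "insert (0, 0, k) {(0, 2, b), (1, 0, a), (-1, 0, 0)} = {(0, 0, k), (1, 0, a), (0, 2, b), (-1, 0, 0)}" by blast
  let ?F = "(\<lambda>z. (0::int, 0::int, z)) ` {0..k}" and ?G = "(\<lambda>z. (0::int, 1::int, z)) ` {0..(k + b) div 2}"
  let ?V = "{(1::int, 0::int, a), (0, 2, b), (-1, 0, 0)}"
  have "?V \<inter> ?F = {}" "(?V \<union> ?F) \<inter> ?G = {}" by (simp_all add: disjoint_iff image_iff)
  then have "card (?V \<union> ?F \<union> ?G) = card ?V + card ?F + card ?G"
    using card_Un_disjoint[of "?V \<union> ?F" ?G] card_Un_disjoint[of ?V ?F] by simp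
  also have "card ?V = 3" by simp
  also have "card ?F = nat (k + 1)" by (subst card_image) (simp_all add: inj_on_def)
  also have "card ?G = nat ((k + b) div 2 + 1)" by (subst card_image) (simp_all add: inj_on_def)
  finally have card: "int (card (lat (insert (0, 0, k) {(0, 2, b), (1, 0, a), (-1, 0, 0)}))) = 3 + (k + 1) + ((k + b) div 2 + 1)"
    unfolding E lat_10a[OF a b k] using k zdiv_mono1[of "-1" "k + b" 2] b by auto
  have "\<lfloor>of_int (3 * k + b) / (2::real)\<rfloor> = (3 * k + b) div 2" 
    using floor_divide_of_int_eq[of "3 * k + b" 2, where 'a = real] by simp
  \<comment> \<open>The floor of the statement splits into \<open>k + (k + b) div 2\<close>, one
    summand for each fibre.\<close>
  then have fl: "\<lfloor>of_int (3 * k + b) / (2::real)\<rfloor> + 5 = 3 + (k + 1) + ((k + b) div 2 + 1)" by simp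
  have "7 \<le> 3 + (k + 1) + ((k + b) div 2 + 1)" using card spike_config_card[OF c] by linarith
  then have "2 \<le> k" using b by auto
  then show ?thesis
  proof (rule in_list_10a[OF _ a b])
    have "hull_equiv {(0, 2, b), (1, 0, a), (-1, 0, 0)} (0, 0, k) [emb (1, 0, a), emb (0, 2, b), emb (-1, 0, 0), emb (0, 0, k)] (\<lfloor>of_int (3 * k + b) / (2::real)\<rfloor> + 5)"
      by (rule hull_equiv4I[OF block_mapI[of 1 1 0 0 1 0 0 0 0 0], of _ "(1, 0, a)" "(0, 2, b)" "(-1, 0, 0)"])
        (use card fl in auto)
    then show "hull_equiv {(0, 2, b), (1, 0, a), (-1, 0, 0)} (0, 0, k) [pt 1 0 a, pt 0 2 b, pt (-1) 0 0, pt 0 0 k] (\<lfloor>of_int (3 * k + b) / (2::real)\<rfloor> + 5)" by simp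
  qed
qed

lemma two_of_card2:
  fixes F :: "int set" assumes "2 \<le> card F" obtains z1 z2 where "z1 \<in> F" "z2 \<in> F" "z1 < z2"
proof -
  obtain z1 z2 where "z1 \<in> F" "z2 \<in> F" "z1 \<noteq> z2" using assms by (metis card_le_Suc0_iff_eq card.infinite not_less_eq_eq numeral_2_eq_2 zero_le)
  then show thesis using that[of z1 z2] that[of z2 z1] by linarith
qed

text \<open>The functional of the apex is constant along the edge under the tip, so a lattice point
  over (0, 2) would give it a forbidden value. The lattice points other than the three vertices lie
  over (0, 0) and (0, 1), so seven points make one of these fibres long enough for its hull with the
  apex to contain a lattice point over (0, 2).\<close>

lemma long_edge_triangle:
  assumes c: "spike_config {(0, t, g), (1, 0, a), (-1, 0, b)} (0, 0, h)" and t: "3 \<le> t"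
  shows False
proof -
  let ?A = "lat {(0, 0, h), (0, t, g), (1, 0, a), (-1, 0, b)}"
  have mem: "(0, 0, h) \<in> ?A" "(0, t, g) \<in> ?A" "(1, 0, a) \<in> ?A" "(-1, 0, b) \<in> ?A" by (simp_all add: lat_incl)
  obtain \<alpha> \<beta> \<gamma> where f1: "2 \<le> \<alpha> * 0 + \<beta> * t + \<gamma>"
    and f: "\<forall>x y z. (x, y, z) \<in> ?A \<longrightarrow> (x, y, z) \<noteq> (0, t, g) \<longrightarrow> \<alpha> * x + \<beta> * y + \<gamma> = 0 \<or> \<alpha> * x + \<beta> * y + \<gamma> = 1"
    using essential_functional[OF c, of 0 t g] by auto
  have "\<gamma> = 0 \<or> \<gamma> = 1" "\<alpha> + \<gamma> = 0 \<or> \<alpha> + \<gamma> = 1" "- \<alpha> + \<gamma> = 0 \<or> - \<alpha> + \<gamma> = 1"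
    using f[rule_format, OF mem(1)] f[rule_format, OF mem(3)] f[rule_format, OF mem(4)] t by simp_all
  then have \<gamma>: "\<gamma> = 0 \<or> \<gamma> = 1" and \<alpha>: "\<alpha> = 0" by auto
  have "0 < \<beta> * t" using f1 \<gamma> by auto
  then have \<beta>: "1 \<le> \<beta>" using t by (simp add: zero_less_mult_iff)
  have no2: False if "(0, 2, z) \<in> ?A" for z
  proof -
    have "\<beta> * 2 + \<gamma> = 0 \<or> \<beta> * 2 + \<gamma> = 1" using f[rule_format, OF that] t \<alpha> by auto
    then show False using \<gamma> \<beta> by arith
  qed
  have loc: "(x, y, z) = (0, t, g) \<or> (x, y, z) = (1, 0, a) \<or> (x, y, z) = (-1, 0, b) \<or> x = 0 \<and> (y = 0 \<or> y = 1)"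
    if q: "(x, y, z) \<in> ?A" for x y z
  proof (cases "(x, y, z) = (0, t, g)")
    case False
    obtain s u v w :: real where w: "0 \<le> s" "0 \<le> u" "0 \<le> v" "0 \<le> w" "s + u + v + w = 1"
      and e: "of_int x = s * of_int 0 + u * of_int 0 + v * of_int 1 + w * of_int (-1)"
        "of_int y = s * of_int 0 + u * of_int t + v * of_int 0 + w * of_int 0"
        "of_int z = s * of_int h + u * of_int g + v * of_int a + w * of_int b"
      using q by (rule lat4_cases)
    have x: "real_of_int x = v - w" and y: "real_of_int y = u * t" and z: "real_of_int z = s * h + u * g + v * a + w * b" using e by simp_all
    have "0 \<le> real_of_int y" using y w t by simp
    then have y0: "0 \<le> y" by simp
    have "\<beta> * y + \<gamma> \<le> 1" using f[rule_format, OF q False] \<alpha> by auto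
    moreover have "y \<le> \<beta> * y" using \<beta> y0 by (simp add: mult_le_cancel_right1)
    ultimately have "y \<le> 1" using \<gamma> by auto
    then have y01: "y = 0 \<or> y = 1" using y0 by auto
    have x1: "real_of_int x \<le> 1" "real_of_int x \<ge> -1" using x w by simp_all
    then have "x = -1 \<or> x = 0 \<or> x = 1" by auto
    moreover have "(x, y, z) = (1, 0, a)" if "x = 1"
    proof -
      have "v = 1" "s = 0" "u = 0" "w = 0" using x w that by simp_all
      then show ?thesis using y z that by simp
    qed
    moreover have "(x, y, z) = (-1, 0, b)" if "x = -1"
    proof -
      have "w = 1" "s = 0" "u = 0" "v = 0" using x w that by simp_all
      then show ?thesis using y z that by simp
    qed
    ultimately show ?thesis using y01 by auto
  qed simp
  define F0 where "F0 = {z. (0, 0, z) \<in> ?A}"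
  define F1 where "F1 = {z. (0, 1, z) \<in> ?A}"
  let ?G0 = "(\<lambda>z. (0::int, 0::int, z)) ` F0" and ?G1 = "(\<lambda>z. (0::int, 1::int, z)) ` F1"
  have fin: "finite ?A" using spike_config_finite[OF c] by simp
  have "?G0 \<subseteq> ?A" "?G1 \<subseteq> ?A" by (auto simp: F0_def F1_def)
  then have finG: "finite ?G0" "finite ?G1" using fin finite_subset by blast+
  then have finF: "finite F0" "finite F1" by (auto dest!: finite_imageD simp: inj_on_def)
  have "?A \<subseteq> {(0, t, g), (1, 0, a), (-1, 0, b)} \<union> ?G0 \<union> ?G1"
  proof
    fix q assume q: "q \<in> ?A"
    obtain x y z where [simp]: "q = (x, y, z)" by (metis prod_cases3)
    show "q \<in> {(0, t, g), (1, 0, a), (-1, 0, b)} \<union> ?G0 \<union> ?G1"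
      using loc[of x y z] q unfolding F0_def F1_def by auto
  qed
  then have "card ?A \<le> card ({(0, t, g), (1, 0, a), (-1, 0, b)} \<union> ?G0 \<union> ?G1)"
    using finG by (intro card_mono) simp_all
  also have "\<dots> \<le> card {(0::int, t, g), (1, 0::int, a), (-1, 0, b)} + card ?G0 + card ?G1"
    by (meson card_Un_le add_le_mono1 order_trans)
  also have "card ?G0 = card F0" by (rule card_image) (simp add: inj_on_def)
  also have "card ?G1 = card F1" by (rule card_image) (simp add: inj_on_def)
  also have "card {(0::int, t, g), (1, 0::int, a), (-1, 0, b)} = 3" using t by simp
  finally have "7 \<le> 3 + card F0 + card F1" using spike_config_card[OF c] by simp
  then consider "3 \<le> card F0" | "2 \<le> card F1" by linarith
  then show False
  proof cases
    case 1
    then obtain z1 z2 where "z1 \<in> F0" "z2 \<in> F0" and z: "z1 + 2 \<le> z2" by (rule wide_pair_of_card3[OF finF(1)])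
    then have z12: "(0, 0, z1) \<in> ?A" "(0, 0, z2) \<in> ?A" by (simp_all add: F0_def)
    \<comment> \<open>A fibre of length two is long enough because of \<open>3 \<le> t\<close>: the
      bound required is \<open>t \<le> 2 * (t - 2) + 1\<close>.\<close>
    have "(t - 2) * 2 \<le> (t - 2) * (z2 - z1)" by (rule mult_left_mono) (use z t in simp_all)
    then have "t \<le> (t - 2) * (z2 - z1) + 1" using t by simp
    then obtain z' where "(0 + 0, 0 + 2, z') \<in> ?A"
      using lat_fibre_ratio[OF z12, of 0 t g t 0 2 2] z t mem(2) by auto
    then show False using no2 by simp
  next
    case 2
    then obtain z1 z2 where "z1 \<in> F1" "z2 \<in> F1" and z: "z1 < z2" by (rule two_of_card2)
    then have z12: "(0, 1, z1) \<in> ?A" "(0, 1, z2) \<in> ?A" by (simp_all add: F1_def)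
    obtain z' where "(0 + 0, 1 + 1, z') \<in> ?A"
      using lat_fibre_scale[OF z12 z, of "t - 1" 0 1 g] mem(2) t by auto
    then show False using no2 by simp
  qed
qed

text \<open>Heights are normalised by rounding: \<open>k\<close> is half of \<open>n\<close> rounded
  down and \<open>- m\<close> is half of \<open>g + k\<close> rounded up; the remainders become
  \<open>a\<close> and \<open>b\<close>.\<close>

lemma in_list_edge_2':
  assumes c: "spike_config {(0, 2, g), (1, 0, - n), (-1, 0, 0)} (0, 0, 0)" and n: "0 < n"
  shows "in_list (hull_equiv {(0, 2, g), (1, 0, - n), (-1, 0, 0)} (0, 0, 0))"
proof -
  define k where "k = n div 2"
  define a where "a = 2 * k - n"
  define b where "b = - ((g + k) mod 2)"
  define m where "m = - ((g + k) div 2 + (g + k) mod 2)"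
  have a: "a \<in> {-1, 0}" unfolding a_def k_def by simp presburger
  have b: "b \<in> {-1, 0}" unfolding b_def by simp presburger
  have k: "0 \<le> k" using n by (simp add: k_def)
  have m: "g + 2 * m + k = b" unfolding m_def b_def by presburger
  show ?thesis
    by (rule in_list_reduce[OF block_mapI[of 1 1 0 0 1 0 0 k m k] _ _ c in_list_edge_2[OF _ a b k]])
      (use m in \<open>auto simp: a_def\<close>)
qed

text \<open>The apex now lies over (1, 2). Apart from the vertices and the fibre of the tip, the
  only candidates are the midpoints of the two edges at the apex, each a lattice point under a
  parity condition.\<close>

lemma lat_double_triangle:
  assumes n: "0 < n"
  shows "lat {(0, 0, 0), (1, 2, g), (1, 0, - n), (-1, 0, 0)} =
    {(1, 2, g), (1, 0, - n), (-1, 0, 0)} \<union> (\<lambda>z. (0, 0, z)) ` {- (n div 2)..0} \<union> {(1, 1, z) |z. 2 * z = g - n} \<union> {(0, 1, z) |z. 2 * z = g}"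
    (is "?A = ?B")
proof (intro equalityI subsetI)
  fix q assume q: "q \<in> ?A"
  obtain x y z where [simp]: "q = (x, y, z)" by (metis prod_cases3)
  obtain t u v w :: real where w: "0 \<le> t" "0 \<le> u" "0 \<le> v" "0 \<le> w" "t + u + v + w = 1"
    and e: "of_int x = t * of_int 0 + u * of_int 1 + v * of_int 1 + w * of_int (-1)"
      "of_int y = t * of_int 0 + u * of_int 2 + v * of_int 0 + w * of_int 0"
      "of_int z = t * of_int 0 + u * of_int g + v * of_int (- n) + w * of_int 0"
    using q unfolding \<open>q = _\<close> by (rule lat4_cases)
  have x: "real_of_int x = u + v - w" and y: "real_of_int y = 2 * u" and z: "real_of_int z = u * g - v * n" using e by simp_all
  have "real_of_int x \<le> 1" "real_of_int x \<ge> -1" "real_of_int y \<ge> 0" "real_of_int y \<le> 2" using x y w by simp_all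
  then have xy: "x = -1 \<or> x = 0 \<or> x = 1" "y = 0 \<or> y = 1 \<or> y = 2" by auto
  consider "y = 2" | "y = 1" | "y = 0" using xy by blast
  then show "q \<in> ?B"
  proof cases
    case 1
    then have h: "u = 1" "v = 0" "w = 0" using y w by simp_all
    then have "x = 1" "z = g" using x z by simp_all
    then show ?thesis using 1 by simp
  next
    case 2
    then have u: "u = 1/2" using y by simp
    then have "x = 0 \<or> x = 1" using x w xy by auto
    then show ?thesis
    proof
      assume [simp]: "x = 0"
      have "w = 1/2" "v = 0" using x w u by simp_all
      then have "real_of_int (2 * z) = real_of_int g" using z u by simp
      then show ?thesis using 2 unfolding of_int_eq_iff by simp
    next
      assume [simp]: "x = 1"
      have "w = 0" "v = 1/2" using x w u by simp_all
      then have "real_of_int (2 * z) = real_of_int (g - n)" using z u by simp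
      then show ?thesis using 2 unfolding of_int_eq_iff by simp
    qed
  next
    case 3
    then have u: "u = 0" using y by simp
    from xy(1) show ?thesis
    proof (elim disjE)
      assume [simp]: "x = -1"
      have "v = 0" using x w u by simp
      then show ?thesis using 3 z u by simp
    next
      assume [simp]: "x = 1"
      have "v = 1" using x w u by simp
      then have "real_of_int z = real_of_int (- n)" using z u by simp
      then have "z = - n" by linarith
      then show ?thesis using 3 by simp
    next
      assume [simp]: "x = 0"
      have v: "v = w" "v \<le> 1/2" using x w u by simp_all
      have "v * n \<le> 1/2 * n" by (rule mult_right_mono) (use v n in simp_all)
      moreover have "0 \<le> v * n" using w n by simp
      ultimately have "real_of_int (- n) \<le> real_of_int (2 * z)" "real_of_int z \<le> real_of_int 0" using z u by simp_all
      then have "- n \<le> 2 * z" "z \<le> 0" by (simp_all only: of_int_le_iff)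
      then have "z \<in> {- (n div 2)..0}" by auto
      then show ?thesis using 3 by simp
    qed
  qed
next
  fix q assume q: "q \<in> ?B"
  have m: "(0, 0, 0) \<in> ?A" "(1, 2, g) \<in> ?A" "(1, 0, - n) \<in> ?A" "(-1, 0, 0) \<in> ?A" by (simp_all add: lat_incl)
  have 1: "(0, 0, z) \<in> ?A" if "z \<in> {- (n div 2)..0}" for z
  proof (rule latI3[OF m(1,3,4), of "1 + 2 * real_of_int z / n" "- z / n" "- z / n"])
    have "- n \<le> 2 * z" using that by auto
    then have "real_of_int (- n) \<le> real_of_int (2 * z)" by (simp only: of_int_le_iff)
    then show "0 \<le> 1 + 2 * real_of_int z / real_of_int n" using n by (simp add: field_simps)
  qed (use that n in \<open>simp_all add: divide_le_0_iff\<close>)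
  have 2: "(1, 1, z) \<in> ?A" if "2 * z = g - n" for z by (rule lat_midpoint[OF m(2,3)]) (use that in simp_all)
  have 3: "(0, 1, z) \<in> ?A" if "2 * z = g" for z by (rule lat_midpoint[OF m(2,4)]) (use that in simp_all)
  show "q \<in> ?A" using q m 1 2 3 by auto
qed

lemma card_lat_double_triangle:
  assumes n: "0 < n"
  shows "int (card (lat {(0, 0, 0), (1, 2, g), (1, 0, - n), (-1, 0, 0)})) =
    n div 2 + 4 + (if even (g - n) then 1 else 0) + (if even g then 1 else 0)"
proof -
  define F where "F = {- (n div 2)..0}"
  define M where "M = {z. 2 * z = g - n}"
  define N where "N = {z. 2 * z = g}"
  let ?V = "{(1::int, 2::int, g), (1, 0, - n), (-1, 0, 0)}" and ?F = "(\<lambda>z. (0::int, 0::int, z)) ` F"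
    and ?M = "(\<lambda>z. (1::int, 1::int, z)) ` M" and ?N = "(\<lambda>z. (0::int, 1::int, z)) ` N"
  have "{(1::int, 1::int, z) |z. 2 * z = g - n} = ?M" "{(0::int, 1::int, z) |z. 2 * z = g} = ?N"
    unfolding M_def N_def by blast+
  then have A: "lat {(0, 0, 0), (1, 2, g), (1, 0, - n), (-1, 0, 0)} = ?V \<union> ?F \<union> ?M \<union> ?N"
    unfolding lat_double_triangle[OF n] F_def by simp
  have half: "{z. 2 * z = c} = (if even c then {c div 2} else {})" for c :: int by auto
  have cM: "card M = (if even (g - n) then 1 else 0)" "finite M" unfolding M_def half by simp_all
  have cN: "card N = (if even g then 1 else 0)" "finite N" unfolding N_def half by simp_all
  have cF: "int (card F) = n div 2 + 1" "finite F" using n by (simp_all add: F_def)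
  have im: "card ?F = card F" "card ?M = card M" "card ?N = card N" by (intro card_image inj_onI; simp)+
  have d: "?V \<inter> ?F = {}" "(?V \<union> ?F) \<inter> ?M = {}" "(?V \<union> ?F \<union> ?M) \<inter> ?N = {}" by auto
  have fin: "finite ?V" "finite ?F" "finite ?M" "finite ?N" using cM cN cF by simp_all
  have "card (?V \<union> ?F \<union> ?M \<union> ?N) = card ?V + card ?F + card ?M + card ?N"
    using card_Un_disjoint[OF _ fin(4) d(3)] card_Un_disjoint[OF _ fin(3) d(2)] card_Un_disjoint[OF fin(1,2) d(1)] fin
    by (simp only: finite_Un simp_thms)
  moreover have "card ?V = 3" by simp
  ultimately show ?thesis unfolding A im using cM cN cF by simp
qed

text \<open>The parities of \<open>n\<close> and \<open>g\<close> decide how many of the two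
  midpoints are lattice points: none gives family (1), one gives family (2), both give family
  (3).\<close>

lemma in_list_double_triangle:
  assumes c: "spike_config {(1, 2, g), (1, 0, - n), (-1, 0, 0)} (0, 0, 0)" and n: "0 < n"
  shows "in_list (hull_equiv {(1, 2, g), (1, 0, - n), (-1, 0, 0)} (0, 0, 0))" (is "in_list (hull_equiv ?E ?v)")
proof -
  have card: "int (card (lat (insert ?v ?E))) = n div 2 + 4 + (if even (g - n) then 1 else 0) + (if even g then 1 else 0)"
    using card_lat_double_triangle[OF n] by simp
  have 7: "7 \<le> card (lat (insert ?v ?E))" using spike_config_card[OF c] by simp
  define k where "k = n div 2"
  show ?thesis
  proof (cases "even n"; cases "even g")
    assume e: "even n" "even g"
    then obtain m where g: "g = 2 * m" by (auto elim: evenE)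
    have nk: "n = 2 * k" using e by (simp add: k_def)
    have card': "int (card (lat (insert ?v ?E))) = k + 6" using card e by (simp add: k_def)
    \<comment> \<open>Size seven is compatible with \<open>k = 1\<close> here, so the width has to
      exclude it: all points other than the tip lie in the plane where this functional is
      -1.\<close>
    have "k \<noteq> 1"
    proof
      assume k: "k = 1"
      have "1 * x + (-1 - m) * y + 1 * z = -1 \<or> 1 * x + (-1 - m) * y + 1 * z = -1 + 1"
        if "(x, y, z) \<in> lat (insert ?v ?E)" "(x, y, z) \<noteq> ?v" for x y z
        using that unfolding lat_double_triangle[OF n] using nk g k by auto
      then show False using not_constant_without_tip[OF c, of 1 "-1 - m" 1 "-1"] by auto
    qed
    then have k: "2 \<le> k" using n nk by simp
    have "hull_equiv ?E ?v [emb (1, -1, 0), emb (-1, 1, 0), emb (-1, -1, 0), emb (0, 0, k)] (k + 6)"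
      by (rule hull_equiv4I[OF block_mapI[of 1 0 "-1" "-1" 1 0 0 k "- k - m" k], of _ "(1, 0, - n)" "(-1, 0, 0)" "(1, 2, g)"])
        (use card' nk g in auto)
    then show ?thesis by (intro in_list_3[OF k]) simp
  next
    assume e: "even n" "odd g"
    then obtain m where g: "g = 2 * m + 1" by (auto elim: oddE)
    have nk: "n = 2 * k" using e by (simp add: k_def)
    have card': "int (card (lat (insert ?v ?E))) = k + 4" using card e by (simp add: k_def)
    have k: "2 \<le> k" using card' 7 by simp
    have "hull_equiv ?E ?v [emb (1, -1, -1), emb (-1, 1, 1), emb (-1, -1, 0), emb (0, 0, k)] (k + 4)"
      by (rule hull_equiv4I[OF block_mapI[of 1 0 "-1" "-1" 1 0 0 "k - 1" "- k - m" k], of _ "(1, 0, - n)" "(-1, 0, 0)" "(1, 2, g)"])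
        (use card' nk g in auto)
    then show ?thesis by (intro in_list_1[OF k]) simp
  next
    assume e: "odd n" "odd g"
    then obtain m where g: "g = 2 * m + 1" by (auto elim: oddE)
    have nk: "n = 2 * k + 1" using e by (simp add: k_def)
    have card': "int (card (lat (insert ?v ?E))) = k + 5" using card e by (simp add: k_def)
    have k: "2 \<le> k" using card' 7 by simp
    have "hull_equiv ?E ?v [emb (1, -1, 0), emb (-1, 1, -1), emb (-1, -1, 0), emb (0, 0, k)] (k + 5)"
      by (rule hull_equiv4I[OF block_mapI[of 1 0 "-1" "-1" 1 0 0 "k + 1" "- k - m - 1" k], of _ "(1, 0, - n)" "(-1, 0, 0)" "(1, 2, g)"])
        (use card' nk g in auto)
    then show ?thesis by (intro in_list_2[OF k]) simp
  next
    assume e: "odd n" "even g"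
    then obtain m where g: "g = 2 * m" by (auto elim: evenE)
    have nk: "n = 2 * k + 1" using e by (simp add: k_def)
    have card': "int (card (lat (insert ?v ?E))) = k + 5" using card e by (simp add: k_def)
    have k: "2 \<le> k" using card' 7 by simp
    \<comment> \<open>The other midpoint is the lattice point now, so the two ends of the edge
      change roles.\<close>
    have "hull_equiv ?E ?v [emb (1, -1, 0), emb (-1, 1, -1), emb (-1, -1, 0), emb (0, 0, k)] (k + 5)"
      by (rule hull_equiv4I[OF block_mapI[of "-1" "-1" 0 1 1 0 0 k "- k - m" k], of _ "(-1, 0, 0)" "(1, 0, - n)" "(1, 2, g)"])
        (use card' nk g in auto)
    then show ?thesis by (intro in_list_2[OF k]) simp
  qed
qed

text \<open>Over the middle of the edge, an apex at lattice distance one would leave width one in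
  the direction \<open>y\<close>, and distance three or more is excluded by
  \<open>long_edge_triangle\<close>.\<close>

lemma in_list_edge_normal:
  assumes c: "spike_config {(s, t, g), (1, 0, - n), (-1, 0, 0)} (0, 0, 0)" and n: "0 < n"
    and st: "s = 0 \<and> 0 < t \<or> s = 1 \<and> t = 2"
  shows "in_list (hull_equiv {(s, t, g), (1, 0, - n), (-1, 0, 0)} (0, 0, 0))"
  using st
proof (elim disjE conjE)
  assume [simp]: "s = 0" and t: "0 < t"
  consider "t = 1" | "t = 2" | "3 \<le> t" using t by linarith
  then show ?thesis
  proof cases
    case 1
    have "0 * x + 1 * y + 0 * z = 0 \<or> 0 * x + 1 * y + 0 * z = 0 + 1"
      if q: "(x, y, z) \<in> lat (insert (0, 0, 0) {(s, t, g), (1, 0, - n), (-1, 0, 0)})" for x y z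
    proof -
      obtain p u v w :: real where "0 \<le> p" "0 \<le> u" "0 \<le> v" "0 \<le> w" "p + u + v + w = 1"
        "of_int y = p * of_int 0 + u * of_int t + v * of_int 0 + w * of_int 0"
        using lat4_cases[OF q] by metis
      then have "real_of_int y \<ge> 0" "real_of_int y \<le> 1" using 1 by simp_all
      then show ?thesis by auto
    qed
    then show ?thesis using not_constant_without_tip[OF c, of 0 1 0 0] by simp
  next
    case 2
    then show ?thesis using in_list_edge_2'[of g n] c n by simp
  next
    case 3
    then show ?thesis using long_edge_triangle[of t g "- n" 0 0] c by simp
  qed
next
  assume "s = 1" "t = 2"
  then show ?thesis using in_list_double_triangle[of g n] c n by simp
qed

text \<open>On the line through the edge functionals 2 and 3 are proportional, so the product of
  their diagonal values equals the product of the two off-diagonal ones, which are -1. Hence the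
  diagonal values are one and the tip lies over the midpoint of the edge. Functional 2 and the
  determinant with vertex 2 then serve as planar coordinates.\<close>

lemma in_list_edge:
  assumes c: "spike_config {(x1, y1, h1), (x2, y2, h2), (x3, y3, h3)} (0, 0, 0)"
    and D: "x2 * y3 - x3 * y2 = 0" "0 < x3 * y1 - x1 * y3" "0 < x1 * y2 - x2 * y1"
  shows "in_list (hull_equiv {(x1, y1, h1), (x2, y2, h2), (x3, y3, h3)} (0, 0, 0))"
proof -
  define d2 where "d2 = x3 * y1 - x1 * y3"
  define d3 where "d3 = x1 * y2 - x2 * y1"
  have d: "0 < d2" "0 < d3" using D by (simp_all add: d2_def d3_def)
  have dep: "d2 * x2 + d3 * x3 = 0" "d2 * y2 + d3 * y3 = 0"
  proof -
    have "d2 * x2 + d3 * x3 = - ((x2 * y3 - x3 * y2) * x1)" "d2 * y2 + d3 * y3 = - ((x2 * y3 - x3 * y2) * y1)"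
      by (simp_all add: d2_def d3_def algebra_simps)
    then show "d2 * x2 + d3 * x3 = 0" "d2 * y2 + d3 * y3 = 0" using D(1) by simp_all
  qed
  let ?E = "{(x1, y1, h1), (x2, y2, h2), (x3, y3, h3)}"
  let ?A = "lat (insert (0, 0, 0) ?E)"
  have mem: "(0, 0, 0) \<in> ?A" "(x1, y1, h1) \<in> ?A" "(x2, y2, h2) \<in> ?A" "(x3, y3, h3) \<in> ?A" by (simp_all add: lat_incl)
  have ne: "(x1, y1) \<noteq> (0, 0)" "(x2, y2) \<noteq> (0, 0)" "(x3, y3) \<noteq> (0, 0)" "(x1, y1) \<noteq> (x2, y2)" "(x1, y1) \<noteq> (x3, y3)" using D by auto
  have ne23: "(x2, y2) \<noteq> (x3, y3)"
  proof
    assume "(x2, y2) = (x3, y3)"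
    then have "(d2 + d3) * x2 = 0" "(d2 + d3) * y2 = 0" using dep by (simp_all add: algebra_simps)
    then show False using d ne(2) by auto
  qed
  \<comment> \<open>The linear part is positive at one end of the edge and the tip lies strictly
    between the ends, so it is negative at the other end; this leaves constant term one and the
    value -1 there.\<close>
  have key: "\<exists>a b. 1 \<le> a * xi + b * yi \<and> a * xj + b * yj = -1 \<and> (a * x1 + b * y1 = 0 \<or> a * x1 + b * y1 = -1)"
    if i: "(xi, yi, zi) \<in> ?E" and j: "(xj, yj, zj) \<in> ?A" "(xj, yj) \<noteq> (xi, yi)" "(xi, yi) \<noteq> (0, 0)" "(x1, y1) \<noteq> (xi, yi)"
      and e: "ei * xi + ej * xj = 0" "ei * yi + ej * yj = 0" "0 < ei" "0 < ej" for xi yi zi xj yj zj ei ej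
  proof -
    obtain a b c where f1: "2 \<le> a * xi + b * yi + c"
      and f: "\<forall>x y z. (x, y, z) \<in> ?A \<longrightarrow> (x, y, z) \<noteq> (xi, yi, zi) \<longrightarrow> a * x + b * y + c = 0 \<or> a * x + b * y + c = 1"
      by (rule essential_functional[OF c i])
    have "(0, 0, 0) \<noteq> (xi, yi, zi)" "(xj, yj, zj) \<noteq> (xi, yi, zi)" "(x1, y1, h1) \<noteq> (xi, yi, zi)" using j(2,3,4) by auto
    note v = f[rule_format, OF mem(1) this(1)] f[rule_format, OF j(1) this(2)] f[rule_format, OF mem(2) this(3)]
    have "ei * (a * xi + b * yi) + ej * (a * xj + b * yj) = a * (ei * xi + ej * xj) + b * (ei * yi + ej * yj)"
      by (simp add: algebra_simps)
    then have s: "ei * (a * xi + b * yi) + ej * (a * xj + b * yj) = 0" using e by simp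
    have "c \<le> 1" using v(1) by auto
    then have "0 < a * xi + b * yi" using f1 by linarith
    then have "0 < ei * (a * xi + b * yi)" using e by simp
    then have "ej * (a * xj + b * yj) < 0" using s by linarith
    then have "a * xj + b * yj < 0" using e by (simp add: mult_less_0_iff)
    moreover have "c = 1 \<and> u = -1" if "u < 0" "c = 0 \<or> c = 1" "u + c = 0 \<or> u + c = 1" for u :: int using that by auto
    ultimately have c1: "c = 1" "a * xj + b * yj = -1" using v(1,2) by simp_all
    have "u = 0 \<or> u = -1" if "u + c = 0 \<or> u + c = 1" for u :: int using that c1(1) by auto
    from this[OF v(3)] have "1 \<le> a * xi + b * yi \<and> a * xj + b * yj = -1 \<and> (a * x1 + b * y1 = 0 \<or> a * x1 + b * y1 = -1)"
      using f1 c1 by linarith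
    then show ?thesis by blast
  qed
  have "(x2, y2, h2) \<in> ?E" "(x3, y3, h3) \<in> ?E" by simp_all
  have "\<exists>a b. 1 \<le> a * x2 + b * y2 \<and> a * x3 + b * y3 = -1 \<and> (a * x1 + b * y1 = 0 \<or> a * x1 + b * y1 = -1)"
    by (rule key[OF \<open>(x2, y2, h2) \<in> ?E\<close> mem(4) ne23[symmetric] ne(2,4) dep d])
  then obtain a2 b2 where 2: "1 \<le> a2 * x2 + b2 * y2" "a2 * x3 + b2 * y3 = -1" "a2 * x1 + b2 * y1 = 0 \<or> a2 * x1 + b2 * y1 = -1"
    by blast
  have dep': "d3 * x3 + d2 * x2 = 0" "d3 * y3 + d2 * y2 = 0" using dep by simp_all
  have "\<exists>a b. 1 \<le> a * x3 + b * y3 \<and> a * x2 + b * y2 = -1 \<and> (a * x1 + b * y1 = 0 \<or> a * x1 + b * y1 = -1)"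
    by (rule key[OF \<open>(x3, y3, h3) \<in> ?E\<close> mem(3) ne23 ne(3,5) dep' d(2,1)])
  then obtain a3 b3 where 3: "1 \<le> a3 * x3 + b3 * y3" "a3 * x2 + b3 * y2 = -1" "a3 * x1 + b3 * y1 = 0 \<or> a3 * x1 + b3 * y1 = -1"
    by blast
  have "(a2 * x2 + b2 * y2) * (a3 * x3 + b3 * y3) - (a2 * x3 + b2 * y3) * (a3 * x2 + b3 * y2) = (a2 * b3 - a3 * b2) * (x2 * y3 - x3 * y2)"
    by (simp add: algebra_simps)
  then have "(a2 * x2 + b2 * y2) * (a3 * x3 + b3 * y3) = 1" using D(1) 2(2) 3(2) by simp
  then have one: "a2 * x2 + b2 * y2 = 1" "a3 * x3 + b3 * y3 = 1" using 2(1) 3(1) by (simp_all add: zmult_eq_1_iff)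
  have "d2 * (a2 * x2 + b2 * y2) + d3 * (a2 * x3 + b2 * y3) = a2 * (d2 * x2 + d3 * x3) + b2 * (d2 * y2 + d3 * y3)"
    by (simp add: algebra_simps)
  then have "d2 = d3" using dep one 2(2) by simp
  then have "d3 * (x2 + x3) = 0" "d3 * (y2 + y3) = 0" using dep by (simp_all add: algebra_simps)
  then have x3: "x3 = - x2" "y3 = - y2" using d by auto
  \<comment> \<open>Coordinates of the apex: \<open>s\<close> along the edge, and \<open>t\<close>,
    its lattice distance from the edge.\<close>
  define s where "s = a2 * x1 + b2 * y1"
  define t where "t = d3"
  have s: "s = 0 \<or> s = -1" using 2(3) by (simp add: s_def)
  have t: "0 < t" using d by (simp add: t_def)
  text \<open>On the line through the edge \<open>a3 = - a2\<close>, so the value of the third functional at the apex determines \<open>s\<close> modulo \<open>t\<close>.\<close>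
  define n where "n = a3 * b2 - b3 * a2"
  have "a3 * x1 + b3 * y1 = - s + n * t"
  proof -
    have "a3 * x1 + b3 * y1 = (a3 * x1 + b3 * y1) * (a2 * x2 + b2 * y2)" using one by simp
    also have "\<dots> = (a3 * x2 + b3 * y2) * (a2 * x1 + b2 * y1) + n * t" by (simp add: n_def t_def d3_def algebra_simps)
    finally show ?thesis using 3(2) by (simp add: s_def)
  qed
  then have nt: "- s + n * t = 0 \<or> - s + n * t = -1" using 3(3) by simp
  \<comment> \<open>A shear along the edge by \<open>\<mu>\<close> brings the apex over the
    midpoint, except that for \<open>t = 2\<close> an offset of one may remain.\<close>
  obtain \<mu> where \<mu>: "s + \<mu> * t = 0 \<or> s + \<mu> * t = 1 \<and> t = 2"
  proof (cases "s = 0")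
    case False
    then have "n * t = -1 \<or> n * t = -2" using s nt by auto
    then have "t dvd 1 \<or> t dvd 2" by (metis dvd_minus_iff dvd_triv_right)
    then have "t = 1 \<or> t = 2" using t zdvd_imp_le[of t 2] by auto
    then show thesis using that[of 1] s False by auto
  qed (use that[of 0] in simp)
  define T where "T = (\<lambda>(x, y, z). ((a2 + \<mu> * y2) * x + (b2 - \<mu> * x2) * y + 0, y2 * x + (- x2) * y + 0, (h3 * a2) * x + (h3 * b2) * y + 1 * z + 0))"
  have bT: "block_map T" unfolding T_def
  proof (rule block_mapI[of "a2 + \<mu> * y2" "- x2" "b2 - \<mu> * x2" y2 1 0 0 "h3 * a2" "h3 * b2" 0])
    have "(a2 + \<mu> * y2) * - x2 - (b2 - \<mu> * x2) * y2 = - (a2 * x2 + b2 * y2)" by (simp add: algebra_simps)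
    then show "(a2 + \<mu> * y2) * - x2 - (b2 - \<mu> * x2) * y2 = 1 \<or> (a2 + \<mu> * y2) * - x2 - (b2 - \<mu> * x2) * y2 = -1" using one by simp
  qed simp
  have T1: "T (x1, y1, h1) = (s + \<mu> * t, t, h1 + h3 * s)"
    by (simp add: T_def s_def t_def d3_def algebra_simps)
  have T2: "T (x2, y2, h2) = (1, 0, h2 + h3)"
  proof -
    have "(a2 + \<mu> * y2) * x2 + (b2 - \<mu> * x2) * y2 = a2 * x2 + b2 * y2" by (simp add: algebra_simps)
    moreover have "h3 * a2 * x2 + h3 * b2 * y2 = h3 * (a2 * x2 + b2 * y2)" by (simp add: algebra_simps)
    ultimately show ?thesis unfolding T_def using one by simp
  qed
  have T3: "T (x3, y3, h3) = (-1, 0, 0)"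
  proof -
    have "(a2 + \<mu> * y2) * - x2 + (b2 - \<mu> * x2) * - y2 = - (a2 * x2 + b2 * y2)" by (simp add: algebra_simps)
    moreover have "h3 * a2 * - x2 + h3 * b2 * - y2 = - h3 * (a2 * x2 + b2 * y2)" by (simp add: algebra_simps)
    ultimately show ?thesis unfolding T_def x3 using one by simp
  qed
  have TE: "T ` ?E = {(s + \<mu> * t, t, h1 + h3 * s), (1, 0, h2 + h3), (-1, 0, 0)}" by (simp add: T1 T2 T3)
  have T0: "T (0, 0, 0) = (0, 0, 0)" by (simp add: T_def)
  have st: "s + \<mu> * t = 0 \<and> 0 < t \<or> s + \<mu> * t = 1 \<and> t = 2" using \<mu> t by blast
  show ?thesis
  proof (rule in_list_reduce[OF bT TE T0 c])
    assume c': "spike_config {(s + \<mu> * t, t, h1 + h3 * s), (1, 0, h2 + h3), (-1, 0, 0)} (0, 0, 0)"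
    \<comment> \<open>Equality would put the tip on the edge in space.\<close>
    have "h2 + h3 \<noteq> 0"
    proof
      assume "h2 + h3 = 0"
      then have z: "2 * 0 = (h2 + h3) + 0" by simp
      have m: "(1, 0, h2 + h3) \<in> lat {(s + \<mu> * t, t, h1 + h3 * s), (1, 0, h2 + h3), (-1, 0, 0)}"
        "(-1, 0, 0) \<in> lat {(s + \<mu> * t, t, h1 + h3 * s), (1, 0, h2 + h3), (-1, 0, 0)}" by (simp_all add: lat_incl)
      have "(0, 0, 0) \<in> lat {(s + \<mu> * t, t, h1 + h3 * s), (1, 0, h2 + h3), (-1, 0, 0)}"
        by (rule lat_midpoint[OF m _ _ z]) simp_all
      then show False using spike_config_tip[OF c'] by simp
    qed
    then consider "0 < - (h2 + h3)" | "0 < h2 + h3" by linarith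
    then show "in_list (hull_equiv {(s + \<mu> * t, t, h1 + h3 * s), (1, 0, h2 + h3), (-1, 0, 0)} (0, 0, 0))"
    proof cases
      case 1
      define n' where "n' = - (h2 + h3)"
      have e: "h2 + h3 = - n'" by (simp add: n'_def)
      show ?thesis unfolding e by (rule in_list_edge_normal[OF c'[unfolded e] _ st]) (use 1 in \<open>simp add: n'_def\<close>)
    next
      case 2
      show ?thesis
        by (rule in_list_reduce[OF block_mapI[of 1 1 0 0 "-1" 0 0 0 0 0] _ _ c' in_list_edge_normal[OF _ 2 st, of "- (h1 + h3 * s)"]]) auto
    qed
  qed
qed

text \<open>An essential vertex never lies over the tip, since its functional is at least two at the
  vertex and at most one at the tip. So at most one of the three determinants vanishes.\<close>

lemma in_list_inside:
  assumes c: "spike_config {(x1, y1, h1), (x2, y2, h2), (x3, y3, h3)} (0, 0, 0)"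
    and D: "0 \<le> x2 * y3 - x3 * y2" "0 \<le> x3 * y1 - x1 * y3" "0 \<le> x1 * y2 - x2 * y1"
    and S: "0 < (x2 * y3 - x3 * y2) + (x3 * y1 - x1 * y3) + (x1 * y2 - x2 * y1)"
  shows "in_list (hull_equiv {(x1, y1, h1), (x2, y2, h2), (x3, y3, h3)} (0, 0, 0))"
proof -
  define d1 where "d1 = x2 * y3 - x3 * y2"
  define d2 where "d2 = x3 * y1 - x1 * y3"
  define d3 where "d3 = x1 * y2 - x2 * y1"
  let ?E = "{(x1, y1, h1), (x2, y2, h2), (x3, y3, h3)}"
  have dep: "d1 * x1 + d2 * x2 + d3 * x3 = 0" "d1 * y1 + d2 * y2 + d3 * y3 = 0"
    by (simp_all add: d1_def d2_def d3_def algebra_simps)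
  have nz: "(x, y) \<noteq> (0, 0)" if q: "(x, y, z) \<in> ?E" for x y z
  proof
    assume xy: "(x, y) = (0, 0)"
    obtain a b d where "2 \<le> a * x + b * y + d"
      and f: "\<forall>x' y' z'. (x', y', z') \<in> lat (insert (0, 0, 0) ?E) \<longrightarrow> (x', y', z') \<noteq> (x, y, z) \<longrightarrow> a * x' + b * y' + d = 0 \<or> a * x' + b * y' + d = 1"
      by (rule essential_functional[OF c q])
    moreover have "(0, 0, 0) \<in> lat (insert (0, 0, 0) ?E)" by (simp add: lat_incl)
    moreover have "(x, y, z) \<in> lat ?E" using q by (rule lat_incl)
    then have "(0, 0, 0) \<noteq> (x, y, z)" using spike_config_tip[OF c] by force
    ultimately have "a * 0 + b * 0 + d = 0 \<or> a * 0 + b * 0 + d = 1" by blast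
    then show False using \<open>2 \<le> a * x + b * y + d\<close> xy by auto
  qed
  have n: "(x1, y1) \<noteq> (0, 0)" "(x2, y2) \<noteq> (0, 0)" "(x3, y3) \<noteq> (0, 0)" using nz by auto
  have S': "0 < d1 + d2 + d3" using S by (simp add: d1_def d2_def d3_def)
  have "\<not> (d1 = 0 \<and> d2 = 0)"
  proof
    assume "d1 = 0 \<and> d2 = 0"
    then show False using dep n(3) S' by simp
  qed
  moreover have "\<not> (d2 = 0 \<and> d3 = 0)"
  proof
    assume "d2 = 0 \<and> d3 = 0"
    then show False using dep n(1) S' by simp
  qed
  moreover have "\<not> (d3 = 0 \<and> d1 = 0)"
  proof
    assume "d3 = 0 \<and> d1 = 0"
    then show False using dep n(2) S' by simp
  qed
  moreover have "0 \<le> d1" "0 \<le> d2" "0 \<le> d3" using D by (simp_all add: d1_def d2_def d3_def)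
  ultimately consider "0 < d1" "0 < d2" "0 < d3" | "d1 = 0" "0 < d2" "0 < d3" | "d2 = 0" "0 < d3" "0 < d1" | "d3 = 0" "0 < d1" "0 < d2"
    by (metis order_le_less)
  then show ?thesis
  proof cases
    case 1
    then show ?thesis unfolding d1_def d2_def d3_def by (rule in_list_interior[OF c])
  next
    case 2
    then show ?thesis unfolding d1_def d2_def d3_def by (rule in_list_edge[OF c])
  next
    case 3
    have e: "{(x2, y2, h2), (x3, y3, h3), (x1, y1, h1)} = ?E" by blast
    from 3 show ?thesis unfolding d1_def d2_def d3_def by (rule in_list_edge[of x2 y2 h2 x3 y3 h3 x1 y1 h1, unfolded e, OF c])
  next
    case 4
    have e: "{(x3, y3, h3), (x1, y1, h1), (x2, y2, h2)} = ?E" by blast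
    from 4 show ?thesis unfolding d1_def d2_def d3_def by (rule in_list_edge[of x3 y3 h3 x1 y1 h1 x2 y2 h2, unfolded e, OF c])
  qed
qed

section \<open>Triangles with the tip over the exterior\<close>

text \<open>Over each vertex there is one point. Over the origin one parameter is left, the weight
  \<open>t\<close> of the tip, between 0 and 1/2. Three times the height runs from \<open>a\<close>
  to \<open>3 * (H + a) / 2\<close>, and the lower end \<open>a / 3 > -1\<close> rounds to
  zero.\<close>

lemma lat_nine:
  assumes a: "a \<in> {-2, -1, 0}" and H: "0 < 3 * H + a"
  shows "lat {(1, 1, H), (1, 0, 0), (0, 1, 0), (-1, -1, a)} =
    {(1, 1, H), (1, 0, 0), (0, 1, 0), (-1, -1, a)} \<union> (\<lambda>z. (0, 0, z)) ` {0..(H + a) div 2}"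
    (is "?A = ?B")
proof (intro equalityI subsetI)
  fix q assume q: "q \<in> ?A"
  obtain x y z where [simp]: "q = (x, y, z)" by (metis prod_cases3)
  obtain t u v w :: real where w: "0 \<le> t" "0 \<le> u" "0 \<le> v" "0 \<le> w" "t + u + v + w = 1"
    and e: "of_int x = t * of_int 1 + u * of_int 1 + v * of_int 0 + w * of_int (-1)"
      "of_int y = t * of_int 1 + u * of_int 0 + v * of_int 1 + w * of_int (-1)"
      "of_int z = t * of_int H + u * of_int 0 + v * of_int 0 + w * of_int a"
    using q unfolding \<open>q = _\<close> by (rule lat4_cases)
  have x: "real_of_int x = t + u - w" and y: "real_of_int y = t + v - w" and z: "real_of_int z = t * H + w * a" using e by simp_all
  have "real_of_int x \<le> 1" "real_of_int x \<ge> -1" "real_of_int y \<ge> -1" "real_of_int y \<le> 1" using x y w by linarith+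
  then have xy: "x = -1 \<or> x = 0 \<or> x = 1" "y = -1 \<or> y = 0 \<or> y = 1" by auto
  consider "x = -1" | "y = -1" | "x = 1" "y = 1" | "x = 1" "y = 0" | "x = 0" "y = 1" | "x = 0" "y = 0" using xy by blast
  then show "q \<in> ?B"
  proof cases
    case 1
    then have h: "t = 0" "u = 0" "w = 1" "v = 0" using x w by linarith+
    then have "y = -1" "z = a" using y z by simp_all
    then show ?thesis using 1 by simp
  next
    case 2
    then have h: "t = 0" "u = 0" "w = 1" "v = 0" using y w by linarith+
    then have "x = -1" "z = a" using x z by simp_all
    then show ?thesis using 2 by simp
  next
    case 3
    then have h: "t = 1" "w = 0" using x y w by linarith+
    then show ?thesis using 3 z by simp
  next
    case 4
    then have h: "t = 0" "w = 0" using x y w by linarith+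
    then show ?thesis using 4 z by simp
  next
    case 5
    then have h: "t = 0" "w = 0" using x y w by linarith+
    then show ?thesis using 5 z by simp
  next
    case 6
    then have h: "3 * w = 1 + t" "u = w - t" "t \<le> 1/2" using x y w by linarith+
    have "3 * real_of_int z = 3 * (t * H) + (3 * w) * a" using z by (simp add: algebra_simps)
    also have "\<dots> = t * real_of_int (3 * H + a) + a" unfolding h(1) by (simp add: algebra_simps)
    finally have zz: "3 * real_of_int z = t * real_of_int (3 * H + a) + a" .
    have "0 \<le> t * real_of_int (3 * H + a)" using w H by simp
    then have "real_of_int z > -1" using zz a by auto
    then have "0 \<le> z" by linarith
    have "t * real_of_int (3 * H + a) \<le> 1/2 * real_of_int (3 * H + a)"
      by (rule mult_right_mono[OF h(3)]) (use H in simp)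
    then have "real_of_int (2 * z) \<le> real_of_int (H + a)" using zz by simp
    then have "2 * z \<le> H + a" by (simp only: of_int_le_iff)
    then show ?thesis using 6 \<open>0 \<le> z\<close> by simp
  qed
next
  fix q assume q: "q \<in> ?B"
  have m: "(1, 1, H) \<in> ?A" "(1, 0, 0) \<in> ?A" "(0, 1, 0) \<in> ?A" "(-1, -1, a) \<in> ?A" by (simp_all add: lat_incl)
  define c where "c = real_of_int (3 * H + a)"
  have c: "0 < c" using H by (simp add: c_def)
  have 1: "(0, 0, z) \<in> ?A" if z: "0 \<le> z" "z \<le> (H + a) div 2" for z
  proof -
    define t where "t = (3 * real_of_int z - a) / c"
    have tc: "t * c = 3 * real_of_int z - a" using c by (simp add: t_def)
    have t0: "0 \<le> t" using z a c by (auto simp: t_def)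
    have "2 * z \<le> H + a" using z by simp
    then have "2 * (3 * z - a) \<le> 3 * H + a" by simp
    then have "real_of_int (2 * (3 * z - a)) \<le> c" unfolding c_def by (simp only: of_int_le_iff)
    then have "2 * t * c \<le> 1 * c" using tc by simp
    then have t1: "2 * t \<le> 1" by (rule mult_right_le_imp_le) (rule c)
    show ?thesis
    proof (rule latI5[OF m(1,1-4), of 0 t "(1 - 2 * t) / 3" "(1 - 2 * t) / 3" "(1 + t) / 3"])
      have "3 * real_of_int z = t * (3 * H + a) + a" using tc by (simp add: c_def)
      then show "real_of_int z = 0 * real_of_int H + t * H + (1 - 2 * t) / 3 * of_int 0 + (1 - 2 * t) / 3 * of_int 0 + (1 + t) / 3 * a"
        by (simp add: field_simps)
    qed (use t0 t1 in \<open>simp_all add: field_simps\<close>)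
  qed
  show "q \<in> ?A" using q m 1 by auto
qed

lemma card_lat_nine:
  assumes a: "a \<in> {-2, -1, 0}" and H: "0 < 3 * H + a"
  shows "int (card (lat {(1, 1, H), (1, 0, 0), (0, 1, 0), (-1, -1, a)})) = (H + a) div 2 + 5"
proof -
  let ?V = "{(1::int, 1::int, H), (1, 0, 0), (0, 1, 0), (-1, -1, a)}" and ?F = "(\<lambda>z. (0::int, 0::int, z)) ` {0..(H + a) div 2}"
  have "?V \<inter> ?F = {}" by auto
  then have "card (?V \<union> ?F) = card ?V + card ?F" by (intro card_Un_disjoint) simp_all
  moreover have "card ?V = 4" by simp
  moreover have "card ?F = card {0..(H + a) div 2}" by (intro card_image inj_onI) simp
  \<comment> \<open>In the extreme case -1 the quotient is -1 and the interval from 0 to it is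
    empty, so the count is still right.\<close>
  moreover have "-1 \<le> H + a" using a H by auto
  then have "-1 \<le> (H + a) div 2" using zdiv_mono1[of "-1" "H + a" 2] by simp
  ultimately show ?thesis unfolding lat_nine[OF a H] by simp
qed

text \<open>\<open>s\<close> is \<open>h / 3\<close> rounded up, which leaves the remainder
  \<open>a\<close> from -2 to 0; \<open>k\<close> and \<open>b\<close> are quotient and remainder of
  \<open>H + a\<close> by two, hence the height \<open>2 * k - a + b\<close> of the tip.\<close>

lemma in_list_nine_normal:
  assumes c: "spike_config {(1, 0, 0), (0, 1, 0), (-1, -1, h)} (1, 1, g)" and pos: "0 < 3 * g + h"
  shows "in_list (hull_equiv {(1, 0, 0), (0, 1, 0), (-1, -1, h)} (1, 1, g))"
proof -
  define s where "s = - ((- h) div 3)"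
  define a where "a = h - 3 * s"
  define H where "H = g + s"
  have "- h = 3 * (- s) + (- h) mod 3" "0 \<le> (- h) mod 3" "(- h) mod 3 < 3" by (simp_all add: s_def)
  then have "a \<le> 0" "-3 < a" unfolding a_def by linarith+
  then have a: "a \<in> {-2, -1, 0}" by auto
  have H: "0 < 3 * H + a" using pos by (simp add: H_def a_def)
  define k where "k = (H + a) div 2"
  define b where "b = (H + a) mod 2"
  have b: "b \<in> {0, 1}" unfolding b_def by auto
  have kb: "H = 2 * k - a + b" 
  proof -
    have "H + a = 2 * ((H + a) div 2) + (H + a) mod 2" by simp
    then show ?thesis unfolding k_def b_def by linarith
  qed
  define T :: "int \<times> int \<times> int \<Rightarrow> int \<times> int \<times> int"
    where "T = (\<lambda>(x, y, z). (1 * x + 0 * y + 0, 0 * x + 1 * y + 0, s * x + s * y + 1 * z + (- s)))"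
  have bT: "block_map T" unfolding T_def by (rule block_mapI[of 1 1 0 0 1 0 0 s s "- s"]) simp_all
  have TE: "T ` {(1, 0, 0), (0, 1, 0), (-1, -1, h)} = {(1, 0, 0), (0, 1, 0), (-1, -1, a)}" and Tv: "T (1, 1, g) = (1, 1, H)"
    by (simp_all add: T_def a_def H_def)
  show ?thesis
  proof (rule in_list_reduce[OF bT TE Tv c])
    assume c': "spike_config {(1, 0, 0), (0, 1, 0), (-1, -1, a)} (1, 1, H)"
    have card: "int (card (lat (insert (1, 1, H) {(1, 0, 0), (0, 1, 0), (-1, -1, a)}))) = k + 5"
      unfolding card_lat_nine[OF a H] k_def by simp
    then have k: "2 \<le> k" using spike_config_card[OF c'] by simp
    have "hull_equiv {(1, 0, 0), (0, 1, 0), (-1, -1, a)} (1, 1, H) [emb (1, 0, 0), emb (0, 1, 0), emb (-1, -1, a), emb (1, 1, 2 * k - a + b)] (k + 5)"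
      by (rule hull_equiv4I[OF block_mapI[of 1 1 0 0 1 0 0 0 0 0], of _ "(1, 0, 0)" "(0, 1, 0)" "(-1, -1, a)"])
        (use card kb in auto)
    then show "in_list (hull_equiv {(1, 0, 0), (0, 1, 0), (-1, -1, a)} (1, 1, H))"
      by (intro in_list_9[OF k a b]) simp
  qed
qed

text \<open>In the plane vertices 1 and 2 are a basis, and vertex 3 and the tip are opposite. If all
  four points were coplanar, only one height would be possible over the origin, against the two
  points of the fibre.\<close>

lemma in_list_nine:
  assumes c: "spike_config {(x1, y1, h1), (x2, y2, h2), (- (x1 + x2), - (y1 + y2), h3)} (x1 + x2, y1 + y2, g)"
    and D: "x1 * y2 - x2 * y1 = 1"
    and z: "(0, 0, z1) \<in> lat (insert (x1 + x2, y1 + y2, g) {(x1, y1, h1), (x2, y2, h2), (- (x1 + x2), - (y1 + y2), h3)})"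
      "(0, 0, z2) \<in> lat (insert (x1 + x2, y1 + y2, g) {(x1, y1, h1), (x2, y2, h2), (- (x1 + x2), - (y1 + y2), h3)})" "z1 < z2"
  shows "in_list (hull_equiv {(x1, y1, h1), (x2, y2, h2), (- (x1 + x2), - (y1 + y2), h3)} (x1 + x2, y1 + y2, g))"
    (is "in_list (hull_equiv ?E ?v)")
proof -
  define l where "l = - (h1 * y2 - h2 * y1)"
  define m where "m = h1 * x2 - h2 * x1"
  define T where "T = (\<lambda>(x, y, z). (y2 * x + (- x2) * y + 0, (- y1) * x + x1 * y + 0, l * x + m * y + 1 * z + 0))"
  have bT: "block_map T" unfolding T_def
    by (rule block_mapI[of y2 x1 "- x2" "- y1" 1 0 0 l m 0]) (use D in \<open>simp_all add: algebra_simps\<close>)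
  have n1: "l * x1 + m * y1 = - h1"
  proof -
    have "l * x1 + m * y1 = - h1 * (x1 * y2 - x2 * y1)" by (simp add: l_def m_def algebra_simps)
    then show ?thesis using D by simp
  qed
  have n2: "l * x2 + m * y2 = - h2"
  proof -
    have "l * x2 + m * y2 = - h2 * (x1 * y2 - x2 * y1)" by (simp add: l_def m_def algebra_simps)
    then show ?thesis using D by simp
  qed
  have T: "T (x1, y1, h1) = (1, 0, 0)" "T (x2, y2, h2) = (0, 1, 0)"
    using D n1 n2 by (simp_all add: T_def algebra_simps)
  have T3: "T (- (x1 + x2), - (y1 + y2), h3) = (-1, -1, h3 + h1 + h2)"
    using D n1 n2 by (simp add: T_def algebra_simps)
  have Tv: "T (x1 + x2, y1 + y2, g) = (1, 1, g - h1 - h2)"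
    using D n1 n2 by (simp add: T_def algebra_simps)
  have T0: "T (0, 0, z) = (0, 0, z)" for z by (simp add: T_def)
  define h where "h = h3 + h1 + h2"
  define g' where "g' = g - h1 - h2"
  have TE: "T ` ?E = {(1, 0, 0), (0, 1, 0), (-1, -1, h)}" unfolding image_insert image_empty T T3 h_def by (rule refl)
  have Tv': "T ?v = (1, 1, g')" unfolding Tv g'_def by (rule refl)
  have l: "lat {(1, 1, g'), (1, 0, 0), (0, 1, 0), (-1, -1, h)} = T ` lat (insert ?v ?E)"
    using lat_block_map[OF bT, of "insert ?v ?E"] unfolding image_insert[of T ?v] TE Tv' .
  have z': "(0, 0, z1) \<in> lat {(1, 1, g'), (1, 0, 0), (0, 1, 0), (-1, -1, h)}" "(0, 0, z2) \<in> lat {(1, 1, g'), (1, 0, 0), (0, 1, 0), (-1, -1, h)}"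
    unfolding l using z T0 by (metis image_eqI)+
  have coplanar: "3 * zz = h" if q: "(0, 0, zz) \<in> lat {(1, 1, g'), (1, 0, 0), (0, 1, 0), (-1, -1, h)}" and pl: "3 * g' + h = 0" for zz
  proof -
    obtain t u v w :: real where "0 \<le> t" "0 \<le> u" "0 \<le> v" "0 \<le> w" and w: "t + u + v + w = 1"
      and e: "of_int 0 = t * of_int 1 + u * of_int 1 + v * of_int 0 + w * of_int (-1)"
        "of_int 0 = t * of_int 1 + u * of_int 0 + v * of_int 1 + w * of_int (-1)"
        "of_int zz = t * of_int g' + u * of_int 0 + v * of_int 0 + w * of_int h"
      using q by (rule lat4_cases)
    have "3 * w = 1 + t" using e w by simp
    have "real_of_int h = - 3 * g'" using pl by linarith
    have "3 * real_of_int zz = t * (3 * g') + (3 * w) * h" using e(3) by (simp add: algebra_simps)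
    also have "\<dots> = h" unfolding \<open>3 * w = 1 + t\<close> \<open>real_of_int h = - 3 * g'\<close> by (simp add: algebra_simps)
    finally have "real_of_int (3 * zz) = real_of_int h" by simp
    then show ?thesis by (simp only: of_int_eq_iff)
  qed
  have "3 * g' + h \<noteq> 0" using coplanar[OF z'(1)] coplanar[OF z'(2)] z(3) by auto
  then consider "0 < 3 * g' + h" | "0 < 3 * (- g') + (- h)" by linarith
  then show ?thesis
  proof (cases, goal_cases)
    case 1
    then show ?case by (intro in_list_reduce[OF bT TE Tv' c in_list_nine_normal])
  next
    case 2
    show ?case
    proof (rule in_list_reduce[OF bT TE Tv' c])
      assume c': "spike_config {(1, 0, 0), (0, 1, 0), (-1, -1, h)} (1, 1, g')"
      show "in_list (hull_equiv {(1, 0, 0), (0, 1, 0), (-1, -1, h)} (1, 1, g'))"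
        by (rule in_list_reduce[OF block_mapI[of 1 1 0 0 "-1" 0 0 0 0 0] _ _ c' in_list_nine_normal[OF _ 2]]) auto
    qed
  qed
qed

text \<open>The origin is no longer under the tip: it is the foot of a fibre with at least two
  lattice points, where the functionals have value one before their constant term is dropped. The
  determinants relative to \<open>(wx, wy)\<close> say that the tip projects outside the triangle
  and onto none of the lines through two vertices.\<close>

locale exterior_tip =
  fixes x1 y1 h1 x2 y2 h2 x3 y3 h3 wx wy wz a1 b1 a2 b2 a3 b3 z1 z2 :: int
  assumes config: "spike_config {(x1, y1, h1), (x2, y2, h2), (x3, y3, h3)} (wx, wy, wz)"
    and fibre: "(0, 0, z1) \<in> lat {(wx, wy, wz), (x1, y1, h1), (x2, y2, h2), (x3, y3, h3)}"
      "(0, 0, z2) \<in> lat {(wx, wy, wz), (x1, y1, h1), (x2, y2, h2), (x3, y3, h3)}" "z1 < z2"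
    and S: "0 < (x2 * y3 - x3 * y2) + (x3 * y1 - x1 * y3) + (x1 * y2 - x2 * y1)"
    and w_nonzero: "(wx, wy) \<noteq> (0, 0)"
    and off_line: "(x2 - wx) * (y3 - wy) - (x3 - wx) * (y2 - wy) \<noteq> 0" "(x3 - wx) * (y1 - wy) - (x1 - wx) * (y3 - wy) \<noteq> 0"
      "(x1 - wx) * (y2 - wy) - (x2 - wx) * (y1 - wy) \<noteq> 0"
    and outside: "(x2 - wx) * (y3 - wy) - (x3 - wx) * (y2 - wy) < 0 \<or> (x3 - wx) * (y1 - wy) - (x1 - wx) * (y3 - wy) < 0 \<or>
      (x1 - wx) * (y2 - wy) - (x2 - wx) * (y1 - wy) < 0"
    and p1: "1 \<le> a1 * x1 + b1 * y1" and p2: "1 \<le> a2 * x2 + b2 * y2" and p3: "1 \<le> a3 * x3 + b3 * y3"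
    and g1: "\<And>x y z. (x, y, z) \<in> lat {(wx, wy, wz), (x1, y1, h1), (x2, y2, h2), (x3, y3, h3)} \<Longrightarrow>
      (x, y, z) \<noteq> (x1, y1, h1) \<Longrightarrow> a1 * x + b1 * y = 0 \<or> a1 * x + b1 * y = -1"
    and g2: "\<And>x y z. (x, y, z) \<in> lat {(wx, wy, wz), (x1, y1, h1), (x2, y2, h2), (x3, y3, h3)} \<Longrightarrow>
      (x, y, z) \<noteq> (x2, y2, h2) \<Longrightarrow> a2 * x + b2 * y = 0 \<or> a2 * x + b2 * y = -1"
    and g3: "\<And>x y z. (x, y, z) \<in> lat {(wx, wy, wz), (x1, y1, h1), (x2, y2, h2), (x3, y3, h3)} \<Longrightarrow>
      (x, y, z) \<noteq> (x3, y3, h3) \<Longrightarrow> a3 * x + b3 * y = 0 \<or> a3 * x + b3 * y = -1"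
begin

abbreviation "A \<equiv> lat {(wx, wy, wz), (x1, y1, h1), (x2, y2, h2), (x3, y3, h3)}"

lemma rotate: "exterior_tip x2 y2 h2 x3 y3 h3 x1 y1 h1 wx wy wz a2 b2 a3 b3 a1 b1 z1 z2"
proof -
  have 1: "{(x2, y2, h2), (x3, y3, h3), (x1, y1, h1)} = {(x1, y1, h1), (x2, y2, h2), (x3, y3, h3)}"
    and 2: "{(wx, wy, wz), (x2, y2, h2), (x3, y3, h3), (x1, y1, h1)} = {(wx, wy, wz), (x1, y1, h1), (x2, y2, h2), (x3, y3, h3)}"
    by blast+
  have S': "0 < (x3 * y1 - x1 * y3) + (x1 * y2 - x2 * y1) + (x2 * y3 - x3 * y2)" using S by simp
  have o': "(x3 - wx) * (y1 - wy) - (x1 - wx) * (y3 - wy) < 0 \<or> (x1 - wx) * (y2 - wy) - (x2 - wx) * (y1 - wy) < 0 \<or>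
      (x2 - wx) * (y3 - wy) - (x3 - wx) * (y2 - wy) < 0" using outside by blast
  show ?thesis unfolding exterior_tip_def 1 2
    by (intro conjI allI impI;
      (fact config fibre S' w_nonzero off_line o' p1 p2 p3 | (rule g2; assumption) | (rule g3; assumption) | (rule g1; assumption)))
qed

lemma vertices_mem: "(wx, wy, wz) \<in> A" "(x1, y1, h1) \<in> A" "(x2, y2, h2) \<in> A" "(x3, y3, h3) \<in> A"
  by (simp_all add: lat_incl)

lemma tip_ne: "(wx, wy, wz) \<noteq> (x1, y1, h1)" "(wx, wy, wz) \<noteq> (x2, y2, h2)" "(wx, wy, wz) \<noteq> (x3, y3, h3)"
proof -
  have "(x1, y1, h1) \<in> lat {(x1, y1, h1), (x2, y2, h2), (x3, y3, h3)}" "(x2, y2, h2) \<in> lat {(x1, y1, h1), (x2, y2, h2), (x3, y3, h3)}"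
    "(x3, y3, h3) \<in> lat {(x1, y1, h1), (x2, y2, h2), (x3, y3, h3)}" by (simp_all add: lat_incl)
  then show "(wx, wy, wz) \<noteq> (x1, y1, h1)" "(wx, wy, wz) \<noteq> (x2, y2, h2)" "(wx, wy, wz) \<noteq> (x3, y3, h3)"
    using spike_config_tip[OF config] by metis+
qed

lemma distinct: "(x1, y1) \<noteq> (x2, y2)" "(x1, y1) \<noteq> (x3, y3)" "(x2, y2) \<noteq> (x3, y3)"
  using S by auto

lemma entries:
  "a1 * x2 + b1 * y2 = 0 \<or> a1 * x2 + b1 * y2 = -1" "a1 * x3 + b1 * y3 = 0 \<or> a1 * x3 + b1 * y3 = -1"
  "a2 * x1 + b2 * y1 = 0 \<or> a2 * x1 + b2 * y1 = -1" "a2 * x3 + b2 * y3 = 0 \<or> a2 * x3 + b2 * y3 = -1"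
  "a3 * x1 + b3 * y1 = 0 \<or> a3 * x1 + b3 * y1 = -1" "a3 * x2 + b3 * y2 = 0 \<or> a3 * x2 + b3 * y2 = -1"
  "a1 * wx + b1 * wy = 0 \<or> a1 * wx + b1 * wy = -1" "a2 * wx + b2 * wy = 0 \<or> a2 * wx + b2 * wy = -1"
  "a3 * wx + b3 * wy = 0 \<or> a3 * wx + b3 * wy = -1"
proof -
  show "a1 * x2 + b1 * y2 = 0 \<or> a1 * x2 + b1 * y2 = -1"
    by (rule g1[OF vertices_mem(3)]) (use distinct(1) in auto)
  show "a1 * x3 + b1 * y3 = 0 \<or> a1 * x3 + b1 * y3 = -1"
    by (rule g1[OF vertices_mem(4)]) (use distinct(2) in auto)
  show "a2 * x1 + b2 * y1 = 0 \<or> a2 * x1 + b2 * y1 = -1"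
    by (rule g2[OF vertices_mem(2)]) (use distinct(1) in auto)
  show "a2 * x3 + b2 * y3 = 0 \<or> a2 * x3 + b2 * y3 = -1"
    by (rule g2[OF vertices_mem(4)]) (use distinct(3) in auto)
  show "a3 * x1 + b3 * y1 = 0 \<or> a3 * x1 + b3 * y1 = -1"
    by (rule g3[OF vertices_mem(2)]) (use distinct(2) in auto)
  show "a3 * x2 + b3 * y2 = 0 \<or> a3 * x2 + b3 * y2 = -1"
    by (rule g3[OF vertices_mem(3)]) (use distinct(3) in auto)
  show "a1 * wx + b1 * wy = 0 \<or> a1 * wx + b1 * wy = -1" by (rule g1[OF vertices_mem(1) tip_ne(1)])
  show "a2 * wx + b2 * wy = 0 \<or> a2 * wx + b2 * wy = -1" by (rule g2[OF vertices_mem(1) tip_ne(2)])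
  show "a3 * wx + b3 * wy = 0 \<or> a3 * wx + b3 * wy = -1" by (rule g3[OF vertices_mem(1) tip_ne(3)])
qed

lemma row1: "(x2 * y3 - x3 * y2) * (a1 * x1 + b1 * y1) + (x3 * y1 - x1 * y3) * (a1 * x2 + b1 * y2)
    + (x1 * y2 - x2 * y1) * (a1 * x3 + b1 * y3) = 0"
  by (simp add: algebra_simps)

lemma row2: "(x2 * y3 - x3 * y2) * (a2 * x1 + b2 * y1) + (x3 * y1 - x1 * y3) * (a2 * x2 + b2 * y2)
    + (x1 * y2 - x2 * y1) * (a2 * x3 + b2 * y3) = 0"
  by (simp add: algebra_simps)

lemma row3: "(x2 * y3 - x3 * y2) * (a3 * x1 + b3 * y1) + (x3 * y1 - x1 * y3) * (a3 * x2 + b3 * y2)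
    + (x1 * y2 - x2 * y1) * (a3 * x3 + b3 * y3) = 0"
  by (simp add: algebra_simps)

text \<open>If this determinant were negative, some row relation would have terms of one sign only,
  one of them nonzero: row 3 or row 2 if a further determinant is not positive, row 1
  otherwise.\<close>

lemma det1_nonneg: "0 \<le> x2 * y3 - x3 * y2"
proof (rule ccontr)
  define d1 where "d1 = x2 * y3 - x3 * y2"
  define d2 where "d2 = x3 * y1 - x1 * y3"
  define d3 where "d3 = x1 * y2 - x2 * y1"
  have r: "d1 * (a1 * x1 + b1 * y1) + d2 * (a1 * x2 + b1 * y2) + d3 * (a1 * x3 + b1 * y3) = 0"
    "d1 * (a2 * x1 + b2 * y1) + d2 * (a2 * x2 + b2 * y2) + d3 * (a2 * x3 + b2 * y3) = 0"
    "d1 * (a3 * x1 + b3 * y1) + d2 * (a3 * x2 + b3 * y2) + d3 * (a3 * x3 + b3 * y3) = 0"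
    using row1 row2 row3 by (simp_all add: d1_def d2_def d3_def)
  have np: "a1 * x2 + b1 * y2 \<le> 0" "a1 * x3 + b1 * y3 \<le> 0" "a2 * x1 + b2 * y1 \<le> 0" "a2 * x3 + b2 * y3 \<le> 0"
    "a3 * x1 + b3 * y1 \<le> 0" "a3 * x2 + b3 * y2 \<le> 0" using entries(1-6) by linarith+
  assume "\<not> 0 \<le> x2 * y3 - x3 * y2"
  then have n1: "d1 < 0" by (simp add: d1_def)
  have S': "0 < d1 + d2 + d3" using S by (simp add: d1_def d2_def d3_def)
  have "0 < d2"
  proof (rule ccontr)
    assume "\<not> 0 < d2"
    then have "0 \<le> d1 * (a3 * x1 + b3 * y1)" "0 \<le> d2 * (a3 * x2 + b3 * y2)" "0 < d3 * (a3 * x3 + b3 * y3)"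
      using n1 S' np p3 by (simp_all add: mult_nonpos_nonpos)
    then show False using r(3) by linarith
  qed
  moreover have "0 < d3"
  proof (rule ccontr)
    assume "\<not> 0 < d3"
    then have "0 \<le> d1 * (a2 * x1 + b2 * y1)" "0 \<le> d3 * (a2 * x3 + b2 * y3)" "0 < d2 * (a2 * x2 + b2 * y2)"
      using n1 S' np p2 by (simp_all add: mult_nonpos_nonpos)
    then show False using r(2) by linarith
  qed
  ultimately have "d1 * (a1 * x1 + b1 * y1) < 0" "d2 * (a1 * x2 + b1 * y2) \<le> 0" "d3 * (a1 * x3 + b1 * y3) \<le> 0"
    using n1 p1 np by (simp_all add: mult_less_0_iff mult_nonneg_nonpos)
  then show False using r(1) by linarith
qed

lemma reflection_not_mem:
  assumes "(- wx, - wy, z) \<in> A" "a3 * wx + b3 * wy = -1" shows "(- wx, - wy, z) = (x3, y3, h3)"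
proof (rule ccontr)
  assume "(- wx, - wy, z) \<noteq> (x3, y3, h3)"
  from g3[OF assms(1) this] show False using assms(2) by auto
qed

text \<open>As for the other lattice points in the interior case, the values in the cone force
  \<open>\<alpha> = \<beta>\<close>. The tip lies outside the triangle, so it is over the sum of
  vertices 1 and 2 instead of half of it. A minor of the functionals then shows that
  \<open>D\<close> is one, and the fibre over the origin makes vertex 3 project to the opposite of
  the tip.\<close>

lemma in_list_cone12:
  assumes d: "0 < x2 * y3 - x3 * y2" "0 < x3 * y1 - x1 * y3" "0 < x1 * y2 - x2 * y1"
    and s: "0 \<le> x1 * wy - wx * y1" "x2 * wy - wx * y2 \<le> 0"
  shows "in_list (hull_equiv {(x1, y1, h1), (x2, y2, h2), (x3, y3, h3)} (wx, wy, wz))"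
proof -
  define \<alpha> where "\<alpha> = wx * y2 - x2 * wy"
  define \<beta> where "\<beta> = x1 * wy - wx * y1"
  define D where "D = x1 * y2 - x2 * y1"
  define P where "P = a1 * x1 + b1 * y1"
  define Q where "Q = a2 * x2 + b2 * y2"
  define G12 where "G12 = a1 * x2 + b1 * y2"
  define G21 where "G21 = a2 * x1 + b2 * y1"
  have ab: "0 \<le> \<alpha>" "0 \<le> \<beta>" "0 < D" "1 \<le> P" "1 \<le> Q" using s d p1 p2 by (simp_all add: \<alpha>_def \<beta>_def D_def P_def Q_def)
  have Dx: "D * wx = \<alpha> * x1 + \<beta> * x2" and Dy: "D * wy = \<alpha> * y1 + \<beta> * y2"
    by (simp_all add: D_def \<alpha>_def \<beta>_def algebra_simps)
  have e1: "D * (a1 * wx + b1 * wy) = \<alpha> * P + \<beta> * G12"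
    and e2: "D * (a2 * wx + b2 * wy) = \<alpha> * G21 + \<beta> * Q"
    and e3: "D * (a3 * wx + b3 * wy) = \<alpha> * (a3 * x1 + b3 * y1) + \<beta> * (a3 * x2 + b3 * y2)"
    by (simp_all add: D_def \<alpha>_def \<beta>_def P_def Q_def G12_def G21_def algebra_simps)
  have nz: "\<not> (\<alpha> = 0 \<and> \<beta> = 0)" using Dx Dy w_nonzero ab by auto
  have le: "a1 * wx + b1 * wy \<le> 0" "a2 * wx + b2 * wy \<le> 0" using entries(7,8) by linarith+
  have l1: "\<alpha> * P + \<beta> * G12 \<le> 0" "\<alpha> * G21 + \<beta> * Q \<le> 0"
    using e1 e2 le ab by (metis mult_nonneg_nonpos less_imp_le)+
  have G: "G12 = 0 \<or> G12 = -1" "G21 = 0 \<or> G21 = -1" using entries by (simp_all add: G12_def G21_def)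
  have PQ: "\<alpha> \<le> \<alpha> * P" "\<beta> \<le> \<beta> * Q" using ab by (simp_all add: mult_le_cancel_left1)
  have G12: "G12 = -1" 
  proof (rule ccontr)
    assume "G12 \<noteq> -1"
    then have "\<alpha> = 0" using G l1 PQ ab by auto
    then show False using l1 PQ ab nz by auto
  qed
  have G21: "G21 = -1" 
  proof (rule ccontr)
    assume "G21 \<noteq> -1"
    then have "\<beta> = 0" using G l1 PQ ab by auto
    then show False using l1 PQ ab nz by auto
  qed
  have l2: "\<alpha> * P \<le> \<beta>" "\<beta> * Q \<le> \<alpha>" using l1 G12 G21 by simp_all
  then have "\<alpha> = \<beta>" using PQ by linarith
  then have eq: "\<alpha> = \<beta>" "0 < \<alpha>" using ab nz by auto
  have "\<alpha> * P = \<alpha>" "\<beta> * Q = \<beta>" using l2 PQ eq by linarith+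
  then have P1: "P = 1" "Q = 1" using eq by auto
  define H13 where "H13 = a1 * x3 + b1 * y3"
  define H23 where "H23 = a2 * x3 + b2 * y3"
  define E1 where "E1 = x2 * y3 - x3 * y2"
  define E2 where "E2 = x3 * y1 - x1 * y3"
  have r1: "E1 - E2 + D * H13 = 0" using row1 G12 P1 unfolding P_def G12_def E1_def E2_def D_def H13_def by simp
  have r2: "E2 - E1 + D * H23 = 0" using row2 G21 P1 unfolding Q_def G21_def E1_def E2_def D_def H23_def by simp
  have "D * (H13 + H23) = 0" using r1 r2 by (simp add: algebra_simps)
  then have "H13 + H23 = 0" using ab by simp
  then have H: "H13 = 0" "H23 = 0" using entries(2,4) by (auto simp: H13_def H23_def)
  define K1 where "K1 = a3 * x1 + b3 * y1"
  define K2 where "K2 = a3 * x2 + b3 * y2"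
  have E: "0 < E1" "E1 = E2" using d r1 H by (simp_all add: E1_def)
  have "E1 * K1 + E2 * K2 + D * (a3 * x3 + b3 * y3) = 0"
    using row3 unfolding K1_def K2_def E1_def E2_def D_def .
  then have "E1 * (K1 + K2) + D * (a3 * x3 + b3 * y3) = 0"
    unfolding E(2)[symmetric] by (simp add: distrib_left)
  moreover have "0 < D * (a3 * x3 + b3 * y3)" using ab p3 by simp
  ultimately have "E1 * (K1 + K2) < 0" by linarith
  then have "K1 + K2 < 0" using E by (simp add: mult_less_0_iff)
  then have K: "K1 + K2 = -1 \<or> K1 + K2 = -2" using entries(5,6) by (auto simp: K1_def K2_def)
  have DK0: "D * (a3 * wx + b3 * wy) = \<alpha> * (K1 + K2)" using e3 eq by (simp add: K1_def K2_def algebra_simps)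
  then have g3w: "a3 * wx + b3 * wy = -1" using K eq ab entries(9) by auto
  then have DK: "D = - (\<alpha> * (K1 + K2))" using DK0 by simp
  text \<open>The tip lies beyond the edge from vertex 1 to vertex 2.\<close>
  have w3: "D * (wx * y3 - x3 * wy) = 0"
  proof -
    have "D * (wx * y3 - x3 * wy) = (D * wx) * y3 - x3 * (D * wy)" by (simp add: algebra_simps)
    also have "\<dots> = \<beta> * E1 - \<alpha> * E2" unfolding Dx Dy E1_def E2_def by (simp add: algebra_simps)
    finally show ?thesis using E eq by simp
  qed
  then have w3: "wx * y3 - x3 * wy = 0" using ab by simp
  have o1: "(x2 - wx) * (y3 - wy) - (x3 - wx) * (y2 - wy) = E1 + \<alpha> - (wx * y3 - x3 * wy)"
    and o2: "(x3 - wx) * (y1 - wy) - (x1 - wx) * (y3 - wy) = E2 + \<beta> + (wx * y3 - x3 * wy)"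
    and o3: "(x1 - wx) * (y2 - wy) - (x2 - wx) * (y1 - wy) = D - \<alpha> - \<beta>"
    by (simp_all add: E1_def E2_def D_def \<alpha>_def \<beta>_def algebra_simps)
  \<comment> \<open>Beyond the edge \<open>D < 2 * \<alpha>\<close>, and of the two possible values
    of \<open>K1 + K2\<close> only -1 allows this.\<close>
  have "D - \<alpha> - \<beta> < 0" using outside unfolding o1 o2 o3 w3 using E eq ab by auto
  then have KK: "K1 + K2 = -1" "D = \<alpha>" using K DK eq by auto
  then have "D * wx = D * (x1 + x2)" "D * wy = D * (y1 + y2)" using Dx Dy eq by (simp_all add: algebra_simps)
  then have w: "wx = x1 + x2" "wy = y1 + y2" using ab by simp_all
  have "(a1 * b3 - a3 * b1) * D = P * K2 - G12 * K1" by (simp add: D_def P_def K2_def G12_def K1_def algebra_simps)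
  then have "(a1 * b3 - a3 * b1) * D = -1" using P1 G12 KK by simp
  then have "D dvd 1" by (metis dvd_triv_right dvd_minus_iff)
  then have D1: "D = 1" using ab by simp
  have x3: "x3 = - (E1 * wx)" "y3 = - (E1 * wy)"
  proof -
    have "E1 * x1 + E2 * x2 + D * x3 = 0" "E1 * y1 + E2 * y2 + D * y3 = 0"
      by (simp_all add: E1_def E2_def D_def algebra_simps)
    then show "x3 = - (E1 * wx)" "y3 = - (E1 * wy)" using D1 E unfolding w by (simp_all add: algebra_simps)
  qed
  \<comment> \<open>Otherwise the fibre yields a lattice point over the opposite of the tip, short
    of vertex 3, and functional 3 would be one there.\<close>
  have "E1 = 1"
  proof (rule ccontr)
    assume "E1 \<noteq> 1"
    then have E2: "2 \<le> E1" using E by simp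
    have "(0 + E1 * (- wx), 0 + E1 * (- wy), h3) \<in> A" using vertices_mem(4) x3 by simp
    then obtain z where "(0 + - wx, 0 + - wy, z) \<in> A" using lat_fibre_scale[OF fibre _ E2] by blast
    then have "- wx = x3 \<and> - wy = y3" using reflection_not_mem[of z] g3w by simp
    then have "(E1 - 1) * wx = 0" "(E1 - 1) * wy = 0" using x3 by (simp_all add: algebra_simps)
    then show False using w_nonzero E2 by simp
  qed
  then have x3': "x3 = - (x1 + x2)" "y3 = - (y1 + y2)" using x3 w by simp_all
  show ?thesis unfolding x3' w
    by (rule in_list_nine[OF _ _ _ _ fibre(3)])
      (use config fibre(1,2) D1 in \<open>simp_all only: x3' w D_def\<close>)
qed

text \<open>If the origin were on the line of vertices 2 and 3, it would be the midpoint of that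
  edge, with functional 1 zero along it. A tip on the side of vertex 1 leaves only the midpoint of
  the edge over the origin, against two points in the fibre. A tip on the other side projects to the
  opposite of vertex 1, and then functional 1 takes only the values 0 and 1 off the tip.\<close>

lemma det1_nonzero: "x2 * y3 - x3 * y2 \<noteq> 0"
proof
  interpret r: exterior_tip x2 y2 h2 x3 y3 h3 x1 y1 h1 wx wy wz a2 b2 a3 b3 a1 b1 z1 z2 by (rule rotate)
  interpret rr: exterior_tip x3 y3 h3 x1 y1 h1 x2 y2 h2 wx wy wz a3 b3 a1 b1 a2 b2 z1 z2 by (rule r.rotate)
  define d2 where "d2 = x3 * y1 - x1 * y3"
  define d3 where "d3 = x1 * y2 - x2 * y1"
  assume d1: "x2 * y3 - x3 * y2 = 0"
  have r: "d2 * (a1 * x2 + b1 * y2) + d3 * (a1 * x3 + b1 * y3) = 0" "d2 * (a2 * x2 + b2 * y2) + d3 * (a2 * x3 + b2 * y3) = 0"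
    "d2 * (a3 * x2 + b3 * y2) + d3 * (a3 * x3 + b3 * y3) = 0"
    using row1 row2 row3 unfolding d1 by (simp_all add: d2_def d3_def)
  have "0 \<le> d2" "0 \<le> d3" "0 < d2 + d3"
    using r.det1_nonneg rr.det1_nonneg S d1 by (simp_all add: d2_def d3_def)
  moreover have "d2 \<noteq> 0"
  proof
    assume "d2 = 0"
    then show False using r(3) p3 \<open>0 < d2 + d3\<close> by auto
  qed
  moreover have "d3 \<noteq> 0"
  proof
    assume "d3 = 0"
    then show False using r(2) p2 \<open>0 < d2 + d3\<close> by auto
  qed
  ultimately have d: "0 < d2" "0 < d3" by linarith+
  have "0 < d2 * (a2 * x2 + b2 * y2)" "0 < d3 * (a3 * x3 + b3 * y3)" using d p2 p3 by simp_all
  then have G23: "a2 * x3 + b2 * y3 = -1" and G32: "a3 * x2 + b3 * y2 = -1"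
    using r(2,3) entries(4,6) by auto
  have "(a2 * x2 + b2 * y2) * (a3 * x3 + b3 * y3) - (a2 * x3 + b2 * y3) * (a3 * x2 + b3 * y2) = (a2 * b3 - a3 * b2) * (x2 * y3 - x3 * y2)"
    by (simp add: algebra_simps)
  then have "(a2 * x2 + b2 * y2) * (a3 * x3 + b3 * y3) = 1" using d1 G23 G32 by simp
  then have one: "a2 * x2 + b2 * y2 = 1" "a3 * x3 + b3 * y3 = 1" using p2 p3 by (simp_all add: zmult_eq_1_iff)
  then have d23: "d2 = d3" using r(2) G23 by simp
  have "d2 * x2 + d3 * x3 = - ((x2 * y3 - x3 * y2) * x1)" "d2 * y2 + d3 * y3 = - ((x2 * y3 - x3 * y2) * y1)"
    by (simp_all add: d2_def d3_def algebra_simps)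
  then have "d3 * (x2 + x3) = 0" "d3 * (y2 + y3) = 0" using d1 d23 by (simp_all add: algebra_simps)
  then have x3: "x3 = - x2" "y3 = - y2" using d by auto
  have "d3 * ((a1 * x2 + b1 * y2) + (a1 * x3 + b1 * y3)) = 0" using r(1) d23 by (simp add: algebra_simps)
  then have "(a1 * x2 + b1 * y2) + (a1 * x3 + b1 * y3) = 0" using d by simp
  then have G12: "a1 * x2 + b1 * y2 = 0" "a1 * x3 + b1 * y3 = 0" using entries(1,2) by linarith+
  \<comment> \<open>The sign tells the side of the tip: vertex 1 in place of the tip would give
    \<open>- d3\<close>, which is negative.\<close>
  define \<sigma> where "\<sigma> = x2 * wy - wx * y2"
  have "(x2 - wx) * (y3 - wy) - (x3 - wx) * (y2 - wy) = - 2 * \<sigma>"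
    unfolding x3 \<sigma>_def by (simp add: algebra_simps)
  then have \<sigma>0: "\<sigma> \<noteq> 0" using off_line(1) by auto
  have \<sigma>: "0 < \<sigma>"
  proof (rule ccontr)
    assume "\<not> 0 < \<sigma>"
    then have neg: "\<sigma> < 0" using \<sigma>0 by simp
    have "2 * zz = h2 + h3" if q: "(0, 0, zz) \<in> A" for zz
    proof -
      obtain t a b c :: real where w: "0 \<le> t" "0 \<le> a" "0 \<le> b" "0 \<le> c" "t + a + b + c = 1"
        and e: "of_int 0 = t * of_int wx + a * of_int x1 + b * of_int x2 + c * of_int x3"
          "of_int 0 = t * of_int wy + a * of_int y1 + b * of_int y2 + c * of_int y3"
          "of_int zz = t * of_int wz + a * of_int h1 + b * of_int h2 + c * of_int h3"
        using q by (rule lat4_cases)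
      have "t * \<sigma> - a * d3 = x2 * (t * wy + a * y1 + b * y2 + c * y3) - y2 * (t * wx + a * x1 + b * x2 + c * x3)"
        unfolding \<sigma>_def d3_def x3 by (simp add: algebra_simps)
      also have "\<dots> = 0" using e(1,2) by simp
      finally have "t * \<sigma> = a * d3" by simp
      moreover have "t * \<sigma> \<le> 0" "0 \<le> a * d3" using w neg d by (simp_all add: mult_nonneg_nonpos)
      ultimately have "t * \<sigma> = 0" "a * d3 = 0" by linarith+
      then have t: "t = 0" "a = 0" using neg d by simp_all
      have "b * x2 - c * x2 = 0" "b * y2 - c * y2 = 0" using e(1,2) t unfolding x3 by simp_all
      then have "(b - c) * x2 = 0" "(b - c) * y2 = 0" by (simp_all only: left_diff_distrib)
      moreover have "x2 \<noteq> 0 \<or> y2 \<noteq> 0" using p2 by auto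
      ultimately have "b = c" by auto
      then have bc: "b = 1/2" "c = 1/2" using w t by simp_all
      have "real_of_int (2 * zz) = real_of_int (h2 + h3)" using e(3) unfolding bc t by simp
      then show ?thesis by (simp only: of_int_eq_iff)
    qed
    from this[OF fibre(1)] this[OF fibre(2)] show False using fibre(3) by simp
  qed
  define u where "u = (a2 * x1 + b2 * y1) + (a3 * x1 + b3 * y1)"
  define v where "v = (a2 * wx + b2 * wy) + (a3 * wx + b3 * wy)"
  have uv: "u \<le> 0" "v \<le> 0" using entries(3,5,8,9) by (auto simp: u_def v_def)
  have "(- d3) * v - u * \<sigma> = ((a2 * x2 + b2 * y2) + (a3 * x2 + b3 * y2)) * (wx * y1 - x1 * wy)"
    unfolding u_def v_def \<sigma>_def d3_def by (simp add: algebra_simps)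
  then have "(- d3) * v = u * \<sigma>" using one G32 by simp
  moreover have "0 \<le> (- d3) * v" "u * \<sigma> \<le> 0" using uv d \<sigma> by (simp_all add: mult_nonneg_nonpos mult_nonpos_nonneg)
  ultimately have "(- d3) * v = 0" by linarith
  then have "v = 0" using d by simp
  then have G2w: "a2 * wx + b2 * wy = 0" using entries(8,9) by (auto simp: v_def)
  have "u * \<sigma> = 0" using \<open>(- d3) * v = 0\<close> \<open>(- d3) * v = u * \<sigma>\<close> by linarith
  then have "u = 0" using \<sigma> by simp
  then have G21: "a2 * x1 + b2 * y1 = 0" using entries(3,5) by (auto simp: u_def)
  have "(- d3) * (a1 * wx + b1 * wy) - (a1 * x1 + b1 * y1) * \<sigma> = (a1 * x2 + b1 * y2) * (wx * y1 - x1 * wy)"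
    unfolding \<sigma>_def d3_def by (simp add: algebra_simps)
  then have "(- d3) * (a1 * wx + b1 * wy) = (a1 * x1 + b1 * y1) * \<sigma>" using G12 by simp
  moreover have "0 < (a1 * x1 + b1 * y1) * \<sigma>" using p1 \<sigma> by simp
  ultimately have "(- d3) * (a1 * wx + b1 * wy) \<noteq> 0" by linarith
  then have G1w: "a1 * wx + b1 * wy = -1" using entries(7) by auto
  define P where "P = a1 * x1 + b1 * y1"
  have P: "1 \<le> P" using p1 by (simp add: P_def)
  have n: "(a1 * b2 - a2 * b1) * (wx * y2 - x2 * wy) = -1"
  proof -
    have "(a1 * b2 - a2 * b1) * (wx * y2 - x2 * wy) = (a1 * wx + b1 * wy) * (a2 * x2 + b2 * y2) - (a1 * x2 + b1 * y2) * (a2 * wx + b2 * wy)"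
      by (simp add: algebra_simps)
    then show ?thesis using G1w one G12 by simp
  qed
  have z: "a1 * (x1 + P * wx) + b1 * (y1 + P * wy) = 0" "a2 * (x1 + P * wx) + b2 * (y1 + P * wy) = 0"
  proof -
    have "a1 * (x1 + P * wx) + b1 * (y1 + P * wy) = P + P * (a1 * wx + b1 * wy)"
       "a2 * (x1 + P * wx) + b2 * (y1 + P * wy) = (a2 * x1 + b2 * y1) + P * (a2 * wx + b2 * wy)"
      by (simp_all add: P_def algebra_simps)
    then show "a1 * (x1 + P * wx) + b1 * (y1 + P * wy) = 0" "a2 * (x1 + P * wx) + b2 * (y1 + P * wy) = 0"
      using G1w G21 G2w by simp_all
  qed
  \<comment> \<open>Functionals 1 and 2 are independent and both vanish at vertex 1 plus
    \<open>P\<close> times the tip, so this planar vector is zero.\<close>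
  have "(a1 * b2 - a2 * b1) * (x1 + P * wx) =
      b2 * (a1 * (x1 + P * wx) + b1 * (y1 + P * wy)) - b1 * (a2 * (x1 + P * wx) + b2 * (y1 + P * wy))"
    "(a1 * b2 - a2 * b1) * (y1 + P * wy) =
      a1 * (a2 * (x1 + P * wx) + b2 * (y1 + P * wy)) - a2 * (a1 * (x1 + P * wx) + b1 * (y1 + P * wy))"
    by (simp_all add: algebra_simps)
  then have "(a1 * b2 - a2 * b1) * (x1 + P * wx) = 0" "(a1 * b2 - a2 * b1) * (y1 + P * wy) = 0"
    unfolding z by simp_all
  moreover have "a1 * b2 - a2 * b1 \<noteq> 0" using n by auto
  ultimately have "x1 + P * wx = 0" "y1 + P * wy = 0" by simp_all
  then have x1: "x1 = - (P * wx)" "y1 = - (P * wy)" by linarith+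
  have "P = 1"
  proof (rule ccontr)
    assume "P \<noteq> 1"
    then have P2: "2 \<le> P" using P by simp
    have "(0 + P * (- wx), 0 + P * (- wy), h1) \<in> A" using vertices_mem(2) x1 by simp
    then obtain z where "(0 + - wx, 0 + - wy, z) \<in> A" using lat_fibre_scale[OF fibre _ P2] by blast
    then have m: "(- wx, - wy, z) \<in> A" by simp
    have "- wx = x1 \<and> - wy = y1"
    proof -
      have "(- wx, - wy, z) = (x1, y1, h1)"
      proof (rule ccontr)
        assume "(- wx, - wy, z) \<noteq> (x1, y1, h1)"
        from g1[OF m this] show False using G1w by auto
      qed
      then show ?thesis by simp
    qed
    then have "(P - 1) * wx = 0" "(P - 1) * wy = 0" using x1 by (simp_all add: algebra_simps)
    then show False using w_nonzero P2 by simp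
  qed
  then have P1: "a1 * x1 + b1 * y1 = 1" by (simp add: P_def)
  text \<open>Without the tip the width in direction \<open>(a1, b1)\<close> is at most one.\<close>
  have narrow: "a1 * x + b1 * y + 0 * z = 0 \<or> a1 * x + b1 * y + 0 * z = 0 + 1" if q: "(x, y, z) \<in> A" "(x, y, z) \<noteq> (wx, wy, wz)" for x y z
  proof (cases "(x, y, z) = (x1, y1, h1)")
    case True
    then show ?thesis using P1 by simp
  next
    case False
    have "a1 * x + b1 * y \<noteq> -1"
    proof
      assume m: "a1 * x + b1 * y = -1"
      obtain t a b c :: real where w: "0 \<le> t" "0 \<le> a" "0 \<le> b" "0 \<le> c" "t + a + b + c = 1"
        and e: "of_int x = t * of_int wx + a * of_int x1 + b * of_int x2 + c * of_int x3"
          "of_int y = t * of_int wy + a * of_int y1 + b * of_int y2 + c * of_int y3"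
          "of_int z = t * of_int wz + a * of_int h1 + b * of_int h2 + c * of_int h3"
        using q(1) by (rule lat4_cases)
      have "real_of_int (a1 * x + b1 * y) = t * real_of_int (a1 * wx + b1 * wy) + a * real_of_int (a1 * x1 + b1 * y1)
          + b * real_of_int (a1 * x2 + b1 * y2) + c * real_of_int (a1 * x3 + b1 * y3)"
        unfolding of_int_add of_int_mult e(1,2) by (simp add: algebra_simps)
      then have "-1 = a - t" unfolding m G1w P1 G12 by simp
      then have t: "t = 1" "a = 0" "b = 0" "c = 0" using w by linarith+
      have "real_of_int x = real_of_int wx" "real_of_int y = real_of_int wy" "real_of_int z = real_of_int wz" using e t by simp_all
      then show False using q(2) by simp
    qed
    then show ?thesis using g1[OF q(1) False] by simp
  qed
  show False by (rule not_constant_without_tip[OF config, of a1 b1 0 0]) (use p1 narrow in auto)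
qed

lemma in_list_exterior: "in_list (hull_equiv {(x1, y1, h1), (x2, y2, h2), (x3, y3, h3)} (wx, wy, wz))"
proof -
  interpret r: exterior_tip x2 y2 h2 x3 y3 h3 x1 y1 h1 wx wy wz a2 b2 a3 b3 a1 b1 z1 z2 by (rule rotate)
  interpret rr: exterior_tip x3 y3 h3 x1 y1 h1 x2 y2 h2 wx wy wz a3 b3 a1 b1 a2 b2 z1 z2 by (rule r.rotate)
  have d: "0 < x2 * y3 - x3 * y2" "0 < x3 * y1 - x1 * y3" "0 < x1 * y2 - x2 * y1"
    using det1_nonneg det1_nonzero r.det1_nonneg r.det1_nonzero rr.det1_nonneg rr.det1_nonzero by linarith+
  have E: "{(x2, y2, h2), (x3, y3, h3), (x1, y1, h1)} = {(x1, y1, h1), (x2, y2, h2), (x3, y3, h3)}"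
     "{(x3, y3, h3), (x1, y1, h1), (x2, y2, h2)} = {(x1, y1, h1), (x2, y2, h2), (x3, y3, h3)}" by blast+
  define s1 where "s1 = x1 * wy - wx * y1"
  define s2 where "s2 = x2 * wy - wx * y2"
  define s3 where "s3 = x3 * wy - wx * y3"
  have sum: "(x2 * y3 - x3 * y2) * s1 + (x3 * y1 - x1 * y3) * s2 + (x1 * y2 - x2 * y1) * s3 = 0"
    by (simp add: s1_def s2_def s3_def algebra_simps)
  have "0 \<le> s1 \<and> s2 \<le> 0 \<or> 0 \<le> s2 \<and> s3 \<le> 0 \<or> 0 \<le> s3 \<and> s1 \<le> 0"
  proof (rule ccontr)
    assume "\<not> ?thesis"
    then have "0 < s1 \<and> 0 < s2 \<and> 0 < s3 \<or> s1 < 0 \<and> s2 < 0 \<and> s3 < 0" by linarith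
    then show False
    proof
      assume "0 < s1 \<and> 0 < s2 \<and> 0 < s3"
      then have "0 < (x2 * y3 - x3 * y2) * s1" "0 < (x3 * y1 - x1 * y3) * s2" "0 < (x1 * y2 - x2 * y1) * s3"
        using d by simp_all
      then show False using sum by linarith
    next
      assume "s1 < 0 \<and> s2 < 0 \<and> s3 < 0"
      then have "(x2 * y3 - x3 * y2) * s1 < 0" "(x3 * y1 - x1 * y3) * s2 < 0" "(x1 * y2 - x2 * y1) * s3 < 0"
        using d by (simp_all add: mult_less_0_iff)
      then show False using sum by linarith
    qed
  qed
  then show ?thesis
  proof (elim disjE conjE)
    assume "0 \<le> s1" "s2 \<le> 0"
    then show ?thesis unfolding s1_def s2_def by (rule in_list_cone12[OF d])
  next
    assume "0 \<le> s2" "s3 \<le> 0"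
    then show ?thesis unfolding s2_def s3_def by (rule r.in_list_cone12[unfolded E, OF d(2,3,1)])
  next
    assume "0 \<le> s3" "s1 \<le> 0"
    then show ?thesis unfolding s3_def s1_def by (rule rr.in_list_cone12[unfolded E, OF d(3,1,2)])
  qed
qed

end

section \<open>Parallel functionals and parity\<close>

text \<open>The two values differ by at most one and their difference is even.\<close>

lemma parity_constant:
  fixes a b c x y x' y' :: int
  assumes "a * x + b * y + c = 0 \<or> a * x + b * y + c = 1" "a * x' + b * y' + c = 0 \<or> a * x' + b * y' + c = 1"
    and "even (x - x')" "even (y - y')"
  shows "a * (x - x') + b * (y - y') = 0"
proof -
  have e: "a * (x - x') + b * (y - y') = (a * x + b * y + c) - (a * x' + b * y' + c)" by (simp add: algebra_simps)
  have "even (a * (x - x') + b * (y - y'))" using assms(3,4) by simp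
  moreover have "u - v = 0" if "u = 0 \<or> u = 1" "v = 0 \<or> v = 1" "even (u - v)" for u v :: int using that by auto
  ultimately show ?thesis using assms(1,2) unfolding e by blast
qed

text \<open>A functional that kills \<open>(dx, dy)\<close> is, up to the positive factor
  \<open>N\<close>, the multiple \<open>a * dy - b * dx\<close> of the determinant with that
  direction, by an identity of Lagrange type. The sign of this factor tells in which direction it
  grows.\<close>

lemma parallel_gain:
  fixes a b x y x' y' dx dy :: int
  assumes "(dx, dy) \<noteq> (0, 0)" "a * dx + b * dy = 0" "a * x' + b * y' < a * x + b * y"
  shows "0 < (a * dy - b * dx) * ((dy * x - dx * y) - (dy * x' - dx * y'))"
proof -
  define N where "N = dx * dx + dy * dy"
  have N: "0 < N" using assms(1) by (auto simp: N_def sum_squares_gt_zero_iff)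
  have "N * ((a * x + b * y) - (a * x' + b * y')) = (a * dy - b * dx) * ((dy * x - dx * y) - (dy * x' - dx * y'))
      + (a * dx + b * dy) * (dx * (x - x') + dy * (y - y'))"
    by (simp add: N_def algebra_simps)
  moreover have "0 < N * ((a * x + b * y) - (a * x' + b * y'))" using N assms(3) by simp
  ultimately show ?thesis unfolding assms(2) by simp
qed

text \<open>Both functionals are multiples of one and the same; since they prefer different points,
  the factors have opposite signs.\<close>

lemma parallel_opposite:
  fixes dx dy :: int
  assumes "(dx, dy) \<noteq> (0, 0)" "a1 * dx + b1 * dy = 0" "a2 * dx + b2 * dy = 0"
    and "a1 * x2 + b1 * y2 < a1 * x1 + b1 * y1" "a2 * x1 + b2 * y1 < a2 * x2 + b2 * y2"
  shows "0 < a1 * dy - b1 * dx \<and> a2 * dy - b2 * dx < 0 \<or> a1 * dy - b1 * dx < 0 \<and> 0 < a2 * dy - b2 * dx"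
proof -
  define u where "u = (dy * x1 - dx * y1) - (dy * x2 - dx * y2)"
  have "0 < (a1 * dy - b1 * dx) * u" using parallel_gain[OF assms(1,2,4)] by (simp add: u_def)
  moreover have "0 < (a2 * dy - b2 * dx) * (- u)" using parallel_gain[OF assms(1,3,5)] by (simp add: u_def)
  ultimately show ?thesis by (auto simp: zero_less_mult_iff mult_less_0_iff)
qed

text \<open>Two of three parallel functionals point in the same direction, so they cannot have different strict maximizers.\<close>
lemma three_parallel:
  fixes dx dy :: int
  assumes "(dx, dy) \<noteq> (0, 0)" "a1 * dx + b1 * dy = 0" "a2 * dx + b2 * dy = 0" "a3 * dx + b3 * dy = 0"
    and "a1 * x2 + b1 * y2 < a1 * x1 + b1 * y1" "a1 * x3 + b1 * y3 < a1 * x1 + b1 * y1"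
    and "a2 * x1 + b2 * y1 < a2 * x2 + b2 * y2" "a2 * x3 + b2 * y3 < a2 * x2 + b2 * y2"
    and "a3 * x1 + b3 * y1 < a3 * x3 + b3 * y3" "a3 * x2 + b3 * y2 < a3 * x3 + b3 * y3"
  shows False
  using parallel_opposite[OF assms(1,2,3,5,7)] parallel_opposite[OF assms(1,2,4,6,9)] parallel_opposite[OF assms(1,3,4,8,10)]
  by linarith

definition parity_class :: "int \<times> int \<times> int \<Rightarrow> int \<times> int" where
  "parity_class q = (fst q mod 2, fst (snd q) mod 2)"

lemma parity_class_eq: "parity_class (x, y, z) = parity_class (x', y', z') \<longleftrightarrow> even (x - x') \<and> even (y - y')"
  by (simp add: parity_class_def mod_eq_dvd_iff)

lemma parity_class_range: "parity_class ` R \<subseteq> {0, 1} \<times> {0, 1}"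
proof -
  have "n mod 2 \<in> {0, 1}" for n :: int by auto
  then show ?thesis unfolding image_subset_iff parity_class_def by (intro ballI SigmaI)
qed

lemma parity_class_cover:
  assumes "card R = 4" "inj_on parity_class R" obtains r where "r \<in> R" "parity_class r = parity_class q"
proof -
  have "card ({0::int, 1} \<times> {0::int, 1}) = 4" by simp
  then have "parity_class ` R = {0, 1} \<times> {0, 1}"
    using card_image[OF assms(2)] assms(1) by (intro card_subset_eq parity_class_range) simp_all
  moreover have "parity_class q \<in> {0, 1} \<times> {0, 1}" using parity_class_range[of "{q}"] by simp
  ultimately have "parity_class q \<in> parity_class ` R" by simp
  then show thesis using that by (metis imageE)
qed

text \<open>The middle one of three points on a line is not the strict maximizer of any affine
  functional. \<open>p\<close> and \<open>q\<close> are the increments of a functional from point 1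
  to points 2 and 3; on collinear points these pairs are proportional for all functionals.\<close>

lemma noncollinear:
  assumes c: "spike_config {(x1, y1, h1), (x2, y2, h2), (x3, y3, h3)} v"
    and ne: "(x1, y1, h1) \<noteq> (x2, y2, h2)" "(x1, y1, h1) \<noteq> (x3, y3, h3)" "(x2, y2, h2) \<noteq> (x3, y3, h3)"
  shows "(x2 * y3 - x3 * y2) + (x3 * y1 - x1 * y3) + (x1 * y2 - x2 * y1) \<noteq> 0"
proof
  let ?E = "{(x1, y1, h1), (x2, y2, h2), (x3, y3, h3)}"
  have E: "(x1, y1, h1) \<in> ?E" "(x2, y2, h2) \<in> ?E" "(x3, y3, h3) \<in> ?E" by simp_all
  have m: "(x1, y1, h1) \<in> lat (insert v ?E)" "(x2, y2, h2) \<in> lat (insert v ?E)" "(x3, y3, h3) \<in> lat (insert v ?E)" by (simp_all add: lat_incl)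
  obtain a1 b1 c1 where f1: "2 \<le> a1 * x1 + b1 * y1 + c1"
    "\<forall>x y z. (x, y, z) \<in> lat (insert v ?E) \<longrightarrow> (x, y, z) \<noteq> (x1, y1, h1) \<longrightarrow> a1 * x + b1 * y + c1 = 0 \<or> a1 * x + b1 * y + c1 = 1"
    by (rule essential_functional[OF c E(1)])
  obtain a2 b2 c2 where f2: "2 \<le> a2 * x2 + b2 * y2 + c2"
    "\<forall>x y z. (x, y, z) \<in> lat (insert v ?E) \<longrightarrow> (x, y, z) \<noteq> (x2, y2, h2) \<longrightarrow> a2 * x + b2 * y + c2 = 0 \<or> a2 * x + b2 * y + c2 = 1"
    by (rule essential_functional[OF c E(2)])
  obtain a3 b3 c3 where f3: "2 \<le> a3 * x3 + b3 * y3 + c3"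
    "\<forall>x y z. (x, y, z) \<in> lat (insert v ?E) \<longrightarrow> (x, y, z) \<noteq> (x3, y3, h3) \<longrightarrow> a3 * x + b3 * y + c3 = 0 \<or> a3 * x + b3 * y + c3 = 1"
    by (rule essential_functional[OF c E(3)])
  define p where "p = (\<lambda>a b. a * (x2 - x1) + b * (y2 - y1))"
  define q where "q = (\<lambda>a b. a * (x3 - x1) + b * (y3 - y1))"
  assume "(x2 * y3 - x3 * y2) + (x3 * y1 - x1 * y3) + (x1 * y2 - x2 * y1) = 0"
  then have D: "(x2 - x1) * (y3 - y1) - (x3 - x1) * (y2 - y1) = 0" by (simp add: algebra_simps)
  have rel: "p a b * q a' b' = q a b * p a' b'" for a b a' b'
  proof -
    have "p a b * q a' b' - q a b * p a' b' = (a * b' - a' * b) * ((x2 - x1) * (y3 - y1) - (x3 - x1) * (y2 - y1))"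
      by (simp add: p_def q_def algebra_simps)
    then show ?thesis using D by simp
  qed
  have v1: "p a1 b1 < 0" "q a1 b1 < 0"
    using f1(1) f1(2)[rule_format, OF m(2) ne(1)[symmetric]] f1(2)[rule_format, OF m(3) ne(2)[symmetric]]
    by (auto simp: p_def q_def algebra_simps)
  have v2: "0 < p a2 b2" "q a2 b2 < p a2 b2"
    using f2(1) f2(2)[rule_format, OF m(1) ne(1)] f2(2)[rule_format, OF m(3) ne(3)[symmetric]]
    by (auto simp: p_def q_def algebra_simps)
  have v3: "0 < q a3 b3" "p a3 b3 < q a3 b3"
    using f3(1) f3(2)[rule_format, OF m(1) ne(2)] f3(2)[rule_format, OF m(2) ne(3)]
    by (auto simp: p_def q_def algebra_simps)
  have "q a1 b1 * p a2 b2 < 0" using v1 v2 by (simp add: mult_less_0_iff)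
  then have "p a1 b1 * q a2 b2 < 0" using rel[of a1 b1 a2 b2] by simp
  then have q2: "0 < q a2 b2" using v1 by (simp add: mult_less_0_iff)
  have "p a1 b1 * q a3 b3 < 0" using v1 v3 by (simp add: mult_less_0_iff)
  then have "q a1 b1 * p a3 b3 < 0" using rel[of a1 b1 a3 b3] by simp
  then have p3: "0 < p a3 b3" using v1 by (simp add: mult_less_0_iff)
  have "q a2 b2 * p a3 b3 < p a2 b2 * q a3 b3" by (rule mult_strict_mono[OF v2(2) v3(2) v2(1)]) (use p3 in simp)
  then show False using rel[of a2 b2 a3 b3] by simp
qed

text \<open>On the line but off the segment, one of vertices 2 and 3 would lie between the tip and
  the other one, where its functional cannot exceed one. In the algebra both off-diagonal values
  come out as one and both diagonal values as at least two, while the linear relation forces the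
  product of the latter to be one.\<close>

lemma tip_off_line:
  assumes c: "spike_config {(x1, y1, h1), (x2, y2, h2), (x3, y3, h3)} (0, 0, 0)"
    and S: "0 < (x2 * y3 - x3 * y2) + (x3 * y1 - x1 * y3) + (x1 * y2 - x2 * y1)"
    and neg: "x3 * y1 - x1 * y3 < 0 \<or> x1 * y2 - x2 * y1 < 0"
  shows "x2 * y3 - x3 * y2 \<noteq> 0"
proof
  assume D1: "x2 * y3 - x3 * y2 = 0"
  define d2 where "d2 = x3 * y1 - x1 * y3"
  define d3 where "d3 = x1 * y2 - x2 * y1"
  have row: "d2 * (a * x2 + b * y2) + d3 * (a * x3 + b * y3) = 0" for a b
  proof -
    have "d2 * (a * x2 + b * y2) + d3 * (a * x3 + b * y3) = - (x2 * y3 - x3 * y2) * (a * x1 + b * y1)"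
      by (simp add: d2_def d3_def algebra_simps)
    then show ?thesis using D1 by simp
  qed
  have d: "d2 < 0 \<and> 0 < d3 \<or> 0 < d2 \<and> d3 < 0" using S neg D1 unfolding d2_def[symmetric] d3_def[symmetric] by linarith
  let ?E = "{(x1, y1, h1), (x2, y2, h2), (x3, y3, h3)}"
  have E: "(x2, y2, h2) \<in> ?E" "(x3, y3, h3) \<in> ?E" by simp_all
  have m: "(0, 0, 0) \<in> lat (insert (0, 0, 0) ?E)" "(x2, y2, h2) \<in> lat (insert (0, 0, 0) ?E)" "(x3, y3, h3) \<in> lat (insert (0, 0, 0) ?E)" by (simp_all add: lat_incl)
  have "(x2, y2, h2) \<in> lat ?E" "(x3, y3, h3) \<in> lat ?E" by (simp_all add: lat_incl)
  then have tip: "(0, 0, 0) \<noteq> (x2, y2, h2)" "(0, 0, 0) \<noteq> (x3, y3, h3)" using spike_config_tip[OF c] by metis+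
  have "(x2, y2) \<noteq> (x3, y3)" using S by auto
  then have ne: "(x2, y2, h2) \<noteq> (x3, y3, h3)" by auto
  obtain a2 b2 c2 where f2: "2 \<le> a2 * x2 + b2 * y2 + c2"
    "\<forall>x y z. (x, y, z) \<in> lat (insert (0, 0, 0) ?E) \<longrightarrow> (x, y, z) \<noteq> (x2, y2, h2) \<longrightarrow> a2 * x + b2 * y + c2 = 0 \<or> a2 * x + b2 * y + c2 = 1"
    by (rule essential_functional[OF c E(1)])
  obtain a3 b3 c3 where f3: "2 \<le> a3 * x3 + b3 * y3 + c3"
    "\<forall>x y z. (x, y, z) \<in> lat (insert (0, 0, 0) ?E) \<longrightarrow> (x, y, z) \<noteq> (x3, y3, h3) \<longrightarrow> a3 * x + b3 * y + c3 = 0 \<or> a3 * x + b3 * y + c3 = 1"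
    by (rule essential_functional[OF c E(2)])
  define P where "P = a2 * x2 + b2 * y2"
  define Q where "Q = a2 * x3 + b2 * y3"
  define R where "R = a3 * x2 + b3 * y2"
  define T where "T = a3 * x3 + b3 * y3"
  have c2: "c2 = 0 \<or> c2 = 1" and c3: "c3 = 0 \<or> c3 = 1"
    using f2(2)[rule_format, OF m(1) tip(1)] f3(2)[rule_format, OF m(1) tip(2)] by simp_all
  have PT: "2 \<le> P + c2" "2 \<le> T + c3" using f2(1) f3(1) by (simp_all add: P_def T_def)
  have QR: "Q + c2 = 0 \<or> Q + c2 = 1" "R + c3 = 0 \<or> R + c3 = 1"
    using f2(2)[rule_format, OF m(3) ne[symmetric]] f3(2)[rule_format, OF m(2) ne] by (simp_all add: Q_def R_def)
  have e: "d2 * P + d3 * Q = 0" "d2 * R + d3 * T = 0" using row by (simp_all add: P_def Q_def R_def T_def)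
  have pos: "0 < P" "0 < T" using PT c2 c3 by auto
  have "0 < Q"
  proof (rule ccontr)
    assume "\<not> 0 < Q"
    then have "d2 * P < 0 \<and> d3 * Q \<le> 0 \<or> 0 < d2 * P \<and> 0 \<le> d3 * Q"
      using d pos by (auto simp: mult_less_0_iff mult_le_0_iff zero_le_mult_iff)
    then show False using e(1) by linarith
  qed
  then have Q: "Q = 1" "c2 = 0" using QR(1) c2 by auto
  have "0 < R"
  proof (rule ccontr)
    assume "\<not> 0 < R"
    then have "d3 * T < 0 \<and> d2 * R \<le> 0 \<or> 0 < d3 * T \<and> 0 \<le> d2 * R"
      using d pos by (auto simp: mult_less_0_iff mult_le_0_iff zero_le_mult_iff)
    then show False using e(2) by linarith
  qed
  then have R: "R = 1" "c3 = 0" using QR(2) c3 by auto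
  have "2 \<le> P" "2 \<le> T" using PT Q R by simp_all
  have d3: "d3 = - (d2 * P)" and d2: "d2 = - (d3 * T)" using e Q R by simp_all
  have "d2 = d2 * (P * T)" using d2 unfolding d3 by simp
  then have "P * T = 1" using d by auto
  then show False using \<open>2 \<le> P\<close> \<open>2 \<le> T\<close> by (simp add: zmult_eq_1_iff)
qed

lemma segment_weights_unique:
  fixes s r s' r' px py qx qy :: real
  assumes "s + r = 1" "s' + r' = 1" "(px, py) \<noteq> (qx, qy)"
    and x: "s * px + r * qx = s' * px + r' * qx" and y: "s * py + r * qy = s' * py + r' * qy"
  shows "s = s' \<and> r = r'"
proof -
  have r: "r = 1 - s" "r' = 1 - s'" using assms(1,2) by simp_all
  have "(s - s') * (px - qx) = 0" "(s - s') * (py - qy) = 0"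
    using x y unfolding r by (simp_all add: algebra_simps)
  then have "s = s'" using assms(3) by auto
  then show ?thesis using r by simp
qed

text \<open>If the functional had its least value 0 at the fibre, only points of value 0 among the
  tip and vertices 2 and 3 could carry weight. Not all three have value 0, as their projections are
  affinely independent; so the weights live on a segment or a point that projects injectively, which
  leaves a single height. Two points in the fibre therefore force the value one.\<close>

lemma value_one_at:
  assumes c: "spike_config {(x1, y1, h1), (x2, y2, h2), (x3, y3, h3)} (0, 0, 0)"
    and D: "x2 * y3 - x3 * y2 \<noteq> 0"
    and o: "(ox, oy, z1) \<in> lat (insert (0, 0, 0) {(x1, y1, h1), (x2, y2, h2), (x3, y3, h3)})"
      "(ox, oy, z2) \<in> lat (insert (0, 0, 0) {(x1, y1, h1), (x2, y2, h2), (x3, y3, h3)})" "z1 < z2"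
    and ne: "(x1, y1) \<noteq> (x2, y2)" "(x1, y1) \<noteq> (x3, y3)"
  shows "\<exists>a b. 1 \<le> a * (x1 - ox) + b * (y1 - oy) \<and>
    (\<forall>x y z. (x, y, z) \<in> lat (insert (0, 0, 0) {(x1, y1, h1), (x2, y2, h2), (x3, y3, h3)}) \<longrightarrow>
      (x, y, z) \<noteq> (x1, y1, h1) \<longrightarrow> a * (x - ox) + b * (y - oy) = 0 \<or> a * (x - ox) + b * (y - oy) = -1)"
proof -
  let ?E = "{(x1, y1, h1), (x2, y2, h2), (x3, y3, h3)}" and ?A = "lat {(0, 0, 0), (x1, y1, h1), (x2, y2, h2), (x3, y3, h3)}"
  have E1: "(x1, y1, h1) \<in> ?E" by simp
  obtain a b d where f1: "2 \<le> a * x1 + b * y1 + d"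
    and f: "\<forall>x y z. (x, y, z) \<in> ?A \<longrightarrow> (x, y, z) \<noteq> (x1, y1, h1) \<longrightarrow> a * x + b * y + d = 0 \<or> a * x + b * y + d = 1"
    by (rule essential_functional[OF c E1])
  have m: "(0, 0, 0) \<in> ?A" "(x2, y2, h2) \<in> ?A" "(x3, y3, h3) \<in> ?A" by (simp_all add: lat_incl)
  have "(x1, y1, h1) \<in> lat ?E" by (simp add: lat_incl)
  then have tip: "(0, 0, 0) \<noteq> (x1, y1, h1)" using spike_config_tip[OF c] by metis
  have ne': "(x2, y2, h2) \<noteq> (x1, y1, h1)" "(x3, y3, h3) \<noteq> (x1, y1, h1)" using ne by auto
  have fv: "a * 0 + b * 0 + d = 0 \<or> a * 0 + b * 0 + d = 1" by (rule f[rule_format, OF m(1) tip])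
  have fp: "a * x2 + b * y2 + d = 0 \<or> a * x2 + b * y2 + d = 1" "a * x3 + b * y3 + d = 0 \<or> a * x3 + b * y3 + d = 1"
    using f[rule_format, OF m(2) ne'(1)] f[rule_format, OF m(3) ne'(2)] .
  define v0 where "v0 = d"
  define v2 where "v2 = a * x2 + b * y2 + d"
  define v3 where "v3 = a * x3 + b * y3 + d"
  have vs: "v0 = 0 \<or> v0 = 1" "v2 = 0 \<or> v2 = 1" "v3 = 0 \<or> v3 = 1" using fv fp by (simp_all add: v0_def v2_def v3_def)
  \<comment> \<open>One of the two points of the fibre differs from vertex 1, so the functional is 0
    or 1 at the fibre.\<close>
  obtain zz where zz: "(ox, oy, zz) \<in> ?A" "(ox, oy, zz) \<noteq> (x1, y1, h1)"
  proof (cases "(ox, oy, z1) = (x1, y1, h1)")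
    case True
    then show thesis using that[of z2] o by auto
  next
    case False
    then show thesis using that[of z1] o by simp
  qed
  have fo: "a * ox + b * oy + d = 0 \<or> a * ox + b * oy + d = 1" by (rule f[rule_format, OF zz])
  have "a * ox + b * oy + d \<noteq> 0"
  proof
    assume z: "a * ox + b * oy + d = 0"
    have some: "v0 = 1 \<or> v2 = 1 \<or> v3 = 1"
    proof (rule ccontr)
      assume "\<not> ?thesis"
      then have *: "d = 0" "a * x2 + b * y2 = 0" "a * x3 + b * y3 = 0" using vs by (simp_all add: v0_def v2_def v3_def)
      have "a * (x2 * y3 - x3 * y2) = (a * x2 + b * y2) * y3 - (a * x3 + b * y3) * y2"
        "b * (x2 * y3 - x3 * y2) = (a * x3 + b * y3) * x2 - (a * x2 + b * y2) * x3" by (simp_all add: algebra_simps)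
      then have "a * (x2 * y3 - x3 * y2) = 0" "b * (x2 * y3 - x3 * y2) = 0" unfolding * by simp_all
      then have "a = 0" "b = 0" using D by (metis mult_eq_0_iff)+
      then show False using f1 * by simp
    qed
    have w: "\<exists>(t::real) (b::real) (c::real). t + b + c = 1 \<and> t * v0 = 0 \<and> b * v2 = 0 \<and> c * v3 = 0 \<and>
        ox = b * real_of_int x2 + c * real_of_int x3 \<and> oy = b * real_of_int y2 + c * real_of_int y3 \<and>
        z = b * real_of_int h2 + c * real_of_int h3"
      if q: "(ox, oy, z) \<in> ?A" for z
    proof -
      obtain t s b' c' :: real where w: "0 \<le> t" "0 \<le> s" "0 \<le> b'" "0 \<le> c'" "t + s + b' + c' = 1"
        and e: "of_int ox = t * of_int 0 + s * of_int x1 + b' * of_int x2 + c' * of_int x3"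
          "of_int oy = t * of_int 0 + s * of_int y1 + b' * of_int y2 + c' * of_int y3"
          "of_int z = t * of_int 0 + s * of_int h1 + b' * of_int h2 + c' * of_int h3"
        using q by (rule lat4_cases)
      define F where "F = real_of_int (a * x1 + b * y1 + d)"
      have "real_of_int (a * ox + b * oy + d) = t * v0 + s * F + b' * v2 + c' * v3"
      proof -
        have "real_of_int d = (t + s + b' + c') * d" using w by simp
        then show ?thesis unfolding F_def of_int_add of_int_mult e(1,2) v0_def v2_def v3_def by (simp add: algebra_simps)
      qed
      then have "t * v0 + s * F + b' * v2 + c' * v3 = 0" unfolding z by simp
      moreover have "0 \<le> t * v0" "0 \<le> b' * v2" "0 \<le> c' * v3" using w vs by auto
      moreover have "s * 2 \<le> s * F"
      proof (rule mult_left_mono)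
        have "real_of_int 2 \<le> real_of_int (a * x1 + b * y1 + d)" using f1 by (simp only: of_int_le_iff)
        then show "2 \<le> F" by (simp add: F_def)
      qed (rule w)
      ultimately have "s = 0" "t * v0 = 0" "b' * v2 = 0" "c' * v3 = 0" using w(2) by linarith+
      then show ?thesis using w e by (intro exI[of _ t] exI[of _ b'] exI[of _ c']) simp
    qed
    obtain t b1 c1 :: real where w1: "t + b1 + c1 = 1" "t * v0 = 0" "b1 * v2 = 0" "c1 * v3 = 0"
      "ox = b1 * real_of_int x2 + c1 * real_of_int x3" "oy = b1 * real_of_int y2 + c1 * real_of_int y3"
      "z1 = b1 * real_of_int h2 + c1 * real_of_int h3" using w[OF o(1)] by blast
    obtain t' b2 c2 :: real where w2: "t' + b2 + c2 = 1" "t' * v0 = 0" "b2 * v2 = 0" "c2 * v3 = 0"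
      "ox = b2 * real_of_int x2 + c2 * real_of_int x3" "oy = b2 * real_of_int y2 + c2 * real_of_int y3"
      "z2 = b2 * real_of_int h2 + c2 * real_of_int h3" using w[OF o(2)] by blast
    have n: "(x2, y2) \<noteq> (0, 0)" "(x3, y3) \<noteq> (0, 0)" "(x2, y2) \<noteq> (x3, y3)" using D by auto
    then have nr: "(real_of_int x2, real_of_int y2) \<noteq> (0, 0)" "(real_of_int x3, real_of_int y3) \<noteq> (0, 0)"
      "(real_of_int x2, real_of_int y2) \<noteq> (real_of_int x3, real_of_int y3)" by simp_all
    from some have "b1 = b2 \<and> c1 = c2"
    proof (elim disjE)
      assume "v0 = 1"
      then have "b1 + c1 = 1" "b2 + c2 = 1" using w1 w2 by simp_all
      then show ?thesis
        by (rule segment_weights_unique[OF _ _ nr(3)]) (use w1(5,6) w2(5,6) in simp_all)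
    next
      assume "v2 = 1"
      then have z: "b1 = 0" "b2 = 0" using w1(3) w2(3) by simp_all
      note eqs = w1(5,6)[unfolded z] w2(5,6)[unfolded z]
      have "c1 + t = 1" "c2 + t' = 1" using w1(1) w2(1) z by simp_all
      then have "c1 = c2 \<and> t = t'"
        by (rule segment_weights_unique[OF _ _ nr(2)]) (use eqs in linarith)+
      then show ?thesis using z by simp
    next
      assume "v3 = 1"
      then have z: "c1 = 0" "c2 = 0" using w1(4) w2(4) by simp_all
      note eqs = w1(5,6)[unfolded z] w2(5,6)[unfolded z]
      have "b1 + t = 1" "b2 + t' = 1" using w1(1) w2(1) z by simp_all
      then have "b1 = b2 \<and> t = t'"
        by (rule segment_weights_unique[OF _ _ nr(1)]) (use eqs in linarith)+
      then show ?thesis using z by simp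
    qed
    then have "real_of_int z1 = real_of_int z2" using w1(7) w2(7) by simp
    then show False using o(3) by simp
  qed
  then have one: "a * ox + b * oy + d = 1" using fo by simp
  have e: "a * (x - ox) + b * (y - oy) = (a * x + b * y + d) - 1" for x y using one by (simp add: algebra_simps)
  have "1 \<le> a * (x1 - ox) + b * (y1 - oy)" using f1 unfolding e by simp
  moreover have "a * (x - ox) + b * (y - oy) = 0 \<or> a * (x - ox) + b * (y - oy) = -1"
    if q: "(x, y, z) \<in> ?A" "(x, y, z) \<noteq> (x1, y1, h1)" for x y z
    using f[rule_format, OF q] unfolding e by linarith
  ultimately show ?thesis by (intro exI[of _ a] exI[of _ b]) blast
qed

text \<open>The weights of the vertices in a combination over the tip are proportional to the
  determinants; since these do not all have the same sign, the weights vanish.\<close>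

lemma fibre_over_outer_tip:
  assumes S: "0 < (x2 * y3 - x3 * y2) + (x3 * y1 - x1 * y3) + (x1 * y2 - x2 * y1)"
    and out: "x2 * y3 - x3 * y2 < 0 \<or> x3 * y1 - x1 * y3 < 0 \<or> x1 * y2 - x2 * y1 < 0"
    and q: "(0, 0, z) \<in> lat {(0, 0, 0), (x1, y1, h1), (x2, y2, h2), (x3, y3, h3)}"
  shows "z = 0"
proof -
  define d1 where "d1 = x2 * y3 - x3 * y2"
  define d2 where "d2 = x3 * y1 - x1 * y3"
  define d3 where "d3 = x1 * y2 - x2 * y1"
  obtain t a b c :: real where w: "0 \<le> t" "0 \<le> a" "0 \<le> b" "0 \<le> c" "t + a + b + c = 1"
    and e: "of_int 0 = t * of_int 0 + a * of_int x1 + b * of_int x2 + c * of_int x3"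
      "of_int 0 = t * of_int 0 + a * of_int y1 + b * of_int y2 + c * of_int y3"
      "of_int z = t * of_int 0 + a * of_int h1 + b * of_int h2 + c * of_int h3"
    using q by (rule lat4_cases)
  have z0: "a * x1 + b * x2 + c * x3 = 0" "a * y1 + b * y2 + c * y3 = 0" using e(1,2) by simp_all
  have "a * d3 - c * d1 = (a * x1 + b * x2 + c * x3) * y2 - (a * y1 + b * y2 + c * y3) * x2"
    by (simp add: d3_def d1_def algebra_simps)
  then have ac: "a * d3 = c * d1" using z0 by simp
  have "b * d3 - c * d2 = (a * y1 + b * y2 + c * y3) * x1 - (a * x1 + b * x2 + c * x3) * y1"
    by (simp add: d3_def d2_def algebra_simps)
  then have bc: "b * d3 = c * d2" using z0 by simp
  have "a * d2 - b * d1 = (a * y1 + b * y2 + c * y3) * x3 - (a * x1 + b * x2 + c * x3) * y3"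
    by (simp add: d1_def d2_def algebra_simps)
  then have ab: "a * d2 = b * d1" using z0 by simp
  define s where "s = a + b + c"
  define D where "D = real_of_int (d1 + d2 + d3)"
  have "0 < d1 + d2 + d3" using S by (simp add: d1_def d2_def d3_def)
  then have D: "0 < D" unfolding D_def by (simp only: of_int_0_less_iff)
  have eq: "a * D = s * d1" "b * D = s * d2" "c * D = s * d3"
    using ac bc ab by (simp_all add: D_def s_def algebra_simps)
  have s0: "0 \<le> s" using w by (simp add: s_def)
  have "s = 0"
  proof (rule ccontr)
    assume "s \<noteq> 0"
    then have sp: "0 < s" using s0 by simp
    have "0 \<le> s * d1" "0 \<le> s * d2" "0 \<le> s * d3" using eq w D by (metis mult_nonneg_nonneg less_imp_le)+
    then have "0 \<le> d1" "0 \<le> d2" "0 \<le> d3" using sp by (simp_all add: zero_le_mult_iff)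
    then show False using out by (simp add: d1_def d2_def d3_def)
  qed
  then have "a = 0" "b = 0" "c = 0" using w by (simp_all add: s_def)
  then show ?thesis using e(3) by simp
qed

text \<open>Suppose the projection is injective on the lattice points. Two non-vertices congruent
  modulo two would make all three functionals parallel, so four non-vertices fill all four parity
  classes, and vertices 1 and 2 have congruent partners. Functional 3 is constant along both
  differences, so these are parallel. Functional 1 is constant along the second difference but not
  along the first, so the second vanishes, which contradicts functional 2.\<close>

lemma two_points_in_fibre:
  assumes c: "spike_config {(x1, y1, h1), (x2, y2, h2), (x3, y3, h3)} (0, 0, 0)"
    and ne: "(x1, y1) \<noteq> (x2, y2)" "(x1, y1) \<noteq> (x3, y3)" "(x2, y2) \<noteq> (x3, y3)"
  obtains x y z z' where "(x, y, z) \<in> lat {(0, 0, 0), (x1, y1, h1), (x2, y2, h2), (x3, y3, h3)}"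
    "(x, y, z') \<in> lat {(0, 0, 0), (x1, y1, h1), (x2, y2, h2), (x3, y3, h3)}" "z < z'"
proof (rule ccontr)
  let ?E = "{(x1, y1, h1), (x2, y2, h2), (x3, y3, h3)}" and ?A = "lat {(0, 0, 0), (x1, y1, h1), (x2, y2, h2), (x3, y3, h3)}"
  note found = that
  assume no: "\<not> thesis"
  have uniq: "z = z'" if m: "(x, y, z) \<in> ?A" "(x, y, z') \<in> ?A" for x y z z'
  proof (rule ccontr)
    assume "z \<noteq> z'"
    then consider "z < z'" | "z' < z" by linarith
    then show False
    proof cases
      case 1
      show False by (rule notE[OF no found[OF m 1]])
    next
      case 2
      show False by (rule notE[OF no found[OF m(2,1) 2]])
    qed
  qed
  have E: "(x1, y1, h1) \<in> ?E" "(x2, y2, h2) \<in> ?E" "(x3, y3, h3) \<in> ?E" by simp_all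
  have m: "(0, 0, 0) \<in> ?A" "(x1, y1, h1) \<in> ?A" "(x2, y2, h2) \<in> ?A" "(x3, y3, h3) \<in> ?A" by (simp_all add: lat_incl)
  obtain a1 b1 c1 where f1: "2 \<le> a1 * x1 + b1 * y1 + c1"
    "\<forall>x y z. (x, y, z) \<in> ?A \<longrightarrow> (x, y, z) \<noteq> (x1, y1, h1) \<longrightarrow> a1 * x + b1 * y + c1 = 0 \<or> a1 * x + b1 * y + c1 = 1"
    by (rule essential_functional[OF c E(1)])
  obtain a2 b2 c2 where f2: "2 \<le> a2 * x2 + b2 * y2 + c2"
    "\<forall>x y z. (x, y, z) \<in> ?A \<longrightarrow> (x, y, z) \<noteq> (x2, y2, h2) \<longrightarrow> a2 * x + b2 * y + c2 = 0 \<or> a2 * x + b2 * y + c2 = 1"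
    by (rule essential_functional[OF c E(2)])
  obtain a3 b3 c3 where f3: "2 \<le> a3 * x3 + b3 * y3 + c3"
    "\<forall>x y z. (x, y, z) \<in> ?A \<longrightarrow> (x, y, z) \<noteq> (x3, y3, h3) \<longrightarrow> a3 * x + b3 * y + c3 = 0 \<or> a3 * x + b3 * y + c3 = 1"
    by (rule essential_functional[OF c E(3)])
  have ne': "(x1, y1, h1) \<noteq> (x2, y2, h2)" "(x1, y1, h1) \<noteq> (x3, y3, h3)" "(x2, y2, h2) \<noteq> (x3, y3, h3)" using ne by auto
  have l1: "a1 * x + b1 * y < a1 * x1 + b1 * y1" if "(x, y, z) \<in> ?A" "(x, y, z) \<noteq> (x1, y1, h1)" for x y z
    using f1(1) f1(2)[rule_format, OF that] by linarith
  have l2: "a2 * x + b2 * y < a2 * x2 + b2 * y2" if "(x, y, z) \<in> ?A" "(x, y, z) \<noteq> (x2, y2, h2)" for x y z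
    using f2(1) f2(2)[rule_format, OF that] by linarith
  have l3: "a3 * x + b3 * y < a3 * x3 + b3 * y3" if "(x, y, z) \<in> ?A" "(x, y, z) \<noteq> (x3, y3, h3)" for x y z
    using f3(1) f3(2)[rule_format, OF that] by linarith
  let ?R = "?A - ?E"
  have finA: "finite ?A" using spike_config_finite[OF c] by simp
  have "card ?E \<le> 3" by (simp add: card_insert_if)
  then have "4 \<le> card ?R" using spike_config_card[OF c] diff_card_le_card_Diff[of ?E ?A] by simp
  then obtain R where R: "R \<subseteq> ?R" "card R = 4" by (rule obtain_subset_with_card_n)
  have inj: "inj_on parity_class R"
  proof (rule inj_onI)
    fix q r assume qr: "q \<in> R" "r \<in> R" "parity_class q = parity_class r"
    obtain x y z where q: "q = (x, y, z)" by (metis prod_cases3)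
    obtain x' y' z' where r: "r = (x', y', z')" by (metis prod_cases3)
    have qA: "(x, y, z) \<in> ?A" "(x, y, z) \<noteq> (x1, y1, h1)" "(x, y, z) \<noteq> (x2, y2, h2)" "(x, y, z) \<noteq> (x3, y3, h3)"
      using qr(1) R(1) unfolding q by blast+
    have rA: "(x', y', z') \<in> ?A" "(x', y', z') \<noteq> (x1, y1, h1)" "(x', y', z') \<noteq> (x2, y2, h2)" "(x', y', z') \<noteq> (x3, y3, h3)"
      using qr(2) R(1) unfolding r by blast+
    have ev: "even (x - x')" "even (y - y')" using qr(3) unfolding q r parity_class_eq by simp_all
    note p1 = parity_constant[OF f1(2)[rule_format, OF qA(1,2)] f1(2)[rule_format, OF rA(1,2)] ev]
    note p2 = parity_constant[OF f2(2)[rule_format, OF qA(1,3)] f2(2)[rule_format, OF rA(1,3)] ev]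
    note p3 = parity_constant[OF f3(2)[rule_format, OF qA(1,4)] f3(2)[rule_format, OF rA(1,4)] ev]
    have "(x - x', y - y') = (0, 0)"
    proof (rule ccontr)
      assume "(x - x', y - y') \<noteq> (0, 0)"
      from three_parallel[OF this p1 p2 p3 l1[OF m(3) ne'(1)[symmetric]] l1[OF m(4) ne'(2)[symmetric]]
          l2[OF m(2) ne'(1)] l2[OF m(4) ne'(3)[symmetric]] l3[OF m(2) ne'(2)] l3[OF m(3) ne'(3)]]
      show False .
    qed
    then have xy: "x' = x" "y' = y" by simp_all
    then show "q = r" using uniq[OF qA(1)] rA(1) unfolding q r by simp
  qed
  obtain r1 where r1: "r1 \<in> R" "parity_class r1 = parity_class (x1, y1, h1)" by (rule parity_class_cover[OF R(2) inj])
  obtain r2 where r2: "r2 \<in> R" "parity_class r2 = parity_class (x2, y2, h2)" by (rule parity_class_cover[OF R(2) inj])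
  obtain x y z where q: "r1 = (x, y, z)" by (metis prod_cases3)
  obtain x' y' z' where r: "r2 = (x', y', z')" by (metis prod_cases3)
  have qA: "(x, y, z) \<in> ?A" "(x, y, z) \<noteq> (x1, y1, h1)" "(x, y, z) \<noteq> (x2, y2, h2)" "(x, y, z) \<noteq> (x3, y3, h3)"
    using r1(1) R(1) unfolding q by blast+
  have rA: "(x', y', z') \<in> ?A" "(x', y', z') \<noteq> (x1, y1, h1)" "(x', y', z') \<noteq> (x2, y2, h2)" "(x', y', z') \<noteq> (x3, y3, h3)"
    using r2(1) R(1) unfolding r by blast+
  have ev1: "even (x - x1)" "even (y - y1)" using r1(2) unfolding q parity_class_eq by simp_all
  have ev2: "even (x' - x2)" "even (y' - y2)" using r2(2) unfolding r parity_class_eq by simp_all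
  define dx where "dx = x - x1"
  define dy where "dy = y - y1"
  define ex where "ex = x' - x2"
  define ey where "ey = y' - y2"
  have d3: "a3 * dx + b3 * dy = 0" unfolding dx_def dy_def
    by (rule parity_constant[OF f3(2)[rule_format, OF qA(1,4)] f3(2)[rule_format, OF m(2) ne'(2)] ev1])
  have e3: "a3 * ex + b3 * ey = 0" unfolding ex_def ey_def
    by (rule parity_constant[OF f3(2)[rule_format, OF rA(1,4)] f3(2)[rule_format, OF m(3) ne'(3)] ev2])
  have e1: "a1 * ex + b1 * ey = 0" unfolding ex_def ey_def
    by (rule parity_constant[OF f1(2)[rule_format, OF rA(1,2)] f1(2)[rule_format, OF m(3) ne'(1)[symmetric]] ev2])
  have d1: "a1 * dx + b1 * dy < 0" using l1[OF qA(1,2)] by (simp add: dx_def dy_def algebra_simps)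
  have e2: "a2 * ex + b2 * ey < 0" using l2[OF rA(1,3)] by (simp add: ex_def ey_def algebra_simps)
  have "a3 \<noteq> 0 \<or> b3 \<noteq> 0" using l3[OF m(2) ne'(2)] by auto
  moreover have "a3 * (dx * ey - dy * ex) = ey * (a3 * dx + b3 * dy) - dy * (a3 * ex + b3 * ey)"
    "b3 * (dx * ey - dy * ex) = dx * (a3 * ex + b3 * ey) - ex * (a3 * dx + b3 * dy)" by (simp_all add: algebra_simps)
  then have "a3 * (dx * ey - dy * ex) = 0" "b3 * (dx * ey - dy * ex) = 0" unfolding d3 e3 by simp_all
  ultimately have det: "dx * ey - dy * ex = 0" by (metis mult_eq_0_iff)
  have "(a1 * dx + b1 * dy) * ex = (a1 * ex + b1 * ey) * dx - b1 * (dx * ey - dy * ex)"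
    "(a1 * dx + b1 * dy) * ey = (a1 * ex + b1 * ey) * dy + a1 * (dx * ey - dy * ex)" by (simp_all add: algebra_simps)
  then have "(a1 * dx + b1 * dy) * ex = 0" "(a1 * dx + b1 * dy) * ey = 0" unfolding e1 det by simp_all
  then have "ex = 0" "ey = 0" using d1 by (metis mult_eq_0_iff less_irrefl)+
  then show False using e2 by simp
qed

text \<open>The origin moves from the tip to the foot of a fibre with two lattice points. That fibre
  is not the one of the tip, which stands alone over its projection.\<close>

lemma in_list_outside:
  assumes c: "spike_config {(x1, y1, h1), (x2, y2, h2), (x3, y3, h3)} (0, 0, 0)"
    and S: "0 < (x2 * y3 - x3 * y2) + (x3 * y1 - x1 * y3) + (x1 * y2 - x2 * y1)"
    and out: "x2 * y3 - x3 * y2 < 0 \<or> x3 * y1 - x1 * y3 < 0 \<or> x1 * y2 - x2 * y1 < 0"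
  shows "in_list (hull_equiv {(x1, y1, h1), (x2, y2, h2), (x3, y3, h3)} (0, 0, 0))"
proof -
  let ?E = "{(x1, y1, h1), (x2, y2, h2), (x3, y3, h3)}" and ?A = "lat {(0, 0, 0), (x1, y1, h1), (x2, y2, h2), (x3, y3, h3)}"
  have E: "{(x2, y2, h2), (x3, y3, h3), (x1, y1, h1)} = ?E" "{(x3, y3, h3), (x1, y1, h1), (x2, y2, h2)} = ?E" by blast+
  have D1: "x2 * y3 - x3 * y2 \<noteq> 0"
  proof (cases "x2 * y3 - x3 * y2 < 0")
    case False
    then show ?thesis using tip_off_line[OF c S] out by blast
  qed simp
  have D2: "x3 * y1 - x1 * y3 \<noteq> 0"
  proof (cases "x3 * y1 - x1 * y3 < 0")
    case False
    have S': "0 < (x3 * y1 - x1 * y3) + (x1 * y2 - x2 * y1) + (x2 * y3 - x3 * y2)" using S by simp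
    show ?thesis using False tip_off_line[of x2 y2 h2 x3 y3 h3 x1 y1 h1, unfolded E, OF c S'] out by blast
  qed simp
  have D3: "x1 * y2 - x2 * y1 \<noteq> 0"
  proof (cases "x1 * y2 - x2 * y1 < 0")
    case False
    have S': "0 < (x1 * y2 - x2 * y1) + (x2 * y3 - x3 * y2) + (x3 * y1 - x1 * y3)" using S by simp
    show ?thesis using False tip_off_line[of x3 y3 h3 x1 y1 h1 x2 y2 h2, unfolded E, OF c S'] out by blast
  qed simp
  have ne: "(x1, y1) \<noteq> (x2, y2)" "(x1, y1) \<noteq> (x3, y3)" "(x2, y2) \<noteq> (x3, y3)" using D1 D2 D3 by auto
  obtain ox oy z1 z2 where o: "(ox, oy, z1) \<in> ?A" "(ox, oy, z2) \<in> ?A" "z1 < z2"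
    by (rule two_points_in_fibre[OF c ne])
  have o0: "(ox, oy) \<noteq> (0, 0)"
  proof
    assume "(ox, oy) = (0, 0)"
    then have "z1 = 0" "z2 = 0" using fibre_over_outer_tip[OF S out, of z1] fibre_over_outer_tip[OF S out, of z2] o by simp_all
    then show False using o(3) by simp
  qed
  obtain a1 b1 where g1: "1 \<le> a1 * (x1 - ox) + b1 * (y1 - oy)"
    "\<forall>x y z. (x, y, z) \<in> ?A \<longrightarrow> (x, y, z) \<noteq> (x1, y1, h1) \<longrightarrow> a1 * (x - ox) + b1 * (y - oy) = 0 \<or> a1 * (x - ox) + b1 * (y - oy) = -1"
    using value_one_at[OF c D1 o ne(1,2)] by blast
  obtain a2 b2 where g2: "1 \<le> a2 * (x2 - ox) + b2 * (y2 - oy)"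
    "\<forall>x y z. (x, y, z) \<in> ?A \<longrightarrow> (x, y, z) \<noteq> (x2, y2, h2) \<longrightarrow> a2 * (x - ox) + b2 * (y - oy) = 0 \<or> a2 * (x - ox) + b2 * (y - oy) = -1"
    using value_one_at[of x2 y2 h2 x3 y3 h3 x1 y1 h1, unfolded E, OF c D2 o ne(3) ne(1)[symmetric]] by blast
  obtain a3 b3 where g3: "1 \<le> a3 * (x3 - ox) + b3 * (y3 - oy)"
    "\<forall>x y z. (x, y, z) \<in> ?A \<longrightarrow> (x, y, z) \<noteq> (x3, y3, h3) \<longrightarrow> a3 * (x - ox) + b3 * (y - oy) = 0 \<or> a3 * (x - ox) + b3 * (y - oy) = -1"
    using value_one_at[of x3 y3 h3 x1 y1 h1 x2 y2 h2, unfolded E, OF c D3 o ne(2,3)[symmetric]] by blast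
  define T :: "int \<times> int \<times> int \<Rightarrow> int \<times> int \<times> int"
    where "T = (\<lambda>(x, y, z). (1 * x + 0 * y + (- ox), 0 * x + 1 * y + (- oy), 0 * x + 0 * y + 1 * z + 0))"
  have bT: "block_map T" unfolding T_def by (rule block_mapI[of 1 1 0 0 1 "- ox" "- oy" 0 0 0]) simp_all
  have T: "T (x, y, z) = (x - ox, y - oy, z)" for x y z by (simp add: T_def)
  let ?E' = "{(x1 - ox, y1 - oy, h1), (x2 - ox, y2 - oy, h2), (x3 - ox, y3 - oy, h3)}"
  have TE: "T ` ?E = ?E'" unfolding image_insert image_empty T by (rule refl)
  have Tv: "T (0, 0, 0) = (- ox, - oy, 0)" unfolding T by simp
  show ?thesis
  proof (rule in_list_reduce[OF bT TE Tv c])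
    assume c': "spike_config ?E' (- ox, - oy, 0)"
    have lat: "lat {(- ox, - oy, 0), (x1 - ox, y1 - oy, h1), (x2 - ox, y2 - oy, h2), (x3 - ox, y3 - oy, h3)} = T ` ?A"
      using lat_block_map[OF bT, of "{(0, 0, 0), (x1, y1, h1), (x2, y2, h2), (x3, y3, h3)}"]
      unfolding image_insert[of T "(0, 0, 0)"] TE Tv .
    have mem: "(x + ox, y + oy, z) \<in> ?A" if "(x, y, z) \<in> T ` ?A" for x y z
    proof -
      obtain q where q: "q \<in> ?A" "(x, y, z) = T q" using \<open>(x, y, z) \<in> T ` ?A\<close> by (rule imageE) blast
      obtain x' y' z' where q': "q = (x', y', z')" by (metis prod_cases3)
      have "x' = x + ox" "y' = y + oy" "z' = z" using q(2) unfolding q' T by simp_all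
      then show ?thesis using q(1) unfolding q' by simp
    qed
    have fib: "(0, 0, z1) \<in> T ` ?A" "(0, 0, z2) \<in> T ` ?A"
    proof -
      have "T (ox, oy, z1) = (0, 0, z1)" "T (ox, oy, z2) = (0, 0, z2)" unfolding T by simp_all
      then show "(0, 0, z1) \<in> T ` ?A" "(0, 0, z2) \<in> T ` ?A" using o(1,2) by (metis image_eqI)+
    qed
    have G1: "a1 * x + b1 * y = 0 \<or> a1 * x + b1 * y = -1" if "(x, y, z) \<in> T ` ?A" "(x, y, z) \<noteq> (x1 - ox, y1 - oy, h1)" for x y z
      using g1(2)[rule_format, OF mem[OF that(1)]] that(2) by auto
    have G2: "a2 * x + b2 * y = 0 \<or> a2 * x + b2 * y = -1" if "(x, y, z) \<in> T ` ?A" "(x, y, z) \<noteq> (x2 - ox, y2 - oy, h2)" for x y z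
      using g2(2)[rule_format, OF mem[OF that(1)]] that(2) by auto
    have G3: "a3 * x + b3 * y = 0 \<or> a3 * x + b3 * y = -1" if "(x, y, z) \<in> T ` ?A" "(x, y, z) \<noteq> (x3 - ox, y3 - oy, h3)" for x y z
      using g3(2)[rule_format, OF mem[OF that(1)]] that(2) by auto
    have "exterior_tip (x1 - ox) (y1 - oy) h1 (x2 - ox) (y2 - oy) h2 (x3 - ox) (y3 - oy) h3 (- ox) (- oy) 0 a1 b1 a2 b2 a3 b3 z1 z2"
      unfolding exterior_tip_def lat
    proof (intro conjI allI impI)
      show "0 < ((x2 - ox) * (y3 - oy) - (x3 - ox) * (y2 - oy)) + ((x3 - ox) * (y1 - oy) - (x1 - ox) * (y3 - oy))
          + ((x1 - ox) * (y2 - oy) - (x2 - ox) * (y1 - oy))" using S by (simp add: algebra_simps)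
    qed (fact c' fib o(3) g1(1) g2(1) g3(1) | (rule G1; assumption) | (rule G2; assumption) | (rule G3; assumption)
        | (use D1 D2 D3 o0 out in simp))+
    then interpret exterior_tip "x1 - ox" "y1 - oy" h1 "x2 - ox" "y2 - oy" h2 "x3 - ox" "y3 - oy" h3 "- ox" "- oy" 0 a1 b1 a2 b2 a3 b3 z1 z2 .
    show "in_list (hull_equiv ?E' (- ox, - oy, 0))" by (rule in_list_exterior)
  qed
qed

text \<open>Exchanging two vertices reverses the orientation, so the total determinant may be taken
  positive.\<close>

lemma in_list_triangle:
  assumes c: "spike_config {(x1, y1, h1), (x2, y2, h2), (x3, y3, h3)} (0, 0, 0)"
    and ne: "(x1, y1, h1) \<noteq> (x2, y2, h2)" "(x1, y1, h1) \<noteq> (x3, y3, h3)" "(x2, y2, h2) \<noteq> (x3, y3, h3)"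
  shows "in_list (hull_equiv {(x1, y1, h1), (x2, y2, h2), (x3, y3, h3)} (0, 0, 0))"
proof -
  have pos: "in_list (hull_equiv {(x1, y1, h1), (x2, y2, h2), (x3, y3, h3)} (0, 0, 0))"
    if c: "spike_config {(x1, y1, h1), (x2, y2, h2), (x3, y3, h3)} (0, 0, 0)"
      and S: "0 < (x2 * y3 - x3 * y2) + (x3 * y1 - x1 * y3) + (x1 * y2 - x2 * y1)"
    for x1 y1 h1 x2 y2 h2 x3 y3 h3
  proof (cases "x2 * y3 - x3 * y2 < 0 \<or> x3 * y1 - x1 * y3 < 0 \<or> x1 * y2 - x2 * y1 < 0")
    case True
    then show ?thesis by (rule in_list_outside[OF c S])
  next
    case False
    then have "0 \<le> x2 * y3 - x3 * y2" "0 \<le> x3 * y1 - x1 * y3" "0 \<le> x1 * y2 - x2 * y1" by linarith+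
    then show ?thesis by (rule in_list_inside[OF c _ _ _ S])
  qed
  have swap: "{(x1, y1, h1), (x3, y3, h3), (x2, y2, h2)} = {(x1, y1, h1), (x2, y2, h2), (x3, y3, h3)}" by blast
  show ?thesis
  proof (cases "0 < (x2 * y3 - x3 * y2) + (x3 * y1 - x1 * y3) + (x1 * y2 - x2 * y1)")
    case True
    then show ?thesis by (rule pos[OF c])
  next
    case False
    then have "0 < (x3 * y2 - x2 * y3) + (x2 * y1 - x1 * y2) + (x1 * y3 - x3 * y1)"
      using noncollinear[OF c ne] by simp
    then show ?thesis by (rule pos[of x1 y1 h1 x3 y3 h3 x2 y2 h2, unfolded swap, OF c])
  qed
qed

section \<open>Quadrilaterals\<close>

text \<open>The two diagonals pass over the origin at heights \<open>- m / 2\<close> and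
  \<open>- n / 2\<close>; the deeper one bounds the fibre from below and the tip bounds it from
  above.\<close>

lemma lat_cross:
  assumes m: "0 < n" "n \<le> m"
  shows "lat {(0, 0, 0), (1, 0, 0), (0, 1, 0), (-1, 0, - m), (0, -1, - n)} =
    {(1, 0, 0), (0, 1, 0), (-1, 0, - m), (0, -1, - n)} \<union> (\<lambda>z. (0, 0, z)) ` {- (m div 2)..0}"
    (is "?A = ?B")
proof (intro equalityI subsetI)
  fix q assume q: "q \<in> ?A"
  obtain x y z where [simp]: "q = (x, y, z)" by (metis prod_cases3)
  obtain e a b c d :: real where w: "0 \<le> e" "0 \<le> a" "0 \<le> b" "0 \<le> c" "0 \<le> d" "e + a + b + c + d = 1"
    and e: "of_int x = e * of_int 0 + a * of_int 1 + b * of_int 0 + c * of_int (-1) + d * of_int 0"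
      "of_int y = e * of_int 0 + a * of_int 0 + b * of_int 1 + c * of_int 0 + d * of_int (-1)"
      "of_int z = e * of_int 0 + a * of_int 0 + b * of_int 0 + c * of_int (- m) + d * of_int (- n)"
    using q unfolding \<open>q = _\<close> by (rule lat5_cases)
  have x: "real_of_int x = a - c" and y: "real_of_int y = b - d" and z: "real_of_int z = - (c * m) - d * n" using e by simp_all
  have "real_of_int x \<le> 1" "real_of_int x \<ge> -1" "real_of_int y \<ge> -1" "real_of_int y \<le> 1" using x y w by linarith+
  then have xy: "x = -1 \<or> x = 0 \<or> x = 1" "y = -1 \<or> y = 0 \<or> y = 1" by auto
  consider "x = 1" | "x = -1" | "y = 1" | "y = -1" | "x = 0" "y = 0" using xy by blast
  then show "q \<in> ?B"
  proof cases
    case 1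
    then have h: "a = 1" "b = 0" "c = 0" "d = 0" using x w by linarith+
    then show ?thesis using 1 y z by simp
  next
    case 2
    then have h: "a = 0" "b = 0" "c = 1" "d = 0" using x w by linarith+
    then have "real_of_int z = real_of_int (- m)" "y = 0" using y z by simp_all
    then show ?thesis using 2 by (simp only: of_int_eq_iff) simp
  next
    case 3
    then have h: "a = 0" "b = 1" "c = 0" "d = 0" using y w by linarith+
    then show ?thesis using 3 x z by simp
  next
    case 4
    then have h: "a = 0" "b = 0" "c = 0" "d = 1" using y w by linarith+
    then have "real_of_int z = real_of_int (- n)" "x = 0" using x z by simp_all
    then show ?thesis using 4 by (simp only: of_int_eq_iff) simp
  next
    case 5
    then have h: "a = c" "b = d" "c + d \<le> 1/2" using x y w by linarith+
    have "d * n \<le> d * m" by (rule mult_left_mono) (use w m in simp_all)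
    moreover have "(c + d) * m \<le> 1/2 * m" by (rule mult_right_mono[OF h(3)]) (use m in simp)
    ultimately have "c * m + d * n \<le> 1/2 * m" by (simp add: algebra_simps)
    moreover have "0 \<le> c * m" "0 \<le> d * n" using w m by simp_all
    ultimately have "real_of_int (- m) \<le> real_of_int (2 * z)" "real_of_int z \<le> real_of_int 0" using z by simp_all
    then have "- m \<le> 2 * z" "z \<le> 0" by (simp_all only: of_int_le_iff)
    then have "z \<in> {- (m div 2)..0}" by auto
    then show ?thesis using 5 by simp
  qed
next
  fix q assume q: "q \<in> ?B"
  have mm: "(0, 0, 0) \<in> ?A" "(1, 0, 0) \<in> ?A" "(0, 1, 0) \<in> ?A" "(-1, 0, - m) \<in> ?A" "(0, -1, - n) \<in> ?A" by (simp_all add: lat_incl)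
  have 1: "(0, 0, z) \<in> ?A" if "z \<in> {- (m div 2)..0}" for z
  proof (rule latI3[OF mm(1,2,4), of "1 + 2 * real_of_int z / m" "- z / m" "- z / m"])
    have "- m \<le> 2 * z" using that by auto
    then have "real_of_int (- m) \<le> real_of_int (2 * z)" by (simp only: of_int_le_iff)
    then show "0 \<le> 1 + 2 * real_of_int z / real_of_int m" using m by (simp add: field_simps)
  qed (use that m in \<open>simp_all add: divide_le_0_iff\<close>)
  show "q \<in> ?A" using q mm 1 by auto
qed

lemma hull_equiv5I:
  assumes T: "block_map T" and E: "E = {e1, e2, e3, e4}" and q: "T e1 = q1" "T e2 = q2" "T e3 = q3" "T e4 = q4" "T v = q5"
    and n: "int (card (lat (insert v E))) = n"
  shows "hull_equiv E v [emb q1, emb q2, emb q3, emb q4, emb q5] n"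
proof (rule hull_equivI[OF T])
  show "T ` insert v E = set [q1, q2, q3, q4, q5]" unfolding E using q by auto
qed (use q n in simp_all)

lemma in_list_cross_normal:
  assumes c: "spike_config {(1, 0, 0), (0, 1, 0), (-1, 0, - m), (0, -1, - n)} (0, 0, 0)" and m: "0 < n" "n \<le> m"
  shows "in_list (hull_equiv {(1, 0, 0), (0, 1, 0), (-1, 0, - m), (0, -1, - n)} (0, 0, 0))"
proof -
  let ?E = "{(1, 0, 0), (0, 1, 0), (-1, 0, - m), (0, -1, - n)}"
  define k where "k = m div 2"
  let ?V = "{(1::int, 0::int, 0), (0, 1, 0), (-1, 0, - m), (0, -1, - n)}" and ?F = "(\<lambda>z. (0::int, 0::int, z)) ` {- (m div 2)..0}"
  have "?V \<inter> ?F = {}" by auto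
  then have "card (?V \<union> ?F) = card ?V + card ?F" by (intro card_Un_disjoint) simp_all
  moreover have "card ?V = 4" by simp
  moreover have "card ?F = card {- (m div 2)..0}" by (intro card_image inj_onI) simp
  moreover have "0 \<le> m div 2" using m by simp
  ultimately have card: "int (card (lat (insert (0, 0, 0) ?E))) = k + 5" unfolding lat_cross[OF m] k_def by simp
  have k: "2 \<le> k" using card spike_config_card[OF c] by simp
  \<comment> \<open>The shear raises the tip to \<open>k\<close> and leaves these remainders at the
    far ends of the diagonals; \<open>n \<le> m\<close> turns into \<open>a \<le> b\<close> and
    \<open>0 < n\<close> into the strict bound \<open>b < 2 * k\<close>.\<close>
  define a where "a = 2 * k - m"
  define b where "b = 2 * k - n"
  have a: "a \<in> {-1, 0}" unfolding a_def k_def by auto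
  have ab: "a \<le> b" "b < 2 * k" using m by (simp_all add: a_def b_def)
  show ?thesis
  proof (rule in_list_8[OF k a ab])
    have "hull_equiv ?E (0, 0, 0) [emb (1, 0, 0), emb (0, 1, 0), emb (-1, 0, a), emb (0, -1, b), emb (0, 0, k)] (k + 5)"
      by (rule hull_equiv5I[OF block_mapI[of 1 1 0 0 1 0 0 "- k" "- k" k], of _ "(1, 0, 0)" "(0, 1, 0)" "(-1, 0, - m)" "(0, -1, - n)"])
        (use card in \<open>auto simp: a_def b_def\<close>)
    then show "hull_equiv ?E (0, 0, 0) [pt 1 0 0, pt 0 1 0, pt (-1) 0 a, pt 0 (-1) b, pt 0 0 k] (k + 5)" by simp
  qed
qed

lemma in_list_cross_neg:
  assumes c: "spike_config {(1, 0, 0), (0, 1, 0), (-1, 0, - m), (0, -1, - n)} (0, 0, 0)" and m: "0 < n" "0 < m"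
  shows "in_list (hull_equiv {(1, 0, 0), (0, 1, 0), (-1, 0, - m), (0, -1, - n)} (0, 0, 0))"
proof (cases "n \<le> m")
  case True
  then show ?thesis by (rule in_list_cross_normal[OF c m(1)])
next
  case False
  then have "m \<le> n" by simp
  show ?thesis
    by (rule in_list_reduce[OF block_mapI[of 0 0 1 1 1 0 0 0 0 0] _ _ c in_list_cross_normal[OF _ m(2) \<open>m \<le> n\<close>]]) auto
qed

text \<open>If \<open>s\<close> and \<open>t\<close> did not have the same strict sign, the tip
  would lie between the midpoints of the two diagonals and thus in the hull of the vertices; each
  diagonal is weighted by the height of the other.\<close>

lemma in_list_cross:
  assumes c: "spike_config {(1, 0, 0), (0, 1, 0), (-1, 0, s), (0, -1, t)} (0, 0, 0)"
  shows "in_list (hull_equiv {(1, 0, 0), (0, 1, 0), (-1, 0, s), (0, -1, t)} (0, 0, 0))"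
proof -
  let ?E = "{(1, 0, 0), (0, 1, 0), (-1, 0, s), (0, -1, t)}"
  have m: "(1, 0, 0) \<in> lat ?E" "(0, 1, 0) \<in> lat ?E" "(-1, 0, s) \<in> lat ?E" "(0, -1, t) \<in> lat ?E" by (simp_all add: lat_incl)
  have no: "\<not> (0 \<le> s * (- t))"
  proof
    assume st: "0 \<le> s * (- t)"
    have "(0, 0, 0) \<in> lat ?E"
    proof (cases "s = 0 \<and> t = 0")
      case True
      then show ?thesis using lat_midpoint[OF m(1,3)] by simp
    next
      case False
      define r where "r = real_of_int (\<bar>s\<bar> + \<bar>t\<bar>)"
      have r: "0 < r" using False by (auto simp: r_def)
      have "\<bar>t\<bar> * s + \<bar>s\<bar> * t = 0" using st by (auto simp: abs_if zero_le_mult_iff mult_le_0_iff)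
      then have z: "real_of_int \<bar>t\<bar> * s + real_of_int \<bar>s\<bar> * t = 0" by (metis of_int_0 of_int_add of_int_mult)
      show ?thesis
      proof (rule latI5[OF m(1,1,3,2,4), of 0 "\<bar>t\<bar> / (2 * r)" "\<bar>t\<bar> / (2 * r)" "\<bar>s\<bar> / (2 * r)" "\<bar>s\<bar> / (2 * r)"])
        show "0 + \<bar>t\<bar> / (2 * r) + \<bar>t\<bar> / (2 * r) + \<bar>s\<bar> / (2 * r) + \<bar>s\<bar> / (2 * r) = 1"
          using r by (simp add: field_simps) (simp add: r_def)
        have "\<bar>t\<bar> / (2 * r) * real_of_int s + \<bar>s\<bar> / (2 * r) * t = (real_of_int \<bar>t\<bar> * s + real_of_int \<bar>s\<bar> * t) / (2 * r)"
          by (simp add: add_divide_distrib)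
        then have "\<bar>t\<bar> / (2 * r) * real_of_int s + \<bar>s\<bar> / (2 * r) * t = 0" unfolding z by simp
        then show "real_of_int 0 = 0 * real_of_int 0 + \<bar>t\<bar> / (2 * r) * real_of_int 0 + \<bar>t\<bar> / (2 * r) * real_of_int s
           + \<bar>s\<bar> / (2 * r) * real_of_int 0 + \<bar>s\<bar> / (2 * r) * real_of_int t" by simp
      qed (use r in simp_all)
    qed
    then show False using spike_config_tip[OF c] by simp
  qed
  then have "0 < s \<and> 0 < t \<or> s < 0 \<and> t < 0" by (auto simp: zero_le_mult_iff mult_le_0_iff not_le)
  then show ?thesis
  proof (elim disjE conjE)
    assume p: "0 < s" "0 < t"
    show ?thesis
      by (rule in_list_reduce[OF block_mapI[of 1 1 0 0 "-1" 0 0 0 0 0] _ _ c in_list_cross_neg[OF _ p(2,1)]]) auto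
  next
    assume p: "s < 0" "t < 0"
    define m n where "m = - s" and "n = - t"
    have e: "s = - m" "t = - n" by (simp_all add: m_def n_def)
    show ?thesis unfolding e by (rule in_list_cross_neg[OF c[unfolded e]]) (use p in \<open>simp_all add: m_def n_def\<close>)
  qed
qed

lemma parallel_reverse:
  fixes dx dy :: int
  assumes "(dx, dy) \<noteq> (0, 0)" "a * dx + b * dy = 0" "a' * dx + b' * dy = 0"
    and opp: "0 < a * dy - b * dx \<and> a' * dy - b' * dx < 0 \<or> a * dy - b * dx < 0 \<and> 0 < a' * dy - b' * dx"
    and lt: "a' * x' + b' * y' < a' * x + b' * y"
  shows "a * x + b * y < a * x' + b * y'"
proof -
  define u where "u = (dy * x - dx * y) - (dy * x' - dx * y')"
  define N where "N = dx * dx + dy * dy"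
  have N: "0 < N" using assms(1) by (auto simp: N_def sum_squares_gt_zero_iff)
  have "0 < (a' * dy - b' * dx) * u" using parallel_gain[OF assms(1,3) lt] by (simp add: u_def)
  then have "(a * dy - b * dx) * u < 0" using opp by (auto simp: zero_less_mult_iff mult_less_0_iff)
  moreover have "N * ((a * x + b * y) - (a * x' + b * y')) = (a * dy - b * dx) * u
      + (a * dx + b * dy) * (dx * (x - x') + dy * (y - y'))"
    by (simp add: N_def u_def algebra_simps)
  ultimately have "N * ((a * x + b * y) - (a * x' + b * y')) < 0" unfolding assms(2) by simp
  then show ?thesis using N by (simp add: mult_less_0_iff)
qed

text \<open>Vertices 1 and 3 agree modulo two, so functionals 2 and 4 are constant along their
  difference, and they point in opposite directions. Comparing tip and vertices under both makes
  their mutual values -1 and places vertices 1 and 3 on a line with the tip. As over an edge,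
  proportional functionals then have diagonal values one, and the figure is centrally
  symmetric.\<close>

lemma in_list_quadrilateral_parity:
  assumes c: "spike_config {(x1, y1, h1), (x2, y2, h2), (x3, y3, h3), (x4, y4, h4)} (0, 0, 0)"
    and ne: "(x1, y1, h1) \<noteq> (x2, y2, h2)" "(x1, y1, h1) \<noteq> (x3, y3, h3)" "(x1, y1, h1) \<noteq> (x4, y4, h4)"
      "(x2, y2, h2) \<noteq> (x3, y3, h3)" "(x2, y2, h2) \<noteq> (x4, y4, h4)" "(x3, y3, h3) \<noteq> (x4, y4, h4)"
    and ev: "even (x1 - x3)" "even (y1 - y3)"
  shows "in_list (hull_equiv {(x1, y1, h1), (x2, y2, h2), (x3, y3, h3), (x4, y4, h4)} (0, 0, 0))"
proof -
  let ?E = "{(x1, y1, h1), (x2, y2, h2), (x3, y3, h3), (x4, y4, h4)}"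
  let ?A = "lat (insert (0, 0, 0) ?E)"
  have E: "(x1, y1, h1) \<in> ?E" "(x2, y2, h2) \<in> ?E" "(x3, y3, h3) \<in> ?E" "(x4, y4, h4) \<in> ?E" by simp_all
  have m: "(0, 0, 0) \<in> ?A" "(x1, y1, h1) \<in> ?A" "(x2, y2, h2) \<in> ?A" "(x3, y3, h3) \<in> ?A" "(x4, y4, h4) \<in> ?A" by (simp_all add: lat_incl)
  have "(x1, y1, h1) \<in> lat ?E" "(x2, y2, h2) \<in> lat ?E" "(x3, y3, h3) \<in> lat ?E" "(x4, y4, h4) \<in> lat ?E" by (simp_all add: lat_incl)
  then have tip: "(0, 0, 0) \<noteq> (x1, y1, h1)" "(0, 0, 0) \<noteq> (x2, y2, h2)" "(0, 0, 0) \<noteq> (x3, y3, h3)" "(0, 0, 0) \<noteq> (x4, y4, h4)"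
    using spike_config_tip[OF c] by metis+
  obtain a1 b1 c1 where f1: "2 \<le> a1 * x1 + b1 * y1 + c1"
    "\<forall>x y z. (x, y, z) \<in> ?A \<longrightarrow> (x, y, z) \<noteq> (x1, y1, h1) \<longrightarrow> a1 * x + b1 * y + c1 = 0 \<or> a1 * x + b1 * y + c1 = 1"
    by (rule essential_functional[OF c E(1)])
  obtain a2 b2 c2 where f2: "2 \<le> a2 * x2 + b2 * y2 + c2"
    "\<forall>x y z. (x, y, z) \<in> ?A \<longrightarrow> (x, y, z) \<noteq> (x2, y2, h2) \<longrightarrow> a2 * x + b2 * y + c2 = 0 \<or> a2 * x + b2 * y + c2 = 1"
    by (rule essential_functional[OF c E(2)])
  obtain a3 b3 c3 where f3: "2 \<le> a3 * x3 + b3 * y3 + c3"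
    "\<forall>x y z. (x, y, z) \<in> ?A \<longrightarrow> (x, y, z) \<noteq> (x3, y3, h3) \<longrightarrow> a3 * x + b3 * y + c3 = 0 \<or> a3 * x + b3 * y + c3 = 1"
    by (rule essential_functional[OF c E(3)])
  obtain a4 b4 c4 where f4: "2 \<le> a4 * x4 + b4 * y4 + c4"
    "\<forall>x y z. (x, y, z) \<in> ?A \<longrightarrow> (x, y, z) \<noteq> (x4, y4, h4) \<longrightarrow> a4 * x + b4 * y + c4 = 0 \<or> a4 * x + b4 * y + c4 = 1"
    by (rule essential_functional[OF c E(4)])
  define g11 where "g11 = a1 * x1 + b1 * y1"
  define g12 where "g12 = a1 * x2 + b1 * y2"
  define g13 where "g13 = a1 * x3 + b1 * y3"
  define g14 where "g14 = a1 * x4 + b1 * y4"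
  define g21 where "g21 = a2 * x1 + b2 * y1"
  define g22 where "g22 = a2 * x2 + b2 * y2"
  define g23 where "g23 = a2 * x3 + b2 * y3"
  define g24 where "g24 = a2 * x4 + b2 * y4"
  define g31 where "g31 = a3 * x1 + b3 * y1"
  define g32 where "g32 = a3 * x2 + b3 * y2"
  define g33 where "g33 = a3 * x3 + b3 * y3"
  define g34 where "g34 = a3 * x4 + b3 * y4"
  define g41 where "g41 = a4 * x1 + b4 * y1"
  define g42 where "g42 = a4 * x2 + b4 * y2"
  define g43 where "g43 = a4 * x3 + b4 * y3"
  define g44 where "g44 = a4 * x4 + b4 * y4"
  have cs: "c1 = 0 \<or> c1 = 1" "c2 = 0 \<or> c2 = 1" "c3 = 0 \<or> c3 = 1" "c4 = 0 \<or> c4 = 1"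
    using f1(2)[rule_format, OF m(1) tip(1)] f2(2)[rule_format, OF m(1) tip(2)] f3(2)[rule_format, OF m(1) tip(3)]
      f4(2)[rule_format, OF m(1) tip(4)] by simp_all
  have v1: "2 \<le> g11 + c1" "g12 + c1 = 0 \<or> g12 + c1 = 1" "g13 + c1 = 0 \<or> g13 + c1 = 1" "g14 + c1 = 0 \<or> g14 + c1 = 1"
    unfolding g11_def g12_def g13_def g14_def
    by (fact f1(1), rule f1(2)[rule_format, OF m(3) ne(1)[symmetric]], rule f1(2)[rule_format, OF m(4) ne(2)[symmetric]],
      rule f1(2)[rule_format, OF m(5) ne(3)[symmetric]])
  have v2: "2 \<le> g22 + c2" "g21 + c2 = 0 \<or> g21 + c2 = 1" "g23 + c2 = 0 \<or> g23 + c2 = 1" "g24 + c2 = 0 \<or> g24 + c2 = 1"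
    unfolding g21_def g22_def g23_def g24_def
    by (fact f2(1), rule f2(2)[rule_format, OF m(2) ne(1)], rule f2(2)[rule_format, OF m(4) ne(4)[symmetric]],
      rule f2(2)[rule_format, OF m(5) ne(5)[symmetric]])
  have v3: "2 \<le> g33 + c3" "g31 + c3 = 0 \<or> g31 + c3 = 1" "g32 + c3 = 0 \<or> g32 + c3 = 1" "g34 + c3 = 0 \<or> g34 + c3 = 1"
    unfolding g31_def g32_def g33_def g34_def
    by (fact f3(1), rule f3(2)[rule_format, OF m(2) ne(2)], rule f3(2)[rule_format, OF m(3) ne(4)],
      rule f3(2)[rule_format, OF m(5) ne(6)[symmetric]])
  have v4: "2 \<le> g44 + c4" "g41 + c4 = 0 \<or> g41 + c4 = 1" "g42 + c4 = 0 \<or> g42 + c4 = 1" "g43 + c4 = 0 \<or> g43 + c4 = 1"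
    unfolding g41_def g42_def g43_def g44_def
    by (fact f4(1), rule f4(2)[rule_format, OF m(2) ne(3)], rule f4(2)[rule_format, OF m(3) ne(5)],
      rule f4(2)[rule_format, OF m(4) ne(6)])
  have d2: "a2 * (x1 - x3) + b2 * (y1 - y3) = 0"
    by (rule parity_constant[OF f2(2)[rule_format, OF m(2) ne(1)] f2(2)[rule_format, OF m(4) ne(4)[symmetric]] ev])
  have d4: "a4 * (x1 - x3) + b4 * (y1 - y3) = 0"
    by (rule parity_constant[OF f4(2)[rule_format, OF m(2) ne(3)] f4(2)[rule_format, OF m(4) ne(6)] ev])
  have d: "(x1 - x3, y1 - y3) \<noteq> (0, 0)"
  proof
    assume "(x1 - x3, y1 - y3) = (0, 0)"
    then have "g13 = g11" by (simp add: g11_def g13_def)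
    then show False using v1 by linarith
  qed
  have lt2: "a2 * x4 + b2 * y4 < a2 * x2 + b2 * y2" using v2 unfolding g24_def g22_def by linarith
  have lt4: "a4 * x2 + b4 * y2 < a4 * x4 + b4 * y4" using v4 unfolding g42_def g44_def by linarith
  note opp = parallel_opposite[OF d d2 d4 lt2 lt4]
  then have opp': "0 < a4 * (y1 - y3) - b4 * (x1 - x3) \<and> a2 * (y1 - y3) - b2 * (x1 - x3) < 0 \<or>
      a4 * (y1 - y3) - b4 * (x1 - x3) < 0 \<and> 0 < a2 * (y1 - y3) - b2 * (x1 - x3)" by blast
  \<comment> \<open>Functional 4 is larger at vertex 4 than at the tip, so the opposite functional 2
    is larger at the tip.\<close>
  have "a2 * x4 + b2 * y4 < a2 * 0 + b2 * 0"
    by (rule parallel_reverse[OF d d2 d4 opp]) (unfold g44_def[symmetric], insert v4(1) cs(4), linarith)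
  then have "g24 < 0" by (simp add: g24_def)
  then have g24: "g24 = -1" "c2 = 1" using v2(4) cs(2) by linarith+
  have "a4 * x2 + b4 * y2 < a4 * 0 + b4 * 0"
    by (rule parallel_reverse[OF d d4 d2 opp']) (unfold g22_def[symmetric], insert v2(1) cs(2), linarith)
  then have "g42 < 0" by (simp add: g42_def)
  then have g42: "g42 = -1" "c4 = 1" using v4(3) cs(4) by linarith+
  \<comment> \<open>The same comparison with vertex 1 in place of the tip excludes the value -1 of
    functional 2 at vertex 1.\<close>
  have "a2 * x4 + b2 * y4 < a2 * x1 + b2 * y1"
    by (rule parallel_reverse[OF d d2 d4 opp]) (unfold g44_def[symmetric] g41_def[symmetric], insert v4(1,2), linarith)
  then have g21: "g21 = 0" using v2 g24 unfolding g24_def g21_def by linarith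
  have "a2 * (x1 - x3) + b2 * (y1 - y3) = g21 - g23" by (simp add: g21_def g23_def algebra_simps)
  then have g23: "g23 = 0" using d2 g21 by simp
  have "(a2 * b4 - a4 * b2) * (x1 - x3) = b4 * (a2 * (x1 - x3) + b2 * (y1 - y3)) - b2 * (a4 * (x1 - x3) + b4 * (y1 - y3))"
    "(a2 * b4 - a4 * b2) * (y1 - y3) = a2 * (a4 * (x1 - x3) + b4 * (y1 - y3)) - a4 * (a2 * (x1 - x3) + b2 * (y1 - y3))"
    by (simp_all add: algebra_simps)
  then have "(a2 * b4 - a4 * b2) * (x1 - x3) = 0" "(a2 * b4 - a4 * b2) * (y1 - y3) = 0" unfolding d2 d4 by simp_all
  then have D24: "a2 * b4 - a4 * b2 = 0" using d by auto
  have "g22 * g44 - g24 * g42 = (a2 * b4 - a4 * b2) * (x2 * y4 - x4 * y2)"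
    by (simp add: g22_def g44_def g24_def g42_def algebra_simps)
  then have "g22 * g44 = 1" using D24 g24 g42 by simp
  then have g22: "g22 = 1" "g44 = 1" using v2(1) v4(1) g24 g42 by (simp_all add: zmult_eq_1_iff)
  have "a2 * (x1 * y3 - x3 * y1) = g21 * y3 - g23 * y1" "b2 * (x1 * y3 - x3 * y1) = g23 * x1 - g21 * x3"
    by (simp_all add: g21_def g23_def algebra_simps)
  then have "a2 * (x1 * y3 - x3 * y1) = 0" "b2 * (x1 * y3 - x3 * y1) = 0" using g21 g23 by simp_all
  moreover have "a2 \<noteq> 0 \<or> b2 \<noteq> 0" using g22 by (auto simp: g22_def)
  ultimately have D13: "x1 * y3 - x3 * y1 = 0" by (metis mult_eq_0_iff)
  have "g11 * g33 - g13 * g31 = (a1 * b3 - a3 * b1) * (x1 * y3 - x3 * y1)"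
    by (simp add: g11_def g33_def g13_def g31_def algebra_simps)
  then have pr: "g11 * g33 = g13 * g31" using D13 by simp
  have lt: "g13 < g11" "g31 < g33" "1 \<le> g11" "1 \<le> g33" using v1 v3 cs by linarith+
  \<comment> \<open>A nonnegative \<open>g13\<close> would make both off-diagonal values positive
    and their product smaller than that of the diagonal values.\<close>
  have "g13 < 0"
  proof (rule ccontr)
    assume n: "\<not> g13 < 0"
    have "0 < g11 * g33" by (rule mult_pos_pos) (use lt in simp_all)
    then have "0 < g13 * g31" unfolding pr .
    then have p: "0 < g13" "0 < g31" using n by (auto simp: zero_less_mult_iff)
    have "g13 * g31 < g11 * g33" by (rule mult_strict_mono[OF lt(1,2)]) (use p lt in simp_all)
    then show False using pr by simp
  qed
  then have g13: "g13 = -1" "c1 = 1" using v1(3) cs(1) by linarith+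
  have "0 < g11 * g33" by (rule mult_pos_pos) (use lt in simp_all)
  then have "g31 < 0" unfolding pr g13(1) by simp
  then have g31: "g31 = -1" "c3 = 1" using v3(2) cs(3) by linarith+
  then have "g11 * g33 = 1" using pr g13 by simp
  then have g11: "g11 = 1" "g33 = 1" using lt by (simp_all add: zmult_eq_1_iff)
  have "(a1 * b2 - a2 * b1) * (x1 * y4 - x4 * y1) = g11 * g24 - g14 * g21"
    by (simp add: g11_def g24_def g14_def g21_def algebra_simps)
  then have "(a1 * b2 - a2 * b1) * (x1 * y4 - x4 * y1) = -1" using g11 g24 g21 by simp
  then have G: "a1 * b2 - a2 * b1 \<noteq> 0" by auto
  have inj: "X = 0 \<and> Y = 0" if "a1 * X + b1 * Y = 0" "a2 * X + b2 * Y = 0" for X Y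
  proof -
    have "(a1 * b2 - a2 * b1) * X = b2 * (a1 * X + b1 * Y) - b1 * (a2 * X + b2 * Y)"
      "(a1 * b2 - a2 * b1) * Y = a1 * (a2 * X + b2 * Y) - a2 * (a1 * X + b1 * Y)" by (simp_all add: algebra_simps)
    then have "(a1 * b2 - a2 * b1) * X = 0" "(a1 * b2 - a2 * b1) * Y = 0" unfolding that by simp_all
    then show ?thesis using G by (metis mult_eq_0_iff)
  qed
  have "a1 * (x1 + x3) + b1 * (y1 + y3) = g11 + g13" "a2 * (x1 + x3) + b2 * (y1 + y3) = g21 + g23"
    by (simp_all add: g11_def g13_def g21_def g23_def algebra_simps)
  then have "x1 + x3 = 0 \<and> y1 + y3 = 0" using g11 g13 g21 g23 by (intro inj) simp_all
  then have x3: "x3 = - x1" "y3 = - y1" by linarith+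
  \<comment> \<open>Vertices 2 and 4 add up to \<open>l\<close> times vertex 1. Functional 1 shows
    that \<open>l\<close> is not positive, functional 3 that it is not negative.\<close>
  define l where "l = g12 + g14"
  have "a1 * (x2 + x4 - l * x1) + b1 * (y2 + y4 - l * y1) = g12 + g14 - l * g11"
     "a2 * (x2 + x4 - l * x1) + b2 * (y2 + y4 - l * y1) = g22 + g24 - l * g21"
    by (simp_all add: g11_def g12_def g14_def g21_def g22_def g24_def algebra_simps)
  then have "x2 + x4 - l * x1 = 0 \<and> y2 + y4 - l * y1 = 0" using g11 g21 g22 g24 by (intro inj) (simp_all add: l_def)
  then have s: "x2 + x4 = l * x1" "y2 + y4 = l * y1" by linarith+
  have "g32 + g34 = a3 * (x2 + x4) + b3 * (y2 + y4)" by (simp add: g32_def g34_def algebra_simps)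
  also have "\<dots> = l * g31" unfolding s g31_def by (simp add: algebra_simps)
  finally have "g32 + g34 = - l" using g31 by simp
  moreover have "g32 \<le> 0" "g34 \<le> 0" "g12 \<le> 0" "g14 \<le> 0" using v3 v1 g31 g13 by linarith+
  ultimately have "l = 0" by (simp add: l_def)
  then have x4: "x4 = - x2" "y4 = - y2" using s by simp_all
  define D where "D = x1 * y2 - x2 * y1"
  have "(a1 * b2 - a2 * b1) * D = g11 * g22 - g12 * g21" by (simp add: D_def g11_def g22_def g12_def g21_def algebra_simps)
  then have "(a1 * b2 - a2 * b1) * D = 1" using g11 g22 g21 by simp
  then have "D dvd 1" by (metis dvd_triv_right)
  then have DD: "D = 1 \<or> D = -1" by auto
  then have D2: "D * D = 1" by auto
  define p where "p = - D * (h1 * y2 - h2 * y1)"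
  define q where "q = - D * (h2 * x1 - h1 * x2)"
  define T :: "int \<times> int \<times> int \<Rightarrow> int \<times> int \<times> int"
    where "T = (\<lambda>(x, y, z). ((D * y2) * x + (- D * x2) * y + 0, (- D * y1) * x + (D * x1) * y + 0, p * x + q * y + 1 * z + 0))"
  have bT: "block_map T" unfolding T_def
  proof (rule block_mapI[of "D * y2" "D * x1" "- D * x2" "- D * y1" 1 0 0 p q 0])
    have "D * y2 * (D * x1) - - D * x2 * (- D * y1) = D * D * D" by (simp add: D_def algebra_simps)
    then show "D * y2 * (D * x1) - - D * x2 * (- D * y1) = 1 \<or> D * y2 * (D * x1) - - D * x2 * (- D * y1) = -1"
      using DD D2 by simp
  qed simp
  have n: "D * y2 * x1 - D * x2 * y1 = 1" "D * x1 * y2 - D * y1 * x2 = 1" "p * x1 + q * y1 = - h1" "p * x2 + q * y2 = - h2"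
  proof -
    have "D * y2 * x1 - D * x2 * y1 = D * D" "D * x1 * y2 - D * y1 * x2 = D * D"
      "p * x1 + q * y1 = - h1 * (D * D)" "p * x2 + q * y2 = - h2 * (D * D)"
      by (simp_all add: D_def p_def q_def algebra_simps)
    then show "D * y2 * x1 - D * x2 * y1 = 1" "D * x1 * y2 - D * y1 * x2 = 1" "p * x1 + q * y1 = - h1" "p * x2 + q * y2 = - h2"
      using D2 by simp_all
  qed
  have T1: "T (x1, y1, h1) = (1, 0, 0)" using n by (simp add: T_def)
  have T2: "T (x2, y2, h2) = (0, 1, 0)" using n by (simp add: T_def)
  have T3: "T (x3, y3, h3) = (-1, 0, h1 + h3)" using n unfolding x3 by (simp add: T_def)
  have T4: "T (x4, y4, h4) = (0, -1, h2 + h4)" using n unfolding x4 by (simp add: T_def)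
  have TE: "T ` ?E = {(1, 0, 0), (0, 1, 0), (-1, 0, h1 + h3), (0, -1, h2 + h4)}"
    unfolding image_insert image_empty T1 T2 T3 T4 by (rule refl)
  have T0: "T (0, 0, 0) = (0, 0, 0)" by (simp add: T_def)
  show ?thesis by (rule in_list_reduce[OF bT TE T0 c in_list_cross])
qed

text \<open>The functional of every essential vertex other than \<open>p\<close> and
  \<open>q\<close> is constant along their difference, and three parallel functionals cannot have
  three strict maximizers.\<close>

lemma congruent_pair_bound:
  assumes c: "spike_config E v" and p: "p \<in> E" and q: "q \<in> lat (insert v E)" and ne: "p \<noteq> q"
    and par: "parity_class p = parity_class q"
  shows "card (E - {p, q}) \<le> 2"
proof (rule ccontr)
  assume "\<not> card (E - {p, q}) \<le> 2"
  then have "3 \<le> card (E - {p, q})" by simp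
  then obtain T where T: "T \<subseteq> E - {p, q}" "card T = 3" by (metis obtain_subset_with_card_n)
  obtain e1 e2 e3 where e: "T = {e1, e2, e3}" "e1 \<noteq> e2" "e2 \<noteq> e3" "e1 \<noteq> e3" using T(2) unfolding card_3_iff by blast
  obtain x1 y1 z1 where e1: "e1 = (x1, y1, z1)" by (metis prod_cases3)
  obtain x2 y2 z2 where e2: "e2 = (x2, y2, z2)" by (metis prod_cases3)
  obtain x3 y3 z3 where e3: "e3 = (x3, y3, z3)" by (metis prod_cases3)
  obtain px py pz where p': "p = (px, py, pz)" by (metis prod_cases3)
  obtain qx qy qz where q': "q = (qx, qy, qz)" by (metis prod_cases3)
  let ?A = "lat (insert v E)"
  have E: "(x1, y1, z1) \<in> E" "(x2, y2, z2) \<in> E" "(x3, y3, z3) \<in> E" "(px, py, pz) \<in> E"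
    and np: "(px, py, pz) \<noteq> (x1, y1, z1)" "(px, py, pz) \<noteq> (x2, y2, z2)" "(px, py, pz) \<noteq> (x3, y3, z3)"
      "(qx, qy, qz) \<noteq> (x1, y1, z1)" "(qx, qy, qz) \<noteq> (x2, y2, z2)" "(qx, qy, qz) \<noteq> (x3, y3, z3)"
    using T(1) p unfolding e(1) e1 e2 e3 p' q' by blast+
  have ne': "(x1, y1, z1) \<noteq> (x2, y2, z2)" "(x2, y2, z2) \<noteq> (x3, y3, z3)" "(x1, y1, z1) \<noteq> (x3, y3, z3)"
    using e(2-4) unfolding e1 e2 e3 .
  have pq: "(qx, qy, qz) \<noteq> (px, py, pz)" using ne unfolding p' q' by (rule not_sym)
  have ev: "even (px - qx)" "even (py - qy)" using par unfolding p' q' parity_class_eq by blast+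
  have m: "(x1, y1, z1) \<in> ?A" "(x2, y2, z2) \<in> ?A" "(x3, y3, z3) \<in> ?A" "(px, py, pz) \<in> ?A"
    using E by (simp_all add: lat_incl)
  have mq: "(qx, qy, qz) \<in> ?A" using q unfolding q' .
  obtain a b c0 where f: "2 \<le> a * px + b * py + c0"
    "\<forall>x y z. (x, y, z) \<in> ?A \<longrightarrow> (x, y, z) \<noteq> (px, py, pz) \<longrightarrow> a * x + b * y + c0 = 0 \<or> a * x + b * y + c0 = 1"
    by (rule essential_functional[OF c E(4)])
  obtain a1 b1 c1 where f1: "2 \<le> a1 * x1 + b1 * y1 + c1"
    "\<forall>x y z. (x, y, z) \<in> ?A \<longrightarrow> (x, y, z) \<noteq> (x1, y1, z1) \<longrightarrow> a1 * x + b1 * y + c1 = 0 \<or> a1 * x + b1 * y + c1 = 1"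
    by (rule essential_functional[OF c E(1)])
  obtain a2 b2 c2 where f2: "2 \<le> a2 * x2 + b2 * y2 + c2"
    "\<forall>x y z. (x, y, z) \<in> ?A \<longrightarrow> (x, y, z) \<noteq> (x2, y2, z2) \<longrightarrow> a2 * x + b2 * y + c2 = 0 \<or> a2 * x + b2 * y + c2 = 1"
    by (rule essential_functional[OF c E(2)])
  obtain a3 b3 c3 where f3: "2 \<le> a3 * x3 + b3 * y3 + c3"
    "\<forall>x y z. (x, y, z) \<in> ?A \<longrightarrow> (x, y, z) \<noteq> (x3, y3, z3) \<longrightarrow> a3 * x + b3 * y + c3 = 0 \<or> a3 * x + b3 * y + c3 = 1"
    by (rule essential_functional[OF c E(3)])
  have d: "(px - qx, py - qy) \<noteq> (0, 0)"
  proof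
    assume "(px - qx, py - qy) = (0, 0)"
    then have "qx = px" "qy = py" by simp_all
    then show False using f(1) f(2)[rule_format, OF mq pq] by simp
  qed
  have k1: "a1 * (px - qx) + b1 * (py - qy) = 0"
    by (rule parity_constant[OF f1(2)[rule_format, OF m(4) np(1)] f1(2)[rule_format, OF mq np(4)] ev])
  have k2: "a2 * (px - qx) + b2 * (py - qy) = 0"
    by (rule parity_constant[OF f2(2)[rule_format, OF m(4) np(2)] f2(2)[rule_format, OF mq np(5)] ev])
  have k3: "a3 * (px - qx) + b3 * (py - qy) = 0"
    by (rule parity_constant[OF f3(2)[rule_format, OF m(4) np(3)] f3(2)[rule_format, OF mq np(6)] ev])
  have 1: "a1 * x2 + b1 * y2 < a1 * x1 + b1 * y1" "a1 * x3 + b1 * y3 < a1 * x1 + b1 * y1"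
    using f1(1) f1(2)[rule_format, OF m(2) ne'(1)[symmetric]] f1(2)[rule_format, OF m(3) ne'(3)[symmetric]] by linarith+
  have 2: "a2 * x1 + b2 * y1 < a2 * x2 + b2 * y2" "a2 * x3 + b2 * y3 < a2 * x2 + b2 * y2"
    using f2(1) f2(2)[rule_format, OF m(1) ne'(1)] f2(2)[rule_format, OF m(3) ne'(2)[symmetric]] by linarith+
  have 3: "a3 * x1 + b3 * y1 < a3 * x3 + b3 * y3" "a3 * x2 + b3 * y2 < a3 * x3 + b3 * y3"
    using f3(1) f3(2)[rule_format, OF m(1) ne'(3)] f3(2)[rule_format, OF m(2) ne'(2)] by linarith+
  show False by (rule three_parallel[OF d k1 k2 k3 1 2 3])
qed

text \<open>The tip and at least four essential vertices do not fit into four parity classes. A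
  congruent pair leaves at most two other essential vertices, so both of its members are essential
  and there are exactly four.\<close>

lemma in_list_quadrilateral:
  assumes c: "spike_config E (0, 0, 0)" and card: "4 \<le> card E"
  shows "in_list (hull_equiv E (0, 0, 0))"
proof -
  let ?v = "(0, 0, 0) :: int \<times> int \<times> int"
  have fin: "finite E" using c unfolding spike_config_def by (elim conjE)
  have v: "?v \<notin> E" using spike_config_tip[OF c] lat_incl by blast
  have "\<not> inj_on parity_class (insert ?v E)"
  proof
    assume "inj_on parity_class (insert ?v E)"
    then have "card (insert ?v E) = card (parity_class ` insert ?v E)" by (rule card_image[symmetric])
    also have "\<dots> \<le> card ({0::int, 1} \<times> {0::int, 1})" by (rule card_mono[OF _ parity_class_range]) simp
    finally show False using card v fin by simp
  qed
  then obtain p' q' where pq': "p' \<in> insert ?v E" "q' \<in> insert ?v E" "p' \<noteq> q'" "parity_class p' = parity_class q'"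
    unfolding inj_on_def by blast
  then obtain p q where pq: "p \<in> E" "q \<in> insert ?v E" "p \<noteq> q" "parity_class p = parity_class q"
  proof (cases "p' = ?v")
    case True
    then show thesis using pq' by (intro that[of q' p']) simp_all
  next
    case False
    then show thesis using pq' by (intro that[of p' q']) simp_all
  qed
  have b: "card (E - {p, q}) \<le> 2" by (rule congruent_pair_bound[OF c pq(1) lat_incl[OF pq(2)] pq(3,4)])
  have qE: "q \<in> E"
  proof (rule ccontr)
    assume "q \<notin> E"
    then have "E - {p, q} = E - {p}" by blast
    then have "card (E - {p, q}) = card E - 1" using pq(1) fin by simp
    then show False using b card by linarith
  qed
  have "{p, q} \<subseteq> E" using pq(1) qE by simp
  then have "card (E - {p, q}) = card E - 2" using pq(3) by (subst card_Diff_subset) simp_all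
  then have "card (E - {p, q}) = 2" using b card by linarith
  then obtain r s where rs: "E - {p, q} = {r, s}" "r \<noteq> s" by (auto simp: card_2_iff)
  obtain x1 y1 z1 where e1: "p = (x1, y1, z1)" by (metis prod_cases3)
  obtain x2 y2 z2 where e2: "r = (x2, y2, z2)" by (metis prod_cases3)
  obtain x3 y3 z3 where e3: "q = (x3, y3, z3)" by (metis prod_cases3)
  obtain x4 y4 z4 where e4: "s = (x4, y4, z4)" by (metis prod_cases3)
  have ne: "p \<noteq> r" "p \<noteq> q" "p \<noteq> s" "r \<noteq> q" "r \<noteq> s" "q \<noteq> s" using rs pq(3) by blast+
  have E: "E = {p, r, q, s}" using rs(1) \<open>{p, q} \<subseteq> E\<close> by blast
  have ev: "even (x1 - x3)" "even (y1 - y3)" using pq(4) unfolding e1 e3 parity_class_eq by blast+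
  show ?thesis unfolding E e1 e2 e3 e4
    by (rule in_list_quadrilateral_parity[OF c[unfolded E e1 e2 e3 e4] ne[unfolded e1 e2 e3 e4] ev])
qed

lemma in_list_origin:
  assumes c: "spike_config E (0, 0, 0)"
  shows "in_list (hull_equiv E (0, 0, 0))"
proof (cases "card E = 3")
  case True
  then obtain p q r where E: "E = {p, q, r}" and ne: "p \<noteq> q" "q \<noteq> r" "p \<noteq> r" unfolding card_3_iff by blast
  obtain x1 y1 z1 where e1: "p = (x1, y1, z1)" by (metis prod_cases3)
  obtain x2 y2 z2 where e2: "q = (x2, y2, z2)" by (metis prod_cases3)
  obtain x3 y3 z3 where e3: "r = (x3, y3, z3)" by (metis prod_cases3)
  show ?thesis unfolding E e1 e2 e3
    by (rule in_list_triangle[OF c[unfolded E e1 e2 e3] ne(1)[unfolded e1 e2] ne(3)[unfolded e1 e3] ne(2)[unfolded e2 e3]])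
next
  case False
  moreover have "3 \<le> card E" using c unfolding spike_config_def by (elim conjE)
  ultimately show ?thesis by (intro in_list_quadrilateral[OF c]) linarith
qed

lemma in_list_spike_config:
  assumes c: "spike_config E v"
  shows "in_list (hull_equiv E v)"
proof -
  obtain x y z where v: "v = (x, y, z)" by (metis prod_cases3)
  have T: "block_map (\<lambda>(p, q, r). (1 * p + 0 * q + - x, 0 * p + 1 * q + - y, 0 * p + 0 * q + 1 * r + - z))"
    by (rule block_mapI[of 1 1 0 0 1 "- x" "- y" 0 0 "- z"]) simp_all
  show ?thesis
    by (rule in_list_reduce[OF T refl _ c in_list_origin]) (simp add: v)
qed

section \<open>Lattice width and the reduction to configurations\<close>

lemma affine_fun_convex_hull:
  assumes "affine_fun f" shows "f ` (convex hull S) = convex hull (f ` S)"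
proof -
  obtain L c where L: "linear L" and f: "f = (\<lambda>x. L x + c)" using assms unfolding affine_fun_def by blast
  have e: "f = (\<lambda>x. c + x) \<circ> L" by (auto simp: f)
  show ?thesis unfolding e image_comp[symmetric] convex_hull_linear_image[OF L] by (simp add: convex_hull_translation)
qed

lemma affine_hull_Max:
  fixes f :: "'a::real_vector \<Rightarrow> real"
  assumes "finite S" "S \<noteq> {}" "affine_fun f"
  shows "(SUP x\<in>convex hull S. f x) = Max (f ` S)" "(INF x\<in>convex hull S. f x) = Min (f ` S)"
proof -
  have sub: "convex hull (f ` S) \<subseteq> {Min (f ` S)..Max (f ` S)}" using assms(1) by (intro hull_minimal) auto
  have m: "Max (f ` S) \<in> f ` S" "Min (f ` S) \<in> f ` S" using assms(1,2) by simp_all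
  have m': "Max (f ` S) \<in> convex hull (f ` S)" "Min (f ` S) \<in> convex hull (f ` S)" using m by (simp_all add: hull_inc)
  show "(SUP x\<in>convex hull S. f x) = Max (f ` S)" unfolding affine_fun_convex_hull[OF assms(3)]
    by (rule cSup_eq_maximum[OF m'(1)]) (use sub in auto)
  show "(INF x\<in>convex hull S. f x) = Min (f ` S)" unfolding affine_fun_convex_hull[OF assms(3)]
    by (rule cInf_eq_minimum[OF m'(2)]) (use sub in auto)
qed

lemma lattice_width_hull:
  fixes S :: "(real ^ 'n) set"
  assumes "finite S" "aff_dim S = int CARD('n)"
  shows "lattice_width (convex hull S) =
    (INF f \<in> {f. integer_functional f \<and> \<not> f constant_on UNIV}. Max (f ` S) - Min (f ` S))"
proof -
  have "S \<noteq> {}" using assms(2) by auto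
  then have "(SUP x\<in>convex hull S. f x) - (INF x\<in>convex hull S. f x) = Max (f ` S) - Min (f ` S)"
    if "integer_functional f" for f
    using affine_hull_Max[OF assms(1), of f] that unfolding integer_functional_def by simp
  then show ?thesis unfolding lattice_width_def aff_dim_convex_hull using assms(2) by (auto intro!: INF_cong)
qed

text \<open>Values at lattice points are integers, so an oscillation above one is at least
  two.\<close>

lemma wide_config:
  fixes S :: "(real ^ 'n) set"
  assumes S: "finite S" "S \<subseteq> int_lattice" and w: "1 < lattice_width (convex hull S)"
    and f: "integer_functional f" "\<not> f constant_on UNIV"
  obtains p q where "p \<in> S" "q \<in> S" "f p + 2 \<le> f q"
proof -
  let ?F = "{f :: real ^ 'n \<Rightarrow> real. integer_functional f \<and> \<not> f constant_on UNIV}"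
  have d: "aff_dim S = int CARD('n)"
    using w by (rule_tac ccontr) (simp add: lattice_width_def aff_dim_convex_hull)
  have ne: "S \<noteq> {}" using d by auto
  have "bdd_below ((\<lambda>f. Max (f ` S) - Min (f ` S)) ` ?F)"
  proof (rule bdd_belowI2)
    fix f :: "real ^ 'n \<Rightarrow> real"
    obtain s where "s \<in> S" using ne by blast
    then have "Min (f ` S) \<le> f s" "f s \<le> Max (f ` S)" using S(1) by simp_all
    then show "0 \<le> Max (f ` S) - Min (f ` S)" by simp
  qed
  then have "lattice_width (convex hull S) \<le> Max (f ` S) - Min (f ` S)"
    unfolding lattice_width_hull[OF S(1) d] by (rule cINF_lower) (use f in simp)
  then have gt: "1 < Max (f ` S) - Min (f ` S)" using w by linarith
  have "Max (f ` S) \<in> f ` S" "Min (f ` S) \<in> f ` S" using S(1) ne by simp_all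
  then obtain p q where pq: "p \<in> S" "q \<in> S" "Min (f ` S) = f p" "Max (f ` S) = f q" by blast
  have "f p \<in> \<int>" "f q \<in> \<int>" using f(1) S(2) pq(1,2) unfolding integer_functional_def by blast+
  then obtain m n where mn: "f p = of_int m" "f q = of_int n" by (auto elim!: Ints_cases)
  have "real_of_int (m + 1) < real_of_int n" using gt unfolding pq(3,4) mn by simp
  then have "m + 2 \<le> n" unfolding of_int_less_iff by simp
  then have "real_of_int (m + 2) \<le> real_of_int n" unfolding of_int_le_iff .
  then have "f p + 2 \<le> f q" unfolding mn by simp
  then show thesis using that pq(1,2) by blast
qed

lemma integer_functional_axis:
  "integer_functional (\<lambda>x :: real ^ 'n. x $ i)" "\<not> (\<lambda>x :: real ^ 'n. x $ i) constant_on UNIV"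
proof -
  have "linear (\<lambda>x :: real ^ 'n. x $ i)" by (rule linearI) simp_all
  then have "affine_fun (\<lambda>x :: real ^ 'n. x $ i)" unfolding affine_fun_def by (intro exI[of _ "\<lambda>x. x $ i"] exI[of _ 0]) simp
  then show "integer_functional (\<lambda>x :: real ^ 'n. x $ i)" unfolding integer_functional_def int_lattice_def by auto
  show "\<not> (\<lambda>x :: real ^ 'n. x $ i) constant_on UNIV"
  proof
    assume "(\<lambda>x :: real ^ 'n. x $ i) constant_on UNIV"
    then obtain y where "\<And>x :: real ^ 'n. x $ i = y" unfolding constant_on_def by blast
    from this[of 0] this[of "axis i 1"] show False by simp
  qed
qed

text \<open>The width is an infimum over infinitely many functionals. Since oscillations on lattice
  points are integers, a width of at most one yields a functional of oscillation below two, hence at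
  most one.\<close>

lemma narrow_full:
  fixes S :: "(real ^ 'n) set"
  assumes S: "finite S" "S \<subseteq> int_lattice" and d: "aff_dim S = int CARD('n)" and w: "lattice_width (convex hull S) \<le> 1"
  obtains f where "integer_functional f" "\<not> f constant_on UNIV" "\<And>p q. p \<in> S \<Longrightarrow> q \<in> S \<Longrightarrow> f q \<le> f p + 1"
proof -
  let ?F = "{f :: real ^ 'n \<Rightarrow> real. integer_functional f \<and> \<not> f constant_on UNIV}"
  have ne: "S \<noteq> {}" using d by auto
  have "\<exists>f\<in>?F. Max (f ` S) - Min (f ` S) < 2"
  proof (rule ccontr)
    assume "\<not> (\<exists>f\<in>?F. Max (f ` S) - Min (f ` S) < 2)"
    then have "\<And>f. f \<in> ?F \<Longrightarrow> 2 \<le> Max (f ` S) - Min (f ` S)" by (meson not_less)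
    moreover have "?F \<noteq> {}" using integer_functional_axis by blast
    ultimately have "2 \<le> lattice_width (convex hull S)"
      unfolding lattice_width_hull[OF S(1) d] by (rule_tac cINF_greatest)
    then show False using w by linarith
  qed
  then obtain f where f: "integer_functional f" "\<not> f constant_on UNIV" "Max (f ` S) - Min (f ` S) < 2" by blast
  have "f q \<le> f p + 1" if pq: "p \<in> S" "q \<in> S" for p q
  proof -
    have "f p \<in> \<int>" "f q \<in> \<int>" using f(1) S(2) pq unfolding integer_functional_def by blast+
    then obtain m n where mn: "f p = of_int m" "f q = of_int n" by (auto elim!: Ints_cases)
    have "f q \<le> Max (f ` S)" "Min (f ` S) \<le> f p" using S(1) pq by simp_all
    then have "real_of_int n < real_of_int (m + 2)" using f(3) unfolding mn by simp
    then have "n \<le> m + 1" unfolding of_int_less_iff by simp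
    then have "real_of_int n \<le> real_of_int (m + 1)" unfolding of_int_le_iff .
    then show ?thesis unfolding mn by simp
  qed
  then show thesis using that f(1,2) by blast
qed

text \<open>A set that is not full-dimensional has width 0 by definition, so a functional has to be
  built: the determinant with the difference of two points of the collinear set, or a coordinate if
  there is at most one point.\<close>

lemma narrow_plane:
  fixes S :: "(real ^ 2) set"
  assumes S: "finite S" "S \<subseteq> int_lattice" and w: "lattice_width (convex hull S) \<le> 1"
  obtains f where "integer_functional f" "\<not> f constant_on UNIV" "\<And>p q. p \<in> S \<Longrightarrow> q \<in> S \<Longrightarrow> f q \<le> f p + 1"
proof (cases "aff_dim S = 2")
  case True
  then have "aff_dim S = int CARD(2)" by simp
  then show thesis by (rule narrow_full[OF S _ w that])
next
  case False
  then have "aff_dim S \<le> 1" using aff_dim_le_DIM[of S] by simp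
  then have col: "collinear S" by (simp add: collinear_aff_dim)
  show thesis
  proof (cases "\<exists>s\<in>S. \<exists>r\<in>S. r \<noteq> s")
    case False
    show thesis
    proof (rule that[OF integer_functional_axis[of 1]])
      fix p q assume "p \<in> S" "q \<in> S"
      then have "q = p" using False by metis
      then show "q $ 1 \<le> p $ 1 + 1" by simp
    qed
  next
    case True
    then obtain s r where sr: "s \<in> S" "r \<in> S" "r \<noteq> s" by blast
    define f where "f = (\<lambda>x :: real ^ 2. (r $ 1 - s $ 1) * x $ 2 - (r $ 2 - s $ 2) * x $ 1)"
    have "linear f" by (rule linearI) (simp_all add: f_def algebra_simps)
    then have "affine_fun f" unfolding affine_fun_def by (intro exI[of _ f] exI[of _ 0]) simp
    moreover have "s \<in> int_lattice" "r \<in> int_lattice" using sr S(2) by blast+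
    ultimately have 1: "integer_functional f"
      unfolding integer_functional_def int_lattice_def by (auto simp: f_def intro!: Ints_diff Ints_mult)
    have 2: "\<not> f constant_on UNIV"
    proof
      assume "f constant_on UNIV"
      then obtain y where y: "\<And>x. f x = y" unfolding constant_on_def by blast
      have "f 0 = 0" "f (axis 1 1) = - (r $ 2 - s $ 2)" "f (axis 2 1) = r $ 1 - s $ 1"
        by (simp_all add: f_def axis_def)
      then have "r = s" unfolding y by (simp add: vec_eq_iff forall_2)
      then show False using sr(3) by simp
    qed
    obtain u where u: "\<And>x y. x \<in> S \<Longrightarrow> y \<in> S \<Longrightarrow> \<exists>c. x - y = c *\<^sub>R u" using col unfolding collinear_def by blast
    have 3: "f q \<le> f p + 1" if pq: "p \<in> S" "q \<in> S" for p q
    proof -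
      obtain c where c: "q - p = c *\<^sub>R u" using u[OF pq(2,1)] by blast
      obtain d where d: "r - s = d *\<^sub>R u" using u[OF sr(2,1)] by blast
      have cc: "q $ i - p $ i = c * u $ i" "r $ i - s $ i = d * u $ i" for i
        using arg_cong[OF c, of "\<lambda>v. v $ i"] arg_cong[OF d, of "\<lambda>v. v $ i"] by simp_all
      have "f q - f p = (r $ 1 - s $ 1) * (q $ 2 - p $ 2) - (r $ 2 - s $ 2) * (q $ 1 - p $ 1)"
        by (simp add: f_def algebra_simps)
      also have "\<dots> = 0" unfolding cc by simp
      finally show ?thesis by simp
    qed
    show thesis by (rule that[OF 1 2 3])
  qed
qed

section \<open>Completing the projection and lifting planar functionals\<close>

lemma integer_functional_plane:
  fixes f :: "real ^ 2 \<Rightarrow> real"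
  assumes "integer_functional f"
  obtains a b c :: int where "\<And>x. f x = of_int a * x $ 1 + of_int b * x $ 2 + of_int c"
proof -
  obtain L d where L: "linear L" "f = (\<lambda>x. L x + d)" and Z: "f ` int_lattice \<subseteq> \<int>"
    using assms unfolding integer_functional_def affine_fun_def by blast
  have lat: "(0 :: real ^ 2) \<in> int_lattice" "(axis i 1 :: real ^ 2) \<in> int_lattice" for i
    unfolding int_lattice_def by (simp_all add: axis_def)
  have z: "f 0 \<in> \<int>" "f (axis i 1) \<in> \<int>" for i using Z lat by blast+
  have L0: "L 0 = 0" using L(1) by (rule linear_0)
  have "L (axis i 1) = f (axis i 1) - f 0" for i using L0 by (simp add: L(2))
  then have "L (axis i 1) \<in> \<int>" for i using z by (metis Ints_diff)
  then obtain a b where ab: "L (axis 1 1) = of_int a" "L (axis 2 1) = of_int b" by (metis Ints_cases)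
  obtain c where c: "d = of_int c" using z(1) L0 by (auto simp: L(2) elim: Ints_cases)
  have "f x = of_int a * x $ 1 + of_int b * x $ 2 + of_int c" for x
  proof -
    have "x = x $ 1 *\<^sub>R axis 1 1 + x $ 2 *\<^sub>R axis 2 1" by (simp add: vec_eq_iff forall_2 axis_def)
    then have "L x = L (x $ 1 *\<^sub>R axis 1 1 + x $ 2 *\<^sub>R axis 2 1)" by simp
    also have "\<dots> = x $ 1 * of_int a + x $ 2 * of_int b"
      using L(1) ab by (simp add: linear_add linear_scale)
    finally show ?thesis by (simp add: L(2) c algebra_simps)
  qed
  then show thesis using that by blast
qed

text \<open>By the Cauchy--Binet identity the cross product of lattice preimages of the unit vectors
  is a third coordinate of determinant one.\<close>
lemma unimodular_extension:
  fixes \<pi> :: "real ^ 3 \<Rightarrow> real ^ 2"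
  assumes "affine_fun \<pi>" "\<pi> ` int_lattice = int_lattice"
  obtains t where "unimodular t" "inj t" "surj t" "\<And>x. t x $ 1 = \<pi> x $ 1" "\<And>x. t x $ 2 = \<pi> x $ 2"
proof -
  obtain L d where L: "linear L" and \<pi>: "\<pi> = (\<lambda>x. L x + d)" using assms(1) unfolding affine_fun_def by blast
  have lat3: "0 \<in> (int_lattice :: (real ^ 3) set)" "axis i 1 \<in> (int_lattice :: (real ^ 3) set)" for i
    unfolding int_lattice_def by (simp_all add: axis_def)
  have lat2: "0 \<in> (int_lattice :: (real ^ 2) set)" "axis i 1 \<in> (int_lattice :: (real ^ 2) set)" for i
    unfolding int_lattice_def by (simp_all add: axis_def)
  have diff: "x - y \<in> int_lattice" if "x \<in> int_lattice" "y \<in> int_lattice" for x y :: "real ^ 'k"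
    using that unfolding int_lattice_def by simp
  have L0: "L 0 = 0" using L by (rule linear_0)
  have "\<pi> 0 \<in> int_lattice" using assms(2) lat3(1) by blast
  then have d: "d \<in> int_lattice" by (simp add: \<pi> L0)
  have LZ: "L x \<in> int_lattice" if "x \<in> int_lattice" for x
  proof -
    have "\<pi> x \<in> int_lattice" using assms(2) that by blast
    then have "\<pi> x - d \<in> int_lattice" using d by (rule diff)
    then show ?thesis by (simp add: \<pi>)
  qed
  have pre: "\<exists>x\<in>int_lattice. L x = y" if y: "y \<in> int_lattice" for y
  proof -
    have "y - - d \<in> int_lattice" using y d by (intro diff) (simp_all add: int_lattice_def)
    then obtain x where "x \<in> int_lattice" "y - - d = \<pi> x" using assms(2) by (metis imageE)
    then show ?thesis by (intro bexI[of _ x]) (simp_all add: \<pi>)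
  qed
  obtain e1 where e1: "e1 \<in> int_lattice" "L e1 = axis 1 1" using pre lat2(2) by blast
  obtain e2 where e2: "e2 \<in> int_lattice" "L e2 = axis 2 1" using pre lat2(2) by blast
  \<comment> \<open>The rows of the linear part, as vectors of space.\<close>
  define r where "r = (\<lambda>i. adjoint L (axis i 1))"
  have r: "r i \<bullet> x = L x $ i" for i x
    using adjoint_works[OF L, of x "axis i 1"] by (simp add: r_def cart_eq_inner_axis inner_commute)
  have rZ: "r i \<in> int_lattice" for i
  proof -
    have "r i $ j = L (axis j 1) $ i" for j using r[of i "axis j 1"] by (simp add: inner_axis)
    then show ?thesis using LZ[OF lat3(2)] unfolding int_lattice_def by simp
  qed
  have cross: "cross3 x y \<in> int_lattice" if "x \<in> int_lattice" "y \<in> int_lattice" for x y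
    using that unfolding int_lattice_def by (auto simp: forall_3 cross_components intro!: Ints_diff Ints_mult)
  define r3 where "r3 = cross3 e1 e2"
  \<comment> \<open>Orthogonal to both rows, this vector spans the kernel of \<open>L\<close>: it
    moves only the third coordinate of \<open>M\<close>.\<close>
  define n where "n = cross3 (r 1) (r 2)"
  have r3Z: "r3 \<in> int_lattice" and nZ: "n \<in> int_lattice" unfolding r3_def n_def by (intro cross e1 e2 rZ)+
  have "r3 \<bullet> n = (r 1 \<bullet> e1) * (r 2 \<bullet> e2) - (r 1 \<bullet> e2) * (r 2 \<bullet> e1)"
    unfolding r3_def n_def by (simp add: cross_components inner_vec_def sum_3 algebra_simps)
  also have "\<dots> = 1" unfolding r e1 e2 by (simp add: axis_def)
  finally have r3n: "r3 \<bullet> n = 1" .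
  have r3e: "r3 \<bullet> e1 = 0" "r3 \<bullet> e2 = 0" unfolding r3_def by (simp_all add: dot_cross_self inner_commute)
  have Ln: "L n $ 1 = 0" "L n $ 2 = 0" unfolding r[symmetric] n_def by (simp_all add: dot_cross_self)
  define M where "M = (\<lambda>x. vector [L x $ 1, L x $ 2, r3 \<bullet> x] :: real ^ 3)"
  define t where "t = (\<lambda>x. M x + vector [d $ 1, d $ 2, 0])"
  have M: "linear M" using L by (intro linearI) (simp_all add: M_def vec3_eq_iff linear_add linear_scale inner_right_distrib)
  \<comment> \<open>The inverse of \<open>M\<close>, with columns \<open>e1\<close>,
    \<open>e2\<close>, \<open>n\<close>; it is integral because these are lattice vectors.\<close>
  define s where "s = (\<lambda>y :: real ^ 3. y $ 1 *\<^sub>R e1 + y $ 2 *\<^sub>R e2 + y $ 3 *\<^sub>R n)"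
  have sZ: "s y \<in> int_lattice" if "y \<in> int_lattice" for y
    using that e1(1) e2(1) nZ unfolding int_lattice_def by (simp add: s_def)
  have Ms: "M (s y) = y" for y
    using L Ln r3n r3e e1(2) e2(2)
    by (simp add: M_def s_def vec3_eq_iff linear_add linear_scale inner_right_distrib axis_def)
  then have "surj M" by (metis surjI)
  then have "inj M" using M linear_surjective_imp_injective by blast
  have "inj t" using \<open>inj M\<close> by (simp add: t_def inj_def)
  have ts: "t (s (y - vector [d $ 1, d $ 2, 0])) = y" for y by (simp add: t_def Ms)
  then have "surj t" by (intro surjI)
  have dZ: "vector [d $ 1, d $ 2, 0 :: real] \<in> (int_lattice :: (real ^ 3) set)"
    using d unfolding int_lattice_def by (simp add: forall_3)
  have "t x \<in> int_lattice" if x: "x \<in> int_lattice" for x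
  proof -
    have "r3 \<bullet> x \<in> \<int>" using r3Z x unfolding int_lattice_def by (auto simp: inner_vec_def intro!: Ints_sum Ints_mult)
    then show ?thesis using LZ[OF x] d unfolding int_lattice_def by (simp add: t_def M_def forall_3)
  qed
  moreover have "y \<in> t ` int_lattice" if y: "y \<in> int_lattice" for y
  proof (rule image_eqI[of _ _ "s (y - vector [d $ 1, d $ 2, 0])"])
    have "y - vector [d $ 1, d $ 2, 0] \<in> int_lattice" using y dZ by (rule diff)
    then show "s (y - vector [d $ 1, d $ 2, 0]) \<in> int_lattice" by (rule sZ)
  qed (simp add: ts)
  ultimately have "t ` int_lattice = int_lattice" by blast
  moreover have "affine_fun t" unfolding affine_fun_def t_def using M by blast
  ultimately have "unimodular t" by (simp add: unimodular_def)
  then show thesis by (rule that[OF _ \<open>inj t\<close> \<open>surj t\<close>]) (simp_all add: t_def M_def \<pi>)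
qed

lemma integer_functional_comp:
  assumes "integer_functional f" "affine_fun t" "t ` int_lattice \<subseteq> int_lattice"
  shows "integer_functional (\<lambda>x. f (t x))"
  using affine_fun_comp[OF assms(2), of f] assms(1,3) unfolding integer_functional_def o_def by blast

lemma not_constant_comp:
  assumes "\<not> f constant_on UNIV" "surj t" shows "\<not> (\<lambda>x. f (t x)) constant_on UNIV"
  using assms unfolding constant_on_def by (metis UNIV_I surjD)

lemma affine_surj:
  fixes \<pi> :: "real ^ 3 \<Rightarrow> real ^ 2" and t :: "real ^ 3 \<Rightarrow> real ^ 3"
  assumes "surj t" "\<And>x. t x $ 1 = \<pi> x $ 1" "\<And>x. t x $ 2 = \<pi> x $ 2"
  shows "surj \<pi>"
proof (rule surjI)
  fix y :: "real ^ 2"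
  define z where "z = inv t (vector [y $ 1, y $ 2, 0])"
  have "t z = vector [y $ 1, y $ 2, 0]" unfolding z_def by (rule surj_f_inv_f[OF assms(1)])
  then have "\<pi> z $ 1 = y $ 1" "\<pi> z $ 2 = y $ 2" unfolding assms(2,3)[symmetric] by simp_all
  then show "\<pi> (inv t (vector [y $ 1, y $ 2, 0])) = y" unfolding z_def[symmetric] by (simp add: vec_eq_iff forall_2)
qed

text \<open>A functional that is narrow on the projection without \<open>\<pi> e\<close> has
  oscillation at least two on \<open>A\<close> after composition with \<open>\<pi>\<close>, so
  \<open>e\<close> alone takes its largest or its smallest value. Subtracting the minimum over the
  other points, or negating and adding their maximum, puts those at 0 and 1.\<close>

lemma essential_projection:
  fixes \<pi> :: "real ^ 3 \<Rightarrow> real ^ 2"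
  assumes A: "finite A" "A \<subseteq> int_lattice" "1 < lattice_width (convex hull A)"
    and \<pi>: "affine_fun \<pi>" "\<pi> ` int_lattice \<subseteq> int_lattice" "surj \<pi>"
    and e: "e \<in> A" "\<And>x. x \<in> A \<Longrightarrow> \<pi> x = \<pi> e \<Longrightarrow> x = e"
    and ess: "\<pi> e \<in> essential_vertices (\<pi> ` A)"
  obtains a b c :: int where "2 \<le> of_int a * \<pi> e $ 1 + of_int b * \<pi> e $ 2 + of_int c"
    "\<And>x. x \<in> A - {e} \<Longrightarrow> of_int a * \<pi> x $ 1 + of_int b * \<pi> x $ 2 + of_int c \<in> {0, 1}"
proof -
  \<comment> \<open>Since \<open>e\<close> is the only point over its projection, removing the image
    removes no other point.\<close>
  have "\<pi> ` A - {\<pi> e} = \<pi> ` (A - {e})"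
  proof (intro equalityI subsetI)
    fix y assume "y \<in> \<pi> ` A - {\<pi> e}"
    then show "y \<in> \<pi> ` (A - {e})" by blast
  next
    fix y assume "y \<in> \<pi> ` (A - {e})"
    then obtain x where x: "x \<in> A" "x \<noteq> e" "y = \<pi> x" by blast
    then have "\<pi> x \<noteq> \<pi> e" using e(2)[OF x(1)] by metis
    then show "y \<in> \<pi> ` A - {\<pi> e}" using x by simp
  qed
  then have w: "lattice_width (convex hull (\<pi> ` (A - {e}))) \<le> 1" using ess by (simp add: essential_vertices_def)
  have fin: "finite (\<pi> ` (A - {e}))" and sub: "\<pi> ` (A - {e}) \<subseteq> int_lattice" using A(1,2) \<pi>(2) by blast+
  obtain f where f: "integer_functional f" "\<not> f constant_on UNIV"
    and le: "\<And>p q. p \<in> \<pi> ` (A - {e}) \<Longrightarrow> q \<in> \<pi> ` (A - {e}) \<Longrightarrow> f q \<le> f p + 1"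
    using narrow_plane[OF fin sub w] by blast
  obtain a b c :: int where abc: "\<And>x. f x = of_int a * x $ 1 + of_int b * x $ 2 + of_int c"
    using integer_functional_plane[OF f(1)] by blast
  obtain p q where pq: "p \<in> A" "q \<in> A" "f (\<pi> p) + 2 \<le> f (\<pi> q)"
    by (rule wide_config[OF A integer_functional_comp[OF f(1) \<pi>(1,2)] not_constant_comp[OF f(2) \<pi>(3)]])
  have Z: "f (\<pi> x) \<in> \<int>" if "x \<in> A" for x
    using integer_functional_comp[OF f(1) \<pi>(1,2)] A(2) that unfolding integer_functional_def by blast
  have peq: "p = e \<or> q = e"
  proof (rule ccontr)
    assume "\<not> (p = e \<or> q = e)"
    then have "f (\<pi> q) \<le> f (\<pi> p) + 1" using pq by (intro le) blast+
    then show False using pq(3) by linarith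
  qed
  have pne: "p \<noteq> q" using pq(3) by auto
  show thesis
  proof (cases "q = e")
    case True
    then have p: "p \<in> A - {e}" using pq pne by blast
    have fp: "finite ((f \<circ> \<pi>) ` (A - {e}))" "(f \<circ> \<pi>) ` (A - {e}) \<noteq> {}" using A(1) p by auto
    define m where "m = Min ((f \<circ> \<pi>) ` (A - {e}))"
    have "m \<in> (f \<circ> \<pi>) ` (A - {e})" unfolding m_def by (rule Min_in[OF fp])
    then obtain r where r: "r \<in> A - {e}" "m = f (\<pi> r)" by auto
    then obtain n where n: "m = of_int n" using Z[of r] by (auto elim: Ints_cases)
    have ml: "m \<le> f (\<pi> x)" if "x \<in> A - {e}" for x unfolding m_def using fp(1) that by simp
    show thesis
    proof (rule that[of a b "c - n"])
      have "m \<le> f (\<pi> p)" by (rule ml[OF p])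
      then have "m + 2 \<le> f (\<pi> e)" using pq(3) unfolding True by linarith
      then show "2 \<le> of_int a * \<pi> e $ 1 + of_int b * \<pi> e $ 2 + of_int (c - n)" unfolding n abc by simp
      fix x assume x: "x \<in> A - {e}"
      have l: "m \<le> f (\<pi> x)" "f (\<pi> x) \<le> m + 1" using ml[OF x] le[of "\<pi> r" "\<pi> x"] r x by auto
      obtain k where k: "f (\<pi> x) = of_int k" using Z[of x] x by (auto elim: Ints_cases)
      have "real_of_int n \<le> of_int k" "real_of_int k \<le> of_int (n + 1)" using l unfolding n k by simp_all
      then have "n \<le> k" "k \<le> n + 1" unfolding of_int_le_iff by simp_all
      then have "k - n = 0 \<or> k - n = 1" by linarith
      then have "real_of_int (k - n) \<in> {0, 1}" by (elim disjE) simp_all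
      moreover have eq: "of_int a * \<pi> x $ 1 + of_int b * \<pi> x $ 2 + of_int (c - n) = real_of_int (k - n)"
        using k unfolding abc by simp
      ultimately show "of_int a * \<pi> x $ 1 + of_int b * \<pi> x $ 2 + of_int (c - n) \<in> {0, 1 :: real}" unfolding eq by blast
    qed
  next
    case False
    then have p: "q \<in> A - {e}" "p = e" using pq peq by blast+
    have fp: "finite ((f \<circ> \<pi>) ` (A - {e}))" "(f \<circ> \<pi>) ` (A - {e}) \<noteq> {}" using A(1) p by auto
    define m where "m = Max ((f \<circ> \<pi>) ` (A - {e}))"
    have "m \<in> (f \<circ> \<pi>) ` (A - {e})" unfolding m_def by (rule Max_in[OF fp])
    then obtain r where r: "r \<in> A - {e}" "m = f (\<pi> r)" by auto
    then obtain n where n: "m = of_int n" using Z[of r] by (auto elim: Ints_cases)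
    have ml: "f (\<pi> x) \<le> m" if "x \<in> A - {e}" for x unfolding m_def using fp(1) that by simp
    show thesis
    proof (rule that[of "- a" "- b" "n - c"])
      have "f (\<pi> q) \<le> m" by (rule ml[OF p(1)])
      then have "f (\<pi> e) + 2 \<le> m" using pq(3) p(2) by simp
      then show "2 \<le> of_int (- a) * \<pi> e $ 1 + of_int (- b) * \<pi> e $ 2 + of_int (n - c)" unfolding n abc by simp
      fix x assume x: "x \<in> A - {e}"
      have l: "f (\<pi> x) \<le> m" "m \<le> f (\<pi> x) + 1" using ml[OF x] le[of "\<pi> x" "\<pi> r"] r x by auto
      obtain k where k: "f (\<pi> x) = of_int k" using Z[of x] x by (auto elim: Ints_cases)
      have "real_of_int k \<le> of_int n" "real_of_int n \<le> of_int (k + 1)" using l unfolding n k by simp_all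
      then have "k \<le> n" "n \<le> k + 1" unfolding of_int_le_iff by simp_all
      then have "n - k = 0 \<or> n - k = 1" by linarith
      then have "real_of_int (n - k) \<in> {0, 1}" by (elim disjE) simp_all
      moreover have eq: "of_int (- a) * \<pi> x $ 1 + of_int (- b) * \<pi> x $ 2 + of_int (n - c) = real_of_int (n - k)"
        using k unfolding abc by simp
      ultimately show "of_int (- a) * \<pi> x $ 1 + of_int (- b) * \<pi> x $ 2 + of_int (n - c) \<in> {0, 1 :: real}" unfolding eq by blast
    qed
  qed
qed

lemma integer_functional_lin_fun:
  fixes a b c :: int
  defines "f \<equiv> \<lambda>x :: real ^ 3. of_int a * x $ 1 + of_int b * x $ 2 + of_int c * x $ 3"
  shows "integer_functional f" "(a, b, c) \<noteq> (0, 0, 0) \<Longrightarrow> \<not> f constant_on UNIV"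
    "f (emb q) = of_int (lin_fun a b c q)"
proof -
  have "linear f" by (rule linearI) (simp_all add: f_def algebra_simps)
  then have "affine_fun f" unfolding affine_fun_def by (intro exI[of _ f] exI[of _ 0]) simp
  then show "integer_functional f" unfolding integer_functional_def int_lattice_def
    by (auto simp: f_def intro!: Ints_add Ints_mult)
  show "\<not> f constant_on UNIV" if "(a, b, c) \<noteq> (0, 0, 0)"
  proof
    assume "f constant_on UNIV"
    then obtain y where y: "\<And>x. f x = y" unfolding constant_on_def by blast
    have "f 0 = 0" "f (axis 1 1) = of_int a" "f (axis 2 1) = of_int b" "f (axis 3 1) = of_int c"
      by (simp_all add: f_def axis_def)
    then show False using that unfolding y by simp
  qed
  show "f (emb q) = of_int (lin_fun a b c q)" by (simp add: f_def lin_fun_def)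
qed

lemma in_list_spiked:
  fixes P :: "(real ^ 3) set"
  assumes sp: "spiked P"
    and qm: "quasi_minimal P"
    and nm: "\<not> minimal P"
    and size: "lattice_size P \<ge> 7"
  shows "in_list (equivalent_to_hull P)"
proof -
  define A where "A = P \<inter> int_lattice"
  have P: "polytope P" "vertices P \<subseteq> int_lattice" and qmA: "quasi_minimal_config A"
    using qm unfolding quasi_minimal_def lattice_polytope_def A_def by simp_all
  have A: "finite A" "A \<subseteq> int_lattice" "1 < lattice_width (convex hull A)"
    using qmA unfolding quasi_minimal_config_def by simp_all
  have KM: "P = convex hull (vertices P)"
    unfolding vertices_def using P(1) by (intro Krein_Milman_Minkowski polytope_imp_compact polytope_imp_convex)
  \<comment> \<open>Essentiality is defined through hulls of lattice points; being a lattice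
    polytope, \<open>P\<close> is the hull of its own.\<close>
  have "vertices P \<subseteq> A" using P(2) unfolding A_def vertices_def extreme_point_of_def by blast
  then have "P \<subseteq> convex hull A" using KM hull_mono by blast
  moreover have "convex hull A \<subseteq> P" unfolding A_def using P(1) by (intro hull_minimal polytope_imp_convex) simp_all
  ultimately have hA: "convex hull A = P" by blast
  define Es where "Es = essential_vertices A"
  have "nonessential_vertices A \<noteq> {}"
    using nm qm A unfolding minimal_def quasi_minimal_def minimal_config_def A_def[symmetric] by simp
  then obtain v0 where v0: "nonessential_vertices A = {v0}"
    using qmA unfolding quasi_minimal_config_def by blast
  have vP: "vertices P = insert v0 Es"
    using v0 unfolding nonessential_vertices_def Es_def essential_vertices_def hA by blast
  have v0E: "v0 \<notin> Es" using v0 unfolding nonessential_vertices_def Es_def by blast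
  have PE: "P = convex hull (insert v0 Es)" using KM unfolding vP .
  have EsA: "Es \<subseteq> A" and v0A: "v0 \<in> A" using \<open>vertices P \<subseteq> A\<close> unfolding vP by simp_all
  have finE: "finite Es" using EsA A(1) by (rule finite_subset)
  have dim: "aff_dim P = 3" using sp by (simp add: spiked_def)
  have "aff_dim (insert v0 Es) = 3" using dim unfolding PE aff_dim_convex_hull .
  \<comment> \<open>Dimension three needs at least four vertices, one of which is the tip.\<close>
  then have "3 \<le> int (card (insert v0 Es)) - 1" using aff_dim_le_card[of "insert v0 Es"] finE by simp
  then have cardE: "3 \<le> card Es" using finE v0E by simp
  \<comment> \<open>An extreme point of \<open>P\<close> lying in the hull of the other vertices
    would be one of them.\<close>
  have tip: "v0 \<notin> convex hull Es"
  proof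
    assume v: "v0 \<in> convex hull Es"
    have "v0 extreme_point_of P" using vP unfolding vertices_def by blast
    moreover have "convex hull Es \<subseteq> P" unfolding PE by (intro hull_mono) blast
    ultimately have "v0 extreme_point_of convex hull Es" using v unfolding extreme_point_of_def by blast
    then show False using v0E extreme_point_of_convex_hull by blast
  qed
  obtain \<pi> :: "real ^ 3 \<Rightarrow> real ^ 2" where \<pi>: "affine_fun \<pi>" "\<pi> ` int_lattice = int_lattice"
    and uniq: "\<forall>w \<in> vertices (convex hull (\<pi> ` A)). \<exists>!x. x \<in> A \<and> \<pi> x = w"
    and bij: "bij_betw \<pi> Es (essential_vertices (\<pi> ` A))"
    using sp unfolding spiked_def Let_def A_def[symmetric] Es_def[symmetric] by blast
  obtain t where t: "unimodular t" "inj t" "surj t" "\<And>x. t x $ 1 = \<pi> x $ 1" "\<And>x. t x $ 2 = \<pi> x $ 2"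
    using unimodular_extension[OF \<pi>] by metis
  have \<pi>s: "surj \<pi>" by (rule affine_surj[OF t(3-5)])
  have ta: "affine_fun t" and tZ: "t ` int_lattice = int_lattice" using t(1) unfolding unimodular_def by simp_all
  define E where "E = emb -` t ` Es"
  have "t v0 \<in> range emb" using v0A A(2) tZ unfolding range_emb by blast
  then obtain v where v: "emb v = t v0" by (metis imageE)
  have "t ` Es \<subseteq> range emb" using EsA A(2) tZ unfolding range_emb by blast
  then have embE: "emb ` E = t ` Es" unfolding E_def image_vimage_eq by (rule Int_absorb2)
  have embvE: "emb ` insert v E = t ` insert v0 Es" using embE v by simp
  have hull: "convex hull (t ` insert v0 Es) = t ` P" unfolding PE by (rule affine_fun_convex_hull[OF ta, symmetric])
  have embA: "emb ` lat (insert v E) = t ` A"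
    unfolding emb_lat embvE hull A_def image_Int[OF t(2)] tZ ..
  have inje: "inj emb" by (simp add: inj_def emb_inj)
  have cE: "card E = card Es"
    using card_image[OF inj_on_subset[OF inje subset_UNIV], of E] card_image[OF inj_on_subset[OF t(2) subset_UNIV], of Es]
    unfolding embE by simp
  have cA: "card (lat (insert v E)) = card A"
    using card_image[OF inj_on_subset[OF inje subset_UNIV], of "lat (insert v E)"]
      card_image[OF inj_on_subset[OF t(2) subset_UNIV], of A] unfolding embA by simp
  have lift: "\<exists>x\<in>A. emb q = t x" if "q \<in> lat (insert v E)" for q
  proof -
    have "emb q \<in> t ` A" using that unfolding embA[symmetric] by (rule imageI)
    then show ?thesis by blast
  qed
  have spike: "spike_config E v"
    unfolding spike_config_def
  proof (intro conjI ballI allI impI)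
    show "finite E" using cE cardE by (intro card_ge_0_finite) simp
    show "3 \<le> card E" using cE cardE by simp
    show "emb v \<notin> convex hull (emb ` E)"
      unfolding embE v affine_fun_convex_hull[OF ta, symmetric] using tip t(2) by (simp add: inj_image_mem_iff)
    show "7 \<le> card (lat (insert v E))" unfolding cA using size by (simp add: lattice_size_def A_def)
  next
    fix q assume "q \<in> E"
    then have "emb q \<in> t ` Es" unfolding E_def by simp
    then obtain e where e: "e \<in> Es" "emb q = t e" by (metis imageE)
    then have eA: "e \<in> A" using EsA by blast
    \<comment> \<open>Being spiked makes the image of an essential vertex essential in the plane,
      and the unique preimage over a vertex lets the planar functional be lifted.\<close>
    have ess: "\<pi> e \<in> essential_vertices (\<pi> ` A)" using bij e(1) unfolding bij_betw_def by blast
    then have "\<pi> e \<in> vertices (convex hull (\<pi> ` A))" unfolding essential_vertices_def by blast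
    then have un: "x = e" if "x \<in> A" "\<pi> x = \<pi> e" for x using uniq that eA by blast
    obtain a b c :: int where abc: "2 \<le> of_int a * \<pi> e $ 1 + of_int b * \<pi> e $ 2 + of_int c"
      "\<And>x. x \<in> A - {e} \<Longrightarrow> of_int a * \<pi> x $ 1 + of_int b * \<pi> x $ 2 + of_int c \<in> {0, 1}"
      using essential_projection[OF A \<pi>(1) equalityD1[OF \<pi>(2)] \<pi>s eA un ess] by metis
    have pf: "real_of_int (plane_fun a b c p) = of_int a * \<pi> x $ 1 + of_int b * \<pi> x $ 2 + of_int c" if "emb p = t x" for p x
    proof -
      have "\<pi> x $ 1 = of_int (fst p)" "\<pi> x $ 2 = of_int (fst (snd p))"
        using t(4,5)[of x] emb_nth(1,2)[of p] unfolding that by simp_all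
      then show ?thesis by (simp add: plane_fun_def)
    qed
    have "2 \<le> plane_fun a b c q"
    proof -
      have "real_of_int 2 \<le> real_of_int (plane_fun a b c q)" using abc(1) unfolding pf[OF e(2)] by simp
      then show ?thesis unfolding of_int_le_iff .
    qed
    moreover have "plane_fun a b c p = 0 \<or> plane_fun a b c p = 1" if p: "p \<in> lat (insert v E) - {q}" for p
    proof -
      obtain x where x: "x \<in> A" "emb p = t x" using lift p by blast
      have "emb p \<noteq> emb q" using p unfolding emb_inj by blast
      then have "x \<noteq> e" unfolding x(2) e(2) by metis
      then have "real_of_int (plane_fun a b c p) \<in> {0, 1}" using abc(2)[of x] x(1) unfolding pf[OF x(2)] by blast
      then show ?thesis by simp
    qed
    ultimately show "\<exists>a b c. 2 \<le> plane_fun a b c q \<and>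
       (\<forall>p\<in>lat (insert v E) - {q}. plane_fun a b c p = 0 \<or> plane_fun a b c p = 1)" by (intro exI conjI ballI)
  next
    fix a b c :: int assume nz: "(a, b, c) \<noteq> (0, 0, 0)"
    let ?f = "\<lambda>x :: real ^ 3. of_int a * x $ 1 + of_int b * x $ 2 + of_int c * x $ 3"
    \<comment> \<open>Non-essentiality of the tip enters here: the points left after its removal
      keep width above one.\<close>
    have "v0 \<in> vertices (convex hull A)" "v0 \<notin> essential_vertices A"
      using v0 unfolding nonessential_vertices_def by blast+
    then have w: "1 < lattice_width (convex hull (A - {v0}))" unfolding essential_vertices_def by simp
    have fin: "finite (A - {v0})" and sub: "A - {v0} \<subseteq> int_lattice" using A by blast+
    obtain x y where xy: "x \<in> A - {v0}" "y \<in> A - {v0}" "?f (t x) + 2 \<le> ?f (t y)"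
      by (rule wide_config[OF fin sub w integer_functional_comp[OF integer_functional_lin_fun(1) ta equalityD1[OF tZ]]
            not_constant_comp[OF integer_functional_lin_fun(2)[OF nz] t(3)]])
    have pull: "\<exists>p\<in>lat (insert v E) - {v}. emb p = t x" if x: "x \<in> A - {v0}" for x
    proof -
      have "t x \<in> emb ` lat (insert v E)" unfolding embA using x by blast
      then obtain p where p: "p \<in> lat (insert v E)" "emb p = t x" by (metis imageE)
      have "t x \<noteq> t v0" using x t(2) by (auto simp: inj_eq)
      then have "p \<noteq> v" using p(2) v by metis
      then show ?thesis using p by blast
    qed
    obtain p where p: "p \<in> lat (insert v E) - {v}" "emb p = t x" using pull[OF xy(1)] by blast
    obtain q where q: "q \<in> lat (insert v E) - {v}" "emb q = t y" using pull[OF xy(2)] by blast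
    have "real_of_int (lin_fun a b c p + 2) \<le> real_of_int (lin_fun a b c q)"
      using xy(3) unfolding p(2)[symmetric] q(2)[symmetric] integer_functional_lin_fun(3) by simp
    then have "lin_fun a b c p + 2 \<le> lin_fun a b c q" unfolding of_int_le_iff .
    then show "\<exists>p\<in>lat (insert v E) - {v}. \<exists>q\<in>lat (insert v E) - {v}. lin_fun a b c p + 2 \<le> lin_fun a b c q"
      using p(1) q(1) by blast
  qed
  show ?thesis
  proof (rule in_list_mono[OF in_list_spike_config[OF spike]])
    fix ps n assume h: "hull_equiv E v ps n"
    then obtain u where u: "unimodular u" "u ` emb ` insert v E = set ps" "u (emb v) = last ps"
      unfolding hull_equiv_def by blast
    have ut: "unimodular (u \<circ> t)" by (rule unimodular_comp[OF t(1) u(1)])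
    have "(u \<circ> t) ` P = convex hull ((u \<circ> t) ` insert v0 Es)"
      unfolding PE by (rule affine_fun_convex_hull) (use ut in \<open>simp add: unimodular_def\<close>)
    also have "(u \<circ> t) ` insert v0 Es = set ps" unfolding image_comp[symmetric] embvE[symmetric] by (rule u(2))
    finally have "(u \<circ> t) ` P = convex hull (set ps)" .
    moreover have "(u \<circ> t) v0 = last ps" using u(3) v by simp
    ultimately show "equivalent_to_hull P ps n"
      using ut v0 h unfolding equivalent_to_hull_def hull_equiv_def A_def by blast
  qed
qed

theorem theorem8:
  fixes P :: "(real ^ 3) set"
  assumes "spiked P"
    and "quasi_minimal P"
    and "\<not> minimal P"
    and "lattice_size P \<ge> 7"
  shows "\<exists>k::int. k \<ge> 2 \<and>
     (equivalent_to_hull P [pt 1 (-1) (-1), pt (-1) 1 1, pt (-1) (-1) 0, pt 0 0 k] (k + 4) \<or>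
      equivalent_to_hull P [pt 1 (-1) 0, pt (-1) 1 (-1), pt (-1) (-1) 0, pt 0 0 k] (k + 5) \<or>
      equivalent_to_hull P [pt 1 (-1) 0, pt (-1) 1 0, pt (-1) (-1) 0, pt 0 0 k] (k + 6) \<or>
      equivalent_to_hull P [pt 2 (-1) (-1), pt (-1) 2 1, pt (-1) (-1) 0, pt 0 0 k] (k + 4) \<or>
      (\<exists>a\<in>{-1, 0}.
        equivalent_to_hull P [pt 1 (-1) (-1), pt 0 1 a, pt (-1) (-1) 0, pt 0 0 k] (k + 4)) \<or>
      (\<exists>a\<in>{-2, -1, 0}.
        equivalent_to_hull P [pt 1 0 0, pt 0 1 a, pt (-1) (-1) 0, pt 0 0 k] (k + 4)) \<or>
      (\<exists>a\<in>{-5, -1}.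
        equivalent_to_hull P [pt 2 1 0, pt (-1) 1 a, pt (-1) (-1) 0, pt 0 0 k] (k + 4)) \<or>
      (\<exists>a\<in>{-1, 0}. \<exists>b. a \<le> b \<and> b < 2 * k \<and>
        equivalent_to_hull P [pt 1 0 0, pt 0 1 0, pt (-1) 0 a, pt 0 (-1) b, pt 0 0 k] (k + 5)) \<or>
      (\<exists>a\<in>{-2, -1, 0}. \<exists>b\<in>{0, 1}.
        equivalent_to_hull P [pt 1 0 0, pt 0 1 0, pt (-1) (-1) a, pt 1 1 (2 * k - a + b)] (k + 5)) \<or>
      (\<exists>a\<in>{-1, 0}. \<exists>b\<in>{-1, 0}.
        equivalent_to_hull P [pt 1 0 a, pt 0 2 b, pt (-1) 0 0, pt 0 0 k]
          (\<lfloor>of_int (3 * k + b) / (2::real)\<rfloor> + 5)) \<or>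
      (\<exists>a\<in>{-1, 0}.
        equivalent_to_hull P [pt 1 0 0, pt 0 2 a, pt (-1) 0 0, pt 0 1 k] (k + 5)))"
  by (rule in_list_spiked[OF assms, unfolded in_list_def])

end
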